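(* Let $E=(E^0,E^1,r,s)$ be a compact topological graph with no sinks. If $s$ is injective and $r$ is surjective (which holds, for example, if $C^*(E)$ is finite), then the backward shift $\sigma:E^\infty\to E^\infty$ is a homeomorphism and there is a natural isomorphism of $C^*$-algebras $C^*(E)\to C(E^\infty)\rtimes_\sigma\mathbb{Z}$.
   Context: A topological graph $E=(E^0,E^1,r,s)$ consists of locally compact Hausdorff second countable spaces $E^0$ (vertices) and $E^1$ (edges) and continuous maps $r,s:E^1\to E^0$ such that $s$ is a local homeomorphism: every $e\in E^1$ has an open neighborhood $U$ such that $s(U)$ is open in $E^0$ and $s|_U:U\to s(U)$ is a homeomorphism. $E$ is compact if $E^0$ and $E^1$ are both compact. A vertex $v$ is a sink if $s^{-1}(v)=\emptyset$; so $E$ has no sinks iff $s$ is surjective. The infinite path space is $E^\infty=\{\alpha:\mathbb{N}\to E^1 : s(\alpha(n))=r(\alpha(n+1))\text{ for every }n\in\mathbb{N}\}$, $\mathbb{N}=\{1,2,\dots\}$, with the topology inherited from the product topology on $\prod_{n\in\mathbb{N}}E^1$. For $\alpha\in E^\infty$ put $r(\alpha)=r(\alpha(1))$. The backward shift $\sigma:E^\infty\to E^\infty$ is $\sigma(\alpha)(n)=\alpha(n+1)$. The $C^*$-algebra $C^*(E)$. For $a\in C_0(E^0)$ and $\xi,\eta\in C_c(E^1)$ put $(a\xi)(e)=a(r(e))\xi(e)$, $(\xi a)(e)=\xi(e)a(s(e))$ for $e\in E^1$, and $\langle\xi,\eta\rangle(v)=\sum_{e\in s^{-1}(v)}\overline{\xi(e)}\eta(e)$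 for $v\in E^0$. Completing $C_c(E^1)$ in the norm $\|\xi\|^2=\|\langle\xi,\xi\rangle\|$ gives a right Hilbert $C_0(E^0)$-module $X(E)$ with a left action $\lambda:C_0(E^0)\to\mathbb{B}(X(E))$ (a $C^*$-correspondence over $C_0(E^0)$), where $\mathbb{B}(X)$ denotes the adjointable operators on $X$. By definition $C^*(E)=\mathcal{O}(X(E))$, the Cuntz-Pimsner algebra defined as follows. Let $X$ be a $C^*$-correspondence over a $C^*$-algebra $A$ with left action $\lambda:A\to\mathbb{B}(X)$. A Toeplitz representation of $X$ on a $C^*$-algebra $B$ is a pair $(\pi,\tau)$, with $\pi:A\to B$ a $*$-homomorphism and $\tau:X\to B$ linear, such that $\tau(a\xi)=\pi(a)\tau(\xi)$ and $\tau(\xi)^*\tau(\eta)=\pi(\langle\xi,\eta\rangle)$ for all $a\in A$, $\xi,\eta\in X$. Let $\theta_{\xi,\eta}(\zeta)=\xi\langle\eta,\zeta\rangle$, and let $\mathbb{K}(X)\subseteq\mathbb{B}(X)$ be the closed linear span of the $\theta_{\xi,\eta}$. There is a unique $*$-homomorphism $\varphi:\mathbb{K}(X)\to B$ with $\varphi(\theta_{\xi,\eta})=\tau(\xi)\tau(\eta)^*$. Let $J_X=\lambda^{-1}(\mathbb{K}(X))\cap\{a\in A: ab=0\text{ for all }b\in\ker\lambda\}$. The representation $(\pi,\tau)$ is covariant if $\varphi(\lambda(a))=\pi(a)$ for all $a\in J_X$. $\mathcal{O}(X)$ is the universal $C^*$-algebra generated by a covariant Toeplitz representation of $X$. For a homeomorphism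 $\sigma$ of a compact space $Y$, $C(Y)\rtimes_\sigma\mathbb{Z}$ is the crossed product, i.e. the universal $C^*$-algebra generated by $C(Y)$ and a unitary $u$ with $uau^*=a\circ\sigma$ for all $a\in C(Y)$. "Natural" refers to the map $C^*(E)\to C(E^\infty)\rtimes_\sigma\mathbb{Z}$ that sends the canonical copy of $a\in C(E^0)$ to $a\circ r\in C(E^\infty)$ (with $r(\alpha)=r(\alpha(1))$) and the canonical copy of $\xi\in C(E^1)$ to $(\xi\circ\mathrm{ev}_1)u$, where $\mathrm{ev}_1:E^\infty\to E^1$, $\mathrm{ev}_1(\alpha)=\alpha(1)$. When $E^0$ is compact, $C^*(E)$ is unital. A unital $C^*$-algebra is finite if every isometry in it is unitary (equivalently, every left-invertible element is right-invertible). *)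

theory Defs
  imports "HOL-Analysis.Analysis"
begin

section \<open>C*-algebras\<close>

text \<open>
  C*-algebras are records with an explicit carrier, because subalgebras and products over
  families of algebras are needed below. They need not be unital.
\<close>

record 'a cstar =
  carr :: "'a set"
  cadd :: "'a \<Rightarrow> 'a \<Rightarrow> 'a"
  czero :: 'a
  cscale :: "complex \<Rightarrow> 'a \<Rightarrow> 'a"
  cmult :: "'a \<Rightarrow> 'a \<Rightarrow> 'a"
  cadj :: "'a \<Rightarrow> 'a"
  cnorm :: "'a \<Rightarrow> real"

definition cdiff :: "'a cstar \<Rightarrow> 'a \<Rightarrow> 'a \<Rightarrow> 'a"
  where "cdiff A x y = cadd A x (cscale A (-1) y)"

locale cstar_algebra =
  fixes A :: "'a cstar"
  assumes zero_closed: "czero A \<in> carr A"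
    and add_closed: "\<lbrakk>x \<in> carr A; y \<in> carr A\<rbrakk> \<Longrightarrow> cadd A x y \<in> carr A"
    and scale_closed: "x \<in> carr A \<Longrightarrow> cscale A c x \<in> carr A"
    and mult_closed: "\<lbrakk>x \<in> carr A; y \<in> carr A\<rbrakk> \<Longrightarrow> cmult A x y \<in> carr A"
    and adj_closed: "x \<in> carr A \<Longrightarrow> cadj A x \<in> carr A"
    and add_assoc: "\<lbrakk>x \<in> carr A; y \<in> carr A; z \<in> carr A\<rbrakk>
      \<Longrightarrow> cadd A (cadd A x y) z = cadd A x (cadd A y z)"
    and add_commute: "\<lbrakk>x \<in> carr A; y \<in> carr A\<rbrakk> \<Longrightarrow> cadd A x y = cadd A y x"
    and add_zero: "x \<in> carr A \<Longrightarrow> cadd A x (czero A) = x"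
    and diff_self: "x \<in> carr A \<Longrightarrow> cdiff A x x = czero A"
    and scale_add: "\<lbrakk>x \<in> carr A; y \<in> carr A\<rbrakk>
      \<Longrightarrow> cscale A c (cadd A x y) = cadd A (cscale A c x) (cscale A c y)"
    and add_scale: "x \<in> carr A \<Longrightarrow> cscale A (c + d) x = cadd A (cscale A c x) (cscale A d x)"
    and scale_scale: "x \<in> carr A \<Longrightarrow> cscale A c (cscale A d x) = cscale A (c * d) x"
    and scale_one: "x \<in> carr A \<Longrightarrow> cscale A 1 x = x"
    and mult_assoc: "\<lbrakk>x \<in> carr A; y \<in> carr A; z \<in> carr A\<rbrakk>
      \<Longrightarrow> cmult A (cmult A x y) z = cmult A x (cmult A y z)"
    and mult_add: "\<lbrakk>x \<in> carr A; y \<in> carr A; z \<in> carr A\<rbrakk>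
      \<Longrightarrow> cmult A x (cadd A y z) = cadd A (cmult A x y) (cmult A x z)"
    and add_mult: "\<lbrakk>x \<in> carr A; y \<in> carr A; z \<in> carr A\<rbrakk>
      \<Longrightarrow> cmult A (cadd A x y) z = cadd A (cmult A x z) (cmult A y z)"
    and scale_mult: "\<lbrakk>x \<in> carr A; y \<in> carr A\<rbrakk>
      \<Longrightarrow> cmult A (cscale A c x) y = cscale A c (cmult A x y)"
    and mult_scale: "\<lbrakk>x \<in> carr A; y \<in> carr A\<rbrakk>
      \<Longrightarrow> cmult A x (cscale A c y) = cscale A c (cmult A x y)"
    and adj_adj: "x \<in> carr A \<Longrightarrow> cadj A (cadj A x) = x"
    and adj_add: "\<lbrakk>x \<in> carr A; y \<in> carr A\<rbrakk> \<Longrightarrow> cadj A (cadd A x y) = cadd A (cadj A x) (cadj A y)"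
    and adj_scale: "x \<in> carr A \<Longrightarrow> cadj A (cscale A c x) = cscale A (cnj c) (cadj A x)"
    and adj_mult: "\<lbrakk>x \<in> carr A; y \<in> carr A\<rbrakk>
      \<Longrightarrow> cadj A (cmult A x y) = cmult A (cadj A y) (cadj A x)"
    and norm_nonneg: "x \<in> carr A \<Longrightarrow> 0 \<le> cnorm A x"
    and norm_eq_zero: "x \<in> carr A \<Longrightarrow> cnorm A x = 0 \<longleftrightarrow> x = czero A"
    and norm_scale: "x \<in> carr A \<Longrightarrow> cnorm A (cscale A c x) = cmod c * cnorm A x"
    and norm_triangle: "\<lbrakk>x \<in> carr A; y \<in> carr A\<rbrakk> \<Longrightarrow> cnorm A (cadd A x y) \<le> cnorm A x + cnorm A y"
    and norm_mult: "\<lbrakk>x \<in> carr A; y \<in> carr A\<rbrakk> \<Longrightarrow> cnorm A (cmult A x y) \<le> cnorm A x * cnorm A y"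
    and norm_cstar: "x \<in> carr A \<Longrightarrow> cnorm A (cmult A (cadj A x) x) = (cnorm A x)\<^sup>2"
    and complete: "\<lbrakk>\<And>n::nat. f n \<in> carr A;
        \<And>\<epsilon>. \<epsilon> > 0 \<Longrightarrow> \<exists>N. \<forall>m\<ge>N. \<forall>n\<ge>N. cnorm A (cdiff A (f m) (f n)) < \<epsilon>\<rbrakk>
      \<Longrightarrow> \<exists>l\<in>carr A. (\<lambda>n. cnorm A (cdiff A (f n) l)) \<longlonglongrightarrow> 0"

definition star_hom :: "'a cstar \<Rightarrow> 'b cstar \<Rightarrow> ('a \<Rightarrow> 'b) \<Rightarrow> bool"
  where "star_hom A B f \<longleftrightarrow>
    (\<forall>x\<in>carr A. f x \<in> carr B) \<and>
    (\<forall>x\<in>carr A. \<forall>y\<in>carr A. f (cadd A x y) = cadd B (f x) (f y)) \<and>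
    (\<forall>c. \<forall>x\<in>carr A. f (cscale A c x) = cscale B c (f x)) \<and>
    (\<forall>x\<in>carr A. \<forall>y\<in>carr A. f (cmult A x y) = cmult B (f x) (f y)) \<and>
    (\<forall>x\<in>carr A. f (cadj A x) = cadj B (f x))"

definition star_iso :: "'a cstar \<Rightarrow> 'b cstar \<Rightarrow> ('a \<Rightarrow> 'b) \<Rightarrow> bool"
  where "star_iso A B f \<longleftrightarrow> star_hom A B f \<and> bij_betw f (carr A) (carr B)"

definition cstar_unit :: "'a cstar \<Rightarrow> 'a \<Rightarrow> bool"
  where "cstar_unit A e \<longleftrightarrow> e \<in> carr A \<and> (\<forall>x\<in>carr A. cmult A e x = x \<and> cmult A x e = x)"

definition cstar_isometry :: "'a cstar \<Rightarrow> 'a \<Rightarrow> bool"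
  where "cstar_isometry A v \<longleftrightarrow> v \<in> carr A \<and> cstar_unit A (cmult A (cadj A v) v)"

definition cstar_unitary :: "'a cstar \<Rightarrow> 'a \<Rightarrow> bool"
  where "cstar_unitary A u \<longleftrightarrow>
    u \<in> carr A \<and> cstar_unit A (cmult A (cadj A u) u) \<and> cstar_unit A (cmult A u (cadj A u))"

definition cstar_finite :: "'a cstar \<Rightarrow> bool"
  where "cstar_finite A \<longleftrightarrow>
    (\<exists>e. cstar_unit A e) \<and> (\<forall>v. cstar_isometry A v \<longrightarrow> cstar_unitary A v)"

definition closed_linear_subspace :: "'a cstar \<Rightarrow> 'a set \<Rightarrow> bool"
  where "closed_linear_subspace A S \<longleftrightarrow>
    S \<subseteq> carr A \<and> czero A \<in> S \<and>
    (\<forall>x\<in>S. \<forall>y\<in>S. cadd A x y \<in> S) \<and> (\<forall>c. \<forall>x\<in>S. cscale A c x \<in> S) \<and>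
    (\<forall>f. \<forall>l\<in>carr A. (\<forall>n::nat. f n \<in> S) \<and> (\<lambda>n. cnorm A (cdiff A (f n) l)) \<longlonglongrightarrow> 0 \<longrightarrow> l \<in> S)"

definition closed_star_subalgebra :: "'a cstar \<Rightarrow> 'a set \<Rightarrow> bool"
  where "closed_star_subalgebra A S \<longleftrightarrow>
    closed_linear_subspace A S \<and>
    (\<forall>x\<in>S. \<forall>y\<in>S. cmult A x y \<in> S) \<and> (\<forall>x\<in>S. cadj A x \<in> S)"

definition closed_span :: "'a cstar \<Rightarrow> 'a set \<Rightarrow> 'a set"
  where "closed_span A G = \<Inter>{S. closed_linear_subspace A S \<and> G \<subseteq> S}"

definition cstar_generated :: "'a cstar \<Rightarrow> 'a set \<Rightarrow> 'a cstar"
  where "cstar_generated A G = A\<lparr>carr := \<Inter>{S. closed_star_subalgebra A S \<and> G \<subseteq> S}\<rparr>"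


section \<open>Universal C*-algebras\<close>

text \<open>The C*-algebra of norm-bounded families, with pointwise operations and supremum norm.\<close>

definition cstar_prod :: "'i set \<Rightarrow> ('i \<Rightarrow> 'u cstar) \<Rightarrow> ('i \<Rightarrow> 'u) cstar"
  where "cstar_prod I B =
    \<lparr>carr = {f \<in> (\<Pi>\<^sub>E i\<in>I. carr (B i)). bdd_above ((\<lambda>i. cnorm (B i) (f i)) ` I)},
     cadd = (\<lambda>f g. \<lambda>i\<in>I. cadd (B i) (f i) (g i)),
     czero = (\<lambda>i\<in>I. czero (B i)),
     cscale = (\<lambda>c f. \<lambda>i\<in>I. cscale (B i) c (f i)),
     cmult = (\<lambda>f g. \<lambda>i\<in>I. cmult (B i) (f i) (g i)),
     cadj = (\<lambda>f. \<lambda>i\<in>I. cadj (B i) (f i)),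
     cnorm = (\<lambda>f. SUP i\<in>I. cnorm (B i) (f i))\<rparr>"

text \<open>
  Let R be the class of representations \<open>(B, \<rho>)\<close> of a family of generators (the set G in
  the type 'g) subject to given relations: B is a C*-algebra and \<open>\<rho>\<close> assigns to each
  generator an element of B. The universal C*-algebra for R is, as usual, realised inside
  the product of all representations, as the C*-subalgebra generated by the tautological
  families \<open>(\<rho> g)\<close> indexed by \<open>(B, \<rho>)\<close>; the homomorphism to a given B is the
  projection to the coordinate \<open>(B, \<rho>)\<close>.

  To make R a set, the algebras B are taken with carrier in the type \<open>nat \<Rightarrow> 'g option\<close>.
  This loses nothing: in a C*-algebra generated by a family indexed by (part of) 'g,
  every element is the limit of a sequence of *-polynomials in the generators with
  coefficients in a countable dense subfield, so there are at most as many elements as there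
  are functions \<open>nat \<Rightarrow> 'g option\<close>. Hence every representation, on a C*-algebra over any
  type whatsoever, is up to isomorphism of the algebra generated by its range one of those in R.
\<close>

type_synonym 'g univ = "nat \<Rightarrow> 'g option"
type_synonym 'g rep = "'g univ cstar \<times> ('g \<Rightarrow> 'g univ)"

definition universal_gen :: "'g rep set \<Rightarrow> 'g \<Rightarrow> ('g rep \<Rightarrow> 'g univ)"
  where "universal_gen R g = (\<lambda>i\<in>R. snd i g)"

definition universal_cstar :: "'g set \<Rightarrow> 'g rep set \<Rightarrow> ('g rep \<Rightarrow> 'g univ) cstar"
  where "universal_cstar G R = cstar_generated (cstar_prod R fst) (universal_gen R ` G)"


section \<open>C*-correspondences and Cuntz-Pimsner algebras\<close>

record ('a, 'x) correspondence =
  coeff :: "'a cstar"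
  mcarr :: "'x set"
  madd :: "'x \<Rightarrow> 'x \<Rightarrow> 'x"
  mzero :: 'x
  mscale :: "complex \<Rightarrow> 'x \<Rightarrow> 'x"
  mright :: "'x \<Rightarrow> 'a \<Rightarrow> 'x"
  mleft :: "'a \<Rightarrow> 'x \<Rightarrow> 'x"
  minner :: "'x \<Rightarrow> 'x \<Rightarrow> 'a"

definition mnorm :: "('a, 'x) correspondence \<Rightarrow> 'x \<Rightarrow> real"
  where "mnorm X \<xi> = sqrt (cnorm (coeff X) (minner X \<xi> \<xi>))"

definition is_adjoint :: "('a, 'x) correspondence \<Rightarrow> ('x \<Rightarrow> 'x) \<Rightarrow> ('x \<Rightarrow> 'x) \<Rightarrow> bool"
  where "is_adjoint X T S \<longleftrightarrow>
    (\<forall>\<xi>\<in>mcarr X. \<forall>\<eta>\<in>mcarr X. minner X (T \<xi>) \<eta> = minner X \<xi> (S \<eta>))"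

definition adjointable_ops :: "('a, 'x) correspondence \<Rightarrow> ('x \<Rightarrow> 'x) cstar"
  where "adjointable_ops X =
    \<lparr>carr = {T \<in> mcarr X \<rightarrow>\<^sub>E mcarr X. \<exists>S \<in> mcarr X \<rightarrow>\<^sub>E mcarr X. is_adjoint X T S},
     cadd = (\<lambda>S T. \<lambda>\<xi>\<in>mcarr X. madd X (S \<xi>) (T \<xi>)),
     czero = (\<lambda>\<xi>\<in>mcarr X. mzero X),
     cscale = (\<lambda>c T. \<lambda>\<xi>\<in>mcarr X. mscale X c (T \<xi>)),
     cmult = (\<lambda>S T. \<lambda>\<xi>\<in>mcarr X. S (T \<xi>)),
     cadj = (\<lambda>T. THE S. S \<in> mcarr X \<rightarrow>\<^sub>E mcarr X \<and> is_adjoint X T S),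
     cnorm = (\<lambda>T. SUP \<xi>\<in>{\<xi>\<in>mcarr X. mnorm X \<xi> \<le> 1}. mnorm X (T \<xi>))\<rparr>"

definition left_op :: "('a, 'x) correspondence \<Rightarrow> 'a \<Rightarrow> ('x \<Rightarrow> 'x)"
  where "left_op X a = (\<lambda>\<xi>\<in>mcarr X. mleft X a \<xi>)"

definition rank_one :: "('a, 'x) correspondence \<Rightarrow> 'x \<Rightarrow> 'x \<Rightarrow> ('x \<Rightarrow> 'x)"
  where "rank_one X \<xi> \<eta> = (\<lambda>\<zeta>\<in>mcarr X. mright X \<xi> (minner X \<eta> \<zeta>))"

definition compact_ops :: "('a, 'x) correspondence \<Rightarrow> ('x \<Rightarrow> 'x) cstar"
  where "compact_ops X = (adjointable_ops X)
    \<lparr>carr := closed_span (adjointable_ops X)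
       {rank_one X \<xi> \<eta> |\<xi> \<eta>. \<xi> \<in> mcarr X \<and> \<eta> \<in> mcarr X}\<rparr>"

definition katsura_ideal :: "('a, 'x) correspondence \<Rightarrow> 'a set"
  where "katsura_ideal X = {a \<in> carr (coeff X).
    left_op X a \<in> carr (compact_ops X) \<and>
    (\<forall>b\<in>carr (coeff X). left_op X b = czero (adjointable_ops X) \<longrightarrow>
       cmult (coeff X) a b = czero (coeff X))}"

definition toeplitz_rep ::
    "('a, 'x) correspondence \<Rightarrow> 'b cstar \<Rightarrow> ('a \<Rightarrow> 'b) \<Rightarrow> ('x \<Rightarrow> 'b) \<Rightarrow> bool"
  where "toeplitz_rep X B \<pi> \<tau> \<longleftrightarrow>
    star_hom (coeff X) B \<pi> \<and>
    (\<forall>\<xi>\<in>mcarr X. \<tau> \<xi> \<in> carr B) \<and>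
    (\<forall>\<xi>\<in>mcarr X. \<forall>\<eta>\<in>mcarr X. \<tau> (madd X \<xi> \<eta>) = cadd B (\<tau> \<xi>) (\<tau> \<eta>)) \<and>
    (\<forall>c. \<forall>\<xi>\<in>mcarr X. \<tau> (mscale X c \<xi>) = cscale B c (\<tau> \<xi>)) \<and>
    (\<forall>a\<in>carr (coeff X). \<forall>\<xi>\<in>mcarr X. \<tau> (mleft X a \<xi>) = cmult B (\<pi> a) (\<tau> \<xi>)) \<and>
    (\<forall>\<xi>\<in>mcarr X. \<forall>\<eta>\<in>mcarr X. cmult B (cadj B (\<tau> \<xi>)) (\<tau> \<eta>) = \<pi> (minner X \<xi> \<eta>))"

text \<open>
  The *-homomorphism \<open>\<phi>\<close> below is uniquely determined by its values on the rank one
  operators and exists for every Toeplitz representation.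
\<close>

definition covariant_rep ::
    "('a, 'x) correspondence \<Rightarrow> 'b cstar \<Rightarrow> ('a \<Rightarrow> 'b) \<Rightarrow> ('x \<Rightarrow> 'b) \<Rightarrow> bool"
  where "covariant_rep X B \<pi> \<tau> \<longleftrightarrow>
    toeplitz_rep X B \<pi> \<tau> \<and>
    (\<exists>\<phi>. star_hom (compact_ops X) B \<phi> \<and>
      (\<forall>\<xi>\<in>mcarr X. \<forall>\<eta>\<in>mcarr X. \<phi> (rank_one X \<xi> \<eta>) = cmult B (\<tau> \<xi>) (cadj B (\<tau> \<eta>))) \<and>
      (\<forall>a\<in>katsura_ideal X. \<phi> (left_op X a) = \<pi> a))"

definition cuntz_pimsner_reps :: "('a, 'x) correspondence \<Rightarrow> ('a + 'x) rep set"
  where "cuntz_pimsner_reps X =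
    {(B, \<rho>). cstar_algebra B \<and> covariant_rep X B (\<lambda>a. \<rho> (Inl a)) (\<lambda>\<xi>. \<rho> (Inr \<xi>))}"

definition cuntz_pimsner ::
    "('a, 'x) correspondence \<Rightarrow> (('a + 'x) rep \<Rightarrow> ('a + 'x) univ) cstar"
  where "cuntz_pimsner X =
    universal_cstar (carr (coeff X) <+> mcarr X) (cuntz_pimsner_reps X)"

definition cp_coeff :: "('a, 'x) correspondence \<Rightarrow> 'a \<Rightarrow> (('a + 'x) rep \<Rightarrow> ('a + 'x) univ)"
  where "cp_coeff X a = universal_gen (cuntz_pimsner_reps X) (Inl a)"

definition cp_module :: "('a, 'x) correspondence \<Rightarrow> 'x \<Rightarrow> (('a + 'x) rep \<Rightarrow> ('a + 'x) univ)"
  where "cp_module X \<xi> = universal_gen (cuntz_pimsner_reps X) (Inr \<xi>)"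


section \<open>Algebras of continuous functions and crossed products\<close>

text \<open>
  A function on a space Y is represented by its extension by 0 to the whole type.
\<close>

definition restrict0 :: "'y topology \<Rightarrow> ('y \<Rightarrow> complex) \<Rightarrow> ('y \<Rightarrow> complex)"
  where "restrict0 Y f = (\<lambda>y. if y \<in> topspace Y then f y else 0)"

definition cont_funs :: "'y topology \<Rightarrow> ('y \<Rightarrow> complex) set"
  where "cont_funs Y = {f. continuous_map Y euclidean f \<and> (\<forall>y. y \<notin> topspace Y \<longrightarrow> f y = 0)}"

definition Cc_funs :: "'y topology \<Rightarrow> ('y \<Rightarrow> complex) set"
  where "Cc_funs Y = {f \<in> cont_funs Y. \<exists>K. compactin Y K \<and> (\<forall>y. y \<notin> K \<longrightarrow> f y = 0)}"

definition C0_funs :: "'y topology \<Rightarrow> ('y \<Rightarrow> complex) set"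
  where "C0_funs Y = {f \<in> cont_funs Y. \<forall>\<epsilon>>0. compactin Y {y \<in> topspace Y. \<epsilon> \<le> cmod (f y)}}"

text \<open>For compact Y this is C(Y), with unit the indicator function of the underlying set of Y.\<close>

definition C0_algebra :: "'y topology \<Rightarrow> ('y \<Rightarrow> complex) cstar"
  where "C0_algebra Y =
    \<lparr>carr = C0_funs Y,
     cadd = (\<lambda>f g y. f y + g y),
     czero = (\<lambda>y. 0),
     cscale = (\<lambda>c f y. c * f y),
     cmult = (\<lambda>f g y. f y * g y),
     cadj = (\<lambda>f y. cnj (f y)),
     cnorm = (\<lambda>f. SUP y. cmod (f y))\<rparr>"

definition crossed_reps :: "'y topology \<Rightarrow> ('y \<Rightarrow> 'y) \<Rightarrow> (('y \<Rightarrow> complex) + unit) rep set"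
  where "crossed_reps Y \<sigma> = {(B, \<rho>).
    cstar_algebra B \<and>
    star_hom (C0_algebra Y) B (\<lambda>a. \<rho> (Inl a)) \<and>
    cstar_unit B (\<rho> (Inl (indicator (topspace Y)))) \<and>
    cstar_unitary B (\<rho> (Inr ())) \<and>
    (\<forall>a\<in>C0_funs Y. cmult B (cmult B (\<rho> (Inr ())) (\<rho> (Inl a))) (cadj B (\<rho> (Inr ())))
       = \<rho> (Inl (restrict0 Y (a \<circ> \<sigma>))))}"

definition crossed_product :: "'y topology \<Rightarrow> ('y \<Rightarrow> 'y) \<Rightarrow>
    ((('y \<Rightarrow> complex) + unit) rep \<Rightarrow> (('y \<Rightarrow> complex) + unit) univ) cstar"
  where "crossed_product Y \<sigma> = universal_cstar (C0_funs Y <+> UNIV) (crossed_reps Y \<sigma>)"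

definition cross_fun :: "'y topology \<Rightarrow> ('y \<Rightarrow> 'y) \<Rightarrow> ('y \<Rightarrow> complex) \<Rightarrow>
    ((('y \<Rightarrow> complex) + unit) rep \<Rightarrow> (('y \<Rightarrow> complex) + unit) univ)"
  where "cross_fun Y \<sigma> a = universal_gen (crossed_reps Y \<sigma>) (Inl a)"

definition cross_unitary :: "'y topology \<Rightarrow> ('y \<Rightarrow> 'y) \<Rightarrow>
    ((('y \<Rightarrow> complex) + unit) rep \<Rightarrow> (('y \<Rightarrow> complex) + unit) univ)"
  where "cross_unitary Y \<sigma> = universal_gen (crossed_reps Y \<sigma>) (Inr ())"


section \<open>Topological graphs\<close>

record ('v, 'e) top_graph =
  verts :: "'v topology"
  edges :: "'e topology"
  rng :: "'e \<Rightarrow> 'v"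
  src :: "'e \<Rightarrow> 'v"

definition local_homeomorphism :: "'a topology \<Rightarrow> 'b topology \<Rightarrow> ('a \<Rightarrow> 'b) \<Rightarrow> bool"
  where "local_homeomorphism X Y f \<longleftrightarrow>
    (\<forall>x\<in>topspace X. \<exists>U. openin X U \<and> x \<in> U \<and> openin Y (f ` U) \<and>
       homeomorphic_map (subtopology X U) (subtopology Y (f ` U)) f)"

definition topological_graph :: "('v, 'e) top_graph \<Rightarrow> bool"
  where "topological_graph E \<longleftrightarrow>
    locally_compact_space (verts E) \<and> Hausdorff_space (verts E) \<and> second_countable (verts E) \<and>
    locally_compact_space (edges E) \<and> Hausdorff_space (edges E) \<and> second_countable (edges E) \<and>
    continuous_map (edges E) (verts E) (rng E) \<and>
    continuous_map (edges E) (verts E) (src E) \<and>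
    local_homeomorphism (edges E) (verts E) (src E)"

definition compact_graph :: "('v, 'e) top_graph \<Rightarrow> bool"
  where "compact_graph E \<longleftrightarrow> compact_space (verts E) \<and> compact_space (edges E)"

definition edges_from :: "('v, 'e) top_graph \<Rightarrow> 'v \<Rightarrow> 'e set"
  where "edges_from E v = {e \<in> topspace (edges E). src E e = v}"

definition no_sinks :: "('v, 'e) top_graph \<Rightarrow> bool"
  where "no_sinks E \<longleftrightarrow> (\<forall>v\<in>topspace (verts E). edges_from E v \<noteq> {})"

text \<open>The edge written \<open>\<alpha>(n)\<close> for \<open>n = 1, 2, ...\<close> is \<open>\<alpha> (n - 1)\<close> here.\<close>

definition inf_paths :: "('v, 'e) top_graph \<Rightarrow> (nat \<Rightarrow> 'e) topology"
  where "inf_paths E = subtopology (product_topology (\<lambda>_. edges E) UNIV)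
    {\<alpha>. \<forall>n. src E (\<alpha> n) = rng E (\<alpha> (Suc n))}"

definition back_shift :: "(nat \<Rightarrow> 'e) \<Rightarrow> (nat \<Rightarrow> 'e)"
  where "back_shift \<alpha> = (\<lambda>n. \<alpha> (Suc n))"

definition first_edge :: "(nat \<Rightarrow> 'e) \<Rightarrow> 'e"
  where "first_edge \<alpha> = \<alpha> 0"

text \<open>
  The completion of the compactly supported continuous functions on the edge space. Since the
  module norm, the square root of \<open>sup\<^sub>v \<Sum>\<^bsub>e \<in> edges_from E v\<^esub> \<bar>\<xi> e\<bar>\<^sup>2\<close>, dominates the
  supremum norm, the completion consists of functions: those that can be approximated in the
  module norm by compactly supported continuous ones.
\<close>

definition graph_module :: "('v, 'e) top_graph \<Rightarrow> ('e \<Rightarrow> complex) set"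
  where "graph_module E = {\<xi>. (\<forall>e. e \<notin> topspace (edges E) \<longrightarrow> \<xi> e = 0) \<and>
    (\<forall>\<epsilon>>0. \<exists>\<eta>\<in>Cc_funs (edges E). \<forall>v\<in>topspace (verts E).
       (\<lambda>e. (cmod (\<xi> e - \<eta> e))\<^sup>2) summable_on edges_from E v \<and>
       (\<Sum>\<^sub>\<infinity>e\<in>edges_from E v. (cmod (\<xi> e - \<eta> e))\<^sup>2) \<le> \<epsilon>\<^sup>2)}"

definition graph_correspondence :: "('v, 'e) top_graph \<Rightarrow> ('v \<Rightarrow> complex, 'e \<Rightarrow> complex) correspondence"
  where "graph_correspondence E =
    \<lparr>coeff = C0_algebra (verts E),
     mcarr = graph_module E,
     madd = (\<lambda>\<xi> \<eta> e. \<xi> e + \<eta> e),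
     mzero = (\<lambda>e. 0),
     mscale = (\<lambda>c \<xi> e. c * \<xi> e),
     mright = (\<lambda>\<xi> a e. \<xi> e * a (src E e)),
     mleft = (\<lambda>a \<xi> e. a (rng E e) * \<xi> e),
     minner = (\<lambda>\<xi> \<eta> v. \<Sum>\<^sub>\<infinity>e\<in>edges_from E v. cnj (\<xi> e) * \<eta> e)\<rparr>"

definition graph_algebra :: "('v, 'e) top_graph \<Rightarrow>
    ((('v \<Rightarrow> complex) + ('e \<Rightarrow> complex)) rep \<Rightarrow> (('v \<Rightarrow> complex) + ('e \<Rightarrow> complex)) univ) cstar"
  where "graph_algebra E = cuntz_pimsner (graph_correspondence E)"

end

theory Submission
  imports Defs
begin

text \<open>
  If \<open>C\<^sup>*(E)\<close> is finite, take a vector \<open>\<xi>\<close> without zeros such that \<open>\<langle>\<xi>,\<xi>\<rangle> = 1\<close>, which exists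
  because \<open>s\<close> is a surjective finite-to-one local homeomorphism. Its image in \<open>C\<^sup>*(E)\<close> is an isometry,
  hence a unitary in every covariant representation. On the \<open>\<ell>\<^sup>2\<close>-space of the finite paths from
  a vertex that receives no edge, the empty path is orthogonal to the range of this isometry. On
  \<open>\<ell>\<^sup>2(E\<^sup>\<infinity>)\<close>, its range projection has nonzero matrix entries between any two paths that differ
  only in their first edges. So all vertices receive edges and \<open>s\<close> is injective.

  If \<open>s\<close> is injective and \<open>r\<close> is surjective, the constant function 1 is a frame of the module, and the
  left action is injective and by compact operators, so covariance says that \<open>u = \<tau>(1)\<close> is unitary. With
  edges counted from 0, the functions \<open>\<alpha> \<mapsto> a(r(\<alpha>(n)))\<close> are dense in \<open>C(E\<^sup>\<infinity>)\<close>, and sending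
  them to \<open>u\<^sup>n \<pi>(a) (u\<^sup>*)\<^sup>n\<close> extends to a homomorphism; this yields the inverse of the natural
  map. The universal algebras only see representations on carriers in a fixed type, which is enough
  because a separable C*-algebra embeds into each of these types.
\<close>

section \<open>Algebra and limits in a C*-algebra\<close>

text \<open>Two obstacles shape the proof. That a star homomorphism is contractive rests on spectral
  theory, so contractivity is carried along in \<open>contractive_hom\<close>, and each map gets it
  for a direct reason: out of C(Y) by an elementary argument, out of a universal algebra because the
  map is a coordinate projection followed by an isometry. And covariance asks for a homomorphism on
  all compact operators, which has to be exhibited; a finite frame writes it as a finite sum. If
  \<open>s\<close> is injective and there are no sinks, \<open>s\<close> is a bijection from edges
  to vertices, so a(r(\<alpha>(n))) = b(r(\<alpha>(n+1))) with b = a o r o s^-1. Hence C(E^infinity)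
  is the direct limit of copies of C(E^0) along the map that sends a to b, and the relations give
  pi(a) = u pi(b) u*, which is exactly the compatibility needed to map the limit. Surjectivity of
  \<open>r\<close> makes every copy isometric, so the map is bounded by 1 before it is extended to
  the closure.\<close>

context cstar_algebra
begin

text \<open>Records carry no topology, so limits are norm limits stated by hand. Membership in the
  carrier is not part of the notion and is demanded separately in the limit laws.\<close>

definition clim :: "(nat \<Rightarrow> 'a) \<Rightarrow> 'a \<Rightarrow> bool"
  where "clim f l \<longleftrightarrow> (\<lambda>n. cnorm A (cdiff A (f n) l)) \<longlonglongrightarrow> 0"

lemma diff_closed: "\<lbrakk>x \<in> carr A; y \<in> carr A\<rbrakk> \<Longrightarrow> cdiff A x y \<in> carr A"
  by (simp add: cdiff_def add_closed scale_closed)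

lemmas closed = zero_closed add_closed scale_closed mult_closed adj_closed diff_closed

lemma zero_add: "x \<in> carr A \<Longrightarrow> cadd A (czero A) x = x"
  using add_commute[OF zero_closed] add_zero by simp

lemma add_left_commute:
  "\<lbrakk>x \<in> carr A; y \<in> carr A; z \<in> carr A\<rbrakk> \<Longrightarrow> cadd A x (cadd A y z) = cadd A y (cadd A x z)"
  by (metis add_assoc add_commute)

lemmas add_ac = add_assoc add_commute add_left_commute

lemma scale_zero_left: "x \<in> carr A \<Longrightarrow> cscale A 0 x = czero A"
proof -
  assume x: "x \<in> carr A"
  have "czero A = cadd A (cscale A 1 x) (cscale A (-1) x)"
    using diff_self[OF x] x by (simp add: cdiff_def scale_one)
  also have "\<dots> = cscale A (1 + -1) x" using x by (simp only: add_scale)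
  finally show ?thesis by simp
qed

lemma scale_zero: "cscale A c (czero A) = czero A"
  using scale_zero_left[OF zero_closed] scale_scale[OF zero_closed, of c 0] by simp

lemma mult_zero: "x \<in> carr A \<Longrightarrow> cmult A x (czero A) = czero A"
  by (metis scale_zero_left mult_scale zero_closed mult_closed)

lemma zero_mult: "x \<in> carr A \<Longrightarrow> cmult A (czero A) x = czero A"
  by (metis scale_zero_left scale_mult zero_closed mult_closed)

lemma adj_zero: "cadj A (czero A) = czero A"
  by (metis adj_scale complex_cnj_zero scale_zero_left zero_closed adj_closed)

lemma norm_zero: "cnorm A (czero A) = 0"
  using norm_eq_zero zero_closed by blast

lemma diff_add_cancel: "\<lbrakk>x \<in> carr A; y \<in> carr A\<rbrakk> \<Longrightarrow> cadd A (cdiff A x y) y = x"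
  using diff_self[of y]
  by (simp add: cdiff_def add_assoc scale_closed add_commute[of _ y] add_zero)

lemma diff_eq_zero_iff: "\<lbrakk>x \<in> carr A; y \<in> carr A\<rbrakk> \<Longrightarrow> cdiff A x y = czero A \<longleftrightarrow> x = y"
  using diff_add_cancel[of x y] diff_self by (auto simp: zero_add)

lemma norm_diff_eq_zero_iff: "\<lbrakk>x \<in> carr A; y \<in> carr A\<rbrakk> \<Longrightarrow> cnorm A (cdiff A x y) = 0 \<longleftrightarrow> x = y"
  by (simp add: norm_eq_zero diff_closed diff_eq_zero_iff)

lemma diff_zero: "x \<in> carr A \<Longrightarrow> cdiff A x (czero A) = x"
  by (simp add: cdiff_def scale_zero add_zero)

lemma scale_diff: "\<lbrakk>x \<in> carr A; y \<in> carr A\<rbrakk>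
    \<Longrightarrow> cscale A c (cdiff A x y) = cdiff A (cscale A c x) (cscale A c y)"
  by (simp add: cdiff_def scale_add scale_scale scale_closed mult.commute)

lemma norm_diff_commute: "\<lbrakk>x \<in> carr A; y \<in> carr A\<rbrakk> \<Longrightarrow> cnorm A (cdiff A x y) = cnorm A (cdiff A y x)"
proof -
  assume xy: "x \<in> carr A" "y \<in> carr A"
  have "cdiff A x y = cscale A (-1) (cdiff A y x)"
    using xy by (simp add: cdiff_def scale_add scale_closed scale_scale scale_one add_commute)
  then show ?thesis using xy by (simp add: norm_scale closed)
qed

lemma diff_add_diff: "\<lbrakk>x \<in> carr A; y \<in> carr A; z \<in> carr A; w \<in> carr A\<rbrakk>
    \<Longrightarrow> cdiff A (cadd A x y) (cadd A z w) = cadd A (cdiff A x z) (cdiff A y w)"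
  by (simp add: cdiff_def scale_add scale_closed add_closed add_ac)

lemma diff_trans: "\<lbrakk>x \<in> carr A; y \<in> carr A; z \<in> carr A\<rbrakk>
    \<Longrightarrow> cdiff A x z = cadd A (cdiff A x y) (cdiff A y z)"
proof -
  assume c: "x \<in> carr A" "y \<in> carr A" "z \<in> carr A"
  have "cadd A (cdiff A x y) (cdiff A y z) = cadd A (cadd A (cdiff A x y) y) (cscale A (-1) z)"
    using c by (simp only: cdiff_def[of A y z] add_assoc[OF diff_closed] scale_closed)
  also have "\<dots> = cdiff A x z" by (simp only: diff_add_cancel c) (simp only: cdiff_def)
  finally show ?thesis ..
qed

lemma norm_diff_triangle: "\<lbrakk>x \<in> carr A; y \<in> carr A; z \<in> carr A\<rbrakk>
    \<Longrightarrow> cnorm A (cdiff A x z) \<le> cnorm A (cdiff A x y) + cnorm A (cdiff A y z)"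
  using norm_triangle[of "cdiff A x y" "cdiff A y z"] by (simp add: diff_closed flip: diff_trans)

lemma norm_le_diff: "\<lbrakk>x \<in> carr A; y \<in> carr A\<rbrakk>
    \<Longrightarrow> cnorm A x \<le> cnorm A (cdiff A x y) + cnorm A y"
  using norm_diff_triangle[of x y "czero A"] by (simp add: zero_closed diff_zero)

lemma mult_diff: "\<lbrakk>x \<in> carr A; y \<in> carr A; z \<in> carr A\<rbrakk>
    \<Longrightarrow> cmult A x (cdiff A y z) = cdiff A (cmult A x y) (cmult A x z)"
  by (simp add: cdiff_def mult_add mult_scale closed)

lemma diff_mult: "\<lbrakk>x \<in> carr A; y \<in> carr A; z \<in> carr A\<rbrakk>
    \<Longrightarrow> cmult A (cdiff A x y) z = cdiff A (cmult A x z) (cmult A y z)"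
  by (simp add: cdiff_def add_mult scale_mult closed)

lemma adj_diff: "\<lbrakk>x \<in> carr A; y \<in> carr A\<rbrakk> \<Longrightarrow> cadj A (cdiff A x y) = cdiff A (cadj A x) (cadj A y)"
  by (simp add: cdiff_def adj_add adj_scale closed)

text \<open>From the C*-identity, |x|^2 = |x* x| <= |x*| |x|; this for \<open>x\<close> and for its
  adjoint gives both inequalities.\<close>

lemma norm_adj: "x \<in> carr A \<Longrightarrow> cnorm A (cadj A x) = cnorm A x"
proof -
  have le: "cnorm A x \<le> cnorm A (cadj A x)" if x: "x \<in> carr A" for x
  proof (cases "cnorm A x = 0")
    case False
    have "cnorm A x * cnorm A x \<le> cnorm A (cadj A x) * cnorm A x"
      using norm_cstar[OF x] norm_mult[OF adj_closed[OF x] x] by (simp add: power2_eq_square)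
    then show ?thesis using False norm_nonneg[OF x] by auto
  qed (use that norm_nonneg adj_closed in auto)
  assume x: "x \<in> carr A"
  show ?thesis using le[OF x] le[OF adj_closed[OF x]] by (simp add: adj_adj x)
qed

lemma climI: "(\<And>n. cnorm A (cdiff A (f n) l) \<le> e n) \<Longrightarrow> e \<longlonglongrightarrow> 0
    \<Longrightarrow> (\<And>n. f n \<in> carr A) \<Longrightarrow> l \<in> carr A \<Longrightarrow> clim f l"
  unfolding clim_def by (rule tendsto_sandwich[of "\<lambda>_. 0" _ _ e]) (auto simp: norm_nonneg diff_closed)

lemma clim_const: "l \<in> carr A \<Longrightarrow> clim (\<lambda>_. l) l"
  by (simp add: clim_def diff_self norm_zero)

lemma clim_unique:
  assumes "clim f l" "clim f m" "\<And>n. f n \<in> carr A" "l \<in> carr A" "m \<in> carr A"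
  shows "l = m"
proof -
  have "(\<lambda>n. cnorm A (cdiff A (f n) l) + cnorm A (cdiff A (f n) m)) \<longlonglongrightarrow> 0 + 0"
    using assms(1,2) unfolding clim_def by (rule tendsto_add)
  moreover have "cnorm A (cdiff A l m) \<le> cnorm A (cdiff A (f n) l) + cnorm A (cdiff A (f n) m)" for n
    using norm_diff_triangle[of l "f n" m] assms by (simp add: norm_diff_commute[of l])
  ultimately have "cnorm A (cdiff A l m) \<le> 0" by (auto intro: LIMSEQ_le_const)
  then have "cnorm A (cdiff A l m) = 0" using norm_nonneg[of "cdiff A l m"] assms diff_closed by force
  then show ?thesis using assms norm_diff_eq_zero_iff by blast
qed

lemma clim_norm:
  assumes "clim f l" "\<And>n. f n \<in> carr A" "l \<in> carr A"
  shows "(\<lambda>n. cnorm A (f n)) \<longlonglongrightarrow> cnorm A l"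
proof (rule LIM_zero_cancel, rule tendsto_rabs_zero_cancel, rule tendsto_sandwich[OF _ _ tendsto_const])
  show "(\<lambda>n. cnorm A (cdiff A (f n) l)) \<longlonglongrightarrow> 0" using assms clim_def by blast
  show "\<forall>\<^sub>F n in sequentially. \<bar>cnorm A (f n) - cnorm A l\<bar> \<le> cnorm A (cdiff A (f n) l)"
  proof (intro always_eventually allI)
    fix n
    show "\<bar>cnorm A (f n) - cnorm A l\<bar> \<le> cnorm A (cdiff A (f n) l)"
      using norm_le_diff[of "f n" l] norm_le_diff[of l "f n"] norm_diff_commute[of "f n" l] assms by auto
  qed
qed auto

lemma clim_add:
  assumes "clim f l" "clim g m" "\<And>n. f n \<in> carr A" "\<And>n. g n \<in> carr A" "l \<in> carr A" "m \<in> carr A"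
  shows "clim (\<lambda>n. cadd A (f n) (g n)) (cadd A l m)"
proof (rule climI)
  show "cnorm A (cdiff A (cadd A (f n) (g n)) (cadd A l m))
      \<le> cnorm A (cdiff A (f n) l) + cnorm A (cdiff A (g n) m)" for n
    using assms by (simp add: diff_add_diff norm_triangle closed)
  show "(\<lambda>n. cnorm A (cdiff A (f n) l) + cnorm A (cdiff A (g n) m)) \<longlonglongrightarrow> 0"
    using tendsto_add[of _ 0 _ _ 0] assms unfolding clim_def by fastforce
qed (use assms closed in auto)

text \<open>The scalars vary too, because \<open>separable_in_generated\<close> approximates an
  arbitrary scalar by scalars from a countable dense set.\<close>

lemma clim_scale':
  assumes "clim f l" "c \<longlonglongrightarrow> d" "\<And>n. f n \<in> carr A" "l \<in> carr A"
  shows "clim (\<lambda>n. cscale A (c n) (f n)) (cscale A d l)"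
proof (rule climI)
  show "cnorm A (cdiff A (cscale A (c n) (f n)) (cscale A d l))
      \<le> cmod (c n) * cnorm A (cdiff A (f n) l) + cmod (c n - d) * cnorm A l" for n
  proof -
    have "cdiff A (cscale A (c n) (f n)) (cscale A d l)
       = cadd A (cscale A (c n) (cdiff A (f n) l)) (cscale A (c n - d) l)"
      using assms diff_trans[of "cscale A (c n) (f n)" "cscale A (c n) l" "cscale A d l"]
      by (simp add: closed flip: scale_diff) (simp add: cdiff_def scale_scale flip: add_scale)
    then show ?thesis
      using assms norm_triangle[of "cscale A (c n) (cdiff A (f n) l)" "cscale A (c n - d) l"]
      by (simp add: closed norm_scale)
  qed
  have "(\<lambda>n. cmod (c n) * cnorm A (cdiff A (f n) l) + cmod (c n - d) * cnorm A l)
      \<longlonglongrightarrow> cmod d * 0 + cmod (d - d) * cnorm A l"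
    using assms unfolding clim_def by (intro tendsto_intros)
  then show "(\<lambda>n. cmod (c n) * cnorm A (cdiff A (f n) l) + cmod (c n - d) * cnorm A l) \<longlonglongrightarrow> 0" by simp
qed (use assms closed in auto)

lemmas clim_scale = clim_scale'[OF _ tendsto_const]

lemma clim_mult:
  assumes "clim f l" "clim g m" "\<And>n. f n \<in> carr A" "\<And>n. g n \<in> carr A" "l \<in> carr A" "m \<in> carr A"
  shows "clim (\<lambda>n. cmult A (f n) (g n)) (cmult A l m)"
proof (rule climI)
  show "cnorm A (cdiff A (cmult A (f n) (g n)) (cmult A l m))
      \<le> cnorm A (f n) * cnorm A (cdiff A (g n) m) + cnorm A (cdiff A (f n) l) * cnorm A m" for n
  proof -
    have "cdiff A (cmult A (f n) (g n)) (cmult A l m)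
       = cadd A (cmult A (f n) (cdiff A (g n) m)) (cmult A (cdiff A (f n) l) m)"
      using assms diff_trans[of "cmult A (f n) (g n)" "cmult A (f n) m" "cmult A l m"]
      by (simp add: mult_diff diff_mult closed)
    then show ?thesis
      using assms norm_triangle[of "cmult A (f n) (cdiff A (g n) m)" "cmult A (cdiff A (f n) l) m"]
        norm_mult[of "f n" "cdiff A (g n) m"] norm_mult[of "cdiff A (f n) l" m]
      by (simp add: closed)
  qed
  have "(\<lambda>n. cnorm A (f n) * cnorm A (cdiff A (g n) m) + cnorm A (cdiff A (f n) l) * cnorm A m)
      \<longlonglongrightarrow> cnorm A l * 0 + 0 * cnorm A m"
    using assms clim_norm[of f l] unfolding clim_def by (intro tendsto_intros) auto
  then show "(\<lambda>n. cnorm A (f n) * cnorm A (cdiff A (g n) m) + cnorm A (cdiff A (f n) l) * cnorm A m)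
      \<longlonglongrightarrow> 0" by simp
qed (use assms closed in auto)

lemma clim_adj:
  assumes "clim f l" "\<And>n. f n \<in> carr A" "l \<in> carr A"
  shows "clim (\<lambda>n. cadj A (f n)) (cadj A l)"
  using assms by (simp add: clim_def norm_adj diff_closed flip: adj_diff)

lemma approx_clim:
  assumes "\<And>e. e > 0 \<Longrightarrow> \<exists>d\<in>D. cnorm A (cdiff A d x) < e" "D \<subseteq> carr A" "x \<in> carr A"
  obtains f where "\<And>n. f n \<in> D" "clim f x"
proof -
  have "\<forall>n. \<exists>d\<in>D. cnorm A (cdiff A d x) < 1 / Suc n" using assms(1) by simp
  then obtain f where f: "\<And>n. f n \<in> D" "\<And>n. cnorm A (cdiff A (f n) x) < 1 / Suc n" by metis
  have "clim f x"
    by (rule climI[OF less_imp_le[OF f(2)]]) (use f assms LIMSEQ_Suc[OF lim_1_over_n] in auto)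
  then show ?thesis using that f by blast
qed

lemma clim_approx: "clim f x \<Longrightarrow> e > 0 \<Longrightarrow> \<exists>n. cnorm A (cdiff A (f n) x) < e"
  unfolding clim_def
  by (drule order_tendstoD(2)[of _ 0 _ e]) (auto simp: eventually_sequentially)

lemma unit_unique: "cstar_unit A d \<Longrightarrow> cstar_unit A e \<Longrightarrow> d = e"
  unfolding cstar_unit_def by metis

text \<open>The C*-identity reads |p|^2 = |p|, so the norm is 0 or 1.\<close>

lemma projection_norm_le: "p \<in> carr A \<Longrightarrow> cmult A (cadj A p) p = p \<Longrightarrow> cnorm A p \<le> 1"
  using norm_cstar[of p] norm_nonneg[of p]
  by (metis mult_cancel_right2 order.refl power2_eq_square zero_le_one)

text \<open>In \<open>\<tau>_right\<close> this is applied to the difference of the two sides of the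
  identity to be proved.\<close>

lemma adj_mult_self_eq_zero: "x \<in> carr A \<Longrightarrow> cmult A (cadj A x) x = czero A \<Longrightarrow> x = czero A"
  using norm_cstar[of x] by (simp add: norm_zero norm_eq_zero)

lemma closed_star_subalgebra_carr: "closed_star_subalgebra A (carr A)"
  unfolding closed_star_subalgebra_def closed_linear_subspace_def by (auto simp: closed)

end

section \<open>Constructions of C*-algebras\<close>

lemma cdiff_update_carr [simp]: "cdiff (A\<lparr>carr := S\<rparr>) = cdiff A"
  by (intro ext) (simp add: cdiff_def)

lemma closed_star_subalgebraD:
  assumes "closed_star_subalgebra A S"
  shows "S \<subseteq> carr A" "czero A \<in> S" "\<And>x y. x \<in> S \<Longrightarrow> y \<in> S \<Longrightarrow> cadd A x y \<in> S"
    "\<And>c x. x \<in> S \<Longrightarrow> cscale A c x \<in> S" "\<And>x y. x \<in> S \<Longrightarrow> y \<in> S \<Longrightarrow> cmult A x y \<in> S"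
    "\<And>x. x \<in> S \<Longrightarrow> cadj A x \<in> S"
    "\<And>f l. \<lbrakk>\<And>n::nat. f n \<in> S; l \<in> carr A; (\<lambda>n. cnorm A (cdiff A (f n) l)) \<longlonglongrightarrow> 0\<rbrakk> \<Longrightarrow> l \<in> S"
  using assms unfolding closed_star_subalgebra_def closed_linear_subspace_def by blast+

lemma cstar_subalgebra:
  assumes "cstar_algebra A" "closed_star_subalgebra A S"
  shows "cstar_algebra (A\<lparr>carr := S\<rparr>)"
proof -
  interpret cstar_algebra A by fact
  note S = closed_star_subalgebraD[OF assms(2)]
  have in_A: "x \<in> S \<Longrightarrow> x \<in> carr A" for x using S(1) by blast
  show ?thesis
  proof unfold_locales
    fix f :: "nat \<Rightarrow> 'a"
    assume f: "\<And>n. f n \<in> carr (A\<lparr>carr := S\<rparr>)"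
      and cauchy: "\<And>\<epsilon>. \<epsilon> > 0 \<Longrightarrow> \<exists>N. \<forall>m\<ge>N. \<forall>n\<ge>N.
        cnorm (A\<lparr>carr := S\<rparr>) (cdiff (A\<lparr>carr := S\<rparr>) (f m) (f n)) < \<epsilon>"
    have "\<exists>l\<in>carr A. (\<lambda>n. cnorm A (cdiff A (f n) l)) \<longlonglongrightarrow> 0"
      by (rule complete) (use f cauchy in_A in auto)
    then obtain l where "l \<in> carr A" "(\<lambda>n. cnorm A (cdiff A (f n) l)) \<longlonglongrightarrow> 0" by blast
    then show "\<exists>l\<in>carr (A\<lparr>carr := S\<rparr>).
        (\<lambda>n. cnorm (A\<lparr>carr := S\<rparr>) (cdiff (A\<lparr>carr := S\<rparr>) (f n) l)) \<longlonglongrightarrow> 0"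
      using S(7)[of f l] f by auto
  qed (use S(2-6) in_A in \<open>auto simp: add_ac add_zero diff_self scale_add add_scale
        scale_scale scale_one mult_assoc mult_add add_mult scale_mult mult_scale adj_adj adj_add
        adj_scale adj_mult norm_nonneg norm_eq_zero norm_scale norm_triangle norm_mult norm_cstar\<close>)
qed

lemma closed_star_subalgebra_generated:
  assumes "cstar_algebra A" "G \<subseteq> carr A"
  shows "closed_star_subalgebra A (carr (cstar_generated A G))"
proof -
  define F where "F = {S. closed_star_subalgebra A S \<and> G \<subseteq> S}"
  have carr: "carr A \<in> F"
    using cstar_algebra.closed_star_subalgebra_carr[OF assms(1)] assms(2) by (simp add: F_def)
  have *: "(\<And>S. S \<in> F \<Longrightarrow> x \<in> S) \<Longrightarrow> x \<in> \<Inter>F" for x by blast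
  have S: "S \<in> F \<Longrightarrow> x \<in> \<Inter>F \<Longrightarrow> x \<in> S" for S x by blast
  have "closed_star_subalgebra A (\<Inter>F)"
    unfolding closed_star_subalgebra_def closed_linear_subspace_def
  proof (intro conjI ballI allI impI; (elim conjE)?)
    show "\<Inter>F \<subseteq> carr A" using carr by blast
    fix f l
    assume l: "l \<in> carr A" "\<forall>n::nat. f n \<in> \<Inter>F" "(\<lambda>n. cnorm A (cdiff A (f n) l)) \<longlonglongrightarrow> 0"
    show "l \<in> \<Inter>F"
    proof (rule *)
      fix S assume "S \<in> F"
      then show "l \<in> S" using l S[of S] closed_star_subalgebraD(7)[of A S f l] by (simp add: F_def)
    qed
  qed (auto simp: F_def dest: closed_star_subalgebraD(2-6))
  then show ?thesis by (simp add: cstar_generated_def F_def)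
qed

lemma cstar_generated_algebra:
  "\<lbrakk>cstar_algebra A; G \<subseteq> carr A\<rbrakk> \<Longrightarrow> cstar_algebra (cstar_generated A G)"
  using cstar_subalgebra[OF _ closed_star_subalgebra_generated]
  by (simp add: cstar_generated_def)

lemma generated_superset: "G \<subseteq> carr (cstar_generated A G)"
  by (auto simp: cstar_generated_def)

lemma generated_least: "closed_star_subalgebra A S \<Longrightarrow> G \<subseteq> S \<Longrightarrow> carr (cstar_generated A G) \<subseteq> S"
  by (auto simp: cstar_generated_def)

lemma cstar_generated_ops [simp]:
  "cadd (cstar_generated A G) = cadd A" "czero (cstar_generated A G) = czero A"
  "cscale (cstar_generated A G) = cscale A" "cmult (cstar_generated A G) = cmult A"
  "cadj (cstar_generated A G) = cadj A" "cnorm (cstar_generated A G) = cnorm A"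
  "cdiff (cstar_generated A G) = cdiff A"
  by (simp_all add: cstar_generated_def)

section \<open>Products of bounded families\<close>

lemma cstar_prod_ops [simp]:
  "cadd (cstar_prod I B) = (\<lambda>f g. \<lambda>i\<in>I. cadd (B i) (f i) (g i))"
  "czero (cstar_prod I B) = (\<lambda>i\<in>I. czero (B i))"
  "cscale (cstar_prod I B) = (\<lambda>c f. \<lambda>i\<in>I. cscale (B i) c (f i))"
  "cmult (cstar_prod I B) = (\<lambda>f g. \<lambda>i\<in>I. cmult (B i) (f i) (g i))"
  "cadj (cstar_prod I B) = (\<lambda>f. \<lambda>i\<in>I. cadj (B i) (f i))"
  by (simp_all add: cstar_prod_def)

lemma cdiff_cstar_prod: "cdiff (cstar_prod I B) f g = (\<lambda>i\<in>I. cdiff (B i) (f i) (g i))"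
  by (auto simp: cdiff_def)

lemma cstar_prod_carrI:
  "\<lbrakk>f \<in> extensional I; \<And>i. i \<in> I \<Longrightarrow> f i \<in> carr (B i); \<And>i. i \<in> I \<Longrightarrow> cnorm (B i) (f i) \<le> K\<rbrakk>
    \<Longrightarrow> f \<in> carr (cstar_prod I B)"
  by (auto simp: cstar_prod_def PiE_def intro!: bdd_aboveI2)

lemma cstar_prod_carrD:
  assumes "f \<in> carr (cstar_prod I B)"
  shows "f \<in> extensional I" "i \<in> I \<Longrightarrow> f i \<in> carr (B i)"
    "i \<in> I \<Longrightarrow> cnorm (B i) (f i) \<le> cnorm (cstar_prod I B) f"
  using assms by (auto simp: cstar_prod_def PiE_def intro!: cSUP_upper)

lemma cstar_prod_norm_least:
  "\<lbrakk>I \<noteq> {}; \<And>i. i \<in> I \<Longrightarrow> cnorm (B i) (f i) \<le> K\<rbrakk> \<Longrightarrow> cnorm (cstar_prod I B) f \<le> K"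
  by (auto simp: cstar_prod_def intro!: cSUP_least)

text \<open>The index set must be nonempty because the norm is a supremum of reals, with no useful
  value on the empty set. Algebraic identities hold coordinatewise; the work lies in the norm and in
  completeness.\<close>

lemma cstar_prod_algebra:
  fixes B :: "'i \<Rightarrow> 'u cstar"
  assumes ne: "I \<noteq> {}" and B: "\<And>i. i \<in> I \<Longrightarrow> cstar_algebra (B i)"
  shows "cstar_algebra (cstar_prod I B)"
proof -
  let ?P = "cstar_prod I B"
  note D = cstar_prod_carrD[of _ I B]
  note alg = cstar_algebra.closed[OF B] cstar_algebra.norm_triangle[OF B]
    cstar_algebra.norm_mult[OF B] cstar_algebra.norm_scale[OF B] cstar_algebra.norm_adj[OF B]
    cstar_algebra.norm_zero[OF B] cstar_algebra.norm_nonneg[OF B]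
  have nonneg: "0 \<le> cnorm ?P f" if "f \<in> carr ?P" for f
  proof -
    obtain i where "i \<in> I" using ne by blast
    then show ?thesis using D(2,3)[OF that] alg by (meson order_trans)
  qed
  have triangle: "cnorm (B i) (cadd (B i) (f i) (g i)) \<le> cnorm ?P f + cnorm ?P g"
    if "f \<in> carr ?P" "g \<in> carr ?P" "i \<in> I" for f g i
    using D(2,3)[OF that(1,3)] D(2,3)[OF that(2,3)] alg(7)[OF that(3)] by (smt (verit))
  have mult: "cnorm (B i) (cmult (B i) (f i) (g i)) \<le> cnorm ?P f * cnorm ?P g"
    if "f \<in> carr ?P" "g \<in> carr ?P" "i \<in> I" for f g i
  proof -
    have "cnorm (B i) (f i) * cnorm (B i) (g i) \<le> cnorm ?P f * cnorm ?P g"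
      using D(2,3)[OF that(1,3)] D(2,3)[OF that(2,3)] alg that nonneg by (intro mult_mono) auto
    then show ?thesis using alg(8)[OF that(3), of "f i" "g i"] D(2) that by force
  qed
  have add_closed: "cadd ?P f g \<in> carr ?P" if "f \<in> carr ?P" "g \<in> carr ?P" for f g
    by (rule cstar_prod_carrI[of _ _ _ "cnorm ?P f + cnorm ?P g"])
      (use that triangle D(2) in \<open>auto simp: alg\<close>)
  have scale_closed: "cscale ?P c f \<in> carr ?P" if "f \<in> carr ?P" for c f
    by (rule cstar_prod_carrI[of _ _ _ "cmod c * cnorm ?P f"])
      (use that D(2,3) in \<open>auto simp: alg intro: mult_left_mono\<close>)
  have ext: "f = g" if "f \<in> extensional I" "g \<in> extensional I" "\<And>i. i \<in> I \<Longrightarrow> f i = g i" for f g :: "'i \<Rightarrow> 'u"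
    using that by (rule extensionalityI)
  show ?thesis
  proof
    show "czero ?P \<in> carr ?P" by (rule cstar_prod_carrI[of _ _ _ 0]) (auto simp: alg)
    fix f g assume f: "f \<in> carr ?P" and g: "g \<in> carr ?P"
    show "cmult ?P f g \<in> carr ?P"
      by (rule cstar_prod_carrI[of _ _ _ "cnorm ?P f * cnorm ?P g"])
        (use f g mult D(2) in \<open>auto simp: alg\<close>)
    show "cnorm ?P (cadd ?P f g) \<le> cnorm ?P f + cnorm ?P g"
      by (rule cstar_prod_norm_least[OF ne]) (use triangle f g in auto)
    show "cnorm ?P (cmult ?P f g) \<le> cnorm ?P f * cnorm ?P g"
      by (rule cstar_prod_norm_least[OF ne]) (use mult f g in auto)
    show "cadd ?P f g = cadd ?P g f"
      by (rule ext) (use f g cstar_algebra.add_commute[OF B] D(2) in auto)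
    show "cadj ?P (cmult ?P f g) = cmult ?P (cadj ?P g) (cadj ?P f)"
      by (rule ext) (use f g cstar_algebra.adj_mult[OF B] D(2) in auto)
    show "cadj ?P (cadd ?P f g) = cadd ?P (cadj ?P f) (cadj ?P g)"
      by (rule ext) (use f g cstar_algebra.adj_add[OF B] D(2) in auto)
    fix c
    show "cscale ?P c (cadd ?P f g) = cadd ?P (cscale ?P c f) (cscale ?P c g)"
      by (rule ext) (use f g cstar_algebra.scale_add[OF B] D(2) in auto)
    show "cmult ?P (cscale ?P c f) g = cscale ?P c (cmult ?P f g)"
      by (rule ext) (use f g cstar_algebra.scale_mult[OF B] D(2) in auto)
    show "cmult ?P f (cscale ?P c g) = cscale ?P c (cmult ?P f g)"
      by (rule ext) (use f g cstar_algebra.mult_scale[OF B] D(2) in auto)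
    fix h assume h: "h \<in> carr ?P"
    show "cadd ?P (cadd ?P f g) h = cadd ?P f (cadd ?P g h)"
      by (rule ext) (use f g h cstar_algebra.add_assoc[OF B] D(2) in auto)
    show "cmult ?P (cmult ?P f g) h = cmult ?P f (cmult ?P g h)"
      by (rule ext) (use f g h cstar_algebra.mult_assoc[OF B] D(2) in auto)
    show "cmult ?P (cadd ?P f g) h = cadd ?P (cmult ?P f h) (cmult ?P g h)"
      by (rule ext) (use f g h cstar_algebra.add_mult[OF B] D(2) in auto)
    show "cmult ?P f (cadd ?P g h) = cadd ?P (cmult ?P f g) (cmult ?P f h)"
      by (rule ext) (use f g h cstar_algebra.mult_add[OF B] D(2) in auto)
  next
    fix f assume f: "f \<in> carr ?P"
    show "cadj ?P f \<in> carr ?P"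
      by (rule cstar_prod_carrI[of _ _ _ "cnorm ?P f"]) (use f D(2,3) in \<open>auto simp: alg\<close>)
    show "cadd ?P f (czero ?P) = f"
      by (rule ext) (use f cstar_algebra.add_zero[OF B] D(1,2) in auto)
    show "cdiff ?P f f = czero ?P"
      by (rule ext) (use f cstar_algebra.diff_self[OF B] D(1,2) in \<open>auto simp: cdiff_cstar_prod\<close>)
    show "cscale ?P 1 f = f"
      by (rule ext) (use f cstar_algebra.scale_one[OF B] D(1,2) in auto)
    show "cadj ?P (cadj ?P f) = f"
      by (rule ext) (use f cstar_algebra.adj_adj[OF B] D(1,2) in auto)
    show "0 \<le> cnorm ?P f" by (rule nonneg[OF f])
    show "cnorm ?P f = 0 \<longleftrightarrow> f = czero ?P"
    proof
      assume 0: "cnorm ?P f = 0"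
      show "f = czero ?P"
      proof (rule ext)
        fix i assume i: "i \<in> I"
        have "cnorm (B i) (f i) = 0" using D(2,3)[OF f i] 0 alg i by (simp add: order_antisym)
        then show "f i = czero ?P i"
          using cstar_algebra.norm_eq_zero[OF B[OF i]] D(2)[OF f i] i by simp
      qed (use D(1)[OF f] in auto)
    next
      assume "f = czero ?P"
      then have "cnorm ?P f \<le> 0" by (intro cstar_prod_norm_least[OF ne]) (auto simp: alg)
      then show "cnorm ?P f = 0" using nonneg[OF f] by simp
    qed
    show "cnorm ?P (cmult ?P (cadj ?P f) f) = (cnorm ?P f)\<^sup>2"
    proof (rule antisym)
      have sq: "cnorm (B i) (cmult (B i) (cadj (B i) (f i)) (f i)) = (cnorm (B i) (f i))\<^sup>2"
        if "i \<in> I" for i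
        using cstar_algebra.norm_cstar[OF B[OF that]] D(2)[OF f that] by simp
      show "cnorm ?P (cmult ?P (cadj ?P f) f) \<le> (cnorm ?P f)\<^sup>2"
        by (rule cstar_prod_norm_least[OF ne])
          (use D(2,3)[OF f] sq in \<open>auto simp: alg intro!: power_mono\<close>)
      have adj: "cadj ?P f \<in> carr ?P"
        by (rule cstar_prod_carrI[of _ _ _ "cnorm ?P f"]) (use f D(2,3) in \<open>auto simp: alg\<close>)
      have ff: "cmult ?P (cadj ?P f) f \<in> carr ?P"
        by (rule cstar_prod_carrI[of _ _ _ "cnorm ?P (cadj ?P f) * cnorm ?P f"])
          (use f adj mult[OF adj f] D(2) in \<open>auto simp: alg\<close>)
      have "cnorm ?P f \<le> sqrt (cnorm ?P (cmult ?P (cadj ?P f) f))"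
      proof (rule cstar_prod_norm_least[OF ne])
        fix i assume i: "i \<in> I"
        have "(cnorm (B i) (f i))\<^sup>2 \<le> cnorm ?P (cmult ?P (cadj ?P f) f)"
          using D(3)[OF ff i] sq[OF i] i by simp
        then show "cnorm (B i) (f i) \<le> sqrt (cnorm ?P (cmult ?P (cadj ?P f) f))"
          by (rule real_le_rsqrt)
      qed
      then show "(cnorm ?P f)\<^sup>2 \<le> cnorm ?P (cmult ?P (cadj ?P f) f)"
        using nonneg[OF f] nonneg[OF ff] by (metis power_mono real_sqrt_pow2)
    qed
    fix c
    show "cscale ?P c f \<in> carr ?P" using scale_closed f by blast
    show "cadj ?P (cscale ?P c f) = cscale ?P (cnj c) (cadj ?P f)"
      by (rule ext) (use f cstar_algebra.adj_scale[OF B] D(1,2) in auto)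
    have le: "cnorm ?P (cscale ?P d g) \<le> cmod d * cnorm ?P g" if "g \<in> carr ?P" for d g
      by (rule cstar_prod_norm_least[OF ne])
        (use D(2,3)[OF that] in \<open>auto simp: alg intro: mult_left_mono\<close>)
    \<comment> \<open>The supremum gives only one inequality directly; the other is that inequality
      for the scalar 1/c.\<close>
    show "cnorm ?P (cscale ?P c f) = cmod c * cnorm ?P f"
    proof (cases "c = 0")
      case True
      then show ?thesis using le[OF f, of 0] nonneg[OF scale_closed[OF f, of 0]] by simp
    next
      case False
      have "cscale ?P (inverse c) (cscale ?P c f) = f"
        by (rule ext) (use False f cstar_algebra.scale_scale[OF B]
              cstar_algebra.scale_one[OF B] D(1,2) in auto)
      then have "cnorm ?P f \<le> cmod (inverse c) * cnorm ?P (cscale ?P c f)"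
        using le[OF scale_closed[OF f], of "inverse c" c] by simp
      then have "cmod c * cnorm ?P f \<le> cnorm ?P (cscale ?P c f)"
        using False by (simp add: norm_inverse norm_divide field_simps)
      then show ?thesis using le[OF f] by (simp add: antisym)
    qed
    fix d
    show "cscale ?P (c + d) f = cadd ?P (cscale ?P c f) (cscale ?P d f)"
      by (rule ext) (use f cstar_algebra.add_scale[OF B] D(1,2) in auto)
    show "cscale ?P c (cscale ?P d f) = cscale ?P (c * d) f"
      by (rule ext) (use f cstar_algebra.scale_scale[OF B] D(1,2) in auto)
  next
    fix f :: "nat \<Rightarrow> 'i \<Rightarrow> 'u"
    assume f: "\<And>n. f n \<in> carr ?P"
      and cauchy: "\<And>\<epsilon>. \<epsilon> > 0 \<Longrightarrow> \<exists>N. \<forall>m\<ge>N. \<forall>n\<ge>N. cnorm ?P (cdiff ?P (f m) (f n)) < \<epsilon>"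
    have diff: "cdiff ?P (f m) (f n) \<in> carr ?P" for m n
      unfolding cdiff_def using f add_closed scale_closed by blast
    have coord: "cnorm (B i) (cdiff (B i) (f m i) (f n i)) \<le> cnorm ?P (cdiff ?P (f m) (f n))"
      if "i \<in> I" for i m n
      using D(3)[OF diff that] that by (simp add: cdiff_cstar_prod)
    have "\<exists>l\<in>carr (B i). (\<lambda>n. cnorm (B i) (cdiff (B i) (f n i) l)) \<longlonglongrightarrow> 0" if i: "i \<in> I" for i
    proof (rule cstar_algebra.complete[OF B[OF i]])
      show "f n i \<in> carr (B i)" for n using D(2)[OF f i] .
      show "\<exists>N. \<forall>m\<ge>N. \<forall>n\<ge>N. cnorm (B i) (cdiff (B i) (f m i) (f n i)) < \<epsilon>" if "\<epsilon> > 0" for \<epsilon>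
        using cauchy[OF that] coord[OF i] by (meson le_less_trans)
    qed
    then obtain l where l: "\<And>i. i \<in> I \<Longrightarrow> l i \<in> carr (B i)"
      "\<And>i. i \<in> I \<Longrightarrow> (\<lambda>n. cnorm (B i) (cdiff (B i) (f n i) (l i))) \<longlonglongrightarrow> 0"
      by metis
    \<comment> \<open>The Cauchy bound holds with one N for all coordinates and survives the limit
      in the second index, so the coordinatewise convergence is uniform.\<close>
    have unif: "\<exists>N. \<forall>m\<ge>N. \<forall>i\<in>I. cnorm (B i) (cdiff (B i) (f m i) (l i)) \<le> \<epsilon>" if \<epsilon>: "\<epsilon> > 0" for \<epsilon>
    proof -
      obtain N where N: "\<And>m n. m \<ge> N \<Longrightarrow> n \<ge> N \<Longrightarrow> cnorm ?P (cdiff ?P (f m) (f n)) < \<epsilon>"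
        using cauchy[OF \<epsilon>] by blast
      have "cnorm (B i) (cdiff (B i) (f m i) (l i)) \<le> \<epsilon>" if m: "m \<ge> N" and i: "i \<in> I" for m i
      proof (rule LIMSEQ_le_const)
        interpret cstar_algebra "B i" by (rule B[OF i])
        show "(\<lambda>n. \<epsilon> + cnorm (B i) (cdiff (B i) (f n i) (l i))) \<longlonglongrightarrow> \<epsilon>"
          using tendsto_add[OF tendsto_const l(2)[OF i], of \<epsilon>] by simp
        show "\<exists>N. \<forall>n\<ge>N. cnorm (B i) (cdiff (B i) (f m i) (l i))
            \<le> \<epsilon> + cnorm (B i) (cdiff (B i) (f n i) (l i))"
        proof (intro exI allI impI)
          fix n assume "n \<ge> N"
          then show "cnorm (B i) (cdiff (B i) (f m i) (l i)) \<le> \<epsilon> + cnorm (B i) (cdiff (B i) (f n i) (l i))"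
            using norm_diff_triangle[of "f m i" "f n i" "l i"] coord[OF i, of m n] N[OF m] D(2)[OF f i] l(1)[OF i]
            by (smt (verit))
        qed
      qed
      then show ?thesis by blast
    qed
    \<comment> \<open>The limit family is bounded since it stays within 1 of some member of the
      sequence.\<close>
    obtain N where N: "\<And>i. i \<in> I \<Longrightarrow> cnorm (B i) (cdiff (B i) (f N i) (l i)) \<le> 1"
      using unif[of 1] by auto
    have L: "restrict l I \<in> carr ?P"
    proof (rule cstar_prod_carrI[of _ _ _ "1 + cnorm ?P (f N)"])
      fix i assume i: "i \<in> I"
      interpret cstar_algebra "B i" by (rule B[OF i])
      show "cnorm (B i) (restrict l I i) \<le> 1 + cnorm ?P (f N)"
        using norm_le_diff[of "l i" "f N i"] norm_diff_commute[of "l i" "f N i"] N[OF i]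
          D(2,3)[OF f i, of N] l(1)[OF i] i by simp
    qed (use l in auto)
    have "(\<lambda>n. cnorm ?P (cdiff ?P (f n) (restrict l I))) \<longlonglongrightarrow> 0"
    proof (rule LIMSEQ_I)
      fix e :: real assume e: "e > 0"
      obtain N where N: "\<And>m i. m \<ge> N \<Longrightarrow> i \<in> I \<Longrightarrow> cnorm (B i) (cdiff (B i) (f m i) (l i)) \<le> e / 2"
        using unif[of "e / 2"] e by auto
      have "norm (cnorm ?P (cdiff ?P (f m) (restrict l I)) - 0) < e" if "m \<ge> N" for m
      proof -
        have "cnorm ?P (cdiff ?P (f m) (restrict l I)) \<le> e / 2"
          by (rule cstar_prod_norm_least[OF ne]) (use N[OF that] in \<open>auto simp: cdiff_cstar_prod\<close>)
        moreover have "cdiff ?P (f m) (restrict l I) \<in> carr ?P"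
          unfolding cdiff_def using f L add_closed scale_closed by blast
        ultimately show ?thesis using nonneg e by force
      qed
      then show "\<exists>N. \<forall>m\<ge>N. norm (cnorm ?P (cdiff ?P (f m) (restrict l I)) - 0) < e" by blast
    qed
    with L show "\<exists>l\<in>carr ?P. (\<lambda>n. cnorm ?P (cdiff ?P (f n) l)) \<longlonglongrightarrow> 0" by blast
  qed (rule add_closed)
qed

text \<open>Moves an algebra along an injection \<open>j\<close> into another type; in this way
  algebras over arbitrary types enter the fixed carrier type of the representations. All operations
  pass through the inverse \<open>k\<close> of \<open>j\<close>.\<close>

definition cstar_transport :: "('a \<Rightarrow> 'b) \<Rightarrow> 'a cstar \<Rightarrow> 'b cstar"
  where "cstar_transport j A = (let k = inv_into (carr A) j in
    \<lparr>carr = j ` carr A,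
     cadd = (\<lambda>x y. j (cadd A (k x) (k y))),
     czero = j (czero A),
     cscale = (\<lambda>c x. j (cscale A c (k x))),
     cmult = (\<lambda>x y. j (cmult A (k x) (k y))),
     cadj = (\<lambda>x. j (cadj A (k x))),
     cnorm = (\<lambda>x. cnorm A (k x))\<rparr>)"

lemma cstar_transport:
  assumes A: "cstar_algebra A" and inj: "inj_on j (carr A)"
  shows "cstar_algebra (cstar_transport j A)"
proof -
  interpret cstar_algebra A by fact
  let ?k = "inv_into (carr A) j"
  let ?T = "cstar_transport j A"
  have k [simp]: "x \<in> carr A \<Longrightarrow> ?k (j x) = x" for x using inj by simp
  have carr [simp]: "carr ?T = j ` carr A" by (simp add: cstar_transport_def Let_def)
  have eq [simp]: "x \<in> carr A \<Longrightarrow> y \<in> carr A \<Longrightarrow> j x = j y \<longleftrightarrow> x = y" for x y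
    using inj by (auto dest: inj_onD)
  note closed [simp]
  have ops [simp]:
    "czero ?T = j (czero A)"
    "\<lbrakk>x \<in> carr A; y \<in> carr A\<rbrakk> \<Longrightarrow> cadd ?T (j x) (j y) = j (cadd A x y)"
    "\<lbrakk>x \<in> carr A; y \<in> carr A\<rbrakk> \<Longrightarrow> cmult ?T (j x) (j y) = j (cmult A x y)"
    "x \<in> carr A \<Longrightarrow> cscale ?T c (j x) = j (cscale A c x)"
    "x \<in> carr A \<Longrightarrow> cadj ?T (j x) = j (cadj A x)"
    "x \<in> carr A \<Longrightarrow> cnorm ?T (j x) = cnorm A x" for x y c
    by (simp_all add: cstar_transport_def Let_def)
  have diff [simp]: "\<lbrakk>x \<in> carr A; y \<in> carr A\<rbrakk> \<Longrightarrow> cdiff ?T (j x) (j y) = j (cdiff A x y)" for x y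
    unfolding cdiff_def by simp
  show ?thesis
  proof
    fix f :: "nat \<Rightarrow> 'b"
    assume f: "\<And>n. f n \<in> carr ?T"
      and cauchy: "\<And>\<epsilon>. \<epsilon> > 0 \<Longrightarrow> \<exists>N. \<forall>m\<ge>N. \<forall>n\<ge>N. cnorm ?T (cdiff ?T (f m) (f n)) < \<epsilon>"
    from f have "\<forall>n. \<exists>x\<in>carr A. f n = j x" by auto
    then obtain g where g: "\<And>n. g n \<in> carr A" "\<And>n. f n = j (g n)" by metis
    have "\<exists>l\<in>carr A. (\<lambda>n. cnorm A (cdiff A (g n) l)) \<longlonglongrightarrow> 0"
      by (rule complete) (use cauchy g in auto)
    then obtain l where l: "l \<in> carr A" "(\<lambda>n. cnorm A (cdiff A (g n) l)) \<longlonglongrightarrow> 0" by blast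
    then have "(\<lambda>n. cnorm ?T (cdiff ?T (f n) (j l))) \<longlonglongrightarrow> 0" using g by simp
    then show "\<exists>l\<in>carr ?T. (\<lambda>n. cnorm ?T (cdiff ?T (f n) l)) \<longlonglongrightarrow> 0" using l(1) by auto
  qed (auto simp: add_ac add_zero diff_self scale_add add_scale
        scale_scale scale_one mult_assoc mult_add add_mult scale_mult mult_scale adj_adj adj_add
        adj_scale adj_mult norm_nonneg norm_eq_zero norm_scale norm_triangle norm_mult norm_cstar)
qed

lemma cstar_transport_hom: "inj_on j (carr A) \<Longrightarrow> star_hom A (cstar_transport j A) j"
  by (simp add: star_hom_def cstar_transport_def Let_def)

lemma cstar_transport_inv_hom:
  assumes "cstar_algebra A" "inj_on j (carr A)"
  shows "star_hom (cstar_transport j A) A (inv_into (carr A) j)"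
  using assms cstar_algebra.closed[OF assms(1)]
  by (auto simp: star_hom_def cstar_transport_def Let_def)

lemma cnorm_transport: "cnorm (cstar_transport j A) x = cnorm A (inv_into (carr A) j x)"
  by (simp add: cstar_transport_def Let_def)

text \<open>The zero algebra. It satisfies the relations of both universal constructions below and
  so makes the index sets of their products nonempty.\<close>

lemma cstar_trivial: "cstar_algebra
    \<lparr>carr = {z}, cadd = \<lambda>_ _. z, czero = z, cscale = \<lambda>_ _. z, cmult = \<lambda>_ _. z, cadj = \<lambda>_. z, cnorm = \<lambda>_. 0\<rparr>"
  by unfold_locales (auto simp: cdiff_def)

section \<open>Homomorphisms\<close>

lemma star_homD:
  assumes "star_hom A B f"
  shows "x \<in> carr A \<Longrightarrow> f x \<in> carr B"
    "x \<in> carr A \<Longrightarrow> y \<in> carr A \<Longrightarrow> f (cadd A x y) = cadd B (f x) (f y)"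
    "x \<in> carr A \<Longrightarrow> f (cscale A c x) = cscale B c (f x)"
    "x \<in> carr A \<Longrightarrow> y \<in> carr A \<Longrightarrow> f (cmult A x y) = cmult B (f x) (f y)"
    "x \<in> carr A \<Longrightarrow> f (cadj A x) = cadj B (f x)"
  using assms unfolding star_hom_def by blast+

lemma star_hom_diff:
  assumes "cstar_algebra A" "star_hom A B f" "x \<in> carr A" "y \<in> carr A"
  shows "f (cdiff A x y) = cdiff B (f x) (f y)"
  using assms cstar_algebra.scale_closed[OF assms(1)] by (simp add: cdiff_def star_homD)

lemma star_hom_zero:
  assumes "cstar_algebra A" "cstar_algebra B" "star_hom A B f"
  shows "f (czero A) = czero B"
  by (metis assms cstar_algebra.diff_self cstar_algebra.zero_closed star_homD(1) star_hom_diff)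

lemma star_hom_comp:
  "star_hom A B f \<Longrightarrow> star_hom B C g \<Longrightarrow> star_hom A C (\<lambda>x. g (f x))"
  unfolding star_hom_def by simp

definition contractive_hom :: "'a cstar \<Rightarrow> 'b cstar \<Rightarrow> ('a \<Rightarrow> 'b) \<Rightarrow> bool"
  where "contractive_hom A B f \<longleftrightarrow> star_hom A B f \<and> (\<forall>x\<in>carr A. cnorm B (f x) \<le> cnorm A x)"

lemma contractive_hom_id: "contractive_hom A A (\<lambda>x. x)"
  by (simp add: contractive_hom_def star_hom_def)

lemma contractive_hom_comp:
  "contractive_hom A B f \<Longrightarrow> contractive_hom B C g \<Longrightarrow> contractive_hom A C (\<lambda>x. g (f x))"
  unfolding contractive_hom_def using star_hom_comp[of A B f C g] star_homD(1)[of A B f]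
  by (meson order_trans)

lemma contractive_hom_clim:
  assumes "cstar_algebra A" "cstar_algebra B" "contractive_hom A B f"
    "\<And>n. x n \<in> carr A" "l \<in> carr A" "cstar_algebra.clim A x l"
  shows "cstar_algebra.clim B (\<lambda>n. f (x n)) (f l)"
proof -
  interpret A: cstar_algebra A by fact
  interpret B: cstar_algebra B by fact
  have f: "star_hom A B f" "\<And>x. x \<in> carr A \<Longrightarrow> cnorm B (f x) \<le> cnorm A x"
    using assms(3) unfolding contractive_hom_def by auto
  show ?thesis
    by (rule B.climI[OF _ assms(6)[unfolded A.clim_def]])
      (use f(2)[OF A.diff_closed] assms f(1) in
        \<open>auto simp: star_homD(1) simp flip: star_hom_diff[OF assms(1) f(1)]\<close>)
qed

text \<open>Contractive maps preserve limits and limits are unique, so the set of agreement is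
  closed. Uniqueness of homomorphisms out of generated algebras rests on this.\<close>

lemma closed_star_subalgebra_equalizer:
  assumes A: "cstar_algebra A" and B: "cstar_algebra B"
    and f: "contractive_hom A B f" and g: "contractive_hom A B g"
  shows "closed_star_subalgebra A {x \<in> carr A. f x = g x}"
proof -
  interpret A: cstar_algebra A by fact
  interpret B: cstar_algebra B by fact
  have fg: "star_hom A B f" "star_hom A B g" using f g unfolding contractive_hom_def by auto
  have "f l = g l" if "\<And>n. x n \<in> carr A \<and> f (x n) = g (x n)" "l \<in> carr A" "A.clim x l" for x l
  proof (rule B.clim_unique[of "\<lambda>n. f (x n)"])
    show "B.clim (\<lambda>n. f (x n)) (f l)"
      using contractive_hom_clim[OF A B f] that by blast
    show "B.clim (\<lambda>n. f (x n)) (g l)"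
      using contractive_hom_clim[OF A B g, of x l] that by simp
  qed (use that star_homD(1)[OF fg(1)] star_homD(1)[OF fg(2)] in auto)
  then show ?thesis
    unfolding closed_star_subalgebra_def closed_linear_subspace_def
    using star_homD(2-5)[OF fg(1)] star_homD(2-5)[OF fg(2)] star_hom_zero[OF A B fg(1)]
      star_hom_zero[OF A B fg(2)] A.closed
    by (auto simp: A.clim_def)
qed

text \<open>An induction principle: a property that is stable under the closed star algebra
  operations and holds on \<open>G\<close> holds on all that \<open>G\<close> generates. A limit of
  elements of \<open>S\<close> first lies in the generated algebra, which is closed in
  \<open>A\<close>; then \<open>S\<close> contains it.\<close>

lemma generated_subset:
  assumes A: "cstar_algebra A" and G: "G \<subseteq> carr A" "G \<subseteq> S"
    and S: "closed_star_subalgebra (cstar_generated A G) S"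
  shows "S = carr (cstar_generated A G)"
proof (rule antisym)
  note gen = closed_star_subalgebraD[OF closed_star_subalgebra_generated[OF A G(1)]]
  note SD = closed_star_subalgebraD[OF S]
  show "S \<subseteq> carr (cstar_generated A G)" by (rule SD(1))
  have "closed_star_subalgebra A S"
    unfolding closed_star_subalgebra_def closed_linear_subspace_def
  proof (intro conjI allI ballI impI; (elim conjE)?)
    show "S \<subseteq> carr A" using SD(1) gen(1) by blast
    fix f l
    assume *: "l \<in> carr A" "\<forall>n::nat. f n \<in> S" "(\<lambda>n. cnorm A (cdiff A (f n) l)) \<longlonglongrightarrow> 0"
    have "l \<in> carr (cstar_generated A G)" by (rule gen(7)[of f]) (use * SD(1) in auto)
    then show "l \<in> S" using SD(7)[of f l] * by simp
  qed (use SD(2-6) in auto)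
  then show "carr (cstar_generated A G) \<subseteq> S" using generated_least G(2) by blast
qed

lemma contractive_hom_eq_on_generated:
  assumes A: "cstar_algebra A" and B: "cstar_algebra B" and G: "G \<subseteq> carr A"
    and f: "contractive_hom (cstar_generated A G) B f" and g: "contractive_hom (cstar_generated A G) B g"
    and eq: "\<And>x. x \<in> G \<Longrightarrow> f x = g x" and x: "x \<in> carr (cstar_generated A G)"
  shows "f x = g x"
proof -
  have "{x \<in> carr (cstar_generated A G). f x = g x} = carr (cstar_generated A G)"
    by (rule generated_subset[OF A G])
      (use eq generated_superset[of G A] closed_star_subalgebra_equalizer[OF cstar_generated_algebra[OF A G] B f g] in auto)
  with x show ?thesis by blast
qed

text \<open>The elements on which \<open>e\<close> acts as the identity from both sides form a
  closed star subalgebra; taking adjoints swaps the two sides and uses that \<open>e\<close> is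
  selfadjoint.\<close>

lemma generated_unit:
  assumes A: "cstar_algebra A" and G: "G \<subseteq> carr A" and e: "e \<in> carr (cstar_generated A G)"
    and adj: "cadj A e = e" and unit: "\<And>x. x \<in> G \<Longrightarrow> cmult A e x = x \<and> cmult A x e = x"
  shows "cstar_unit (cstar_generated A G) e"
proof -
  let ?U = "cstar_generated A G"
  interpret cstar_algebra ?U by (rule cstar_generated_algebra[OF A G])
  let ?S = "{x \<in> carr ?U. cmult A e x = x \<and> cmult A x e = x}"
  have "closed_star_subalgebra ?U ?S"
    unfolding closed_star_subalgebra_def closed_linear_subspace_def
  proof (intro conjI allI ballI impI; (elim conjE)?)
    fix x assume x: "x \<in> ?S"
    then have "cadj A (cmult A e x) = cmult A (cadj A x) e" "cadj A (cmult A x e) = cmult A e (cadj A x)"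
      using adj_mult[of e x] adj_mult[of x e] e adj by simp_all
    then show "cadj ?U x \<in> ?S" using x adj_closed[of x] by simp
  next
    fix f l
    assume l: "l \<in> carr ?U" "\<forall>n::nat. f n \<in> ?S" "(\<lambda>n. cnorm ?U (cdiff ?U (f n) l)) \<longlonglongrightarrow> 0"
    have lim: "clim f l" using l(3) by (simp add: clim_def)
    have f: "\<And>n. f n \<in> carr ?U" "\<And>n. cmult A e (f n) = f n" "\<And>n. cmult A (f n) e = f n"
      using l(2) by auto
    have "cmult ?U e l = l"
      using clim_mult[OF clim_const[OF e] lim] f l(1) e lim
      by (intro clim_unique[of f]) (auto simp: mult_closed[simplified])
    moreover have "cmult ?U l e = l"
      using clim_mult[OF lim clim_const[OF e]] f l(1) e lim
      by (intro clim_unique[of f]) (auto simp: mult_closed[simplified])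
    ultimately show "l \<in> ?S" using l(1) by simp
  next
    fix x y assume "x \<in> ?S" "y \<in> ?S"
    then have xy: "x \<in> carr ?U" "y \<in> carr ?U" "cmult ?U e x = x" "cmult ?U x e = x"
      "cmult ?U e y = y" "cmult ?U y e = y" by auto
    have "cmult ?U e (cmult ?U x y) = cmult ?U x y" using mult_assoc[OF e xy(1,2)] xy by metis
    moreover have "cmult ?U (cmult ?U x y) e = cmult ?U x y" using mult_assoc[OF xy(1,2) e] xy by metis
    ultimately show "cmult ?U x y \<in> ?S" using xy mult_closed by auto
  qed (use closed e mult_add mult_scale add_mult scale_mult mult_zero zero_mult in auto)
  then have "?S = carr ?U" by (rule generated_subset[OF A G, rotated]) (use unit generated_superset[of G A] in auto)
  then show ?thesis using e unfolding cstar_unit_def by auto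
qed

section \<open>Separability and the universal property\<close>

text \<open>The approximating sequence may run anywhere in \<open>carr A\<close>, so the notion
  passes to unions and to generated algebras without moving points into \<open>S\<close>.\<close>

definition separable_in :: "'a cstar \<Rightarrow> 'a set \<Rightarrow> bool"
  where "separable_in A S \<longleftrightarrow>
    (\<exists>d::nat \<Rightarrow> 'a. range d \<subseteq> carr A \<and> (\<forall>x\<in>S. \<forall>e>0. \<exists>n. cnorm A (cdiff A (d n) x) < e))"

lemma separable_inI:
  assumes "countable D" "D \<noteq> {}" "D \<subseteq> carr A"
    "\<And>x e. x \<in> S \<Longrightarrow> e > 0 \<Longrightarrow> \<exists>d\<in>D. cnorm A (cdiff A d x) < e"
  shows "separable_in A S"
  unfolding separable_in_def
  using assms range_from_nat_into[OF assms(2,1)]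
  by (intro exI[of _ "from_nat_into D"]) (metis from_nat_into_surj)

lemma separable_in_Un:
  assumes "separable_in A S" "separable_in A T"
  shows "separable_in A (S \<union> T)"
proof -
  obtain c d :: "nat \<Rightarrow> _" where
    c: "range c \<subseteq> carr A" "\<And>x e. x \<in> S \<Longrightarrow> e > 0 \<Longrightarrow> \<exists>n. cnorm A (cdiff A (c n) x) < e" and
    d: "range d \<subseteq> carr A" "\<And>x e. x \<in> T \<Longrightarrow> e > 0 \<Longrightarrow> \<exists>n. cnorm A (cdiff A (d n) x) < e"
    using assms unfolding separable_in_def by metis
  show ?thesis
  proof (rule separable_inI[of "range c \<union> range d"])
    fix x and e :: real assume "x \<in> S \<union> T" "e > 0"
    then show "\<exists>d\<in>range c \<union> range d. cnorm A (cdiff A d x) < e" using c(2) d(2) by blast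
  qed (use c(1) d(1) in auto)
qed

text \<open>Record for each dense point and each radius 1/(k+1) whether the ball contains
  \<open>x\<close>; the table of answers determines \<open>x\<close>. Only the values
  \<open>None\<close> and \<open>Some undefined\<close> occur, so the type \<open>'g\<close> is
  arbitrary.\<close>

lemma separable_in_embedding:
  assumes A: "cstar_algebra A" and S: "S \<subseteq> carr A" "separable_in A S"
  obtains j :: "'a \<Rightarrow> 'g univ" where "inj_on j S"
proof -
  interpret cstar_algebra A by fact
  obtain d :: "nat \<Rightarrow> 'a" where d: "\<And>n. d n \<in> carr A"
    "\<And>x e. x \<in> S \<Longrightarrow> e > 0 \<Longrightarrow> \<exists>n. cnorm A (cdiff A (d n) x) < e"
    using S(2) unfolding separable_in_def by blast
  define j :: "'a \<Rightarrow> 'g univ" where "j x n = (case prod_decode n of (m, k) \<Rightarrow>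
    if cnorm A (cdiff A (d m) x) < 1 / Suc k then Some undefined else None)" for x n
  have "inj_on j S"
  proof (rule inj_onI, rule ccontr)
    fix x y assume xy: "x \<in> S" "y \<in> S" "j x = j y" "x \<noteq> y"
    have "cnorm A (cdiff A x y) > 0"
      using xy S(1) norm_diff_eq_zero_iff[of x y] norm_nonneg[OF diff_closed, of x y] by (auto simp: less_le)
    \<comment> \<open>With this radius no ball can contain both \<open>x\<close> and
      \<open>y\<close>.\<close>
    then obtain k where k: "1 / Suc k < cnorm A (cdiff A x y) / 2"
      by (metis half_gt_zero nat_approx_posE)
    obtain m where m: "cnorm A (cdiff A (d m) x) < 1 / Suc k"
      using d(2)[OF xy(1), of "1 / Suc k"] by auto
    have "j x (prod_encode (m, k)) = j y (prod_encode (m, k))" using xy(3) by simp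
    then have "cnorm A (cdiff A (d m) y) < 1 / Suc k" using m by (simp add: j_def split: if_splits)
    then show False
      using k m norm_diff_triangle[of x "d m" y] norm_diff_commute[of x "d m"] d(1) xy S(1) by force
  qed
  then show thesis by (rule that)
qed

text \<open>Syntax for star polynomials without constant term. It is countable as a datatype over
  natural numbers; \<open>Gen\<close> and \<open>Scale\<close> refer to elements and scalars by
  index.\<close>

datatype word = Gen nat | Add word word | Mult word word | Adj word | Scale nat word

instance word :: countable by countable_datatype

primrec word_value :: "'a cstar \<Rightarrow> (nat \<Rightarrow> 'a) \<Rightarrow> (nat \<Rightarrow> complex) \<Rightarrow> word \<Rightarrow> 'a" where
  "word_value A d q (Gen n) = d n"
| "word_value A d q (Add v w) = cadd A (word_value A d q v) (word_value A d q w)"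
| "word_value A d q (Mult v w) = cmult A (word_value A d q v) (word_value A d q w)"
| "word_value A d q (Adj w) = cadj A (word_value A d q w)"
| "word_value A d q (Scale n w) = cscale A (q n) (word_value A d q w)"

text \<open>Words evaluated at points that approximate \<open>G\<close>, with scalars from a
  countable dense set, have countably many values. By the limit laws, the limits of these values
  form a closed star subalgebra, and it contains \<open>G\<close>.\<close>

lemma separable_in_generated:
  assumes A: "cstar_algebra A" and G: "G \<subseteq> carr A" "separable_in A G"
  shows "separable_in A (carr (cstar_generated A G))"
proof -
  interpret cstar_algebra A by fact
  obtain d :: "nat \<Rightarrow> 'a" where d: "\<And>n. d n \<in> carr A"
    "\<And>x e. x \<in> G \<Longrightarrow> e > 0 \<Longrightarrow> \<exists>n. cnorm A (cdiff A (d n) x) < e"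
    using G(2) unfolding separable_in_def by blast
  obtain Q :: "complex set" where Q: "countable Q" "\<And>X. open X \<Longrightarrow> X \<noteq> {} \<Longrightarrow> \<exists>q\<in>Q. q \<in> X"
    using countable_dense_setE by blast
  have "Q \<noteq> {}" using Q(2)[of UNIV] by auto
  define q where "q = from_nat_into Q"
  have q: "\<exists>f. (\<lambda>n. q (f n)) \<longlonglongrightarrow> c" for c
  proof -
    have "\<exists>m. dist (q m) c < 1 / Suc n" for n
    proof -
      obtain x where "x \<in> Q" "dist x c < 1 / Suc n" using Q(2)[of "ball c (1 / Suc n)"]
        by (auto simp: dist_commute)
      then show ?thesis using from_nat_into_surj[OF Q(1)] unfolding q_def by metis
    qed
    then obtain f where f: "\<And>n. dist (q (f n)) c < 1 / Suc n" by metis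
    have "(\<lambda>n. dist (q (f n)) c) \<longlonglongrightarrow> 0"
      by (rule tendsto_sandwich[OF _ _ tendsto_const LIMSEQ_Suc[OF lim_1_over_n]])
        (use f in \<open>auto intro!: always_eventually less_imp_le\<close>)
    then show ?thesis using tendsto_dist_iff by blast
  qed
  let ?v = "word_value A d q"
  have v: "?v w \<in> carr A" for w by (induction w) (auto simp: closed d)
  define S where "S = {x \<in> carr A. \<exists>f. clim (\<lambda>n. ?v (f n)) x}"
  have lim: "\<exists>w. cnorm A (cdiff A (?v w) x) < e" if "x \<in> S" "e > 0" for x e
    using that clim_approx unfolding S_def by blast
  have S_I: "x \<in> S" if x: "x \<in> carr A" "\<And>e. e > 0 \<Longrightarrow> \<exists>w. cnorm A (cdiff A (?v w) x) < e" for x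
  proof -
    obtain f where f: "\<And>n. f n \<in> range ?v" "clim f x"
      by (rule approx_clim[of "range ?v" x]) (use x v in auto)
    have "\<forall>n. \<exists>w. f n = ?v w" using f(1) by (auto simp: image_iff)
    then obtain w where "\<And>n. f n = ?v (w n)" by metis
    then have "f = (\<lambda>n. ?v (w n))" by blast
    then show ?thesis using f(2) x(1) by (auto simp: S_def)
  qed
  have "closed_star_subalgebra A S"
    unfolding closed_star_subalgebra_def closed_linear_subspace_def
  proof (intro conjI allI ballI impI; (elim conjE)?)
    show "S \<subseteq> carr A" by (auto simp: S_def)
    fix x assume x: "x \<in> S"
    then obtain f where f: "clim (\<lambda>n. ?v (f n)) x" "x \<in> carr A" by (auto simp: S_def)
    have "clim (\<lambda>n. ?v (Adj (f n))) (cadj A x)" using clim_adj[OF f(1) v f(2)] by simp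
    then show "cadj A x \<in> S" using f(2) by (auto simp: S_def adj_closed intro!: exI[of _ "\<lambda>n. Adj (f n)"])
    {
      fix c
      obtain k where "(\<lambda>n. q (k n)) \<longlonglongrightarrow> c" using q by blast
      then have "clim (\<lambda>n. ?v (Scale (k n) (f n))) (cscale A c x)"
        using clim_scale'[OF f(1) _ v f(2)] by simp
      then show "cscale A c x \<in> S"
        using f(2) by (auto simp: S_def scale_closed intro!: exI[of _ "\<lambda>n. Scale (k n) (f n)"])
    }
    fix y assume "y \<in> S"
    then obtain g where g: "clim (\<lambda>n. ?v (g n)) y" "y \<in> carr A" by (auto simp: S_def)
    have "clim (\<lambda>n. ?v (Add (f n) (g n))) (cadd A x y)" using clim_add[OF f(1) g(1) v v f(2) g(2)] by simp
    then show "cadd A x y \<in> S"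
      using f(2) g(2) by (auto simp: S_def add_closed intro!: exI[of _ "\<lambda>n. Add (f n) (g n)"])
    have "clim (\<lambda>n. ?v (Mult (f n) (g n))) (cmult A x y)" using clim_mult[OF f(1) g(1) v v f(2) g(2)] by simp
    then show "cmult A x y \<in> S"
      using f(2) g(2) by (auto simp: S_def mult_closed intro!: exI[of _ "\<lambda>n. Mult (f n) (g n)"])
  next
    \<comment> \<open>Zero need not be the value of a word, so it is approached by scalars tending
      to 0 times a fixed element.\<close>
    obtain k where "(\<lambda>n. q (k n)) \<longlonglongrightarrow> 0" using q by blast
    then have "clim (\<lambda>n. ?v (Scale (k n) (Gen 0))) (cscale A 0 (d 0))"
      using clim_scale'[OF clim_const[OF d(1)[of 0]] _ d(1) d(1)] by simp
    then show "czero A \<in> S"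
      using d(1) by (auto simp: S_def scale_zero_left zero_closed intro!: exI[of _ "\<lambda>n. Scale (k n) (Gen 0)"])
  next
    fix f l
    assume l: "l \<in> carr A" "\<forall>n::nat. f n \<in> S" "(\<lambda>n. cnorm A (cdiff A (f n) l)) \<longlonglongrightarrow> 0"
    show "l \<in> S"
    proof (rule S_I[OF l(1)])
      fix e :: real assume e: "e > 0"
      obtain n where n: "cnorm A (cdiff A (f n) l) < e / 2"
        using clim_approx[of f l "e / 2"] e l(3) by (auto simp: clim_def)
      obtain w where "cnorm A (cdiff A (?v w) (f n)) < e / 2" using lim[of "f n" "e / 2"] l(2) e by auto
      moreover have "f n \<in> carr A" using l(2) by (simp add: S_def)
      ultimately have "cnorm A (cdiff A (?v w) l) < e"
        using norm_diff_triangle[of "?v w" "f n" l] n v l(1) by simp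
      then show "\<exists>w. cnorm A (cdiff A (?v w) l) < e" by blast
    qed
  qed
  moreover have "G \<subseteq> S"
  proof
    fix x assume x: "x \<in> G"
    show "x \<in> S"
    proof (rule S_I)
      fix e :: real assume "e > 0"
      then obtain n where "cnorm A (cdiff A (?v (Gen n)) x) < e" using d(2)[OF x] by auto
      then show "\<exists>w. cnorm A (cdiff A (?v w) x) < e" by blast
    qed (use x G(1) in auto)
  qed
  ultimately have sub: "carr (cstar_generated A G) \<subseteq> S" by (rule generated_least)
  show ?thesis
  proof (rule separable_inI[of "range ?v"])
    fix x and e :: real assume "x \<in> carr (cstar_generated A G)" "e > 0"
    then show "\<exists>d\<in>range ?v. cnorm A (cdiff A d x) < e" using sub lim by blast
  qed (use v in auto)
qed

text \<open>The bound \<open>gen_bounded\<close>, uniform over all representations, is what puts the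
  tautological families into the product of bounded families.\<close>

locale universal_family =
  fixes G :: "'g set" and R :: "'g rep set"
  assumes nonempty: "R \<noteq> {}"
    and algebra: "i \<in> R \<Longrightarrow> cstar_algebra (fst i)"
    and gen_closed: "i \<in> R \<Longrightarrow> g \<in> G \<Longrightarrow> snd i g \<in> carr (fst i)"
    and gen_bounded: "g \<in> G \<Longrightarrow> \<exists>K. \<forall>i\<in>R. cnorm (fst i) (snd i g) \<le> K"
begin

abbreviation "P \<equiv> cstar_prod R fst"
abbreviation "U \<equiv> universal_cstar G R"

lemma prod_algebra: "cstar_algebra P"
  using cstar_prod_algebra[OF nonempty] algebra by blast

lemma gens_closed: "universal_gen R ` G \<subseteq> carr P"
proof (rule image_subsetI)
  fix g assume g: "g \<in> G"
  obtain K where K: "\<And>i. i \<in> R \<Longrightarrow> cnorm (fst i) (snd i g) \<le> K" using gen_bounded[OF g] by blast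
  show "universal_gen R g \<in> carr P"
    by (rule cstar_prod_carrI[of _ _ _ K]) (use gen_closed[OF _ g] K in \<open>auto simp: universal_gen_def\<close>)
qed

lemma universal_algebra: "cstar_algebra U"
  unfolding universal_cstar_def by (rule cstar_generated_algebra[OF prod_algebra gens_closed])

lemma gen_carr: "g \<in> G \<Longrightarrow> universal_gen R g \<in> carr U"
  using generated_superset[of "universal_gen R ` G" P] by (auto simp: universal_cstar_def)

lemma carr_subset: "carr U \<subseteq> carr P"
  unfolding universal_cstar_def
  by (rule closed_star_subalgebraD(1)[OF closed_star_subalgebra_generated[OF prod_algebra gens_closed]])

lemma universal_ops [simp]:
  assumes "i \<in> R"
  shows "cadd U x y i = cadd (fst i) (x i) (y i)" "czero U i = czero (fst i)"
    "cscale U c x i = cscale (fst i) c (x i)" "cmult U x y i = cmult (fst i) (x i) (y i)"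
    "cadj U x i = cadj (fst i) (x i)" "universal_gen R g i = snd i g"
  using assms by (simp_all add: universal_cstar_def universal_gen_def)

lemma carr_coord: "x \<in> carr U \<Longrightarrow> i \<in> R \<Longrightarrow> x i \<in> carr (fst i)"
  using carr_subset cstar_prod_carrD(2)[of x R fst i] by auto

lemma universal_eqI: "\<lbrakk>x \<in> carr U; y \<in> carr U; \<And>i. i \<in> R \<Longrightarrow> x i = y i\<rbrakk> \<Longrightarrow> x = y"
  using carr_subset cstar_prod_carrD(1)[of x R fst] cstar_prod_carrD(1)[of y R fst]
  by (intro extensionalityI[of x R y]) auto

lemma coord_contractive_hom: "i \<in> R \<Longrightarrow> contractive_hom U (fst i) (\<lambda>x. x i)"
  unfolding contractive_hom_def star_hom_def
  using carr_coord carr_subset cstar_prod_carrD(3)[of _ R fst i]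
  by (auto simp: universal_cstar_def)

text \<open>The transported representation is itself one of the indices, so the homomorphism is the
  projection to that coordinate followed by the inverse of \<open>j\<close>. It is contractive since
  the product norm is a supremum over the coordinates.\<close>

lemma universal_hom:
  assumes C: "cstar_algebra C" and j: "inj_on j (carr C)" and R: "(cstar_transport j C, \<lambda>g. j (\<rho> g)) \<in> R"
    and \<rho>: "\<And>g. g \<in> G \<Longrightarrow> \<rho> g \<in> carr C"
  obtains F where "contractive_hom U C F" "\<And>g. g \<in> G \<Longrightarrow> F (universal_gen R g) = \<rho> g"
proof
  let ?i = "(cstar_transport j C, \<lambda>g. j (\<rho> g))"
  let ?k = "inv_into (carr C) j"
  have k: "contractive_hom (cstar_transport j C) C ?k"
    unfolding contractive_hom_def using cstar_transport_inv_hom[OF C j] by (simp add: cnorm_transport)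
  show "contractive_hom U C (\<lambda>x. ?k (x ?i))"
    using contractive_hom_comp[OF coord_contractive_hom[OF R]] k by simp
  show "?k (universal_gen R g ?i) = \<rho> g" if "g \<in> G" for g
    using R \<rho>[OF that] j by simp
qed

lemma universal_hom_eq:
  assumes "cstar_algebra C" "contractive_hom U C f" "contractive_hom U C g"
    "\<And>x. x \<in> G \<Longrightarrow> f (universal_gen R x) = g (universal_gen R x)" "x \<in> carr U"
  shows "f x = g x"
  using contractive_hom_eq_on_generated[OF prod_algebra assms(1) gens_closed, of f g x] assms(2-5)
  by (auto simp: universal_cstar_def)

text \<open>Lets the universal algebra of one set of relations occur as the carrier of a
  representation of another, whose generators have a different type \<open>'h\<close>.\<close>

lemma universal_embedding:
  assumes "separable_in P (universal_gen R ` G)"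
  obtains j :: "('g rep \<Rightarrow> 'g univ) \<Rightarrow> 'h univ" where "inj_on j (carr U)"
proof -
  have "separable_in P (carr U)"
    unfolding universal_cstar_def by (rule separable_in_generated[OF prod_algebra gens_closed assms])
  from separable_in_embedding[OF prod_algebra carr_subset this] that show thesis by blast
qed

end

section \<open>Continuous functions on a compact space\<close>

lemma continuous_map_complex_mult [continuous_intros]:
  fixes f g :: "'a \<Rightarrow> complex"
  shows "\<lbrakk>continuous_map X euclidean f; continuous_map X euclidean g\<rbrakk>
    \<Longrightarrow> continuous_map X euclidean (\<lambda>x. f x * g x)"
  by (simp add: continuous_map_atin tendsto_mult)

lemma continuous_map_cnj [continuous_intros]:
  "continuous_map X euclidean f \<Longrightarrow> continuous_map X euclidean (\<lambda>x. cnj (f x))"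
  by (simp add: continuous_map_atin tendsto_cnj)

lemma continuous_map_Re [continuous_intros]:
  "continuous_map X euclidean f \<Longrightarrow> continuous_map X euclidean (\<lambda>x. Re (f x))"
  by (simp add: continuous_map_atin tendsto_Re)

lemma continuous_map_complex_of_real [continuous_intros]:
  "continuous_map X euclidean f \<Longrightarrow> continuous_map X euclidean (\<lambda>x. complex_of_real (f x))"
  by (simp add: continuous_map_atin tendsto_of_real)

lemma continuous_map_sqrt [continuous_intros]:
  "continuous_map X euclidean f \<Longrightarrow> continuous_map X euclidean (\<lambda>x. sqrt (f x))"
  by (simp add: continuous_map_atin tendsto_real_sqrt)

section \<open>The C*-algebra C(Y) of a compact space\<close>

lemma restrict0_cont_funs:
  assumes "continuous_map Y euclidean f"
  shows "restrict0 Y f \<in> cont_funs Y"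
proof -
  have "continuous_map Y euclidean (restrict0 Y f)"
    by (rule continuous_map_eq[OF assms]) (simp add: restrict0_def)
  then show ?thesis by (simp add: cont_funs_def restrict0_def)
qed

lemma cont_fun_bounded:
  assumes "compact_space Y" "f \<in> cont_funs Y"
  obtains K where "\<And>y. cmod (f y) \<le> K"
proof -
  have "compactin euclidean (f ` topspace Y)"
    using assms image_compactin[of Y "topspace Y" euclidean f] by (simp add: compact_space_def cont_funs_def)
  then have "bounded (f ` topspace Y)" by (simp add: compact_imp_bounded)
  then obtain K where "\<forall>y\<in>topspace Y. cmod (f y) \<le> K" by (auto simp: bounded_iff)
  then have "cmod (f y) \<le> max K 0" for y using assms(2) by (cases "y \<in> topspace Y") (auto simp: cont_funs_def)
  then show ?thesis using that by blast
qed

lemma C0_funs_compact: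
  assumes "compact_space Y"
  shows "C0_funs Y = cont_funs Y"
proof -
  have "compactin Y {y \<in> topspace Y. \<epsilon> \<le> cmod (f y)}" if "f \<in> cont_funs Y" for f \<epsilon>
  proof -
    have "continuous_map Y euclideanreal (\<lambda>y. cmod (f y))"
      using that by (intro continuous_intros) (simp add: cont_funs_def)
    then have "closedin Y {y \<in> topspace Y. cmod (f y) \<in> {\<epsilon>..}}"
      by (rule closedin_continuous_map_preimage) simp
    then show ?thesis using closedin_compact_space[OF assms] by simp
  qed
  then show ?thesis by (auto simp: C0_funs_def)
qed

lemma Cc_funs_compact: "compact_space Y \<Longrightarrow> Cc_funs Y = cont_funs Y"
  by (auto simp: Cc_funs_def cont_funs_def compact_space_def)

lemma C0_algebra_ops [simp]:
  "cadd (C0_algebra Y) = (\<lambda>f g y. f y + g y)" "czero (C0_algebra Y) = (\<lambda>y. 0)"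
  "cscale (C0_algebra Y) = (\<lambda>c f y. c * f y)" "cmult (C0_algebra Y) = (\<lambda>f g y. f y * g y)"
  "cadj (C0_algebra Y) = (\<lambda>f y. cnj (f y))"
  by (simp_all add: C0_algebra_def)

lemma cdiff_C0_algebra [simp]: "cdiff (C0_algebra Y) f g = (\<lambda>y. f y - g y)"
  by (simp add: cdiff_def)

lemma C0_algebra_carr: "compact_space Y \<Longrightarrow> carr (C0_algebra Y) = cont_funs Y"
  by (simp add: C0_algebra_def C0_funs_compact)

lemma C0_algebra_norm_upper:
  assumes "compact_space Y" "f \<in> cont_funs Y"
  shows "cmod (f y) \<le> cnorm (C0_algebra Y) f"
proof -
  obtain K where "\<And>y. cmod (f y) \<le> K" using cont_fun_bounded[OF assms] by blast
  then show ?thesis by (auto simp: C0_algebra_def intro!: cSUP_upper bdd_aboveI2)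
qed

lemma C0_algebra_norm_least: "(\<And>y. cmod (f y) \<le> K) \<Longrightarrow> cnorm (C0_algebra Y) f \<le> K"
  by (auto simp: C0_algebra_def intro!: cSUP_least)

lemma cont_funs_closed:
  assumes "f \<in> cont_funs Y" "g \<in> cont_funs Y"
  shows "(\<lambda>y. f y + g y) \<in> cont_funs Y" "(\<lambda>y. f y - g y) \<in> cont_funs Y"
    "(\<lambda>y. f y * g y) \<in> cont_funs Y" "(\<lambda>y. c * f y) \<in> cont_funs Y" "(\<lambda>y. cnj (f y)) \<in> cont_funs Y"
  using assms by (auto simp: cont_funs_def intro!: continuous_intros)

lemma zero_cont_funs: "(\<lambda>y. 0) \<in> cont_funs Y"
  by (simp add: cont_funs_def)

lemma C0_algebra_algebra:
  assumes Y: "compact_space Y"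
  shows "cstar_algebra (C0_algebra Y)"
proof -
  let ?A = "C0_algebra Y"
  note carr [simp] = C0_algebra_carr[OF Y]
  note upper = C0_algebra_norm_upper[OF Y]
  note least = C0_algebra_norm_least
  have nonneg: "0 \<le> cnorm ?A f" if "f \<in> cont_funs Y" for f
    using upper[OF that, of undefined] norm_ge_zero order_trans by blast
  show ?thesis
  proof
    fix f g assume "f \<in> carr ?A" "g \<in> carr ?A"
    then have f: "f \<in> cont_funs Y" and g: "g \<in> cont_funs Y" by auto
    show "cnorm ?A (cadd ?A f g) \<le> cnorm ?A f + cnorm ?A g"
      by (rule least) (use upper[OF f] upper[OF g] in \<open>auto intro!: norm_triangle_le add_mono\<close>)
    show "cnorm ?A (cmult ?A f g) \<le> cnorm ?A f * cnorm ?A g"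
      by (rule least) (use upper[OF f] upper[OF g] nonneg f in \<open>auto simp: norm_mult intro!: mult_mono\<close>)
  next
    fix f assume "f \<in> carr ?A"
    then have f: "f \<in> cont_funs Y" by simp
    show "0 \<le> cnorm ?A f" by (rule nonneg[OF f])
    show "cnorm ?A f = 0 \<longleftrightarrow> f = czero ?A"
    proof
      assume "cnorm ?A f = 0"
      then show "f = czero ?A" using upper[OF f] by auto
    next
      assume "f = czero ?A"
      then show "cnorm ?A f = 0" using nonneg[OF f] by (intro antisym least) auto
    qed
    show "cnorm ?A (cscale ?A c f) = cmod c * cnorm ?A f" for c
    proof (rule antisym)
      show "cnorm ?A (cscale ?A c f) \<le> cmod c * cnorm ?A f"
        by (rule least) (use upper[OF f] in \<open>auto simp: norm_mult intro: mult_left_mono\<close>)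
      have cf: "(\<lambda>y. c * f y) \<in> cont_funs Y" using cont_funs_closed(4)[OF f f] .
      show "cmod c * cnorm ?A f \<le> cnorm ?A (cscale ?A c f)"
      proof (cases "c = 0")
        case True
        then show ?thesis using nonneg[OF cf] by simp
      next
        case False
        have "cnorm ?A f \<le> cnorm ?A (cscale ?A c f) / cmod c"
          by (rule least) (use upper[OF cf] False in \<open>simp add: norm_mult field_simps\<close>)
        then show ?thesis using False by (simp add: field_simps)
      qed
    qed
    show "cnorm ?A (cmult ?A (cadj ?A f) f) = (cnorm ?A f)\<^sup>2"
    proof (rule antisym)
      have sq: "cmod (cnj (f y) * f y) = (cmod (f y))\<^sup>2" for y by (simp add: norm_mult power2_eq_square)
      show "cnorm ?A (cmult ?A (cadj ?A f) f) \<le> (cnorm ?A f)\<^sup>2"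
        by (rule least) (use upper[OF f] sq in \<open>simp add: power_mono\<close>)
      have ff: "(\<lambda>y. cnj (f y) * f y) \<in> cont_funs Y"
        using cont_funs_closed(3)[OF cont_funs_closed(5)[OF f f] f] .
      have "cnorm ?A f \<le> sqrt (cnorm ?A (cmult ?A (cadj ?A f) f))"
        by (rule least) (use upper[OF ff] sq in \<open>simp add: real_le_rsqrt\<close>)
      then show "(cnorm ?A f)\<^sup>2 \<le> cnorm ?A (cmult ?A (cadj ?A f) f)"
        using nonneg[OF f] nonneg[OF ff] power_mono[of "cnorm ?A f" _ 2] by fastforce
    qed
  next
    fix f :: "nat \<Rightarrow> 'a \<Rightarrow> complex"
    assume "\<And>n. f n \<in> carr ?A"
      and cauchy: "\<And>\<epsilon>. \<epsilon> > 0 \<Longrightarrow> \<exists>N. \<forall>m\<ge>N. \<forall>n\<ge>N. cnorm ?A (cdiff ?A (f m) (f n)) < \<epsilon>"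
    then have f: "f n \<in> cont_funs Y" for n by simp
    have "\<exists>N. \<forall>m n x. N \<le> m \<longrightarrow> N \<le> n \<longrightarrow> x \<in> topspace Y \<longrightarrow> dist (f m x) (f n x) < \<epsilon>"
      if \<epsilon>: "\<epsilon> > 0" for \<epsilon>
    proof -
      obtain N where N: "\<And>m n. m \<ge> N \<Longrightarrow> n \<ge> N \<Longrightarrow> cnorm ?A (cdiff ?A (f m) (f n)) < \<epsilon>"
        using cauchy[OF \<epsilon>] by blast
      have "dist (f m x) (f n x) < \<epsilon>" if "m \<ge> N" "n \<ge> N" for m n x
        using N[OF that] upper[OF cont_funs_closed(2)[OF f f], of m x n]
        by (simp add: dist_norm)
      then show ?thesis by blast
    qed
    then obtain g where g: "continuous_map Y euclidean g"
      "\<And>\<epsilon>. 0 < \<epsilon> \<Longrightarrow> \<forall>\<^sub>F n in sequentially. \<forall>x\<in>topspace Y. dist (f n x) (g x) < \<epsilon>"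
      using Met_TC.continuous_map_uniformly_Cauchy_limit[where X=Y and f=f] f
      by (auto simp: cont_funs_def complete_UNIV) blast
    \<comment> \<open>The uniform limit is controlled on \<open>Y\<close> only and is cut off to 0
      elsewhere.\<close>
    have r: "restrict0 Y g \<in> cont_funs Y" using restrict0_cont_funs g(1) by blast
    have "(\<lambda>n. cnorm ?A (cdiff ?A (f n) (restrict0 Y g))) \<longlonglongrightarrow> 0"
    proof (rule tendstoI)
      fix e :: real assume e: "e > 0"
      have bound: "cnorm ?A (cdiff ?A (f n) (restrict0 Y g)) \<le> e / 2"
        if "\<forall>x\<in>topspace Y. dist (f n x) (g x) < e / 2" for n
        by (rule least) (use that f[of n] e in \<open>auto simp: restrict0_def dist_norm cont_funs_def intro: less_imp_le\<close>)
      have "\<forall>\<^sub>F n in sequentially. \<forall>x\<in>topspace Y. dist (f n x) (g x) < e / 2" using g(2)[of "e / 2"] e by simp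
      then show "\<forall>\<^sub>F n in sequentially. dist (cnorm ?A (cdiff ?A (f n) (restrict0 Y g))) 0 < e"
      proof eventually_elim
        case (elim n)
        show ?case using bound[OF elim] nonneg[OF cont_funs_closed(2)[OF f[of n] r]] e by simp
      qed
    qed
    then show "\<exists>l\<in>carr ?A. (\<lambda>n. cnorm ?A (cdiff ?A (f n) l)) \<longlonglongrightarrow> 0" using r by auto
  qed (auto simp: cont_funs_closed zero_cont_funs algebra_simps)
qed

lemma indicator_cont_funs: "indicator (topspace Y) \<in> cont_funs Y"
proof -
  have "continuous_map Y euclidean (indicator (topspace Y) :: _ \<Rightarrow> complex)"
    by (rule continuous_map_eq[of _ _ "\<lambda>_. 1"]) auto
  then show ?thesis by (auto simp: cont_funs_def)
qed

text \<open>
  A real function \<open>g\<close> with \<open>\<bar>g\<bar> \<le> 1\<close> is the mean of the unitaries \<open>g \<plusminus> i \<surd>(1 - g\<^sup>2)\<close>, and a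
  homomorphism does not increase the norm of a unitary; this avoids spectral theory.
\<close>

lemma C0_algebra_hom_contractive:
  assumes Y: "compact_space Y" and B: "cstar_algebra B" and hom: "star_hom (C0_algebra Y) B \<pi>"
  shows "contractive_hom (C0_algebra Y) B \<pi>"
proof -
  interpret B: cstar_algebra B by fact
  let ?A = "C0_algebra Y"
  interpret A: cstar_algebra ?A by (rule C0_algebra_algebra[OF Y])
  note carr [simp] = C0_algebra_carr[OF Y]
  note \<pi> = star_homD[OF hom, simplified]
  let ?one = "indicator (topspace Y) :: _ \<Rightarrow> complex"
  have sq: "cmult B (cadj B (\<pi> f)) (\<pi> f) = \<pi> (\<lambda>y. cnj (f y) * f y)" if f: "f \<in> cont_funs Y" for f
    using \<pi>(4)[of "\<lambda>y. cnj (f y)" f] \<pi>(5)[of f] f cont_funs_closed(5)[OF f f] by simp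
  \<comment> \<open>The homomorphism need not be unital: the image of 1 is a projection, so its norm
    is at most 1.\<close>
  have "cmult B (cadj B (\<pi> ?one)) (\<pi> ?one) = \<pi> (\<lambda>y. cnj (?one y) * ?one y)"
    by (rule sq[OF indicator_cont_funs])
  also have "(\<lambda>y. cnj (?one y) * ?one y) = ?one" by (auto simp: indicator_def)
  finally have p: "cnorm B (\<pi> ?one) \<le> 1" using \<pi>(1) indicator_cont_funs B.projection_norm_le by blast
  have unitary: "cnorm B (\<pi> u) \<le> 1" if u: "u \<in> cont_funs Y" "\<And>y. y \<in> topspace Y \<Longrightarrow> cnj (u y) * u y = 1" for u
  proof -
    have "(cnorm B (\<pi> u))\<^sup>2 = cnorm B (\<pi> (\<lambda>y. cnj (u y) * u y))"
      using B.norm_cstar[of "\<pi> u"] \<pi>(1) u(1) sq[OF u(1)] by simp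
    also have "(\<lambda>y. cnj (u y) * u y) = ?one" using u by (auto simp: indicator_def cont_funs_def)
    finally have "(cnorm B (\<pi> u))\<^sup>2 \<le> 1" using p by simp
    then show ?thesis by (simp add: power_le_one_iff abs_square_le_1 abs_le_iff)
  qed
  have real: "cnorm B (\<pi> g) \<le> 1"
    if g: "g \<in> cont_funs Y" "\<And>y. cnj (g y) = g y" "\<And>y. cmod (g y) \<le> 1" for g
  proof -
    define u where "u = restrict0 Y (\<lambda>y. g y + \<i> * complex_of_real (sqrt (1 - Re (g y) * Re (g y))))"
    have gc: "continuous_map Y euclidean g" using g(1) by (simp add: cont_funs_def)
    have u: "u \<in> cont_funs Y"
      unfolding u_def by (intro restrict0_cont_funs continuous_intros gc)
    have re: "g y = complex_of_real (Re (g y))" for y using g(2)[of y] by (simp add: complex_eq_iff)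
    have "Re (g y) * Re (g y) \<le> 1" for y
      using abs_Re_le_cmod[of "g y"] g(3)[of y] by (simp add: abs_square_le_1 flip: power2_eq_square)
    then have mod: "cnj (u y) * u y = 1" if "y \<in> topspace Y" for y
      using that re[of y] g(2)[of y] unfolding u_def restrict0_def
      by (simp add: complex_eq_iff algebra_simps)
    have uc: "(\<lambda>y. cnj (u y)) \<in> cont_funs Y" using cont_funs_closed(5)[OF u u] .
    have "g = (\<lambda>y. (1/2) * (u y + cnj (u y)))"
    proof
      fix y show "g y = (1/2) * (u y + cnj (u y))"
        using g(1) g(2)[of y] by (cases "y \<in> topspace Y") (auto simp: u_def restrict0_def cont_funs_def)
    qed
    then have "\<pi> g = \<pi> (\<lambda>y. (1/2) * (u y + cnj (u y)))" by (rule arg_cong)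
    also have "\<dots> = cscale B (1/2) (\<pi> (\<lambda>y. u y + cnj (u y)))"
      using \<pi>(3)[of "\<lambda>y. u y + cnj (u y)" "1/2"] cont_funs_closed(1)[OF u uc] by simp
    also have "\<pi> (\<lambda>y. u y + cnj (u y)) = cadd B (\<pi> u) (cadj B (\<pi> u))"
      using \<pi>(2)[of u "\<lambda>y. cnj (u y)"] \<pi>(5)[of u] u uc by simp
    finally have "cnorm B (\<pi> g) \<le> 1/2 * (cnorm B (\<pi> u) + cnorm B (\<pi> u))"
      using B.norm_triangle[of "\<pi> u" "cadj B (\<pi> u)"] u
      by (simp add: B.norm_scale B.closed B.norm_adj \<pi>(1))
    then show ?thesis using unitary[OF u mod] by simp
  qed
  have "cnorm B (\<pi> f) \<le> cnorm ?A f" if f: "f \<in> cont_funs Y" for f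
  proof (cases "cnorm ?A f = 0")
    case True
    then have "f = czero ?A" using A.norm_eq_zero f by simp
    then have "\<pi> f = czero B" using star_hom_zero[OF A.cstar_algebra_axioms B hom] by blast
    then show ?thesis using True B.norm_zero by simp
  next
    case False
    define M where "M = cnorm ?A f"
    have M: "M > 0" using False A.norm_nonneg[of f] f by (simp add: M_def)
    \<comment> \<open>The C*-identity reduces an arbitrary \<open>f\<close> to the real function
      |f|^2 / M^2, which is bounded by 1.\<close>
    let ?h = "\<lambda>y. complex_of_real (1 / M\<^sup>2) * (cnj (f y) * f y)"
    have ff: "(\<lambda>y. cnj (f y) * f y) \<in> cont_funs Y"
      using cont_funs_closed(3)[OF cont_funs_closed(5)[OF f f] f] .
    have "cnorm B (\<pi> ?h) \<le> 1"
    proof (rule real)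
      show "?h \<in> cont_funs Y" using cont_funs_closed(4)[OF ff ff] .
      show "cmod (?h y) \<le> 1" for y
        using C0_algebra_norm_upper[OF Y f, of y] M
        by (simp add: M_def norm_mult norm_divide norm_power power2_eq_square divide_simps mult_mono)
    qed simp
    also have "\<pi> ?h = cscale B (complex_of_real (1 / M\<^sup>2)) (\<pi> (\<lambda>y. cnj (f y) * f y))"
      by (rule \<pi>(3)) (rule ff)
    also have "\<pi> (\<lambda>y. cnj (f y) * f y) = cmult B (cadj B (\<pi> f)) (\<pi> f)"
      by (rule sq[OF f, symmetric])
    also have "cnorm B (cscale B (complex_of_real (1 / M\<^sup>2)) \<dots>) = (1 / M\<^sup>2) * (cnorm B (\<pi> f))\<^sup>2"
      using \<pi>(1)[of f] f B.norm_cstar by (simp add: B.norm_scale B.closed norm_divide norm_power)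
    finally have "(cnorm B (\<pi> f))\<^sup>2 \<le> M\<^sup>2" using M by (simp add: field_simps)
    then have "cnorm B (\<pi> f) \<le> M" by (rule power2_le_imp_le) (use M in simp)
    then show ?thesis by (simp only: M_def)
  qed
  then show ?thesis using hom by (simp add: contractive_hom_def)
qed

lemma compact_space_finite_subcover:
  assumes "compact_space X" "\<And>U. U \<in> \<C> \<Longrightarrow> openin X U" "topspace X \<subseteq> \<Union>\<C>"
  obtains \<F> where "finite \<F>" "\<F> \<subseteq> \<C>" "topspace X \<subseteq> \<Union>\<F>"
proof -
  have "Ball \<C> (openin X) \<and> topspace X \<subseteq> \<Union>\<C> \<longrightarrow> (\<exists>\<F>. finite \<F> \<and> \<F> \<subseteq> \<C> \<and> topspace X \<subseteq> \<Union>\<F>)"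
    using assms(1) unfolding compact_space_def compactin_def by (rule conjE) (erule spec)
  then show thesis using assms(2,3) that by meson
qed

text \<open>A finite list of basic open sets with approximate values, together with a tolerance,
  pins a function down up to twice the tolerance once the sets cover the space. There are countably
  many such descriptions, and one function is chosen for each that can be met.\<close>

lemma C0_algebra_separable:
  assumes Y: "compact_space Y" and sc: "second_countable Y"
  shows "separable_in (C0_algebra Y) (cont_funs Y)"
proof -
  let ?A = "C0_algebra Y"
  obtain \<B> where \<B>: "countable \<B>" "\<And>V. V \<in> \<B> \<Longrightarrow> openin Y V"
    "\<And>U x. openin Y U \<Longrightarrow> x \<in> U \<Longrightarrow> \<exists>V\<in>\<B>. x \<in> V \<and> V \<subseteq> U"
    using sc unfolding second_countable_def by metis
  obtain Q :: "complex set" where Q: "countable Q" "\<And>X. open X \<Longrightarrow> X \<noteq> {} \<Longrightarrow> \<exists>q\<in>Q. q \<in> X"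
    using countable_dense_setE by blast
  define good :: "('a set \<times> complex) list \<Rightarrow> nat \<Rightarrow> ('a \<Rightarrow> complex) \<Rightarrow> bool" where
    "good L n f \<longleftrightarrow> f \<in> cont_funs Y \<and> (\<forall>(V, q)\<in>set L. \<forall>y\<in>V. cmod (f y - q) < 1 / Suc n)" for L n f
  \<comment> \<open>Descriptions that no function meets receive the zero function, to keep
    \<open>D\<close> inside the carrier.\<close>
  define F where "F L n = (if \<exists>f. good L n f then SOME f. good L n f else (\<lambda>_. 0))" for L n
  define D where "D = (\<lambda>(L, n). F L n) ` (lists (\<B> \<times> Q) \<times> UNIV)"
  have F: "good L n (F L n)" if "good L n f" for L n f
    using someI[of "good L n" f] that by (auto simp: F_def)
  show ?thesis
  proof (rule separable_inI)
    show "countable D" unfolding D_def using \<B>(1) Q(1) by (intro countable_image countable_SIGMA) auto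
    show "D \<noteq> {}" unfolding D_def by auto
    show "D \<subseteq> carr ?A"
    proof -
      have "F L n \<in> cont_funs Y" for L n
      proof (cases "\<exists>f. good L n f")
        case True
        then show ?thesis using F good_def by blast
      next
        case False
        then show ?thesis by (simp add: F_def zero_cont_funs)
      qed
      then show ?thesis by (auto simp: D_def C0_algebra_carr[OF Y])
    qed
    fix g and e :: real assume g: "g \<in> cont_funs Y" and e: "e > 0"
    obtain n where n: "1 / Suc n < e / 2" using nat_approx_posE[of "e / 2"] e by auto
    define \<C> where "\<C> = {V \<in> \<B>. \<exists>q\<in>Q. \<forall>z\<in>V. cmod (g z - q) < 1 / Suc n}"
    have opn: "openin Y V" if "V \<in> \<C>" for V using that \<B>(2) by (simp add: \<C>_def)
    have cover: "topspace Y \<subseteq> \<Union>\<C>"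
    proof
      fix y assume y: "y \<in> topspace Y"
      obtain q where q: "q \<in> Q" "q \<in> ball (g y) (1 / Suc n)" using Q(2)[of "ball (g y) (1 / Suc n)"] by auto
      have "openin Y {z \<in> topspace Y. g z \<in> ball q (1 / Suc n)}"
        by (rule openin_continuous_map_preimage[of _ euclidean]) (use g in \<open>auto simp: cont_funs_def\<close>)
      then obtain V where "V \<in> \<B>" "y \<in> V" "V \<subseteq> {z \<in> topspace Y. g z \<in> ball q (1 / Suc n)}"
        using \<B>(3)[of "{z \<in> topspace Y. g z \<in> ball q (1 / Suc n)}" y] y q by (auto simp: dist_commute)
      then show "y \<in> \<Union>\<C>"
        using q(1) by (auto simp: \<C>_def dist_norm norm_minus_commute intro!: exI[of _ V] bexI[of _ q])
    qed
    obtain \<F> where \<F>: "finite \<F>" "\<F> \<subseteq> \<C>" "topspace Y \<subseteq> \<Union>\<F>"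
      by (rule compact_space_finite_subcover[OF Y opn cover])
    have "\<forall>V\<in>\<F>. \<exists>q. q \<in> Q \<and> (\<forall>z\<in>V. cmod (g z - q) < 1 / Suc n)"
      using \<F>(2) unfolding \<C>_def by blast
    then obtain q where q: "\<And>V. V \<in> \<F> \<Longrightarrow> q V \<in> Q \<and> (\<forall>z\<in>V. cmod (g z - q V) < 1 / Suc n)"
      using bchoice[of \<F> "\<lambda>V q. q \<in> Q \<and> (\<forall>z\<in>V. cmod (g z - q) < 1 / Suc n)"] by blast
    obtain Vs where Vs: "set Vs = \<F>" using finite_list[OF \<F>(1)] by blast
    define L where "L = map (\<lambda>V. (V, q V)) Vs"
    have "good L n g" using g q Vs by (auto simp: good_def L_def)
    then have f: "good L n (F L n)" by (rule F)
    have "cnorm ?A (cdiff ?A (F L n) g) \<le> 2 / Suc n"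
    proof (rule C0_algebra_norm_least)
      fix y show "cmod (cdiff ?A (F L n) g y) \<le> 2 / Suc n"
      proof (cases "y \<in> topspace Y")
        case True
        then obtain V where V: "V \<in> \<F>" "y \<in> V" using \<F>(3) by blast
        have "(V, q V) \<in> set L" using V Vs by (auto simp: L_def)
        then have "cmod (F L n y - q V) < 1 / Suc n" using f V(2) by (auto simp: good_def)
        moreover have "cmod (g y - q V) < 1 / Suc n" using q V by blast
        ultimately show ?thesis using norm_triangle_ineq4[of "F L n y - q V" "g y - q V"] by simp
      next
        case False
        then show ?thesis using f g by (simp add: good_def cont_funs_def)
      qed
    qed
    moreover have "F L n \<in> D"
      using \<F>(2) q Vs by (auto simp: D_def L_def \<C>_def intro!: image_eqI[of _ _ "(L, n)"])
    ultimately show "\<exists>d\<in>D. cnorm ?A (cdiff ?A d g) < e" using n by (intro bexI[of _ "F L n"]) auto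
  qed
qed

section \<open>Partitions of unity\<close>

text \<open>Take a Urysohn function at each point; by compactness finitely many of them have a sum
  that is positive everywhere, and dividing by the sum normalizes them. Nothing is asserted about
  values off the space.\<close>

lemma partition_of_unity:
  assumes X: "compact_space X" "Hausdorff_space X"
    and cover: "\<And>x. x \<in> topspace X \<Longrightarrow> \<exists>U\<in>\<U>. openin X U \<and> x \<in> U"
  obtains n :: nat and \<psi> :: "nat \<Rightarrow> 'a \<Rightarrow> real" and V :: "nat \<Rightarrow> 'a set" where
    "\<And>i. i < n \<Longrightarrow> V i \<in> \<U>" "\<And>i. i < n \<Longrightarrow> continuous_map X euclidean (\<psi> i)"
    "\<And>i x. i < n \<Longrightarrow> x \<in> topspace X \<Longrightarrow> 0 \<le> \<psi> i x"
    "\<And>i x. i < n \<Longrightarrow> x \<in> topspace X \<Longrightarrow> x \<notin> V i \<Longrightarrow> \<psi> i x = 0"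
    "\<And>x. x \<in> topspace X \<Longrightarrow> (\<Sum>i<n. \<psi> i x) = 1"
proof -
  have normal: "normal_space X" using compact_Hausdorff_or_regular_imp_normal_space X by blast
  define Q where "Q x U h \<longleftrightarrow> U \<in> \<U> \<and> continuous_map X euclideanreal h \<and> h x = 1
      \<and> (\<forall>y\<in>topspace X. 0 \<le> h y \<and> (y \<notin> U \<longrightarrow> h y = 0))" for x U h
  have "\<exists>U h. Q x U h" if x: "x \<in> topspace X" for x
  proof -
    obtain U where U: "U \<in> \<U>" "openin X U" "x \<in> U" using cover[OF x] by blast
    have "closedin X {x}" using closedin_Hausdorff_singleton[OF X(2) x] .
    moreover have "closedin X (topspace X - U)" using U(2) by blast
    ultimately obtain h where h: "continuous_map X euclideanreal h" "h ` {x} \<subseteq> {1::real}" "h ` (topspace X - U) \<subseteq> {0}"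
      using Urysohn_lemma_alt[OF normal, of "{x}" "topspace X - U"] U(3) by (auto simp: disjnt_def)
    \<comment> \<open>The absolute value makes the function nonnegative and keeps the values 0 and
      1.\<close>
    show ?thesis
      by (rule exI[of _ U], rule exI[of _ "\<lambda>y. \<bar>h y\<bar>"]) (use U(1) h in \<open>auto simp: Q_def intro!: continuous_intros\<close>)
  qed
  then obtain U h where Q: "\<And>x. x \<in> topspace X \<Longrightarrow> Q x (U x) (h x)" by metis
  have Uh: "\<And>x. x \<in> topspace X \<Longrightarrow> U x \<in> \<U>"
    "\<And>x. x \<in> topspace X \<Longrightarrow> continuous_map X euclideanreal (h x)"
    "\<And>x. x \<in> topspace X \<Longrightarrow> h x x = (1::real)"
    "\<And>x y. x \<in> topspace X \<Longrightarrow> y \<in> topspace X \<Longrightarrow> 0 \<le> h x y"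
    "\<And>x y. x \<in> topspace X \<Longrightarrow> y \<in> topspace X \<Longrightarrow> y \<notin> U x \<Longrightarrow> h x y = 0"
    using Q by (auto simp: Q_def)
  define W where "W x = {y \<in> topspace X. h x y \<in> {0<..}}" for x
  have W: "openin X (W x)" if "x \<in> topspace X" for x
    unfolding W_def by (rule openin_continuous_map_preimage[OF Uh(2)[OF that]]) simp
  have cover': "topspace X \<subseteq> \<Union>(W ` topspace X)" using Uh(3) by (force simp: W_def)
  have opn: "openin X V" if "V \<in> W ` topspace X" for V using that W by blast
  obtain \<F> where \<F>: "finite \<F>" "\<F> \<subseteq> W ` topspace X" "topspace X \<subseteq> \<Union>\<F>"
    by (rule compact_space_finite_subcover[OF X(1) opn cover'])
  obtain F where F: "F \<subseteq> topspace X" "finite F" "\<F> = W ` F" using finite_subset_image[OF \<F>(1,2)] by blast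
  define n where "n = card F"
  obtain p where p: "bij_betw p {..<n} F" using ex_bij_betw_nat_finite[OF F(2)] by (auto simp: n_def atLeast0LessThan)
  have pF: "p i \<in> topspace X" if "i < n" for i using p that F(1) by (auto simp: bij_betw_def)
  define S where "S y = (\<Sum>i<n. h (p i) y)" for y
  have S_pos: "S y > 0" if y: "y \<in> topspace X" for y
  proof -
    obtain x where x: "x \<in> F" "y \<in> W x" using \<F>(3) F(3) y by blast
    then obtain i where i: "i < n" "p i = x" using p by (auto simp: bij_betw_def image_iff)
    have "0 < h (p i) y" using x i by (simp add: W_def)
    also have "\<dots> \<le> S y" unfolding S_def by (rule member_le_sum) (use i Uh(4) pF y in auto)
    finally show ?thesis .
  qed
  have S_cont: "continuous_map X euclideanreal S"
    unfolding S_def using Uh(2) pF by (intro continuous_intros) auto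
  show ?thesis
  proof (rule that[of n "\<lambda>i. U (p i)" "\<lambda>i y. h (p i) y / S y"])
    show "continuous_map X euclidean (\<lambda>y. h (p i) y / S y)" if "i < n" for i
      using Uh(2) pF[OF that] S_cont S_pos by (intro continuous_intros) force+
    show "(\<Sum>i<n. h (p i) y / S y) = 1" if "y \<in> topspace X" for y
      using S_pos[OF that] by (simp add: S_def flip: sum_divide_distrib)
  qed (use Uh pF S_pos in \<open>auto intro!: divide_nonneg_pos\<close>)
qed

section \<open>Compact topological graphs\<close>

text \<open>Near each point only the part of the set inside a chart matters; its image is open in
  the image of the chart, which is itself open.\<close>

lemma local_homeomorphism_imp_open_map:
  assumes "local_homeomorphism X Y f"
  shows "open_map X Y f"
  unfolding open_map_def
proof (intro allI impI)
  fix V assume V: "openin X V"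
  show "openin Y (f ` V)"
  proof (subst openin_subopen, intro ballI)
    fix y assume "y \<in> f ` V"
    then obtain x where x: "x \<in> V" "y = f x" by blast
    then have "x \<in> topspace X" using V openin_subset by blast
    then obtain U where U: "openin X U" "x \<in> U" "openin Y (f ` U)"
      "homeomorphic_map (subtopology X U) (subtopology Y (f ` U)) f"
      using assms unfolding local_homeomorphism_def by blast
    have "openin (subtopology X U) (U \<inter> V)" using V by (simp add: openin_subtopology_Int2)
    then have "openin (subtopology Y (f ` U)) (f ` (U \<inter> V))"
      using homeomorphic_imp_open_map[OF U(4)] unfolding open_map_def by blast
    then have "openin Y (f ` (U \<inter> V))" using openin_trans_full U(3) by blast
    then show "\<exists>T. openin Y T \<and> y \<in> T \<and> T \<subseteq> f ` V" using x U(2) by blast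
  qed
qed

locale compact_topological_graph =
  fixes E :: "('v, 'e) top_graph"
  assumes graph: "topological_graph E" and compact: "compact_graph E"
begin

abbreviation "V \<equiv> topspace (verts E)"
abbreviation "W \<equiv> topspace (edges E)"
abbreviation "s \<equiv> src E"
abbreviation "r \<equiv> rng E"
abbreviation "X \<equiv> graph_correspondence E"

lemma spaces:
  "compact_space (verts E)" "compact_space (edges E)" "Hausdorff_space (verts E)" "Hausdorff_space (edges E)"
  "second_countable (verts E)" "second_countable (edges E)"
  "continuous_map (edges E) (verts E) r" "continuous_map (edges E) (verts E) s"
  "local_homeomorphism (edges E) (verts E) s"
  using graph compact by (auto simp: topological_graph_def compact_graph_def)

lemma src_V: "e \<in> W \<Longrightarrow> s e \<in> V" and rng_V: "e \<in> W \<Longrightarrow> r e \<in> V"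
  using spaces(7,8) by (auto simp: continuous_map_def)

lemma edges_from_iff: "e \<in> edges_from E v \<longleftrightarrow> e \<in> W \<and> s e = v"
  by (auto simp: edges_from_def)

text \<open>Charts of the local homeomorphism \<open>s\<close> cover the edges. In the support of
  each function at most one edge of a fibre of \<open>s\<close> survives, which reduces statements
  about sums over fibres to the injective case.\<close>

lemma src_partition:
  obtains n :: nat and \<psi> :: "nat \<Rightarrow> 'e \<Rightarrow> real" where
    "\<And>i. i < n \<Longrightarrow> continuous_map (edges E) euclidean (\<psi> i)"
    "\<And>i e. i < n \<Longrightarrow> e \<in> W \<Longrightarrow> 0 \<le> \<psi> i e"
    "\<And>i. i < n \<Longrightarrow> inj_on s {e \<in> W. \<psi> i e \<noteq> 0}"
    "\<And>e. e \<in> W \<Longrightarrow> (\<Sum>i<n. \<psi> i e) = 1"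
proof -
  let ?\<U> = "{U. inj_on s U}"
  have cover: "\<exists>U\<in>?\<U>. openin (edges E) U \<and> e \<in> U" if e: "e \<in> W" for e
  proof -
    obtain U where U: "openin (edges E) U" "e \<in> U"
      "homeomorphic_map (subtopology (edges E) U) (subtopology (verts E) (s ` U)) s"
      using spaces(9) e unfolding local_homeomorphism_def by blast
    have "inj_on s U"
      using homeomorphic_imp_injective_map[OF U(3)] openin_subset[OF U(1)] by (simp add: Int_absorb1)
    then show ?thesis using U by blast
  qed
  show ?thesis
  proof (rule partition_of_unity[OF spaces(2,4) cover])
    fix n :: nat and \<psi> :: "nat \<Rightarrow> 'e \<Rightarrow> real" and U :: "nat \<Rightarrow> 'e set"
    assume p: "\<And>i. i < n \<Longrightarrow> U i \<in> ?\<U>" "\<And>i. i < n \<Longrightarrow> continuous_map (edges E) euclidean (\<psi> i)"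
      "\<And>i x. i < n \<Longrightarrow> x \<in> W \<Longrightarrow> 0 \<le> \<psi> i x"
      "\<And>i x. i < n \<Longrightarrow> x \<in> W \<Longrightarrow> x \<notin> U i \<Longrightarrow> \<psi> i x = 0"
      "\<And>x. x \<in> W \<Longrightarrow> (\<Sum>i<n. \<psi> i x) = 1"
    have "inj_on s {e \<in> W. \<psi> i e \<noteq> 0}" if "i < n" for i
      by (rule inj_on_subset[of s "U i"]) (use p(1,4)[OF that] in auto)
    then show thesis using that[of n \<psi>] p(2,3,5) by blast
  qed
qed

text \<open>Each edge from \<open>v\<close> lies in the support of some function of the partition,
  and each support holds at most one of them; so the size of the partition bounds all fibres at
  once.\<close>

lemma card_edges_from_bounded: "\<exists>N. \<forall>v. finite (edges_from E v) \<and> card (edges_from E v) \<le> N"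
proof -
  obtain n and \<psi> :: "nat \<Rightarrow> 'e \<Rightarrow> real" where p:
    "\<And>i. i < n \<Longrightarrow> inj_on s {e \<in> W. \<psi> i e \<noteq> 0}" "\<And>e. e \<in> W \<Longrightarrow> (\<Sum>i<n. \<psi> i e) = 1"
    by (rule src_partition) blast
  show ?thesis
  proof (intro exI allI)
    fix v
    define F where "F i = {e \<in> edges_from E v. \<psi> i e \<noteq> 0}" for i
    have F: "finite (F i) \<and> card (F i) \<le> 1" if "i < n" for i
    proof -
      have "s ` F i \<subseteq> {v}" by (auto simp: F_def edges_from_iff)
      moreover have "inj_on s (F i)"
        by (rule inj_on_subset[OF p(1)[OF that]]) (auto simp: F_def edges_from_iff)
      ultimately show ?thesis
        using finite_imageD[of s "F i"] card_image[of s "F i"] finite_subset[of "s ` F i" "{v}"]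
          card_mono[of "{v}" "s ` F i"] by simp
    qed
    have eq: "edges_from E v = (\<Union>i<n. F i)"
    proof (intro equalityI subsetI)
      fix e assume e: "e \<in> edges_from E v"
      then have "(\<Sum>i<n. \<psi> i e) \<noteq> 0" using p(2) by (simp add: edges_from_iff)
      then obtain i where "i < n" "\<psi> i e \<noteq> 0" by (metis (no_types, lifting) lessThan_iff sum.neutral)
      then show "e \<in> (\<Union>i<n. F i)" using e by (auto simp: F_def)
    qed (auto simp: F_def)
    have "card (edges_from E v) \<le> (\<Sum>i<n. card (F i))"
      unfolding eq by (rule card_UN_le) simp
    also have "\<dots> \<le> (\<Sum>i<n. 1)" using F by (intro sum_mono) auto
    finally show "finite (edges_from E v) \<and> card (edges_from E v) \<le> n"
      using F unfolding eq by auto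
  qed
qed

lemma finite_edges_from: "finite (edges_from E v)"
  using card_edges_from_bounded by blast

text \<open>The pushforward of a function along \<open>s\<close>, as a finite sum. The module inner
  product is the pushforward of cnj(\<xi>) \<eta>, and the number of edges in a fibre is the
  pushforward of 1.\<close>

definition fibre_sum :: "('e \<Rightarrow> complex) \<Rightarrow> 'v \<Rightarrow> complex"
  where "fibre_sum f v = (\<Sum>e\<in>edges_from E v. f e)"

text \<open>
  Where \<open>s\<close> is injective on the support of \<open>f\<close>, the preimage under \<open>fibre_sum f\<close> of a set
  avoiding 0 is the image under \<open>s\<close> of a preimage under \<open>f\<close>, and \<open>s\<close> is both open and closed.
\<close>

lemma fibre_sum_cont_inj:
  assumes f: "f \<in> cont_funs (edges E)" and inj: "inj_on s {e \<in> W. f e \<noteq> 0}"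
  shows "fibre_sum f \<in> cont_funs (verts E)"
proof -
  have fc: "continuous_map (edges E) euclidean f" using f by (simp add: cont_funs_def)
  have val: "fibre_sum f (s e) = f e" if e: "e \<in> W" "f e \<noteq> 0" for e
  proof -
    have "fibre_sum f (s e) = (\<Sum>d\<in>{e}. f d)"
      unfolding fibre_sum_def
    proof (rule sum.mono_neutral_right[OF finite_edges_from])
      show "\<forall>d\<in>edges_from E (s e) - {e}. f d = 0"
        using inj e by (auto simp: edges_from_iff inj_on_def)
    qed (use e in \<open>auto simp: edges_from_iff\<close>)
    then show ?thesis by simp
  qed
  have zero: "\<exists>e\<in>W. s e = v \<and> f e \<noteq> 0" if "fibre_sum f v \<noteq> 0" for v
    using that sum.neutral[of "edges_from E v" f] unfolding fibre_sum_def edges_from_iff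
    by (metis edges_from_iff)
  have image: "{v \<in> V. fibre_sum f v \<in> C} = s ` {e \<in> W. f e \<in> C}" if "0 \<notin> C" for C
  proof (intro equalityI subsetI)
    fix v assume "v \<in> {v \<in> V. fibre_sum f v \<in> C}"
    then have v: "fibre_sum f v \<in> C" "fibre_sum f v \<noteq> 0" using that by auto
    then obtain e where "e \<in> W" "s e = v" "f e \<noteq> 0" using zero by blast
    then show "v \<in> s ` {e \<in> W. f e \<in> C}" using v(1) val by force
  next
    fix v assume "v \<in> s ` {e \<in> W. f e \<in> C}"
    then obtain e where e: "e \<in> W" "f e \<in> C" "v = s e" by blast
    then have "f e \<noteq> 0" using that by auto
    then show "v \<in> {v \<in> V. fibre_sum f v \<in> C}" using e val src_V by auto
  qed
  have "continuous_map (verts E) euclidean (fibre_sum f)"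
    unfolding continuous_map_closedin
  proof (intro conjI allI impI)
    fix C :: "complex set" assume C: "closedin euclidean C"
    show "closedin (verts E) {v \<in> V. fibre_sum f v \<in> C}"
    proof (cases "0 \<in> C")
      case False
      have "closed_map (edges E) (verts E) s"
        by (rule continuous_imp_closed_map[OF spaces(8,2,3)])
      moreover have "closedin (edges E) {e \<in> W. f e \<in> C}"
        using closedin_continuous_map_preimage[OF fc C] .
      ultimately show ?thesis unfolding image[OF False] closed_map_def by blast
    next
      \<comment> \<open>If \<open>C\<close> contains 0, its complement does not, and openness of
        \<open>s\<close> applies to the complement; in the other case closedness of \<open>s\<close>
        applies to \<open>C\<close> itself.\<close>
      case True
      have "openin (edges E) {e \<in> W. f e \<in> - C}"
        by (rule openin_continuous_map_preimage[OF fc]) (use C in \<open>simp add: open_Compl\<close>)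
      then have "openin (verts E) {v \<in> V. fibre_sum f v \<in> - C}"
        using local_homeomorphism_imp_open_map[OF spaces(9)] True image[of "- C"]
        unfolding open_map_def by simp
      moreover have "V - {v \<in> V. fibre_sum f v \<in> C} = {v \<in> V. fibre_sum f v \<in> - C}" by blast
      ultimately show ?thesis by (simp add: closedin_def Collect_mono_iff)
    qed
  qed auto
  moreover have "fibre_sum f v = 0" if "v \<notin> V" for v
    using that src_V unfolding fibre_sum_def by (intro sum.neutral) (auto simp: edges_from_iff)
  ultimately show ?thesis by (simp add: cont_funs_def)
qed

lemma cont_funs_sum:
  "(\<And>i. i < n \<Longrightarrow> f i \<in> cont_funs Y) \<Longrightarrow> (\<lambda>y. \<Sum>i<(n::nat). f i y) \<in> cont_funs Y"
  by (induction n) (auto simp: zero_cont_funs intro: cont_funs_closed(1))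

text \<open>The partition of unity splits \<open>f\<close> into pieces on whose supports
  \<open>s\<close> is injective, and the fibre sum is additive in the pieces.\<close>

lemma fibre_sum_cont:
  assumes f: "f \<in> cont_funs (edges E)"
  shows "fibre_sum f \<in> cont_funs (verts E)"
proof -
  obtain n and \<psi> :: "nat \<Rightarrow> 'e \<Rightarrow> real" where p:
    "\<And>i. i < n \<Longrightarrow> continuous_map (edges E) euclidean (\<psi> i)"
    "\<And>i. i < n \<Longrightarrow> inj_on s {e \<in> W. \<psi> i e \<noteq> 0}" "\<And>e. e \<in> W \<Longrightarrow> (\<Sum>i<n. \<psi> i e) = 1"
    by (rule src_partition) blast
  have "fibre_sum (\<lambda>e. complex_of_real (\<psi> i e) * f e) \<in> cont_funs (verts E)" if i: "i < n" for i
  proof (rule fibre_sum_cont_inj)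
    show "(\<lambda>e. complex_of_real (\<psi> i e) * f e) \<in> cont_funs (edges E)"
      using f p(1)[OF i] by (auto simp: cont_funs_def intro!: continuous_intros)
    show "inj_on s {e \<in> W. complex_of_real (\<psi> i e) * f e \<noteq> 0}"
      by (rule inj_on_subset[OF p(2)[OF i]]) auto
  qed
  then have "(\<lambda>v. \<Sum>i<n. fibre_sum (\<lambda>e. complex_of_real (\<psi> i e) * f e) v) \<in> cont_funs (verts E)"
    by (rule cont_funs_sum)
  also have "(\<lambda>v. \<Sum>i<n. fibre_sum (\<lambda>e. complex_of_real (\<psi> i e) * f e) v) = fibre_sum f"
  proof
    fix v
    have "(\<Sum>i<n. fibre_sum (\<lambda>e. complex_of_real (\<psi> i e) * f e) v)
        = (\<Sum>e\<in>edges_from E v. \<Sum>i<n. complex_of_real (\<psi> i e) * f e)"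
      unfolding fibre_sum_def by (rule sum.swap)
    also have "\<dots> = (\<Sum>e\<in>edges_from E v. complex_of_real (\<Sum>i<n. \<psi> i e) * f e)"
      by (simp add: sum_distrib_right)
    also have "\<dots> = fibre_sum f v"
      unfolding fibre_sum_def by (rule sum.cong) (use p(3) in \<open>auto simp: edges_from_iff\<close>)
    finally show "(\<Sum>i<n. fibre_sum (\<lambda>e. complex_of_real (\<psi> i e) * f e) v) = fibre_sum f v" .
  qed
  finally show ?thesis .
qed

text \<open>Approximation in the module norm is in particular uniform, and uniform limits of
  continuous functions are continuous. Conversely, on a compact space every continuous function has
  compact support, so completing adds nothing.\<close>

lemma graph_module: "graph_module E = cont_funs (edges E)"
proof (intro equalityI subsetI)
  fix \<xi> assume "\<xi> \<in> cont_funs (edges E)"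
  then show "\<xi> \<in> graph_module E"
    unfolding graph_module_def Cc_funs_compact[OF spaces(2)]
    by (auto simp: cont_funs_def intro!: bexI[of _ \<xi>])
next
  fix \<xi> assume \<xi>: "\<xi> \<in> graph_module E"
  have approx: "\<exists>\<eta>\<in>cont_funs (edges E). \<forall>e\<in>W. dist (\<eta> e) (\<xi> e) < \<epsilon>" if \<epsilon>: "\<epsilon> > 0" for \<epsilon>
  proof -
    obtain \<eta> where \<eta>: "\<eta> \<in> cont_funs (edges E)"
      "\<And>v. v \<in> V \<Longrightarrow> (\<Sum>\<^sub>\<infinity>e\<in>edges_from E v. (cmod (\<xi> e - \<eta> e))\<^sup>2) \<le> (\<epsilon>/2)\<^sup>2"
      using \<xi> \<epsilon> half_gt_zero[OF \<epsilon>] unfolding graph_module_def Cc_funs_compact[OF spaces(2)] by blast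
    have "dist (\<eta> e) (\<xi> e) < \<epsilon>" if e: "e \<in> W" for e
    proof -
      have "(cmod (\<xi> e - \<eta> e))\<^sup>2 \<le> (\<Sum>e\<in>edges_from E (s e). (cmod (\<xi> e - \<eta> e))\<^sup>2)"
        by (rule member_le_sum) (use e finite_edges_from in \<open>auto simp: edges_from_iff\<close>)
      also have "\<dots> \<le> (\<epsilon>/2)\<^sup>2" using \<eta>(2)[OF src_V[OF e]] finite_edges_from by simp
      finally have "cmod (\<xi> e - \<eta> e) \<le> \<epsilon>/2" by (rule power2_le_imp_le) (use \<epsilon> in simp)
      then show ?thesis using \<epsilon> by (simp add: dist_norm norm_minus_commute)
    qed
    then show ?thesis using \<eta>(1) by blast
  qed
  have "\<forall>n. \<exists>\<eta>. \<eta> \<in> cont_funs (edges E) \<and> (\<forall>e\<in>W. dist (\<eta> e) (\<xi> e) < 1 / Suc n)"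
    using approx by (metis of_nat_0_less_iff zero_less_Suc zero_less_divide_1_iff)
  then obtain \<eta> where \<eta>: "\<And>n. \<eta> n \<in> cont_funs (edges E)" "\<And>n e. e \<in> W \<Longrightarrow> dist (\<eta> n e) (\<xi> e) < 1 / Suc n"
    by metis
  have "continuous_map (edges E) Met_TC.mtopology \<xi>"
  proof (rule Met_TC.continuous_map_uniform_limit[where f=\<eta> and F=sequentially])
    show "\<forall>\<^sub>F n in sequentially. continuous_map (edges E) Met_TC.mtopology (\<eta> n)"
      using \<eta>(1) by (simp add: cont_funs_def)
    fix \<epsilon> :: real assume "\<epsilon> > 0"
    then obtain N where N: "1 / Suc N < \<epsilon>" using nat_approx_posE by blast
    have "dist (\<eta> n e) (\<xi> e) < \<epsilon>" if "n \<ge> N" "e \<in> W" for n e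
    proof -
      have "1 / real (Suc n) \<le> 1 / real (Suc N)" using that(1) by (simp add: frac_le)
      then show ?thesis using \<eta>(2)[OF that(2), of n] N by simp
    qed
    then show "\<forall>\<^sub>F n in sequentially. \<forall>e\<in>W. \<xi> e \<in> UNIV \<and> dist (\<eta> n e) (\<xi> e) < \<epsilon>"
      by (auto simp: eventually_sequentially)
  qed simp
  then show "\<xi> \<in> cont_funs (edges E)" using \<xi> by (simp add: cont_funs_def graph_module_def)
qed

section \<open>The graph correspondence of a compact graph\<close>

lemma X_ops [simp]:
  "coeff X = C0_algebra (verts E)" "mcarr X = cont_funs (edges E)"
  "madd X = (\<lambda>\<xi> \<eta> e. \<xi> e + \<eta> e)" "mzero X = (\<lambda>e. 0)" "mscale X = (\<lambda>c \<xi> e. c * \<xi> e)"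
  "mright X = (\<lambda>\<xi> a e. \<xi> e * a (s e))" "mleft X = (\<lambda>a \<xi> e. a (r e) * \<xi> e)"
  "minner X = (\<lambda>\<xi> \<eta>. fibre_sum (\<lambda>e. cnj (\<xi> e) * \<eta> e))"
  by (simp_all add: graph_correspondence_def graph_module fibre_sum_def[abs_def] finite_edges_from)

lemma inner_cont:
  "\<lbrakk>\<xi> \<in> cont_funs (edges E); \<eta> \<in> cont_funs (edges E)\<rbrakk>
    \<Longrightarrow> fibre_sum (\<lambda>e. cnj (\<xi> e) * \<eta> e) \<in> cont_funs (verts E)"
  by (intro fibre_sum_cont cont_funs_closed(3) cont_funs_closed(5))

lemma left_cont: "\<lbrakk>a \<in> cont_funs (verts E); \<xi> \<in> cont_funs (edges E)\<rbrakk>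
    \<Longrightarrow> (\<lambda>e. a (r e) * \<xi> e) \<in> cont_funs (edges E)"
  and right_cont: "\<lbrakk>a \<in> cont_funs (verts E); \<xi> \<in> cont_funs (edges E)\<rbrakk>
    \<Longrightarrow> (\<lambda>e. \<xi> e * a (s e)) \<in> cont_funs (edges E)"
  using continuous_map_compose[OF spaces(7), of euclidean a] continuous_map_compose[OF spaces(8), of euclidean a]
  by (auto simp: cont_funs_def o_def intro!: continuous_intros)

lemma inner_definite:
  assumes "\<xi> \<in> cont_funs (edges E)" "fibre_sum (\<lambda>e. cnj (\<xi> e) * \<xi> e) = (\<lambda>_. 0)"
  shows "\<xi> = (\<lambda>_. 0)"
proof
  fix e show "\<xi> e = 0"
  proof (cases "e \<in> W")
    case True
    have "(\<Sum>d\<in>edges_from E (s e). complex_of_real ((cmod (\<xi> d))\<^sup>2)) = 0"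
      using fun_cong[OF assms(2), of "s e"]
      by (simp add: fibre_sum_def complex_norm_square mult.commute del: of_real_power)
    then have "(\<Sum>d\<in>edges_from E (s e). (cmod (\<xi> d))\<^sup>2) = 0"
      by (simp only: of_real_eq_0_iff flip: of_real_sum)
    then have "\<forall>d\<in>edges_from E (s e). (cmod (\<xi> d))\<^sup>2 = 0"
      by (subst (asm) sum_nonneg_eq_0_iff) (use finite_edges_from in auto)
    then show ?thesis using True by (auto simp: edges_from_iff)
  qed (use assms(1) in \<open>auto simp: cont_funs_def\<close>)
qed

text \<open>The square roots of a partition of unity subordinate to a cover by sets on which \<open>s\<close> is injective.\<close>

lemma frame_exists:
  obtains n :: nat and \<xi> where "\<And>i. i < n \<Longrightarrow> \<xi> i \<in> cont_funs (edges E)"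
    "\<And>d e. \<lbrakk>d \<in> W; e \<in> W; s d = s e\<rbrakk> \<Longrightarrow> (\<Sum>i<n. \<xi> i d * cnj (\<xi> i e)) = (if d = e then 1 else 0)"
proof -
  obtain n and \<psi> :: "nat \<Rightarrow> 'e \<Rightarrow> real" where p:
    "\<And>i. i < n \<Longrightarrow> continuous_map (edges E) euclidean (\<psi> i)"
    "\<And>i e. i < n \<Longrightarrow> e \<in> W \<Longrightarrow> 0 \<le> \<psi> i e"
    "\<And>i. i < n \<Longrightarrow> inj_on s {e \<in> W. \<psi> i e \<noteq> 0}"
    "\<And>e. e \<in> W \<Longrightarrow> (\<Sum>i<n. \<psi> i e) = 1"
    by (rule src_partition) blast
  define \<xi> where "\<xi> i = restrict0 (edges E) (\<lambda>e. complex_of_real (sqrt (\<psi> i e)))" for i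
  show ?thesis
  proof
    show "\<xi> i \<in> cont_funs (edges E)" if "i < n" for i
      unfolding \<xi>_def by (intro restrict0_cont_funs continuous_intros p(1)[OF that])
    fix d e assume de: "d \<in> W" "e \<in> W" "s d = s e"
    show "(\<Sum>i<n. \<xi> i d * cnj (\<xi> i e)) = (if d = e then 1 else 0)"
    proof (cases "d = e")
      case True
      have "(\<Sum>i<n. \<xi> i d * cnj (\<xi> i e)) = (\<Sum>i<n. complex_of_real (\<psi> i d))"
        by (rule sum.cong) (use True de p(2) in \<open>auto simp: \<xi>_def restrict0_def simp flip: of_real_mult\<close>)
      then show ?thesis using True p(4)[OF de(1)] by (simp flip: of_real_sum)
    next
      case False
      have "\<psi> i d = 0 \<or> \<psi> i e = 0" if "i < n" for i
        using p(3)[OF that] de False by (auto simp: inj_on_def)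
      then have "(\<Sum>i<n. \<xi> i d * cnj (\<xi> i e)) = 0"
        by (intro sum.neutral) (auto simp: \<xi>_def restrict0_def)
      then show ?thesis using False by simp
    qed
  qed
qed

text \<open>Weight each edge by 1 over the square root of the number of edges with its source. That
  number is a fibre sum of 1, hence continuous in the vertex; without sinks the squared weights add
  up to 1 over every vertex.\<close>

lemma normalized_exists:
  assumes "no_sinks E"
  obtains \<xi> where "\<xi> \<in> cont_funs (edges E)" "\<And>e. e \<in> W \<Longrightarrow> \<xi> e \<noteq> 0"
    "fibre_sum (\<lambda>e. cnj (\<xi> e) * \<xi> e) = indicator V"
proof -
  define N where "N v = Re (fibre_sum (indicator W) v)" for v
  have N: "N v = real (card (edges_from E v))" for v
  proof -
    have "fibre_sum (indicator W) v = (\<Sum>e\<in>edges_from E v. 1)"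
      unfolding fibre_sum_def by (rule sum.cong) (auto simp: edges_from_iff)
    then show ?thesis by (simp add: N_def)
  qed
  have pos: "N (s e) > 0" if "e \<in> W" for e
    using that finite_edges_from[of "s e"] by (auto simp: N card_gt_0_iff edges_from_iff)
  have Nc: "continuous_map (verts E) euclidean N"
    unfolding N_def using fibre_sum_cont[OF indicator_cont_funs] by (intro continuous_intros) (simp add: cont_funs_def)
  have Nsc: "continuous_map (edges E) euclidean (\<lambda>e. N (s e))"
    using continuous_map_compose[OF spaces(8) Nc] by (simp add: o_def)
  define \<xi> where "\<xi> = restrict0 (edges E) (\<lambda>e. complex_of_real (1 / sqrt (N (s e))))"
  have \<xi>: "\<xi> e = complex_of_real (1 / sqrt (N (s e)))" if "e \<in> W" for e
    using that by (simp add: \<xi>_def restrict0_def)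
  show ?thesis
  proof
    show "\<xi> \<in> cont_funs (edges E)"
      unfolding \<xi>_def by (intro restrict0_cont_funs continuous_intros Nsc) (use pos in force)
    show "\<xi> e \<noteq> 0" if "e \<in> W" for e using \<xi>[OF that] pos[OF that] by simp
    show "fibre_sum (\<lambda>e. cnj (\<xi> e) * \<xi> e) = indicator V"
    proof
      fix v
      show "fibre_sum (\<lambda>e. cnj (\<xi> e) * \<xi> e) v = indicator V v"
      proof (cases "v \<in> V")
        case True
        then have ne: "edges_from E v \<noteq> {}" using assms by (simp add: no_sinks_def)
        then have Npos: "N v > 0" by (simp add: N card_gt_0_iff finite_edges_from)
        have "fibre_sum (\<lambda>e. cnj (\<xi> e) * \<xi> e) v = (\<Sum>e\<in>edges_from E v. complex_of_real (1 / N v))"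
          unfolding fibre_sum_def
          by (rule sum.cong) (use Npos in \<open>auto simp: edges_from_iff \<xi> simp flip: of_real_mult\<close>)
        also have "\<dots> = complex_of_real (N v) * complex_of_real (1 / N v)" by (simp add: N)
        also have "\<dots> = 1" using Npos by (simp flip: of_real_mult)
        finally show ?thesis using True by simp
      next
        case False
        then have "edges_from E v = {}" using src_V by (auto simp: edges_from_iff)
        then show ?thesis using False by (simp add: fibre_sum_def)
      qed
    qed
  qed
qed

end

section \<open>Toeplitz representations of a graph correspondence\<close>

primrec csum :: "'a cstar \<Rightarrow> (nat \<Rightarrow> 'a) \<Rightarrow> nat \<Rightarrow> 'a" where
  "csum A f 0 = czero A"
| "csum A f (Suc n) = cadd A (csum A f n) (f n)"

lemma csum_cong: "(\<And>i. i < n \<Longrightarrow> f i = g i) \<Longrightarrow> csum A f n = csum A g n"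
  by (induction n) auto

context cstar_algebra
begin

lemma csum_closed: "(\<And>i. i < n \<Longrightarrow> f i \<in> carr A) \<Longrightarrow> csum A f n \<in> carr A"
  by (induction n) (auto simp: closed)

lemma mult_csum: "x \<in> carr A \<Longrightarrow> (\<And>i. i < n \<Longrightarrow> f i \<in> carr A)
    \<Longrightarrow> cmult A x (csum A f n) = csum A (\<lambda>i. cmult A x (f i)) n"
  by (induction n) (auto simp: mult_zero mult_add csum_closed)

lemma csum_mult: "x \<in> carr A \<Longrightarrow> (\<And>i. i < n \<Longrightarrow> f i \<in> carr A)
    \<Longrightarrow> cmult A (csum A f n) x = csum A (\<lambda>i. cmult A (f i) x) n"
  by (induction n) (auto simp: zero_mult add_mult csum_closed)

lemma csum_adj: "(\<And>i. i < n \<Longrightarrow> f i \<in> carr A) \<Longrightarrow> cadj A (csum A f n) = csum A (\<lambda>i. cadj A (f i)) n"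
  by (induction n) (auto simp: adj_zero adj_add csum_closed)

lemma csum_scale: "(\<And>i. i < n \<Longrightarrow> f i \<in> carr A) \<Longrightarrow> cscale A c (csum A f n) = csum A (\<lambda>i. cscale A c (f i)) n"
  by (induction n) (auto simp: scale_zero scale_add csum_closed)

lemma csum_add: "(\<And>i. i < n \<Longrightarrow> f i \<in> carr A) \<Longrightarrow> (\<And>i. i < n \<Longrightarrow> g i \<in> carr A)
    \<Longrightarrow> cadd A (csum A f n) (csum A g n) = csum A (\<lambda>i. cadd A (f i) (g i)) n"
proof (induction n)
  case (Suc n)
  then have c: "csum A f n \<in> carr A" "csum A g n \<in> carr A" "f n \<in> carr A" "g n \<in> carr A"
    using csum_closed by auto
  have "cadd A (cadd A (csum A f n) (f n)) (cadd A (csum A g n) (g n))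
      = cadd A (cadd A (csum A f n) (csum A g n)) (cadd A (f n) (g n))"
    using c by (simp add: add_ac add_closed)
  then show ?case using Suc by simp
qed (simp add: add_zero zero_closed)

end

context compact_topological_graph
begin

text \<open>The inner product as a constant of its own, so that it stays folded where the
  simplification rules \<open>X_ops\<close> would expand \<open>minner X\<close>.\<close>

definition edge_inner :: "('e \<Rightarrow> complex) \<Rightarrow> ('e \<Rightarrow> complex) \<Rightarrow> 'v \<Rightarrow> complex"
  where "edge_inner \<xi> \<eta> = fibre_sum (\<lambda>e. cnj (\<xi> e) * \<eta> e)"

lemma minner_eq: "minner X = edge_inner"
  by (simp add: edge_inner_def[abs_def])

lemma inner_closed:
  "\<lbrakk>\<xi> \<in> cont_funs (edges E); \<eta> \<in> cont_funs (edges E)\<rbrakk> \<Longrightarrow> edge_inner \<xi> \<eta> \<in> cont_funs (verts E)"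
  unfolding edge_inner_def by (rule inner_cont)

lemma inner_right: "edge_inner \<xi> (\<lambda>e. \<eta> e * a (s e)) = (\<lambda>v. edge_inner \<xi> \<eta> v * a v)"
  unfolding edge_inner_def fibre_sum_def
  by (auto simp: sum_distrib_right edges_from_iff mult.assoc intro!: sum.cong)

lemma inner_left: "edge_inner (\<lambda>e. \<xi> e * a (s e)) \<eta> = (\<lambda>v. cnj (a v) * edge_inner \<xi> \<eta> v)"
  unfolding edge_inner_def fibre_sum_def
  by (auto simp: sum_distrib_left edges_from_iff mult_ac intro!: sum.cong)

lemma inner_sum_left: "edge_inner (\<lambda>e. \<Sum>i<(n::nat). f i e * c i (s e)) \<eta> v = (\<Sum>i<n. cnj (c i v) * edge_inner (f i) \<eta> v)"
proof -
  have "edge_inner (\<lambda>e. \<Sum>i<n. f i e * c i (s e)) \<eta> v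
      = (\<Sum>e\<in>edges_from E v. \<Sum>i<n. cnj (c i v) * (cnj (f i e) * \<eta> e))"
    unfolding edge_inner_def fibre_sum_def
    by (auto simp: sum_distrib_right sum_distrib_left edges_from_iff mult_ac intro!: sum.cong)
  also have "\<dots> = (\<Sum>i<n. cnj (c i v) * edge_inner (f i) \<eta> v)"
    unfolding edge_inner_def fibre_sum_def by (subst sum.swap) (simp add: sum_distrib_left)
  finally show ?thesis .
qed

lemma inner_commute: "edge_inner \<eta> \<xi> v = cnj (edge_inner \<xi> \<eta> v)"
  by (simp add: edge_inner_def fibre_sum_def mult.commute)

text \<open>The difference of the two elements has inner product 0 with itself, and the inner
  product is definite.\<close>

lemma inner_eqI:
  assumes \<xi>: "\<xi> \<in> cont_funs (edges E)" "\<zeta> \<in> cont_funs (edges E)"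
    and eq: "\<And>\<eta>. \<eta> \<in> cont_funs (edges E) \<Longrightarrow> edge_inner \<xi> \<eta> = edge_inner \<zeta> \<eta>"
  shows "\<xi> = \<zeta>"
proof -
  let ?\<delta> = "\<lambda>e. \<xi> e - \<zeta> e"
  have \<delta>: "?\<delta> \<in> cont_funs (edges E)" using \<xi> by (rule cont_funs_closed(2))
  have "edge_inner ?\<delta> ?\<delta> v = edge_inner \<xi> ?\<delta> v - edge_inner \<zeta> ?\<delta> v" for v
    by (simp add: edge_inner_def fibre_sum_def sum_subtractf left_diff_distrib)
  then have "edge_inner ?\<delta> ?\<delta> = (\<lambda>_. 0)" using eq[OF \<delta>] by auto
  then have "?\<delta> = (\<lambda>_. 0)" using inner_definite[OF \<delta>] by (simp add: edge_inner_def)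
  then show ?thesis by (metis eq_iff_diff_eq_0 ext)
qed

section \<open>Adjointable and compact operators on the module\<close>

lemma is_adjoint_iff: "is_adjoint X T S \<longleftrightarrow>
    (\<forall>\<xi>\<in>cont_funs (edges E). \<forall>\<eta>\<in>cont_funs (edges E). edge_inner (T \<xi>) \<eta> = edge_inner \<xi> (S \<eta>))"
  by (simp add: is_adjoint_def edge_inner_def)

lemma adjoint_unique:
  assumes "S \<in> mcarr X \<rightarrow>\<^sub>E mcarr X" "S' \<in> mcarr X \<rightarrow>\<^sub>E mcarr X" "is_adjoint X T S" "is_adjoint X T S'"
  shows "S = S'"
proof (rule PiE_ext[OF assms(1,2)])
  fix \<eta> assume \<eta>: "\<eta> \<in> mcarr X"
  show "S \<eta> = S' \<eta>"
  proof (rule inner_eqI)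
    fix \<xi> assume \<xi>: "\<xi> \<in> cont_funs (edges E)"
    have "edge_inner \<xi> (S \<eta>) = edge_inner \<xi> (S' \<eta>)" using assms(3,4) \<xi> \<eta> by (simp add: is_adjoint_iff flip: minner_eq)
    then show "edge_inner (S \<eta>) \<xi> = edge_inner (S' \<eta>) \<xi>" using inner_commute by (intro ext) metis
  qed (use assms \<eta> in auto)
qed

lemma carr_adjointable_ops: "carr (adjointable_ops X) =
    {T \<in> mcarr X \<rightarrow>\<^sub>E mcarr X. \<exists>S \<in> mcarr X \<rightarrow>\<^sub>E mcarr X. is_adjoint X T S}"
  by (simp add: adjointable_ops_def)

text \<open>The closed span in \<open>compact_ops\<close> is an intersection of closed subspaces; it
  lies in the adjointable operators because they form one of these subspaces. The limit clause is
  immediate, since the limit is taken in the carrier.\<close>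

lemma adjointable_closed_subspace:
  "closed_linear_subspace (adjointable_ops X) (carr (adjointable_ops X))"
proof -
  let ?O = "adjointable_ops X"
  have zero: "czero ?O \<in> carr ?O"
    unfolding adjointable_ops_def is_adjoint_iff
    by (auto simp: zero_cont_funs edge_inner_def fibre_sum_def intro!: bexI[of _ "\<lambda>\<xi>\<in>cont_funs (edges E). (\<lambda>_. 0)"])
  have add: "cadd ?O S T \<in> carr ?O" if S: "S \<in> carr ?O" and T: "T \<in> carr ?O" for S T
  proof -
    obtain S' where S': "S \<in> mcarr X \<rightarrow>\<^sub>E mcarr X" "S' \<in> mcarr X \<rightarrow>\<^sub>E mcarr X" "is_adjoint X S S'"
      using S by (auto simp: adjointable_ops_def)
    obtain T' where T': "T \<in> mcarr X \<rightarrow>\<^sub>E mcarr X" "T' \<in> mcarr X \<rightarrow>\<^sub>E mcarr X" "is_adjoint X T T'"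
      using T by (auto simp: adjointable_ops_def)
    let ?A = "\<lambda>\<xi>\<in>cont_funs (edges E). \<lambda>e. S' \<xi> e + T' \<xi> e"
    have "edge_inner (\<lambda>e. S \<xi> e + T \<xi> e) \<eta> = edge_inner \<xi> (\<lambda>e. S' \<eta> e + T' \<eta> e)"
      if "\<xi> \<in> cont_funs (edges E)" "\<eta> \<in> cont_funs (edges E)" for \<xi> \<eta>
    proof
      fix v
      have "edge_inner (S \<xi>) \<eta> = edge_inner \<xi> (S' \<eta>)" "edge_inner (T \<xi>) \<eta> = edge_inner \<xi> (T' \<eta>)"
        using that S'(3) T'(3) by (auto simp: is_adjoint_iff)
      then have "edge_inner (S \<xi>) \<eta> v + edge_inner (T \<xi>) \<eta> v = edge_inner \<xi> (S' \<eta>) v + edge_inner \<xi> (T' \<eta>) v" by simp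
      then show "edge_inner (\<lambda>e. S \<xi> e + T \<xi> e) \<eta> v = edge_inner \<xi> (\<lambda>e. S' \<eta> e + T' \<eta> e) v"
        by (simp add: edge_inner_def fibre_sum_def sum.distrib distrib_left distrib_right)
    qed
    then have "is_adjoint X (cadd ?O S T) ?A"
      by (simp add: is_adjoint_iff adjointable_ops_def)
    moreover have "?A \<in> mcarr X \<rightarrow>\<^sub>E mcarr X" "cadd ?O S T \<in> mcarr X \<rightarrow>\<^sub>E mcarr X"
      using S'(1,2) T'(1,2) by (auto simp: adjointable_ops_def PiE_def Pi_def intro!: cont_funs_closed)
    ultimately show ?thesis unfolding carr_adjointable_ops by blast
  qed
  have scale: "cscale ?O c T \<in> carr ?O" if T: "T \<in> carr ?O" for c T
  proof -
    obtain T' where T': "T \<in> mcarr X \<rightarrow>\<^sub>E mcarr X" "T' \<in> mcarr X \<rightarrow>\<^sub>E mcarr X" "is_adjoint X T T'"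
      using T by (auto simp: adjointable_ops_def)
    let ?A = "\<lambda>\<xi>\<in>cont_funs (edges E). \<lambda>e. cnj c * T' \<xi> e"
    have "edge_inner (\<lambda>e. c * T \<xi> e) \<eta> = edge_inner \<xi> (\<lambda>e. cnj c * T' \<eta> e)"
      if "\<xi> \<in> cont_funs (edges E)" "\<eta> \<in> cont_funs (edges E)" for \<xi> \<eta>
    proof
      fix v
      have "edge_inner (T \<xi>) \<eta> = edge_inner \<xi> (T' \<eta>)" using that T'(3) by (auto simp: is_adjoint_iff)
      then have "cnj c * edge_inner (T \<xi>) \<eta> v = cnj c * edge_inner \<xi> (T' \<eta>) v" by simp
      then show "edge_inner (\<lambda>e. c * T \<xi> e) \<eta> v = edge_inner \<xi> (\<lambda>e. cnj c * T' \<eta> e) v"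
        by (simp add: edge_inner_def fibre_sum_def sum_distrib_left mult_ac)
    qed
    then have "is_adjoint X (cscale ?O c T) ?A"
      by (simp add: is_adjoint_iff adjointable_ops_def)
    moreover have "?A \<in> mcarr X \<rightarrow>\<^sub>E mcarr X" "cscale ?O c T \<in> mcarr X \<rightarrow>\<^sub>E mcarr X"
      using T'(1,2) by (auto simp: adjointable_ops_def PiE_def Pi_def intro!: cont_funs_closed(4))
    ultimately show ?thesis unfolding carr_adjointable_ops by blast
  qed
  show ?thesis unfolding closed_linear_subspace_def using zero add scale by simp
qed

lemma rank_one_adjointable:
  assumes \<xi>: "\<xi> \<in> cont_funs (edges E)" "\<eta> \<in> cont_funs (edges E)"
  shows "rank_one X \<xi> \<eta> \<in> carr (adjointable_ops X)"
proof -
  have closed: "rank_one X \<xi> \<eta> \<in> mcarr X \<rightarrow>\<^sub>E mcarr X"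
    if "\<xi> \<in> cont_funs (edges E)" "\<eta> \<in> cont_funs (edges E)" for \<xi> \<eta>
    using that right_cont[OF inner_closed] by (auto simp: rank_one_def edge_inner_def)
  have "edge_inner (\<lambda>e. \<xi> e * edge_inner \<eta> \<zeta> (s e)) \<omega> = edge_inner \<zeta> (\<lambda>e. \<eta> e * edge_inner \<xi> \<omega> (s e))" for \<zeta> \<omega>
    unfolding inner_left inner_right using inner_commute by (intro ext) metis
  then have "is_adjoint X (rank_one X \<xi> \<eta>) (rank_one X \<eta> \<xi>)"
    by (simp add: is_adjoint_iff rank_one_def edge_inner_def)
  then show ?thesis using closed[OF \<xi>] closed[OF \<xi>(2,1)] unfolding carr_adjointable_ops by blast
qed

lemma compact_ops_subset: "carr (compact_ops X) \<subseteq> carr (adjointable_ops X)"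
  using adjointable_closed_subspace rank_one_adjointable
  by (auto simp: compact_ops_def closed_span_def)

lemma rank_one_compact:
  "\<lbrakk>\<xi> \<in> cont_funs (edges E); \<eta> \<in> cont_funs (edges E)\<rbrakk> \<Longrightarrow> rank_one X \<xi> \<eta> \<in> carr (compact_ops X)"
  by (auto simp: compact_ops_def closed_span_def)

text \<open>A finite Parseval frame: the rank one operators of the vectors with themselves add up to
  the identity. On each fibre of \<open>s\<close>, the matrix of that sum is the identity
  matrix.\<close>

definition frame :: "nat \<Rightarrow> (nat \<Rightarrow> 'e \<Rightarrow> complex) \<Rightarrow> bool"
  where "frame n \<xi> \<longleftrightarrow> (\<forall>i<n. \<xi> i \<in> cont_funs (edges E)) \<and>
    (\<forall>d\<in>W. \<forall>e\<in>W. s d = s e \<longrightarrow> (\<Sum>i<n. \<xi> i d * cnj (\<xi> i e)) = (if d = e then 1 else 0))"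

lemma frame_expansion:
  assumes "frame n \<xi>" "\<eta> \<in> cont_funs (edges E)"
  shows "(\<lambda>d. \<Sum>i<n. \<xi> i d * edge_inner (\<xi> i) \<eta> (s d)) = \<eta>"
proof
  fix d
  show "(\<Sum>i<n. \<xi> i d * edge_inner (\<xi> i) \<eta> (s d)) = \<eta> d"
  proof (cases "d \<in> W")
    case True
    have "(\<Sum>i<n. \<xi> i d * edge_inner (\<xi> i) \<eta> (s d)) = (\<Sum>i<n. \<Sum>e\<in>edges_from E (s d). \<xi> i d * cnj (\<xi> i e) * \<eta> e)"
      by (simp add: edge_inner_def fibre_sum_def sum_distrib_left mult.assoc)
    also have "\<dots> = (\<Sum>e\<in>edges_from E (s d). (\<Sum>i<n. \<xi> i d * cnj (\<xi> i e)) * \<eta> e)"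
      by (subst sum.swap) (simp add: sum_distrib_right)
    also have "\<dots> = (\<Sum>e\<in>edges_from E (s d). if d = e then \<eta> e else 0)"
      using assms(1) True by (intro sum.cong) (auto simp: frame_def edges_from_iff)
    also have "\<dots> = \<eta> d" using True finite_edges_from by (simp add: edges_from_iff)
    finally show ?thesis .
  next
    case False
    then have "\<eta> d = 0" "\<And>i. i < n \<Longrightarrow> \<xi> i d = 0" using assms by (auto simp: frame_def cont_funs_def)
    then show ?thesis by simp
  qed
qed

end

section \<open>Consequences of the Toeplitz relations\<close>

locale toeplitz = compact_topological_graph E + B: cstar_algebra B
  for E :: "('v, 'e) top_graph" and B :: "'b cstar" +
  fixes \<pi> :: "('v \<Rightarrow> complex) \<Rightarrow> 'b" and \<tau> :: "('e \<Rightarrow> complex) \<Rightarrow> 'b"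
  assumes rep: "toeplitz_rep (graph_correspondence E) B \<pi> \<tau>"
begin

lemma \<pi>_hom: "star_hom (C0_algebra (verts E)) B \<pi>"
  using rep by (simp add: toeplitz_rep_def)

lemmas \<pi>_contractive = C0_algebra_hom_contractive[OF spaces(1) B.cstar_algebra_axioms \<pi>_hom]

lemma \<pi>_closed: "a \<in> cont_funs (verts E) \<Longrightarrow> \<pi> a \<in> carr B"
  and \<pi>_mult: "\<lbrakk>a \<in> cont_funs (verts E); b \<in> cont_funs (verts E)\<rbrakk> \<Longrightarrow> \<pi> (\<lambda>v. a v * b v) = cmult B (\<pi> a) (\<pi> b)"
  and \<pi>_adj: "a \<in> cont_funs (verts E) \<Longrightarrow> \<pi> (\<lambda>v. cnj (a v)) = cadj B (\<pi> a)"
  using star_homD[OF \<pi>_hom] by (auto simp: C0_algebra_carr[OF spaces(1)])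

lemma \<tau>_closed: "\<xi> \<in> cont_funs (edges E) \<Longrightarrow> \<tau> \<xi> \<in> carr B"
  and \<tau>_add: "\<lbrakk>\<xi> \<in> cont_funs (edges E); \<eta> \<in> cont_funs (edges E)\<rbrakk> \<Longrightarrow> \<tau> (\<lambda>e. \<xi> e + \<eta> e) = cadd B (\<tau> \<xi>) (\<tau> \<eta>)"
  and \<tau>_scale: "\<xi> \<in> cont_funs (edges E) \<Longrightarrow> \<tau> (\<lambda>e. c * \<xi> e) = cscale B c (\<tau> \<xi>)"
  and \<tau>_left: "\<lbrakk>a \<in> cont_funs (verts E); \<xi> \<in> cont_funs (edges E)\<rbrakk>
    \<Longrightarrow> \<tau> (\<lambda>e. a (r e) * \<xi> e) = cmult B (\<pi> a) (\<tau> \<xi>)"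
  and \<tau>_inner: "\<lbrakk>\<xi> \<in> cont_funs (edges E); \<eta> \<in> cont_funs (edges E)\<rbrakk>
    \<Longrightarrow> cmult B (cadj B (\<tau> \<xi>)) (\<tau> \<eta>) = \<pi> (edge_inner \<xi> \<eta>)"
  using rep by (auto simp: toeplitz_rep_def C0_algebra_carr[OF spaces(1)] edge_inner_def)

text \<open>Right linearity is not among the Toeplitz relations. With x and y for the two sides, the
  products x* x, x* y, y* x and y* y all equal the same element \<open>c\<close>, so the adjoint of
  x - y times x - y is 0.\<close>

lemma \<tau>_right:
  assumes a: "a \<in> cont_funs (verts E)" and \<xi>: "\<xi> \<in> cont_funs (edges E)"
  shows "\<tau> (\<lambda>e. \<xi> e * a (s e)) = cmult B (\<tau> \<xi>) (\<pi> a)"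
proof -
  let ?\<xi>a = "\<lambda>e. \<xi> e * a (s e)"
  define x y where "x = \<tau> ?\<xi>a" and "y = cmult B (\<tau> \<xi>) (\<pi> a)"
  have \<xi>a: "?\<xi>a \<in> cont_funs (edges E)" using right_cont[OF a \<xi>] .
  have ca: "(\<lambda>v. cnj (a v)) \<in> cont_funs (verts E)" using cont_funs_closed(5)[OF a a] .
  have x: "x \<in> carr B" and y: "y \<in> carr B"
    using \<tau>_closed \<pi>_closed a \<xi> \<xi>a by (auto simp: x_def y_def B.closed)
  define c where "c = \<pi> (\<lambda>v. cnj (a v) * edge_inner \<xi> \<xi> v * a v)"
  have t: "\<tau> \<xi> \<in> carr B" "\<pi> a \<in> carr B" "\<tau> ?\<xi>a \<in> carr B" using \<tau>_closed \<pi>_closed a \<xi> \<xi>a by auto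
  have xx: "cmult B (cadj B x) x = c"
    unfolding x_def c_def \<tau>_inner[OF \<xi>a \<xi>a] inner_left inner_right by (simp add: mult_ac)
  have xy: "cmult B (cadj B x) y = c"
  proof -
    have "cmult B (cadj B x) y = cmult B (cmult B (cadj B (\<tau> ?\<xi>a)) (\<tau> \<xi>)) (\<pi> a)"
      using t by (simp add: x_def y_def B.mult_assoc B.closed)
    also have "\<dots> = \<pi> (\<lambda>v. edge_inner ?\<xi>a \<xi> v * a v)"
      unfolding \<tau>_inner[OF \<xi>a \<xi>] using \<pi>_mult[OF inner_closed[OF \<xi>a \<xi>] a] by simp
    finally show ?thesis unfolding c_def inner_left .
  qed
  have yz: "cmult B (cadj B y) z = cmult B (cadj B (\<pi> a)) (cmult B (cadj B (\<tau> \<xi>)) z)" if "z \<in> carr B" for z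
    using t that by (simp add: y_def B.adj_mult B.mult_assoc B.closed)
  have yx: "cmult B (cadj B y) x = c"
  proof -
    have "cmult B (cadj B y) x = cmult B (cadj B (\<pi> a)) (\<pi> (edge_inner \<xi> ?\<xi>a))"
      using yz[OF x] \<tau>_inner[OF \<xi> \<xi>a] by (simp add: x_def)
    also have "\<dots> = \<pi> (\<lambda>v. cnj (a v) * edge_inner \<xi> ?\<xi>a v)"
      using \<pi>_mult[OF ca inner_closed[OF \<xi> \<xi>a]] \<pi>_adj[OF a] by simp
    finally show ?thesis unfolding c_def inner_right by (simp add: mult.assoc)
  qed
  have yy: "cmult B (cadj B y) y = c"
  proof -
    have "cmult B (cadj B (\<tau> \<xi>)) y = cmult B (\<pi> (edge_inner \<xi> \<xi>)) (\<pi> a)"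
      unfolding \<tau>_inner[OF \<xi> \<xi>, symmetric] using t by (simp add: y_def B.mult_assoc B.closed)
    also have "\<dots> = \<pi> (\<lambda>v. edge_inner \<xi> \<xi> v * a v)" using \<pi>_mult[OF inner_closed[OF \<xi> \<xi>] a] by simp
    finally have "cmult B (cadj B y) y = cmult B (cadj B (\<pi> a)) (\<pi> (\<lambda>v. edge_inner \<xi> \<xi> v * a v))"
      using yz[OF y] by simp
    also have "\<dots> = \<pi> (\<lambda>v. cnj (a v) * (edge_inner \<xi> \<xi> v * a v))"
      using \<pi>_mult[OF ca cont_funs_closed(3)[OF inner_closed[OF \<xi> \<xi>] a]] \<pi>_adj[OF a] by simp
    finally show ?thesis by (simp add: c_def mult.assoc)
  qed
  have cc: "c \<in> carr B" using x xx by (metis B.mult_closed B.adj_closed)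
  have "cmult B (cadj B (cdiff B x y)) (cdiff B x y) = cdiff B (cdiff B c c) (cdiff B c c)"
    using x y xx xy yx yy by (simp add: B.adj_diff B.mult_diff B.diff_mult B.closed)
  also have "\<dots> = czero B" using B.diff_self[OF cc] B.diff_self[OF B.zero_closed] by simp
  finally have "cdiff B x y = czero B" by (rule B.adj_mult_self_eq_zero[OF B.diff_closed[OF x y]])
  then show ?thesis using x y B.diff_eq_zero_iff unfolding x_def y_def by blast
qed

text \<open>By the C*-identity. The bound does not depend on the representation, as
  \<open>gen_bounded\<close> demands.\<close>

lemma \<tau>_norm: "\<xi> \<in> cont_funs (edges E) \<Longrightarrow> (cnorm B (\<tau> \<xi>))\<^sup>2 \<le> cnorm (C0_algebra (verts E)) (edge_inner \<xi> \<xi>)"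
proof -
  assume \<xi>: "\<xi> \<in> cont_funs (edges E)"
  have "cnorm B (\<pi> (edge_inner \<xi> \<xi>)) \<le> cnorm (C0_algebra (verts E)) (edge_inner \<xi> \<xi>)"
    using \<pi>_contractive inner_closed[OF \<xi> \<xi>] unfolding contractive_hom_def C0_algebra_carr[OF spaces(1)] by blast
  then show ?thesis using B.norm_cstar[OF \<tau>_closed[OF \<xi>]] \<tau>_inner[OF \<xi> \<xi>] by simp
qed

lemma \<tau>_zero: "\<tau> (\<lambda>_. 0) = czero B"
  using \<tau>_scale[OF zero_cont_funs, of 0] B.scale_zero_left[OF \<tau>_closed[OF zero_cont_funs]] by simp

lemma \<tau>_sum: "(\<And>i. i < n \<Longrightarrow> f i \<in> cont_funs (edges E))
    \<Longrightarrow> \<tau> (\<lambda>e. \<Sum>i<n. f i e) = csum B (\<lambda>i. \<tau> (f i)) n"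
  by (induction n) (auto simp: \<tau>_zero \<tau>_add cont_funs_sum)

text \<open>
  A frame represents every adjointable operator \<open>T\<close> by \<open>\<Sum>\<^sub>i \<tau> (T \<xi>\<^sub>i) (\<tau> \<xi>\<^sub>i)\<^sup>*\<close>, so no
  separate construction on the compact operators is needed.
\<close>

lemma frame_covariant:
  assumes frame: "frame n \<xi>"
    and cov: "\<And>a. a \<in> katsura_ideal X \<Longrightarrow>
      cmult B (\<pi> a) (csum B (\<lambda>i. cmult B (\<tau> (\<xi> i)) (cadj B (\<tau> (\<xi> i)))) n) = \<pi> a"
  shows "covariant_rep X B \<pi> \<tau>"
proof -
  let ?O = "adjointable_ops X"
  have \<xi>: "\<xi> i \<in> cont_funs (edges E)" if "i < n" for i using frame that by (simp add: frame_def)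
  have \<tau>\<xi>: "\<tau> (\<xi> i) \<in> carr B" "cadj B (\<tau> (\<xi> i)) \<in> carr B" if "i < n" for i
    using \<tau>_closed[OF \<xi>[OF that]] B.adj_closed by auto
  define \<phi> where "\<phi> T = csum B (\<lambda>i. cmult B (\<tau> (T (\<xi> i))) (cadj B (\<tau> (\<xi> i)))) n" for T
  \<comment> \<open>\<open>P\<close> is the sum of the products of each
    \<open>\<tau> (\<xi> i)\<close> with its adjoint. It is selfadjoint and fixes every
    \<open>\<tau> \<zeta>\<close> from the left, like an image of the identity operator.\<close>
  define P where "P = \<phi> (\<lambda>\<eta>. \<eta>)"
  have T_closed: "T \<eta> \<in> cont_funs (edges E)" if "T \<in> carr ?O" "\<eta> \<in> cont_funs (edges E)" for T \<eta>
    using that by (auto simp: adjointable_ops_def)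
  have summand: "cmult B (\<tau> (T (\<xi> i))) (cadj B (\<tau> (\<xi> i))) \<in> carr B" if "T \<in> carr ?O" "i < n" for T i
    using \<tau>_closed[OF T_closed[OF that(1) \<xi>[OF that(2)]]] \<tau>\<xi>(2)[OF that(2)] by (rule B.mult_closed)
  have \<phi>_closed: "\<phi> T \<in> carr B" if "T \<in> carr ?O" for T
    unfolding \<phi>_def using summand[OF that] by (rule B.csum_closed)
  have P_term: "cmult B (\<tau> (\<xi> i)) (cadj B (\<tau> (\<xi> i))) \<in> carr B" if "i < n" for i
    using \<tau>\<xi>[OF that] by (rule B.mult_closed)
  have P_closed: "P \<in> carr B" unfolding P_def \<phi>_def using P_term by (rule B.csum_closed)
  have expand: "csum B (\<lambda>i. cmult B (\<tau> (f i)) (\<pi> (c i))) n = \<tau> (\<lambda>e. \<Sum>i<n. f i e * c i (s e))"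
    if "\<And>i. i < n \<Longrightarrow> f i \<in> cont_funs (edges E)" "\<And>i. i < n \<Longrightarrow> c i \<in> cont_funs (verts E)" for f c
  proof -
    have "csum B (\<lambda>i. cmult B (\<tau> (f i)) (\<pi> (c i))) n = csum B (\<lambda>i. \<tau> (\<lambda>e. f i e * c i (s e))) n"
      by (rule csum_cong) (use that \<tau>_right in auto)
    also have "\<dots> = \<tau> (\<lambda>e. \<Sum>i<n. f i e * c i (s e))"
      using that right_cont by (intro \<tau>_sum[symmetric]) auto
    finally show ?thesis .
  qed
  \<comment> \<open>\<open>T\<close> is known to have an adjoint, but its linearity is not given.
    Pairing with a test vector moves \<open>T\<close> to its adjoint and leaves the frame expansion
    of \<open>\<zeta>\<close>.\<close>
  have T_expand: "(\<lambda>e. \<Sum>i<n. T (\<xi> i) e * edge_inner (\<xi> i) \<zeta> (s e)) = T \<zeta>"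
    if T: "T \<in> carr ?O" and \<zeta>: "\<zeta> \<in> cont_funs (edges E)" for T \<zeta>
  proof (rule inner_eqI)
    obtain S where S: "S \<in> mcarr X \<rightarrow>\<^sub>E mcarr X" "is_adjoint X T S" using T by (auto simp: adjointable_ops_def)
    show "(\<lambda>e. \<Sum>i<n. T (\<xi> i) e * edge_inner (\<xi> i) \<zeta> (s e)) \<in> cont_funs (edges E)"
      by (intro cont_funs_sum right_cont inner_closed T_closed[OF T] \<xi> \<zeta>)
    show "T \<zeta> \<in> cont_funs (edges E)" using T_closed[OF T \<zeta>] .
    fix \<eta> assume \<eta>: "\<eta> \<in> cont_funs (edges E)"
    have "edge_inner (\<lambda>e. \<Sum>i<n. T (\<xi> i) e * edge_inner (\<xi> i) \<zeta> (s e)) \<eta> v = edge_inner (T \<zeta>) \<eta> v" for v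
    proof -
      have "edge_inner (\<lambda>e. \<Sum>i<n. T (\<xi> i) e * edge_inner (\<xi> i) \<zeta> (s e)) \<eta> v
          = (\<Sum>i<n. cnj (edge_inner (\<xi> i) \<zeta> v) * edge_inner (\<xi> i) (S \<eta>) v)"
        by (subst inner_sum_left[where f="\<lambda>i. T (\<xi> i)" and c="\<lambda>i. edge_inner (\<xi> i) \<zeta>"])
          (use S(2) \<xi> \<eta> in \<open>auto simp: is_adjoint_iff intro!: sum.cong\<close>)
      also have "\<dots> = edge_inner (\<lambda>e. \<Sum>i<n. \<xi> i e * edge_inner (\<xi> i) \<zeta> (s e)) (S \<eta>) v"
        by (rule inner_sum_left[where f=\<xi> and c="\<lambda>i. edge_inner (\<xi> i) \<zeta>", symmetric])
      also have "\<dots> = edge_inner (T \<zeta>) \<eta> v"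
        unfolding frame_expansion[OF frame \<zeta>] using S(2) \<zeta> \<eta> by (simp add: is_adjoint_iff)
      finally show ?thesis .
    qed
    then show "edge_inner (\<lambda>e. \<Sum>i<n. T (\<xi> i) e * edge_inner (\<xi> i) \<zeta> (s e)) \<eta> = edge_inner (T \<zeta>) \<eta>" by blast
  qed
  have \<phi>_\<tau>: "cmult B (\<phi> T) (\<tau> \<zeta>) = \<tau> (T \<zeta>)" if T: "T \<in> carr ?O" and \<zeta>: "\<zeta> \<in> cont_funs (edges E)" for T \<zeta>
  proof -
    have "cmult B (\<phi> T) (\<tau> \<zeta>) = csum B (\<lambda>i. cmult B (cmult B (\<tau> (T (\<xi> i))) (cadj B (\<tau> (\<xi> i)))) (\<tau> \<zeta>)) n"
      unfolding \<phi>_def using \<tau>_closed[OF \<zeta>] summand[OF T] by (rule B.csum_mult)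
    also have "\<dots> = csum B (\<lambda>i. cmult B (\<tau> (T (\<xi> i))) (\<pi> (edge_inner (\<xi> i) \<zeta>))) n"
      by (rule csum_cong)
        (use \<tau>_closed \<tau>\<xi> \<xi> T_closed[OF T] \<zeta> \<tau>_inner in \<open>simp add: B.mult_assoc\<close>)
    also have "\<dots> = \<tau> (T \<zeta>)"
      using T_expand[OF T \<zeta>] expand[of "\<lambda>i. T (\<xi> i)" "\<lambda>i. edge_inner (\<xi> i) \<zeta>"] T_closed[OF T] \<xi> \<zeta> inner_closed
      by simp
    finally show ?thesis .
  qed
  have P_\<tau>: "cmult B P (\<tau> \<zeta>) = \<tau> \<zeta>" if \<zeta>: "\<zeta> \<in> cont_funs (edges E)" for \<zeta>
  proof -
    have "cmult B P (\<tau> \<zeta>) = csum B (\<lambda>i. cmult B (cmult B (\<tau> (\<xi> i)) (cadj B (\<tau> (\<xi> i)))) (\<tau> \<zeta>)) n"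
      unfolding P_def \<phi>_def using \<tau>_closed[OF \<zeta>] P_term by (rule B.csum_mult)
    also have "\<dots> = csum B (\<lambda>i. cmult B (\<tau> (\<xi> i)) (\<pi> (edge_inner (\<xi> i) \<zeta>))) n"
      by (rule csum_cong) (use \<tau>_closed \<tau>\<xi> \<xi> \<zeta> \<tau>_inner in \<open>simp add: B.mult_assoc\<close>)
    also have "\<dots> = \<tau> \<zeta>"
      using frame_expansion[OF frame \<zeta>] expand[of \<xi> "\<lambda>i. edge_inner (\<xi> i) \<zeta>"] \<xi> \<zeta> inner_closed by simp
    finally show ?thesis .
  qed
  have P_adj: "cadj B P = P"
  proof -
    have "cadj B P = csum B (\<lambda>i. cadj B (cmult B (\<tau> (\<xi> i)) (cadj B (\<tau> (\<xi> i))))) n"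
      unfolding P_def \<phi>_def using P_term by (rule B.csum_adj)
    also have "\<dots> = P" unfolding P_def \<phi>_def
      by (rule csum_cong) (use \<tau>\<xi> in \<open>simp add: B.adj_mult B.adj_adj\<close>)
    finally show ?thesis .
  qed
  have \<tau>_P: "cmult B (cadj B (\<tau> \<eta>)) P = cadj B (\<tau> \<eta>)" if "\<eta> \<in> cont_funs (edges E)" for \<eta>
    using P_\<tau>[OF that] B.adj_mult[OF P_closed \<tau>_closed[OF that]] P_adj by simp
  have \<phi>_mult: "cmult B x (\<phi> T) = csum B (\<lambda>i. cmult B (cmult B x (\<tau> (T (\<xi> i)))) (cadj B (\<tau> (\<xi> i)))) n"
    if T: "T \<in> carr ?O" and x: "x \<in> carr B" for x T
  proof -
    have "cmult B x (\<phi> T) = csum B (\<lambda>i. cmult B x (cmult B (\<tau> (T (\<xi> i))) (cadj B (\<tau> (\<xi> i))))) n"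
      unfolding \<phi>_def using x summand[OF T] by (rule B.mult_csum)
    also have "\<dots> = csum B (\<lambda>i. cmult B (cmult B x (\<tau> (T (\<xi> i)))) (cadj B (\<tau> (\<xi> i)))) n"
      by (rule csum_cong) (use x \<tau>_closed T_closed[OF T] \<xi> \<tau>\<xi> in \<open>simp add: B.mult_assoc\<close>)
    finally show ?thesis .
  qed
  have P_\<phi>: "cmult B P (\<phi> T) = \<phi> T" if T: "T \<in> carr ?O" for T
    unfolding \<phi>_mult[OF T P_closed] unfolding \<phi>_def
    by (rule csum_cong) (use P_\<tau> T_closed[OF T] \<xi> in simp)
  \<comment> \<open>The adjoint of \<open>\<phi> T\<close> sends each \<open>\<tau> \<zeta>\<close>
    to \<open>\<tau> (S \<zeta>)\<close>. It also absorbs \<open>P\<close> on the right, and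
    expanding that \<open>P\<close> produces the sum that defines \<open>\<phi> S\<close>.\<close>
  have \<phi>_adj: "\<phi> S = cadj B (\<phi> T)"
    if T: "T \<in> carr ?O" and S: "S \<in> mcarr X \<rightarrow>\<^sub>E mcarr X" "is_adjoint X T S" for S T
  proof -
    have S_closed: "S \<eta> \<in> cont_funs (edges E)" if "\<eta> \<in> cont_funs (edges E)" for \<eta> using S(1) that by auto
    have aT: "cadj B (\<phi> T) = csum B (\<lambda>i. cmult B (\<tau> (\<xi> i)) (cadj B (\<tau> (T (\<xi> i))))) n"
    proof -
      have "cadj B (\<phi> T) = csum B (\<lambda>i. cadj B (cmult B (\<tau> (T (\<xi> i))) (cadj B (\<tau> (\<xi> i))))) n"
        unfolding \<phi>_def using summand[OF T] by (rule B.csum_adj)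
      also have "\<dots> = csum B (\<lambda>i. cmult B (\<tau> (\<xi> i)) (cadj B (\<tau> (T (\<xi> i))))) n"
        by (rule csum_cong) (use \<tau>\<xi> \<tau>_closed T_closed[OF T] \<xi> in \<open>simp add: B.adj_mult B.adj_adj\<close>)
      finally show ?thesis .
    qed
    have a\<phi>_\<tau>: "cmult B (cadj B (\<phi> T)) (\<tau> \<zeta>) = \<tau> (S \<zeta>)" if \<zeta>: "\<zeta> \<in> cont_funs (edges E)" for \<zeta>
    proof -
      have "cmult B (cadj B (\<phi> T)) (\<tau> \<zeta>)
          = csum B (\<lambda>i. cmult B (cmult B (\<tau> (\<xi> i)) (cadj B (\<tau> (T (\<xi> i))))) (\<tau> \<zeta>)) n"
        unfolding aT
        by (rule B.csum_mult) (use \<tau>_closed \<zeta> \<tau>\<xi> T_closed[OF T] \<xi> in \<open>auto simp: B.closed\<close>)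
      also have "\<dots> = csum B (\<lambda>i. cmult B (\<tau> (\<xi> i)) (\<pi> (edge_inner (\<xi> i) (S \<zeta>)))) n"
      proof (rule csum_cong)
        fix i assume i: "i < n"
        have "edge_inner (T (\<xi> i)) \<zeta> = edge_inner (\<xi> i) (S \<zeta>)" using S(2) \<xi>[OF i] \<zeta> by (simp add: is_adjoint_iff)
        then show "cmult B (cmult B (\<tau> (\<xi> i)) (cadj B (\<tau> (T (\<xi> i))))) (\<tau> \<zeta>)
            = cmult B (\<tau> (\<xi> i)) (\<pi> (edge_inner (\<xi> i) (S \<zeta>)))"
          using \<tau>_inner[OF T_closed[OF T \<xi>[OF i]] \<zeta>] \<tau>_closed \<zeta> \<tau>\<xi>[OF i] T_closed[OF T \<xi>[OF i]]
          by (simp add: B.mult_assoc B.closed)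
      qed
      also have "\<dots> = \<tau> (S \<zeta>)"
        using frame_expansion[OF frame S_closed[OF \<zeta>]] expand[of \<xi> "\<lambda>i. edge_inner (\<xi> i) (S \<zeta>)"] \<xi> \<zeta>
          inner_closed S_closed by simp
      finally show ?thesis .
    qed
    have aT_closed: "cadj B (\<phi> T) \<in> carr B" using \<phi>_closed[OF T] by (rule B.adj_closed)
    have "cadj B (\<phi> T) = cmult B (cadj B (\<phi> T)) P"
      using P_\<phi>[OF T] B.adj_mult[OF P_closed \<phi>_closed[OF T]] P_adj by simp
    also have "\<dots> = csum B (\<lambda>i. cmult B (cadj B (\<phi> T)) (cmult B (\<tau> (\<xi> i)) (cadj B (\<tau> (\<xi> i))))) n"
      unfolding P_def \<phi>_def[of "\<lambda>\<eta>. \<eta>"] using aT_closed P_term by (rule B.mult_csum)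
    also have "\<dots> = \<phi> S" unfolding \<phi>_def[of S]
      by (rule csum_cong) (use a\<phi>_\<tau> \<xi> \<tau>\<xi> aT_closed in \<open>simp flip: B.mult_assoc\<close>)
    finally show ?thesis by simp
  qed
  have hom: "star_hom (compact_ops X) B \<phi>"
    unfolding star_hom_def
  proof (intro conjI ballI allI)
    fix T assume "T \<in> carr (compact_ops X)"
    then have T: "T \<in> carr ?O" using compact_ops_subset by blast
    show "\<phi> T \<in> carr B" using \<phi>_closed[OF T] .
    have "csum B (\<lambda>i. cscale B c (cmult B (\<tau> (T (\<xi> i))) (cadj B (\<tau> (\<xi> i))))) n = cscale B c (\<phi> T)" for c
      unfolding \<phi>_def using summand[OF T] by (rule B.csum_scale[symmetric])
    moreover have "\<phi> (cscale (compact_ops X) c T)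
        = csum B (\<lambda>i. cscale B c (cmult B (\<tau> (T (\<xi> i))) (cadj B (\<tau> (\<xi> i))))) n" for c
      unfolding \<phi>_def compact_ops_def adjointable_ops_def
      by (rule csum_cong) (use \<xi> \<tau>_scale \<tau>_closed T_closed[OF T] \<tau>\<xi> in \<open>simp add: B.scale_mult\<close>)
    ultimately show "\<phi> (cscale (compact_ops X) c T) = cscale B c (\<phi> T)" for c by simp
    obtain S where S: "S \<in> mcarr X \<rightarrow>\<^sub>E mcarr X" "is_adjoint X T S" using T by (auto simp: adjointable_ops_def)
    have "cadj (compact_ops X) T = (THE S. S \<in> mcarr X \<rightarrow>\<^sub>E mcarr X \<and> is_adjoint X T S)"
      by (simp add: compact_ops_def adjointable_ops_def)
    also have "\<dots> = S" by (rule the_equality) (use S adjoint_unique in blast)+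
    finally show "\<phi> (cadj (compact_ops X) T) = cadj B (\<phi> T)" using \<phi>_adj[OF T S] by simp
    fix R assume "R \<in> carr (compact_ops X)"
    then have R: "R \<in> carr ?O" using compact_ops_subset by blast
    have "\<phi> (cadd (compact_ops X) T R) = csum B (\<lambda>i. cadd B (cmult B (\<tau> (T (\<xi> i))) (cadj B (\<tau> (\<xi> i))))
        (cmult B (\<tau> (R (\<xi> i))) (cadj B (\<tau> (\<xi> i))))) n"
      unfolding \<phi>_def compact_ops_def adjointable_ops_def
      by (rule csum_cong) (use \<xi> \<tau>_add \<tau>_closed T_closed[OF T] T_closed[OF R] \<tau>\<xi> in \<open>simp add: B.add_mult\<close>)
    then show "\<phi> (cadd (compact_ops X) T R) = cadd B (\<phi> T) (\<phi> R)"
      using B.csum_add[OF summand[OF T] summand[OF R]] by (simp add: \<phi>_def)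
    have "cmult B (\<phi> T) (\<phi> R) = csum B (\<lambda>i. cmult B (cmult B (\<phi> T) (\<tau> (R (\<xi> i)))) (cadj B (\<tau> (\<xi> i)))) n"
      by (rule \<phi>_mult[OF R \<phi>_closed[OF T]])
    also have "\<dots> = \<phi> (\<lambda>\<eta>\<in>mcarr X. T (R \<eta>))"
      unfolding \<phi>_def[of "\<lambda>\<eta>\<in>mcarr X. T (R \<eta>)"]
      by (rule csum_cong) (use \<xi> \<phi>_\<tau>[OF T] T_closed[OF R] in simp)
    also have "(\<lambda>\<eta>\<in>mcarr X. T (R \<eta>)) = cmult (compact_ops X) T R"
      by (simp add: compact_ops_def adjointable_ops_def)
    finally show "\<phi> (cmult (compact_ops X) T R) = cmult B (\<phi> T) (\<phi> R)" by simp
  qed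
  \<comment> \<open>Right linearity of \<open>\<tau>\<close> extracts a factor \<open>P\<close> on
    the right, which the adjoint of \<open>\<tau> \<zeta>\<close> absorbs.\<close>
  moreover have "\<phi> (rank_one X \<eta> \<zeta>) = cmult B (\<tau> \<eta>) (cadj B (\<tau> \<zeta>))"
    if \<eta>: "\<eta> \<in> cont_funs (edges E)" and \<zeta>: "\<zeta> \<in> cont_funs (edges E)" for \<eta> \<zeta>
  proof -
    have \<tau>: "\<tau> \<eta> \<in> carr B" "cadj B (\<tau> \<zeta>) \<in> carr B" using \<tau>_closed \<eta> \<zeta> B.adj_closed by auto
    have "\<phi> (rank_one X \<eta> \<zeta>) = csum B (\<lambda>i. cmult B (cmult B (\<tau> \<eta>) (cadj B (\<tau> \<zeta>)))
        (cmult B (\<tau> (\<xi> i)) (cadj B (\<tau> (\<xi> i))))) n"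
      unfolding \<phi>_def
    proof (rule csum_cong)
      fix i assume i: "i < n"
      have "\<tau> (rank_one X \<eta> \<zeta> (\<xi> i)) = cmult B (\<tau> \<eta>) (cmult B (cadj B (\<tau> \<zeta>)) (\<tau> (\<xi> i)))"
        using \<tau>_right[OF inner_closed[OF \<zeta> \<xi>[OF i]] \<eta>] \<tau>_inner[OF \<zeta> \<xi>[OF i]] \<xi>[OF i]
        by (simp add: rank_one_def edge_inner_def)
      then show "cmult B (\<tau> (rank_one X \<eta> \<zeta> (\<xi> i))) (cadj B (\<tau> (\<xi> i)))
          = cmult B (cmult B (\<tau> \<eta>) (cadj B (\<tau> \<zeta>))) (cmult B (\<tau> (\<xi> i)) (cadj B (\<tau> (\<xi> i))))"
        using \<tau> \<tau>\<xi>[OF i] by (simp add: B.mult_assoc B.closed)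
    qed
    also have "\<dots> = cmult B (cmult B (\<tau> \<eta>) (cadj B (\<tau> \<zeta>))) P"
      unfolding P_def \<phi>_def by (rule B.mult_csum[symmetric]) (use \<tau> P_term B.mult_closed in auto)
    also have "\<dots> = cmult B (\<tau> \<eta>) (cadj B (\<tau> \<zeta>))"
      using \<tau> P_closed \<tau>_P[OF \<zeta>] by (simp add: B.mult_assoc)
    finally show ?thesis .
  qed
  \<comment> \<open>The left side equals \<open>\<pi> a\<close> times \<open>P\<close>, and the
    assumption \<open>cov\<close> says that this product is \<open>\<pi> a\<close>.\<close>
  moreover have "\<phi> (left_op X a) = \<pi> a" if a: "a \<in> katsura_ideal X" for a
  proof -
    have ac: "a \<in> cont_funs (verts E)" using a by (simp add: katsura_ideal_def C0_algebra_carr[OF spaces(1)])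
    have "\<phi> (left_op X a) = csum B (\<lambda>i. cmult B (\<pi> a) (cmult B (\<tau> (\<xi> i)) (cadj B (\<tau> (\<xi> i))))) n"
      unfolding \<phi>_def
      by (rule csum_cong) (use \<xi> \<tau>_left[OF ac] \<pi>_closed[OF ac] \<tau>\<xi> in \<open>simp add: left_op_def B.mult_assoc\<close>)
    also have "\<dots> = cmult B (\<pi> a) P"
      unfolding P_def \<phi>_def by (rule B.mult_csum[symmetric]) (use \<pi>_closed[OF ac] P_term in auto)
    finally show ?thesis using cov[OF a] by (simp add: P_def \<phi>_def)
  qed
  ultimately show ?thesis using rep by (auto simp: covariant_rep_def)
qed

end

section \<open>Operators on a Hilbert space\<close>

text \<open>
  The inner product on \<open>ell2\<close> is the real part of the usual one, so that the library's real inner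
  product spaces apply; the complex structure is the operator \<open>ell2_i\<close>, with which the operators in
  \<open>ell2_ops\<close> have to commute.
\<close>

typedef 's ell2 = "{x :: 's \<Rightarrow> complex. (\<lambda>i. (cmod (x i))\<^sup>2) summable_on UNIV}"
  morphisms coord Abs_ell2
  by (rule exI[of _ "\<lambda>_. 0"]) simp

lemma ell2_sum_le:
  "finite F \<Longrightarrow> (\<Sum>i\<in>F. (cmod (coord x i))\<^sup>2) \<le> (\<Sum>\<^sub>\<infinity>i. (cmod (coord x i))\<^sup>2)"
  using coord[of x] by (intro finite_sum_le_infsum) auto

lemma ell2_memI:
  fixes x :: "'s \<Rightarrow> complex"
  assumes "\<And>F. finite F \<Longrightarrow> (\<Sum>i\<in>F. (cmod (x i))\<^sup>2) \<le> K"
  shows "(\<lambda>i. (cmod (x i))\<^sup>2) summable_on UNIV" "(\<Sum>\<^sub>\<infinity>i. (cmod (x i))\<^sup>2) \<le> K"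
proof -
  show s: "(\<lambda>i. (cmod (x i))\<^sup>2) summable_on UNIV"
    by (rule nonneg_bdd_above_summable_on) (use assms in \<open>auto intro!: bdd_aboveI2\<close>)
  show "(\<Sum>\<^sub>\<infinity>i. (cmod (x i))\<^sup>2) \<le> K"
    by (rule infsum_le_finite_sums[OF s]) (use assms in auto)
qed

lemma ell2_add_mem:
  fixes x y :: "'s \<Rightarrow> complex"
  assumes "(\<lambda>i. (cmod (x i))\<^sup>2) summable_on UNIV" "(\<lambda>i. (cmod (y i))\<^sup>2) summable_on UNIV"
  shows "(\<lambda>i. (cmod (x i + y i))\<^sup>2) summable_on UNIV"
proof (rule ell2_memI(1))
  fix F :: "'s set" assume F: "finite F"
  have "(cmod (x i + y i))\<^sup>2 \<le> 2 * (cmod (x i))\<^sup>2 + 2 * (cmod (y i))\<^sup>2" for i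
  proof -
    have "(cmod (x i + y i))\<^sup>2 \<le> (cmod (x i) + cmod (y i))\<^sup>2" by (simp add: norm_triangle_ineq power_mono)
    also have "\<dots> \<le> 2 * (cmod (x i))\<^sup>2 + 2 * (cmod (y i))\<^sup>2"
      using sum_squares_bound[of "cmod (x i)" "cmod (y i)"] by (simp add: power2_sum)
    finally show ?thesis .
  qed
  then have "(\<Sum>i\<in>F. (cmod (x i + y i))\<^sup>2) \<le> (\<Sum>i\<in>F. 2 * (cmod (x i))\<^sup>2 + 2 * (cmod (y i))\<^sup>2)"
    by (intro sum_mono) auto
  also have "\<dots> = 2 * (\<Sum>i\<in>F. (cmod (x i))\<^sup>2) + 2 * (\<Sum>i\<in>F. (cmod (y i))\<^sup>2)"
    by (simp add: sum.distrib sum_distrib_left)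
  also have "\<dots> \<le> 2 * (\<Sum>\<^sub>\<infinity>i. (cmod (x i))\<^sup>2) + 2 * (\<Sum>\<^sub>\<infinity>i. (cmod (y i))\<^sup>2)"
    by (intro add_mono mult_left_mono finite_sum_le_infsum assms) (use F in auto)
  finally show "(\<Sum>i\<in>F. (cmod (x i + y i))\<^sup>2) \<le> 2 * (\<Sum>\<^sub>\<infinity>i. (cmod (x i))\<^sup>2) + 2 * (\<Sum>\<^sub>\<infinity>i. (cmod (y i))\<^sup>2)" .
qed

lemma ell2_mult_mem:
  fixes x :: "'s \<Rightarrow> complex"
  assumes "(\<lambda>i. (cmod (x i))\<^sup>2) summable_on UNIV"
  shows "(\<lambda>i. (cmod (c * x i))\<^sup>2) summable_on UNIV"
  using summable_on_cmult_right[OF assms, of "(cmod c)\<^sup>2"] by (simp add: norm_mult power_mult_distrib)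

lemma coord_mem: "(\<lambda>i. (cmod (coord x i))\<^sup>2) summable_on UNIV"
  using coord[of x] by simp

lemma ell2_eqI: "(\<And>i. coord x i = coord y i) \<Longrightarrow> x = y"
  by (metis coord_inject ext)

instantiation ell2 :: (type) real_vector
begin

definition "0 = Abs_ell2 (\<lambda>_. 0)"
definition "x + y = Abs_ell2 (\<lambda>i. coord x i + coord y i)"
definition "- x = Abs_ell2 (\<lambda>i. (-1) * coord x i)"
definition "x - y = x + - (y :: 'a ell2)"
definition "c *\<^sub>R x = Abs_ell2 (\<lambda>i. complex_of_real c * coord x i)"

lemma coord_simps:
  "coord 0 i = 0" "coord (x + y) i = coord x i + coord y i" "coord (- x) i = - coord x i"
  "coord (x - y) i = coord x i - coord y i" "coord (c *\<^sub>R x) i = complex_of_real c * coord x i"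
proof -
  show add: "coord (x + y) i = coord x i + coord y i" for x y :: "'a ell2"
    unfolding plus_ell2_def by (subst Abs_ell2_inverse) (simp_all add: ell2_add_mem coord_mem)
  show neg: "coord (- x) i = - coord x i" for x :: "'a ell2"
    unfolding uminus_ell2_def
    by (subst Abs_ell2_inverse) (use ell2_mult_mem[OF coord_mem, of "-1" x] in simp_all)
  show "coord 0 i = 0" unfolding zero_ell2_def by (subst Abs_ell2_inverse) simp_all
  show "coord (x - y) i = coord x i - coord y i" unfolding minus_ell2_def add neg by simp
  show "coord (c *\<^sub>R x) i = complex_of_real c * coord x i"
    unfolding scaleR_ell2_def by (subst Abs_ell2_inverse) (simp_all only: ell2_mult_mem coord_mem mem_Collect_eq)
qed

instance
  by standard (auto intro!: ell2_eqI simp: coord_simps algebra_simps)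

end

lemma inner_summable: "(\<lambda>i. norm (coord x i \<bullet> coord y i)) summable_on UNIV"
proof (rule nonneg_bdd_above_summable_on)
  show "bdd_above (sum (\<lambda>i. norm (coord x i \<bullet> coord y i)) ` {F. F \<subseteq> UNIV \<and> finite F})"
  proof (rule bdd_aboveI2)
    fix F :: "'a set" assume "F \<in> {F. F \<subseteq> UNIV \<and> finite F}"
    then have F: "finite F" by simp
    have "norm (coord x i \<bullet> coord y i) \<le> (cmod (coord x i))\<^sup>2 + (cmod (coord y i))\<^sup>2" for i
    proof -
      have "norm (coord x i \<bullet> coord y i) \<le> cmod (coord x i) * cmod (coord y i)"
        using Cauchy_Schwarz_ineq2[of "coord x i" "coord y i"] by simp
      also have "\<dots> \<le> (cmod (coord x i))\<^sup>2 + (cmod (coord y i))\<^sup>2"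
      proof -
        have "0 \<le> cmod (coord x i) * cmod (coord y i)" by simp
        moreover have "2 * (cmod (coord x i) * cmod (coord y i)) \<le> (cmod (coord x i))\<^sup>2 + (cmod (coord y i))\<^sup>2"
          using sum_squares_bound[of "cmod (coord x i)" "cmod (coord y i)"] by (simp add: mult.assoc)
        ultimately show ?thesis by linarith
      qed
      finally show ?thesis .
    qed
    then have "(\<Sum>i\<in>F. norm (coord x i \<bullet> coord y i)) \<le> (\<Sum>i\<in>F. (cmod (coord x i))\<^sup>2 + (cmod (coord y i))\<^sup>2)"
      by (intro sum_mono) auto
    also have "\<dots> \<le> (\<Sum>\<^sub>\<infinity>i. (cmod (coord x i))\<^sup>2) + (\<Sum>\<^sub>\<infinity>i. (cmod (coord y i))\<^sup>2)"
      using ell2_sum_le[OF F, of x] ell2_sum_le[OF F, of y] by (simp add: sum.distrib)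
    finally show "(\<Sum>i\<in>F. norm (coord x i \<bullet> coord y i)) \<le> (\<Sum>\<^sub>\<infinity>i. (cmod (coord x i))\<^sup>2) + (\<Sum>\<^sub>\<infinity>i. (cmod (coord y i))\<^sup>2)" .
  qed
qed simp

instantiation ell2 :: (type) real_inner
begin

definition "inner x y = (\<Sum>\<^sub>\<infinity>i. coord x i \<bullet> coord y i)"
definition "norm x = sqrt (inner x (x :: 'a ell2))"
definition "sgn x = x /\<^sub>R norm (x :: 'a ell2)"
definition "dist x y = norm (x - (y :: 'a ell2))"
definition [code del]: "uniformity = (INF e\<in>{0<..}. principal {(x, y :: 'a ell2). dist x y < e})"
definition [code del]: "open (U :: 'a ell2 set) \<longleftrightarrow> (\<forall>x\<in>U. eventually (\<lambda>(x', y). x' = x \<longrightarrow> y \<in> U) uniformity)"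

instance
proof
  fix x y z :: "'a ell2" and c :: real
  note summable = Infinite_Sum.abs_summable_summable[OF inner_summable]
  show "inner x y = inner y x" unfolding inner_ell2_def by (simp add: inner_commute)
  show "inner (x + y) z = inner x z + inner y z"
    unfolding inner_ell2_def by (simp add: coord_simps inner_add_left infsum_add summable)
  show "inner (c *\<^sub>R x) y = c * inner x y"
  proof -
    have "inner (c *\<^sub>R x) y = (\<Sum>\<^sub>\<infinity>i. c * (coord x i \<bullet> coord y i))"
      unfolding inner_ell2_def by (rule infsum_cong) (simp add: coord_simps inner_complex_def algebra_simps)
    then show ?thesis unfolding inner_ell2_def by (simp add: infsum_cmult_right summable)
  qed
  show nonneg: "0 \<le> inner x x" unfolding inner_ell2_def by (rule infsum_nonneg) simp
  show "inner x x = 0 \<longleftrightarrow> x = 0"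
  proof
    assume "inner x x = 0"
    then have "coord x i \<bullet> coord x i = 0" for i
      using nonneg_infsum_le_0D[of "\<lambda>i. coord x i \<bullet> coord x i" UNIV i] summable[of x x]
      by (simp add: inner_ell2_def)
    then show "x = 0" by (intro ell2_eqI) (simp add: coord_simps)
  qed (simp add: inner_ell2_def coord_simps)
qed (simp_all add: norm_ell2_def sgn_ell2_def dist_ell2_def uniformity_ell2_def open_ell2_def)

end

lemma norm_ell2_sq: "(norm x)\<^sup>2 = (\<Sum>\<^sub>\<infinity>i. (cmod (coord x i))\<^sup>2)"
  by (simp add: power2_norm_eq_inner inner_ell2_def)

lemma ell2_sum_le_norm: "finite F \<Longrightarrow> (\<Sum>i\<in>F. (cmod (coord x i))\<^sup>2) \<le> (norm x)\<^sup>2"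
  unfolding norm_ell2_sq by (rule ell2_sum_le)

lemma coord_le_norm: "cmod (coord x i) \<le> norm x"
  by (rule power2_le_imp_le) (use ell2_sum_le_norm[of "{i}" x] in simp_all)

lemma ell2_normI:
  assumes "\<And>F. finite F \<Longrightarrow> (\<Sum>i\<in>F. (cmod (x i))\<^sup>2) \<le> K\<^sup>2" "0 \<le> K"
  shows "coord (Abs_ell2 x) = x" "norm (Abs_ell2 x) \<le> K"
proof -
  note m = ell2_memI[of x, OF assms(1)]
  show c: "coord (Abs_ell2 x) = x" by (rule Abs_ell2_inverse) (use m(1) in simp)
  have "(norm (Abs_ell2 x))\<^sup>2 \<le> K\<^sup>2" unfolding norm_ell2_sq c using m(2) .
  then show "norm (Abs_ell2 x) \<le> K" using assms(2) by (rule power2_le_imp_le)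
qed

instance ell2 :: (type) banach
proof
  fix X :: "nat \<Rightarrow> 'a ell2" assume X: "Cauchy X"
  have "Cauchy (\<lambda>n. coord (X n) i)" for i
  proof (rule metric_CauchyI)
    fix e :: real assume "e > 0"
    then obtain N where N: "\<And>m n. m \<ge> N \<Longrightarrow> n \<ge> N \<Longrightarrow> dist (X m) (X n) < e" using metric_CauchyD[OF X] by blast
    have "dist (coord (X m) i) (coord (X n) i) < e" if "m \<ge> N" "n \<ge> N" for m n
      using N[OF that] coord_le_norm[of "X m - X n" i] by (simp add: dist_norm coord_simps)
    then show "\<exists>N. \<forall>m\<ge>N. \<forall>n\<ge>N. dist (coord (X m) i) (coord (X n) i) < e" by blast
  qed
  then have "\<forall>i. \<exists>l. (\<lambda>n. coord (X n) i) \<longlonglongrightarrow> l" by (simp add: Cauchy_convergent_iff convergent_def)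
  then obtain l where l: "\<And>i. (\<lambda>n. coord (X n) i) \<longlonglongrightarrow> l i" by metis
  \<comment> \<open>Bounds on finite partial sums pass to the coordinatewise limit, with one index
    \<open>N\<close> for all finite sets.\<close>
  have unif: "\<exists>N. \<forall>m\<ge>N. \<forall>F. finite F \<longrightarrow> (\<Sum>i\<in>F. (cmod (coord (X m) i - l i))\<^sup>2) \<le> e\<^sup>2" if e: "e > 0" for e
  proof -
    obtain N where N: "\<And>m n. m \<ge> N \<Longrightarrow> n \<ge> N \<Longrightarrow> dist (X m) (X n) < e" using metric_CauchyD[OF X e] by blast
    have "(\<Sum>i\<in>F. (cmod (coord (X m) i - l i))\<^sup>2) \<le> e\<^sup>2" if m: "m \<ge> N" and F: "finite F" for m F
    proof (rule LIMSEQ_le_const2)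
      show "(\<lambda>n. \<Sum>i\<in>F. (cmod (coord (X m) i - coord (X n) i))\<^sup>2) \<longlonglongrightarrow> (\<Sum>i\<in>F. (cmod (coord (X m) i - l i))\<^sup>2)"
        by (intro tendsto_intros l)
      have "(\<Sum>i\<in>F. (cmod (coord (X m) i - coord (X n) i))\<^sup>2) \<le> e\<^sup>2" if "n \<ge> N" for n
      proof -
        have "(\<Sum>i\<in>F. (cmod (coord (X m) i - coord (X n) i))\<^sup>2) \<le> (norm (X m - X n))\<^sup>2"
          using ell2_sum_le_norm[OF F, of "X m - X n"] by (simp add: coord_simps)
        also have "\<dots> \<le> e\<^sup>2" using N[OF m that] by (intro power_mono) (auto simp: dist_norm)
        finally show ?thesis .
      qed
      then show "\<exists>N. \<forall>n\<ge>N. (\<Sum>i\<in>F. (cmod (coord (X m) i - coord (X n) i))\<^sup>2) \<le> e\<^sup>2" by blast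
    qed
    then show ?thesis by blast
  qed
  obtain N where N: "\<And>F. finite F \<Longrightarrow> (\<Sum>i\<in>F. (cmod (coord (X N) i - l i))\<^sup>2) \<le> 1\<^sup>2"
    using unif[of 1] by force
  \<comment> \<open>The coordinatewise limit is square summable because it differs from
    \<open>X N\<close> by a square summable family.\<close>
  define L where "L = X N - Abs_ell2 (\<lambda>i. coord (X N) i - l i)"
  have L: "coord L = l"
    using ell2_normI(1)[of "\<lambda>i. coord (X N) i - l i" 1] N by (intro ext) (simp add: L_def coord_simps)
  have "X \<longlonglongrightarrow> L"
  proof (rule metric_LIMSEQ_I)
    fix e :: real assume e: "e > 0"
    obtain M where M: "\<And>m F. m \<ge> M \<Longrightarrow> finite F \<Longrightarrow> (\<Sum>i\<in>F. (cmod (coord (X m) i - l i))\<^sup>2) \<le> (e/2)\<^sup>2"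
      using unif[of "e/2"] e by auto
    have "dist (X m) L < e" if "m \<ge> M" for m
    proof -
      have "Abs_ell2 (\<lambda>i. coord (X m) i - l i) = X m - L"
        using ell2_normI(1)[of "\<lambda>i. coord (X m) i - l i" "e/2"] M[OF that] e
        by (intro ell2_eqI) (simp add: coord_simps L)
      then have "norm (X m - L) \<le> e/2"
        using ell2_normI(2)[of "\<lambda>i. coord (X m) i - l i" "e/2"] M[OF that] e by simp
      then show ?thesis using e by (simp add: dist_norm)
    qed
    then show "\<exists>M. \<forall>m\<ge>M. dist (X m) L < e" by blast
  qed
  then show "convergent X" by (auto simp: convergent_def)
qed

text \<open>The concrete operators below are introduced through this: one bound on finite partial
  sums shows both that the image family is square summable and that the operator is bounded.\<close>

lemma coord_Blinfun:
  fixes f :: "'s ell2 \<Rightarrow> 't \<Rightarrow> complex"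
  assumes bound: "\<And>x F. finite F \<Longrightarrow> (\<Sum>i\<in>F. (cmod (f x i))\<^sup>2) \<le> (M * norm x)\<^sup>2" and M: "0 \<le> M"
    and add: "\<And>x y i. f (x + y) i = f x i + f y i"
    and scale: "\<And>c x i. f (c *\<^sub>R x) i = complex_of_real c * f x i"
  shows "coord (Blinfun (\<lambda>x. Abs_ell2 (f x)) x) i = f x i"
proof -
  define T where "T x = Abs_ell2 (f x)" for x
  have c: "coord (T x) = f x" and n: "norm (T x) \<le> norm x * M" for x
    unfolding T_def using ell2_normI[of "f x" "M * norm x", OF bound] M by (simp_all add: mult.commute)
  have "bounded_linear T"
    by (rule bounded_linear_intro[of _ M]) (auto intro!: ell2_eqI simp: c n coord_simps add scale)
  then show ?thesis by (simp add: bounded_linear_Blinfun_apply c flip: T_def)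
qed

section \<open>Adjoints and the C*-algebra of operators\<close>

definition ell2_i :: "'s ell2 \<Rightarrow>\<^sub>L 's ell2"
  where "ell2_i = Blinfun (\<lambda>x. Abs_ell2 (\<lambda>k. \<i> * coord x k))"

lemma coord_ell2_i: "coord (ell2_i x) k = \<i> * coord x k"
  unfolding ell2_i_def
  by (rule coord_Blinfun[where M=1])
    (simp_all add: norm_mult ell2_sum_le_norm coord_simps algebra_simps)

text \<open>This skew-adjointness is what turns a complex scalar into its conjugate when adjoints
  are taken.\<close>

lemma inner_ell2_i: "inner (ell2_i x) y = - inner x (ell2_i y)"
proof -
  have "inner (ell2_i x) y = (\<Sum>\<^sub>\<infinity>k. - (coord x k \<bullet> coord (ell2_i y) k))"
    unfolding inner_ell2_def by (rule infsum_cong) (simp add: coord_ell2_i inner_complex_def)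
  then show ?thesis by (simp add: inner_ell2_def infsum_uminus)
qed

text \<open>Every operator in \<open>ell2_ops\<close> comes with an adjoint as part of its
  membership. For operators commuting with \<open>ell2_i\<close> the adjoint for the real inner
  product is the complex adjoint.\<close>

definition adjoint_pair :: "('s ell2 \<Rightarrow>\<^sub>L 's ell2) \<Rightarrow> ('s ell2 \<Rightarrow>\<^sub>L 's ell2) \<Rightarrow> bool"
  where "adjoint_pair T S \<longleftrightarrow> (\<forall>x y. inner (T x) y = inner x (S y))"

lemma adjoint_pair_unique: "adjoint_pair T S \<Longrightarrow> adjoint_pair T S' \<Longrightarrow> S = S'"
  unfolding adjoint_pair_def by (intro blinfun_eqI) (metis vector_eq_ldot)

lemma adjoint_pair_sym: "adjoint_pair T S \<Longrightarrow> adjoint_pair S T"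
  unfolding adjoint_pair_def by (metis inner_commute)

lemma adjoint_pair_norm: "adjoint_pair T S \<Longrightarrow> norm S = norm T"
proof -
  have le: "norm S \<le> norm T" if "adjoint_pair T S" for T S :: "'s ell2 \<Rightarrow>\<^sub>L 's ell2"
  proof (rule norm_blinfun_bound)
    fix y
    have "norm (S y) * norm (S y) = inner (T (S y)) y"
      using that unfolding adjoint_pair_def by (metis power2_norm_eq_inner power2_eq_square)
    also have "\<dots> \<le> norm (T (S y)) * norm y" by (rule norm_cauchy_schwarz)
    also have "\<dots> \<le> norm T * norm (S y) * norm y" by (intro mult_right_mono norm_blinfun) simp
    finally show "norm (S y) \<le> norm T * norm y"
      by (cases "S y = 0") (simp_all add: mult_ac)
  qed simp
  assume "adjoint_pair T S"
  then show ?thesis using le adjoint_pair_sym by (metis order_antisym)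
qed

definition ell2_ops :: "('s ell2 \<Rightarrow>\<^sub>L 's ell2) cstar"
  where "ell2_ops =
    \<lparr>carr = {T. (\<exists>S. adjoint_pair T S) \<and> (\<forall>x. T (ell2_i x) = ell2_i (T x))},
     cadd = (+),
     czero = 0,
     cscale = (\<lambda>c T. Re c *\<^sub>R T + Im c *\<^sub>R (ell2_i o\<^sub>L T)),
     cmult = (o\<^sub>L),
     cadj = (\<lambda>T. THE S. adjoint_pair T S),
     cnorm = norm\<rparr>"

lemma ell2_ops_simps [simp]: "cadd ell2_ops = (+)" "czero ell2_ops = 0" "cmult ell2_ops = (o\<^sub>L)" "cnorm ell2_ops = norm"
  by (simp_all add: ell2_ops_def)

lemma ell2_ops_adj: "adjoint_pair T S \<Longrightarrow> cadj ell2_ops T = S"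
  unfolding ell2_ops_def using adjoint_pair_unique by (auto intro: the_equality)

lemma ell2_ops_scale: "cscale ell2_ops c T x = Re c *\<^sub>R T x + Im c *\<^sub>R ell2_i (T x)"
  by (simp add: ell2_ops_def blinfun.bilinear_simps)

lemma coord_ell2_ops_scale: "coord (cscale ell2_ops c T x) k = c * coord (T x) k"
  by (simp add: ell2_ops_scale coord_simps coord_ell2_i complex_eq_iff algebra_simps)

lemma ell2_ops_diff: "cdiff ell2_ops S T = S - T"
  by (rule blinfun_eqI) (simp add: cdiff_def ell2_ops_scale blinfun.bilinear_simps)

lemma ell2_ops_carrD:
  assumes "T \<in> carr ell2_ops"
  shows "adjoint_pair T (cadj ell2_ops T)" "T (ell2_i x) = ell2_i (T x)"
  using assms ell2_ops_adj[of T] by (auto simp: ell2_ops_def)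

lemma ell2_ops_carrI: "adjoint_pair T S \<Longrightarrow> (\<And>x. T (ell2_i x) = ell2_i (T x)) \<Longrightarrow> T \<in> carr ell2_ops"
  by (auto simp: ell2_ops_def)

lemma adjoint_pair_i:
  assumes "adjoint_pair T S" "\<And>x. T (ell2_i x) = ell2_i (T x)"
  shows "S (ell2_i x) = ell2_i (S x)"
proof -
  have T: "inner (T z) y = inner z (S y)" for z y using assms(1) by (simp add: adjoint_pair_def)
  have "inner z (S (ell2_i x)) = inner z (ell2_i (S x))" for z
  proof -
    have "inner z (S (ell2_i x)) = - inner (ell2_i (T z)) x" by (simp add: inner_ell2_i flip: T)
    also have "\<dots> = - inner (ell2_i z) (S x)" unfolding assms(2)[symmetric] T ..
    finally show ?thesis by (simp add: inner_ell2_i)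
  qed
  then show ?thesis using vector_eq_ldot by blast
qed

lemma adjoint_pair_add: "adjoint_pair T S \<Longrightarrow> adjoint_pair T' S' \<Longrightarrow> adjoint_pair (T + T') (S + S')"
  by (simp add: adjoint_pair_def blinfun.bilinear_simps inner_add_left inner_add_right)

lemma adjoint_pair_diff: "adjoint_pair T S \<Longrightarrow> adjoint_pair T' S' \<Longrightarrow> adjoint_pair (T - T') (S - S')"
  by (simp add: adjoint_pair_def blinfun.bilinear_simps inner_diff_left inner_diff_right)

lemma adjoint_pair_comp: "adjoint_pair T S \<Longrightarrow> adjoint_pair T' S' \<Longrightarrow> adjoint_pair (T o\<^sub>L T') (S' o\<^sub>L S)"
  by (simp add: adjoint_pair_def)

lemma adjoint_pair_scale:
  assumes "adjoint_pair T S" "\<And>x. T (ell2_i x) = ell2_i (T x)"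
  shows "adjoint_pair (cscale ell2_ops c T) (cscale ell2_ops (cnj c) S)"
proof -
  have "inner (ell2_i (T x)) y = - inner x (ell2_i (S y))" for x y
    using assms(1) adjoint_pair_i[OF assms] inner_ell2_i[of "T x" y] by (simp add: adjoint_pair_def)
  then show ?thesis
    using assms(1)
    by (simp add: adjoint_pair_def ell2_ops_scale inner_add_left inner_diff_right inner_add_right)
qed

lemma ell2_ops_closed:
  assumes "S \<in> carr ell2_ops" "T \<in> carr ell2_ops"
  shows "S + T \<in> carr ell2_ops" "S o\<^sub>L T \<in> carr ell2_ops" "cscale ell2_ops c T \<in> carr ell2_ops"
    "cadj ell2_ops T \<in> carr ell2_ops" "S - T \<in> carr ell2_ops"
proof -
  note S = ell2_ops_carrD[OF assms(1)] and T = ell2_ops_carrD[OF assms(2)]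
  show "S + T \<in> carr ell2_ops"
    by (rule ell2_ops_carrI[OF adjoint_pair_add[OF S(1) T(1)]]) (simp add: S(2) T(2) blinfun.bilinear_simps)
  show "S - T \<in> carr ell2_ops"
    by (rule ell2_ops_carrI[OF adjoint_pair_diff[OF S(1) T(1)]]) (simp add: S(2) T(2) blinfun.bilinear_simps)
  show "S o\<^sub>L T \<in> carr ell2_ops"
    by (rule ell2_ops_carrI[OF adjoint_pair_comp[OF S(1) T(1)]]) (simp add: S(2) T(2))
  show "cscale ell2_ops c T \<in> carr ell2_ops"
    by (rule ell2_ops_carrI[OF adjoint_pair_scale[OF T]]) (simp add: T(2) ell2_ops_scale blinfun.bilinear_simps)
  show "cadj ell2_ops T \<in> carr ell2_ops"
    by (rule ell2_ops_carrI[OF adjoint_pair_sym[OF T(1)]]) (rule adjoint_pair_i[OF T])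
qed

lemma ell2_ops_algebra: "cstar_algebra (ell2_ops :: ('s ell2 \<Rightarrow>\<^sub>L 's ell2) cstar)"
proof
  let ?A = "ell2_ops :: ('s ell2 \<Rightarrow>\<^sub>L 's ell2) cstar"
  show "czero ?A \<in> carr ?A"
    by (simp, rule ell2_ops_carrI[of 0 0]) (auto simp: adjoint_pair_def blinfun.bilinear_simps)
  fix S T assume S: "S \<in> carr ?A" and T: "T \<in> carr ?A"
  show "cadd ?A S T \<in> carr ?A" "cmult ?A S T \<in> carr ?A" using ell2_ops_closed[OF S T] by simp_all
  show "cadd ?A S T = cadd ?A T S" by simp
  show "cadj ?A (cadd ?A S T) = cadd ?A (cadj ?A S) (cadj ?A T)"
    using adjoint_pair_add[OF ell2_ops_carrD(1)[OF S] ell2_ops_carrD(1)[OF T]] by (simp add: ell2_ops_adj)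
  show "cadj ?A (cmult ?A S T) = cmult ?A (cadj ?A T) (cadj ?A S)"
    using adjoint_pair_comp[OF ell2_ops_carrD(1)[OF S] ell2_ops_carrD(1)[OF T]] by (simp add: ell2_ops_adj)
  show "cnorm ?A (cadd ?A S T) \<le> cnorm ?A S + cnorm ?A T" by (simp add: norm_triangle_ineq)
  show "cnorm ?A (cmult ?A S T) \<le> cnorm ?A S * cnorm ?A T" by (simp add: norm_blinfun_compose)
  fix c
  show "cscale ?A c (cadd ?A S T) = cadd ?A (cscale ?A c S) (cscale ?A c T)"
    by (intro blinfun_eqI ell2_eqI) (simp add: coord_ell2_ops_scale coord_simps blinfun.bilinear_simps algebra_simps)
  show "cmult ?A (cscale ?A c S) T = cscale ?A c (cmult ?A S T)"
    by (intro blinfun_eqI ell2_eqI) (simp add: coord_ell2_ops_scale)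
  show "cmult ?A S (cscale ?A c T) = cscale ?A c (cmult ?A S T)"
    by (intro blinfun_eqI) (simp add: ell2_ops_scale blinfun.bilinear_simps ell2_ops_carrD(2)[OF S])
  fix R assume "R \<in> carr ?A"
  show "cadd ?A (cadd ?A S T) R = cadd ?A S (cadd ?A T R)" by (simp add: add.assoc)
  show "cmult ?A (cmult ?A S T) R = cmult ?A S (cmult ?A T R)" by (intro blinfun_eqI) simp
  show "cmult ?A (cadd ?A S T) R = cadd ?A (cmult ?A S R) (cmult ?A T R)"
    by (intro blinfun_eqI) (simp add: blinfun.bilinear_simps)
  show "cmult ?A S (cadd ?A T R) = cadd ?A (cmult ?A S T) (cmult ?A S R)"
    by (intro blinfun_eqI) (simp add: blinfun.bilinear_simps)
next
  let ?A = "ell2_ops :: ('s ell2 \<Rightarrow>\<^sub>L 's ell2) cstar"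
  fix T assume T: "T \<in> carr ?A"
  note D = ell2_ops_carrD[OF T]
  show "cadj ?A T \<in> carr ?A" using ell2_ops_closed(4)[OF T T] .
  show "cadd ?A T (czero ?A) = T" by simp
  show "cdiff ?A T T = czero ?A" by (simp add: ell2_ops_diff)
  show "cscale ?A 1 T = T" by (intro blinfun_eqI ell2_eqI) (simp add: coord_ell2_ops_scale)
  show "cadj ?A (cadj ?A T) = T" by (rule ell2_ops_adj[OF adjoint_pair_sym[OF D(1)]])
  show "0 \<le> cnorm ?A T" "cnorm ?A T = 0 \<longleftrightarrow> T = czero ?A" by simp_all
  show "cnorm ?A (cmult ?A (cadj ?A T) T) = (cnorm ?A T)\<^sup>2"
  proof (rule antisym)
    let ?S = "cadj ?A T"
    have "norm (?S o\<^sub>L T) \<le> norm ?S * norm T" by (rule norm_blinfun_compose)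
    then show "cnorm ?A (cmult ?A ?S T) \<le> (cnorm ?A T)\<^sup>2"
      by (simp add: adjoint_pair_norm[OF D(1)] power2_eq_square)
    \<comment> \<open>Cauchy-Schwarz applied to |T x|^2 = <x, T* T x> gives the remaining half of
      the C*-identity.\<close>
    have "norm T \<le> sqrt (norm (?S o\<^sub>L T))"
    proof (rule norm_blinfun_bound)
      fix x
      have "(norm (T x))\<^sup>2 = inner x ((?S o\<^sub>L T) x)"
        using D(1) by (simp add: adjoint_pair_def power2_norm_eq_inner)
      also have "\<dots> \<le> norm x * norm ((?S o\<^sub>L T) x)" by (rule norm_cauchy_schwarz)
      also have "\<dots> \<le> norm x * (norm (?S o\<^sub>L T) * norm x)" by (intro mult_left_mono norm_blinfun) simp
      also have "\<dots> = (sqrt (norm (?S o\<^sub>L T)) * norm x)\<^sup>2" by (simp add: power_mult_distrib power2_eq_square)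
      finally show "norm (T x) \<le> sqrt (norm (?S o\<^sub>L T)) * norm x"
        by (rule power2_le_imp_le) simp
    qed simp
    then have "(norm T)\<^sup>2 \<le> (sqrt (norm (?S o\<^sub>L T)))\<^sup>2" by (intro power_mono) auto
    then show "(cnorm ?A T)\<^sup>2 \<le> cnorm ?A (cmult ?A ?S T)" by simp
  qed
  fix c
  show closed: "cscale ?A c T \<in> carr ?A" using ell2_ops_closed(3)[OF T T] .
  show "cadj ?A (cscale ?A c T) = cscale ?A (cnj c) (cadj ?A T)"
    by (rule ell2_ops_adj[OF adjoint_pair_scale[OF D]])
  have nc: "norm (cscale ?A c T x) = cmod c * norm (T x)" for x
  proof -
    have "(norm (cscale ?A c T x))\<^sup>2 = (cmod c)\<^sup>2 * (norm (T x))\<^sup>2"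
      unfolding norm_ell2_sq coord_ell2_ops_scale norm_mult power_mult_distrib
      by (rule infsum_cmult_right) (rule coord_mem)
    then have "(norm (cscale ?A c T x))\<^sup>2 = (cmod c * norm (T x))\<^sup>2" by (simp add: power_mult_distrib)
    then show ?thesis by (rule power2_eq_imp_eq) simp_all
  qed
  show "cnorm ?A (cscale ?A c T) = cmod c * cnorm ?A T"
  proof (simp, rule antisym)
    show "norm (cscale ?A c T) \<le> cmod c * norm T"
      by (rule norm_blinfun_bound) (auto simp: nc mult.assoc intro!: mult_left_mono norm_blinfun)
    show "cmod c * norm T \<le> norm (cscale ?A c T)"
    proof (cases "c = 0")
      case False
      have "norm T \<le> norm (cscale ?A c T) / cmod c"
      proof (rule norm_blinfun_bound)
        fix x show "norm (T x) \<le> norm (cscale ?A c T) / cmod c * norm x"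
          using norm_blinfun[of "cscale ?A c T" x] False by (simp add: nc field_simps)
      qed simp
      then show ?thesis using False by (simp add: field_simps)
    qed simp
  qed
  fix d
  show "cscale ?A (c + d) T = cadd ?A (cscale ?A c T) (cscale ?A d T)"
    by (intro blinfun_eqI ell2_eqI) (simp add: coord_ell2_ops_scale coord_simps blinfun.bilinear_simps algebra_simps)
  show "cscale ?A c (cscale ?A d T) = cscale ?A (c * d) T"
    by (intro blinfun_eqI ell2_eqI) (simp add: coord_ell2_ops_scale)
next
  let ?A = "ell2_ops :: ('s ell2 \<Rightarrow>\<^sub>L 's ell2) cstar"
  fix f :: "nat \<Rightarrow> 's ell2 \<Rightarrow>\<^sub>L 's ell2"
  assume f: "\<And>n. f n \<in> carr ?A"
    and cauchy: "\<And>\<epsilon>. \<epsilon> > 0 \<Longrightarrow> \<exists>N. \<forall>m\<ge>N. \<forall>n\<ge>N. cnorm ?A (cdiff ?A (f m) (f n)) < \<epsilon>"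
  note D = ell2_ops_carrD[OF f]
  have fC: "Cauchy f" using cauchy by (simp add: Cauchy_def dist_norm ell2_ops_diff)
  let ?g = "\<lambda>n. cadj ?A (f n)"
  \<comment> \<open>Taking adjoints preserves norms, so the adjoints form a Cauchy sequence too;
    their limit is an adjoint of the limit of \<open>f\<close>.\<close>
  have "norm (?g m - ?g n) = norm (f m - f n)" for m n
    by (rule adjoint_pair_norm[OF adjoint_pair_diff[OF D(1) D(1)]])
  then have gC: "Cauchy ?g" using fC by (simp add: Cauchy_def dist_norm)
  obtain T where T: "f \<longlonglongrightarrow> T" using fC Cauchy_convergent_iff convergent_def by blast
  obtain S where S: "?g \<longlonglongrightarrow> S" using gC Cauchy_convergent_iff convergent_def by blast
  have "adjoint_pair T S" unfolding adjoint_pair_def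
  proof (intro allI)
    fix x y
    have "(\<lambda>n. inner (f n x) y) \<longlonglongrightarrow> inner (T x) y" by (intro tendsto_intros T)
    moreover have "(\<lambda>n. inner x (?g n y)) \<longlonglongrightarrow> inner x (S y)" by (intro tendsto_intros S)
    moreover have "inner (f n x) y = inner x (?g n y)" for n using D(1) by (simp add: adjoint_pair_def)
    ultimately show "inner (T x) y = inner x (S y)" using LIMSEQ_unique by auto
  qed
  moreover have "T (ell2_i x) = ell2_i (T x)" for x
  proof (rule LIMSEQ_unique)
    show "(\<lambda>n. f n (ell2_i x)) \<longlonglongrightarrow> T (ell2_i x)" by (intro tendsto_intros T)
    show "(\<lambda>n. f n (ell2_i x)) \<longlonglongrightarrow> ell2_i (T x)" unfolding D(2) by (intro tendsto_intros T)
  qed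
  ultimately have "T \<in> carr ?A" by (rule ell2_ops_carrI)
  moreover have "(\<lambda>n. cnorm ?A (cdiff ?A (f n) T)) \<longlonglongrightarrow> 0"
    using T by (simp add: ell2_ops_diff tendsto_norm_zero LIM_zero)
  ultimately show "\<exists>l\<in>carr ?A. (\<lambda>n. cnorm ?A (cdiff ?A (f n) l)) \<longlonglongrightarrow> 0" by blast
qed

section \<open>The universal property of a graph algebra\<close>

lemma separable_in_lipschitz:
  assumes f: "\<And>x. x \<in> carr A \<Longrightarrow> f x \<in> carr B" and K: "0 \<le> K"
    and lip: "\<And>x y. x \<in> carr A \<Longrightarrow> y \<in> carr A \<Longrightarrow> cnorm B (cdiff B (f x) (f y)) \<le> K * cnorm A (cdiff A x y)"
    and S: "S \<subseteq> carr A" "separable_in A S"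
  shows "separable_in B (f ` S)"
proof -
  obtain d :: "nat \<Rightarrow> _" where d: "range d \<subseteq> carr A"
    "\<And>x e. x \<in> S \<Longrightarrow> e > 0 \<Longrightarrow> \<exists>n. cnorm A (cdiff A (d n) x) < e"
    using S(2) unfolding separable_in_def by metis
  show ?thesis
  proof (rule separable_inI[of "range (\<lambda>n. f (d n))"])
    fix y and e :: real assume y: "y \<in> f ` S" and e: "e > 0"
    then obtain x where x: "x \<in> S" "y = f x" by blast
    \<comment> \<open>The denominator \<open>K + 1\<close> also serves \<open>K = 0\<close> and
      makes the final inequality strict.\<close>
    obtain n where n: "cnorm A (cdiff A (d n) x) < e / (K + 1)" using d(2)[OF x(1), of "e / (K + 1)"] e K by auto
    have "cnorm B (cdiff B (f (d n)) y) \<le> K * cnorm A (cdiff A (d n) x)"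
      unfolding x(2) using lip d(1) x(1) S(1) by blast
    also have "\<dots> \<le> K * (e / (K + 1))" using n K by (intro mult_left_mono) auto
    also have "\<dots> < e" using e K by (simp add: field_simps)
    finally show "\<exists>d\<in>range (\<lambda>n. f (d n)). cnorm B (cdiff B d y) < e" by blast
  qed (use d(1) f in auto)
qed

lemma separable_in_contractive:
  assumes A: "cstar_algebra A" and f: "contractive_hom A B f" and S: "S \<subseteq> carr A" "separable_in A S"
  shows "separable_in B (f ` S)"
proof (rule separable_in_lipschitz[where K=1])
  have hom: "star_hom A B f" and le: "\<And>x. x \<in> carr A \<Longrightarrow> cnorm B (f x) \<le> cnorm A x"
    using f by (auto simp: contractive_hom_def)
  show "f x \<in> carr B" if "x \<in> carr A" for x using star_homD(1)[OF hom that] .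
  show "cnorm B (cdiff B (f x) (f y)) \<le> 1 * cnorm A (cdiff A x y)" if "x \<in> carr A" "y \<in> carr A" for x y
    using le[of "cdiff A x y"] cstar_algebra.diff_closed[OF A that] star_hom_diff[OF A hom that] by simp
qed (use S in auto)

lemma star_hom_generated:
  assumes "star_hom A B f" "f ` carr A \<subseteq> carr (cstar_generated B G)"
  shows "star_hom A (cstar_generated B G) f"
  using assms by (auto simp: star_hom_def)

lemma star_hom_into_prod:
  assumes "\<And>i. i \<in> I \<Longrightarrow> star_hom A (B i) (\<lambda>x. f x i)" "\<And>x. x \<in> carr A \<Longrightarrow> f x \<in> carr (cstar_prod I B)"
    "cstar_algebra A" "\<And>x. f x \<in> extensional I"
  shows "star_hom A (cstar_prod I B) f"
proof -
  note A = cstar_algebra.closed[OF assms(3)]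
  show ?thesis
    unfolding star_hom_def
    using assms(2) star_homD(2-5)[OF assms(1)]
    by (auto intro!: extensionalityI[of _ I] assms(4))
qed

lemma covariant_rep_comp:
  assumes B: "cstar_algebra B" and rep: "covariant_rep X B \<pi> \<tau>" and j: "star_hom B B' j"
  shows "covariant_rep X B' (\<lambda>a. j (\<pi> a)) (\<lambda>\<xi>. j (\<tau> \<xi>))"
proof -
  note j = star_homD[OF j]
  have T: "toeplitz_rep X B \<pi> \<tau>" using rep by (simp add: covariant_rep_def)
  then have \<pi>: "star_hom (coeff X) B \<pi>" and \<tau>: "\<And>\<xi>. \<xi> \<in> mcarr X \<Longrightarrow> \<tau> \<xi> \<in> carr B"
    and rel: "\<And>\<xi> \<eta>. \<xi> \<in> mcarr X \<Longrightarrow> \<eta> \<in> mcarr X \<Longrightarrow> \<tau> (madd X \<xi> \<eta>) = cadd B (\<tau> \<xi>) (\<tau> \<eta>)"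
      "\<And>c \<xi>. \<xi> \<in> mcarr X \<Longrightarrow> \<tau> (mscale X c \<xi>) = cscale B c (\<tau> \<xi>)"
      "\<And>a \<xi>. a \<in> carr (coeff X) \<Longrightarrow> \<xi> \<in> mcarr X \<Longrightarrow> \<tau> (mleft X a \<xi>) = cmult B (\<pi> a) (\<tau> \<xi>)"
      "\<And>\<xi> \<eta>. \<xi> \<in> mcarr X \<Longrightarrow> \<eta> \<in> mcarr X \<Longrightarrow> \<pi> (minner X \<xi> \<eta>) = cmult B (cadj B (\<tau> \<xi>)) (\<tau> \<eta>)"
    by (auto simp: toeplitz_rep_def)
  note \<tau>' = cstar_algebra.adj_closed[OF B \<tau>]
  have "toeplitz_rep X B' (\<lambda>a. j (\<pi> a)) (\<lambda>\<xi>. j (\<tau> \<xi>))"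
    unfolding toeplitz_rep_def
    using star_hom_comp[OF \<pi> assms(3)] star_homD(1)[OF \<pi>] \<tau> \<tau>' by (simp add: rel j)
  moreover obtain \<phi> where \<phi>: "star_hom (compact_ops X) B \<phi>"
    "\<And>\<xi> \<eta>. \<xi> \<in> mcarr X \<Longrightarrow> \<eta> \<in> mcarr X \<Longrightarrow> \<phi> (rank_one X \<xi> \<eta>) = cmult B (\<tau> \<xi>) (cadj B (\<tau> \<eta>))"
    "\<And>a. a \<in> katsura_ideal X \<Longrightarrow> \<phi> (left_op X a) = \<pi> a"
    using rep unfolding covariant_rep_def by metis
  have "star_hom (compact_ops X) B' (\<lambda>T. j (\<phi> T))" by (rule star_hom_comp[OF \<phi>(1) assms(3)])
  then show ?thesis
    unfolding covariant_rep_def using calculation \<phi>(2,3) \<tau> \<tau>'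
    by (intro conjI exI[of _ "\<lambda>T. j (\<phi> T)"]) (simp_all add: j)
qed

context toeplitz
begin

abbreviation "gens \<equiv> \<pi> ` cont_funs (verts E) \<union> \<tau> ` cont_funs (edges E)"
abbreviation "C \<equiv> cstar_generated B gens"

lemma gens_closed: "gens \<subseteq> carr B"
  using \<pi>_closed \<tau>_closed by auto

text \<open>\<open>\<pi>\<close> is contractive on the separable algebra C(E^0). All fibres have at
  most \<open>N\<close> edges, so the norm of \<open>\<tau> \<zeta>\<close> is at most sqrt N times
  the supremum norm, and separability of C(E^1) carries over as well.\<close>

lemma gens_separable: "separable_in B gens"
proof (rule separable_in_Un)
  show "separable_in B (\<pi> ` cont_funs (verts E))"
    by (rule separable_in_contractive[OF C0_algebra_algebra[OF spaces(1)] \<pi>_contractive])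
      (simp_all add: C0_algebra_carr spaces C0_algebra_separable)
  obtain N where N: "\<And>v. card (edges_from E v) \<le> N" using card_edges_from_bounded by blast
  let ?F = "C0_algebra (edges E)"
  interpret F: cstar_algebra ?F by (rule C0_algebra_algebra[OF spaces(2)])
  note carr = C0_algebra_carr[OF spaces(2)]
  have bound: "cnorm B (\<tau> \<zeta>) \<le> sqrt N * cnorm ?F \<zeta>" if \<zeta>: "\<zeta> \<in> cont_funs (edges E)" for \<zeta>
  proof (rule power2_le_imp_le)
    have "cnorm (C0_algebra (verts E)) (edge_inner \<zeta> \<zeta>) \<le> N * (cnorm ?F \<zeta>)\<^sup>2"
    proof (rule C0_algebra_norm_least)
      fix v
      have "cmod (edge_inner \<zeta> \<zeta> v) \<le> (\<Sum>e\<in>edges_from E v. cmod (cnj (\<zeta> e) * \<zeta> e))"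
        unfolding edge_inner_def fibre_sum_def by (rule norm_sum)
      also have "\<dots> \<le> (\<Sum>e\<in>edges_from E v. (cnorm ?F \<zeta>)\<^sup>2)"
        using C0_algebra_norm_upper[OF spaces(2) \<zeta>] F.norm_nonneg[of \<zeta>] \<zeta>
        by (intro sum_mono) (simp add: norm_mult power2_eq_square mult_mono carr)
      also have "\<dots> = card (edges_from E v) * (cnorm ?F \<zeta>)\<^sup>2" by simp
      also have "\<dots> \<le> N * (cnorm ?F \<zeta>)\<^sup>2" using N by (intro mult_right_mono) auto
      finally show "cmod (edge_inner \<zeta> \<zeta> v) \<le> N * (cnorm ?F \<zeta>)\<^sup>2" .
    qed
    then show "(cnorm B (\<tau> \<zeta>))\<^sup>2 \<le> (sqrt N * cnorm ?F \<zeta>)\<^sup>2"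
      using \<tau>_norm[OF \<zeta>] by (simp add: power_mult_distrib)
    show "0 \<le> sqrt N * cnorm ?F \<zeta>" using F.norm_nonneg[of \<zeta>] \<zeta> by (simp add: carr)
  qed
  show "separable_in B (\<tau> ` cont_funs (edges E))"
  proof (rule separable_in_lipschitz[of ?F \<tau> B "sqrt N"])
    fix \<xi> \<eta> assume "\<xi> \<in> carr ?F" "\<eta> \<in> carr ?F"
    then have c: "\<xi> \<in> cont_funs (edges E)" "\<eta> \<in> cont_funs (edges E)" by (auto simp: carr)
    have m: "(\<lambda>e. (-1) * \<eta> e) \<in> cont_funs (edges E)" using cont_funs_closed(4)[OF c(2) c(2)] .
    have "cdiff B (\<tau> \<xi>) (\<tau> \<eta>) = \<tau> (\<lambda>e. \<xi> e - \<eta> e)"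
      using \<tau>_add[OF c(1) m] \<tau>_scale[OF c(2), of "-1"] by (simp add: cdiff_def)
    then show "cnorm B (cdiff B (\<tau> \<xi>) (\<tau> \<eta>)) \<le> sqrt N * cnorm ?F (cdiff ?F \<xi> \<eta>)"
      using bound[OF cont_funs_closed(2)[OF c]] by simp
  qed (use \<tau>_closed C0_algebra_separable[OF spaces(2,6)] in \<open>auto simp: carr\<close>)
qed

lemma generated_algebra: "cstar_algebra C"
  by (rule cstar_generated_algebra[OF B.cstar_algebra_axioms gens_closed])

text \<open>A representation on a large algebra, such as all operators on a Hilbert space, may be
  cut down to what it generates; that algebra fits into the carrier type of any universal
  construction.\<close>

lemma generated_embedding:
  obtains j :: "'b \<Rightarrow> 'g univ" where "inj_on j (carr C)"
proof -
  have "carr C \<subseteq> carr B"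
    by (rule closed_star_subalgebraD(1)[OF closed_star_subalgebra_generated[OF B.cstar_algebra_axioms gens_closed]])
  moreover have "separable_in B (carr C)"
    by (rule separable_in_generated[OF B.cstar_algebra_axioms gens_closed gens_separable])
  ultimately show thesis
    using separable_in_embedding[OF B.cstar_algebra_axioms] that by blast
qed

lemma generated_toeplitz: "toeplitz E C \<pi> \<tau>"
proof -
  have sub: "gens \<subseteq> carr C" by (rule generated_superset)
  have "star_hom (C0_algebra (verts E)) C \<pi>"
    by (rule star_hom_generated[OF \<pi>_hom]) (use sub in \<open>simp add: C0_algebra_carr spaces\<close>)
  then have "toeplitz_rep X C \<pi> \<tau>"
    using rep sub unfolding toeplitz_rep_def by auto
  then show ?thesis
    unfolding toeplitz_def toeplitz_axioms_def
    using compact_topological_graph_axioms generated_algebra by blast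
qed

lemma generated_unit: "cstar_unit C (\<pi> (indicator V))"
proof (rule generated_unit[OF B.cstar_algebra_axioms gens_closed])
  let ?one = "indicator V :: 'v \<Rightarrow> complex"
  have one: "?one \<in> cont_funs (verts E)" by (rule indicator_cont_funs)
  show "\<pi> ?one \<in> carr C" using generated_superset[of gens B] one by blast
  have "(\<lambda>v. cnj (?one v)) = ?one" by (auto simp: fun_eq_iff indicator_def)
  then show "cadj B (\<pi> ?one) = \<pi> ?one" using \<pi>_adj[OF one] by simp
  fix x assume "x \<in> gens"
  then consider a where "a \<in> cont_funs (verts E)" "x = \<pi> a" | \<xi> where "\<xi> \<in> cont_funs (edges E)" "x = \<tau> \<xi>" by blast
  then show "cmult B (\<pi> ?one) x = x \<and> cmult B x (\<pi> ?one) = x"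
  proof cases
    case 1
    have "(\<lambda>v. ?one v * a v) = a" "(\<lambda>v. a v * ?one v) = a"
      using 1(1) by (auto simp: fun_eq_iff cont_funs_def indicator_def)
    then show ?thesis using \<pi>_mult[OF one 1(1)] \<pi>_mult[OF 1(1) one] 1(2) by simp
  next
    case 2
    have "(\<lambda>e. ?one (r e) * \<xi> e) = \<xi>" "(\<lambda>e. \<xi> e * ?one (s e)) = \<xi>"
      using 2(1) src_V rng_V by (auto simp: fun_eq_iff cont_funs_def indicator_def)
    then show ?thesis using \<tau>_left[OF one 2(1)] \<tau>_right[OF one 2(1)] 2(2) by simp
  qed
qed

end

section \<open>The graph algebra as a universal algebra\<close>

context compact_topological_graph
begin

abbreviation "R \<equiv> cuntz_pimsner_reps X"

lemma toeplitz_of_rep: "i \<in> R \<Longrightarrow> toeplitz E (fst i) (\<lambda>a. snd i (Inl a)) (\<lambda>\<xi>. snd i (Inr \<xi>))"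
  using compact_topological_graph_axioms
  by (auto simp: toeplitz_def toeplitz_axioms_def cuntz_pimsner_reps_def covariant_rep_def)

lemma universal_family: "universal_family (carr (coeff X) <+> mcarr X) R"
proof -
  define Z :: "(('v \<Rightarrow> complex) + ('e \<Rightarrow> complex)) univ cstar" where
    "Z = \<lparr>carr = {undefined}, cadd = \<lambda>_ _. undefined, czero = undefined, cscale = \<lambda>_ _. undefined,
      cmult = \<lambda>_ _. undefined, cadj = \<lambda>_. undefined, cnorm = \<lambda>_. 0\<rparr>"
  have "covariant_rep X Z (\<lambda>_. undefined) (\<lambda>_. undefined)"
    by (auto simp: covariant_rep_def toeplitz_rep_def star_hom_def Z_def intro!: exI[of _ "\<lambda>_. undefined"])
  then have "(Z, \<lambda>_. undefined) \<in> R"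
    using cstar_trivial[of undefined] by (simp add: cuntz_pimsner_reps_def Z_def)
  then have ne: "R \<noteq> {}" by blast
  have alg: "cstar_algebra (fst i)" if "i \<in> R" for i using that by (auto simp: cuntz_pimsner_reps_def)
  have closed: "snd i g \<in> carr (fst i)" if "i \<in> R" "g \<in> carr (coeff X) <+> mcarr X" for i g
    using that(2) toeplitz.\<pi>_closed[OF toeplitz_of_rep[OF that(1)]] toeplitz.\<tau>_closed[OF toeplitz_of_rep[OF that(1)]]
    by (auto simp: C0_algebra_carr spaces)
  have bounded: "\<exists>K. \<forall>i\<in>R. cnorm (fst i) (snd i g) \<le> K" if g: "g \<in> carr (coeff X) <+> mcarr X" for g
  proof (cases g)
    case (Inl a)
    then have a: "a \<in> carr (C0_algebra (verts E))" using g by auto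
    have "cnorm (fst i) (snd i g) \<le> cnorm (C0_algebra (verts E)) a" if "i \<in> R" for i
      using toeplitz.\<pi>_contractive[OF toeplitz_of_rep[OF that]] a Inl by (simp add: contractive_hom_def)
    then show ?thesis by blast
  next
    case (Inr \<xi>)
    then have \<xi>: "\<xi> \<in> cont_funs (edges E)" using g by auto
    have "cnorm (fst i) (snd i g) \<le> sqrt (cnorm (C0_algebra (verts E)) (edge_inner \<xi> \<xi>))" if "i \<in> R" for i
      using toeplitz.\<tau>_norm[OF toeplitz_of_rep[OF that] \<xi>] Inr by (simp add: real_le_rsqrt)
    then show ?thesis by blast
  qed
  show ?thesis unfolding universal_family_def using ne alg closed bounded by blast
qed

sublocale U: universal_family "carr (coeff X) <+> mcarr X" R
  by (rule universal_family)

lemma graph_algebra_eq: "graph_algebra E = U.U"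
  by (simp add: graph_algebra_def cuntz_pimsner_def)

text \<open>Only the Toeplitz relations are lifted to the product. Covariance is used coordinate by
  coordinate where it is needed, in \<open>graph_algebra_crossed\<close>.\<close>

lemma universal_toeplitz: "toeplitz E U.P (cp_coeff X) (cp_module X)"
proof -
  note T = toeplitz_of_rep
  have gen: "cp_coeff X a \<in> carr U.P" if "a \<in> cont_funs (verts E)" for a
    using U.gens_closed that by (auto simp: cp_coeff_def C0_algebra_carr spaces)
  have gen': "cp_module X \<xi> \<in> carr U.P" if "\<xi> \<in> cont_funs (edges E)" for \<xi>
    using U.gens_closed that by (auto simp: cp_module_def)
  have ext: "cp_coeff X a \<in> extensional R" "cp_module X \<xi> \<in> extensional R" for a \<xi>
    by (simp_all add: cp_coeff_def cp_module_def universal_gen_def)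
  have at: "cp_coeff X a i = snd i (Inl a)" "cp_module X \<xi> i = snd i (Inr \<xi>)" if "i \<in> R" for i a \<xi>
    using that by (simp_all add: cp_coeff_def cp_module_def universal_gen_def)
  have "star_hom (C0_algebra (verts E)) U.P (cp_coeff X)"
  proof (rule star_hom_into_prod)
    show "star_hom (C0_algebra (verts E)) (fst i) (\<lambda>a. cp_coeff X a i)" if "i \<in> R" for i
      using toeplitz.\<pi>_hom[OF T[OF that]] that by (simp add: at)
  qed (use gen ext C0_algebra_algebra[OF spaces(1)] in \<open>auto simp: C0_algebra_carr spaces\<close>)
  moreover have "cp_module X (\<lambda>e. \<xi> e + \<eta> e) = cadd U.P (cp_module X \<xi>) (cp_module X \<eta>)"
    if "\<xi> \<in> cont_funs (edges E)" "\<eta> \<in> cont_funs (edges E)" for \<xi> \<eta>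
    by (rule extensionalityI[of _ R]) (use that toeplitz.\<tau>_add[OF T] in \<open>auto simp: ext at\<close>)
  moreover have "cp_module X (\<lambda>e. c * \<xi> e) = cscale U.P c (cp_module X \<xi>)"
    if "\<xi> \<in> cont_funs (edges E)" for c \<xi>
    by (rule extensionalityI[of _ R]) (use that toeplitz.\<tau>_scale[OF T] in \<open>auto simp: ext at\<close>)
  moreover have "cp_module X (\<lambda>e. a (r e) * \<xi> e) = cmult U.P (cp_coeff X a) (cp_module X \<xi>)"
    if "a \<in> cont_funs (verts E)" "\<xi> \<in> cont_funs (edges E)" for a \<xi>
    by (rule extensionalityI[of _ R]) (use that toeplitz.\<tau>_left[OF T] in \<open>auto simp: ext at\<close>)
  moreover have "cmult U.P (cadj U.P (cp_module X \<xi>)) (cp_module X \<eta>) = cp_coeff X (edge_inner \<xi> \<eta>)"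
    if "\<xi> \<in> cont_funs (edges E)" "\<eta> \<in> cont_funs (edges E)" for \<xi> \<eta>
    by (rule extensionalityI[of _ R]) (use that toeplitz.\<tau>_inner[OF T] in \<open>auto simp: ext at\<close>)
  ultimately have "toeplitz_rep X U.P (cp_coeff X) (cp_module X)"
    using gen' unfolding toeplitz_rep_def minner_eq by (simp add: C0_algebra_carr spaces)
  then show ?thesis
    unfolding toeplitz_def toeplitz_axioms_def
    using compact_topological_graph_axioms U.prod_algebra by blast
qed

lemma graph_algebra_generated:
  "graph_algebra E = cstar_generated U.P (cp_coeff X ` cont_funs (verts E) \<union> cp_module X ` cont_funs (edges E))"
proof -
  have "universal_gen R ` (carr (coeff X) <+> mcarr X)
      = cp_coeff X ` cont_funs (verts E) \<union> cp_module X ` cont_funs (edges E)"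
    by (auto simp: cp_coeff_def cp_module_def C0_algebra_carr spaces image_iff Plus_def)
  then show ?thesis by (simp only: graph_algebra_eq universal_cstar_def)
qed

lemma graph_algebra_toeplitz: "toeplitz E (graph_algebra E) (cp_coeff X) (cp_module X)"
  unfolding graph_algebra_generated by (rule toeplitz.generated_toeplitz[OF universal_toeplitz])

lemma graph_algebra_unit: "cstar_unit (graph_algebra E) (cp_coeff X (indicator V))"
  unfolding graph_algebra_generated by (rule toeplitz.generated_unit[OF universal_toeplitz])

lemma graph_algebra_embedding:
  obtains j :: "_ \<Rightarrow> 'g univ" where "inj_on j (carr (graph_algebra E))"
  unfolding graph_algebra_generated by (rule toeplitz.generated_embedding[OF universal_toeplitz])

lemma graph_algebra_hom:
  fixes j :: "'b \<Rightarrow> (('v \<Rightarrow> complex) + ('e \<Rightarrow> complex)) univ"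
  assumes C: "cstar_algebra C" and cov: "covariant_rep X C \<pi> \<tau>" and j: "inj_on j (carr C)"
  obtains F where "contractive_hom (graph_algebra E) C F"
    "\<And>a. a \<in> cont_funs (verts E) \<Longrightarrow> F (cp_coeff X a) = \<pi> a"
    "\<And>\<xi>. \<xi> \<in> cont_funs (edges E) \<Longrightarrow> F (cp_module X \<xi>) = \<tau> \<xi>"
proof -
  interpret toeplitz E C \<pi> \<tau>
    using compact_topological_graph_axioms C cov by (simp add: toeplitz_def toeplitz_axioms_def covariant_rep_def)
  define \<rho> where "\<rho> = case_sum \<pi> \<tau>"
  have "(cstar_transport j C, \<lambda>g. j (\<rho> g)) \<in> R"
    using cstar_transport[OF C j] covariant_rep_comp[OF C cov cstar_transport_hom[OF j]]
    by (simp add: cuntz_pimsner_reps_def \<rho>_def)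
  moreover have "\<rho> g \<in> carr C" if "g \<in> carr (coeff X) <+> mcarr X" for g
    using that \<pi>_closed \<tau>_closed by (auto simp: \<rho>_def C0_algebra_carr spaces)
  ultimately obtain F where F: "contractive_hom U.U C F"
    "\<And>g. g \<in> carr (coeff X) <+> mcarr X \<Longrightarrow> F (universal_gen R g) = \<rho> g"
    using U.universal_hom[OF C j] by blast
  show thesis
  proof
    show "contractive_hom (graph_algebra E) C F" using F(1) by (simp add: graph_algebra_eq)
    show "F (cp_coeff X a) = \<pi> a" if "a \<in> cont_funs (verts E)" for a
      using F(2)[of "Inl a"] that by (simp add: InlI cp_coeff_def \<rho>_def C0_algebra_carr spaces)
    show "F (cp_module X \<xi>) = \<tau> \<xi>" if "\<xi> \<in> cont_funs (edges E)" for \<xi>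
      using F(2)[of "Inr \<xi>"] that by (simp add: InrI cp_module_def \<rho>_def)
  qed
qed

text \<open>The normalization of \<open>\<xi>\<close> makes its image an isometry already in the
  graph algebra. Finiteness is applied there, and the resulting identity is carried to
  \<open>C\<close> by the homomorphism from the universal property.\<close>

lemma finite_graph_algebra_unitary:
  fixes j :: "'b \<Rightarrow> (('v \<Rightarrow> complex) + ('e \<Rightarrow> complex)) univ"
  assumes fin: "cstar_finite (graph_algebra E)" and C: "cstar_algebra C" and rep: "covariant_rep X C \<pi> \<tau>"
    and j: "inj_on j (carr C)"
    and \<xi>: "\<xi> \<in> cont_funs (edges E)" "edge_inner \<xi> \<xi> = indicator V"
  shows "cmult C (\<tau> \<xi>) (cadj C (\<tau> \<xi>)) = \<pi> (indicator V)"
proof -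
  let ?A = "graph_algebra E" and ?v = "cp_module X \<xi>" and ?p = "cp_coeff X (indicator V)"
  interpret A: toeplitz E ?A "cp_coeff X" "cp_module X" by (rule graph_algebra_toeplitz)
  have v: "?v \<in> carr ?A" using A.\<tau>_closed[OF \<xi>(1)] .
  have "cmult ?A (cadj ?A ?v) ?v = ?p" using A.\<tau>_inner[OF \<xi>(1) \<xi>(1)] \<xi>(2) by simp
  then have "cstar_isometry ?A ?v" using v graph_algebra_unit by (simp add: cstar_isometry_def)
  then have "cstar_unitary ?A ?v" using fin by (simp add: cstar_finite_def)
  then have eq: "cmult ?A ?v (cadj ?A ?v) = ?p"
    using A.B.unit_unique[OF _ graph_algebra_unit] by (simp add: cstar_unitary_def)
  obtain F where F: "contractive_hom ?A C F" "\<And>a. a \<in> cont_funs (verts E) \<Longrightarrow> F (cp_coeff X a) = \<pi> a"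
    "\<And>\<xi>. \<xi> \<in> cont_funs (edges E) \<Longrightarrow> F (cp_module X \<xi>) = \<tau> \<xi>"
    by (rule graph_algebra_hom[OF C rep j]) blast
  have hom: "star_hom ?A C F" using F(1) by (simp add: contractive_hom_def)
  have "cmult C (F ?v) (cadj C (F ?v)) = F ?p"
    using star_homD(4)[OF hom v A.B.adj_closed[OF v]] star_homD(5)[OF hom v] eq by simp
  then show ?thesis using F(2)[OF indicator_cont_funs] F(3)[OF \<xi>(1)] by simp
qed

end

section \<open>Representations on path spaces\<close>

text \<open>A weighted composition operator, extended by 0 off \<open>D\<close>. Vertex functions
  will act with \<open>p = id\<close>, edge functions with the map that drops the first edge of a
  path.\<close>

definition weighted_comp :: "('s \<Rightarrow> complex) \<Rightarrow> ('s \<Rightarrow> 's) \<Rightarrow> 's set \<Rightarrow> ('s ell2 \<Rightarrow>\<^sub>L 's ell2)"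
  where "weighted_comp w p D = Blinfun (\<lambda>x. Abs_ell2 (\<lambda>k. if k \<in> D then w k * coord x (p k) else 0))"

text \<open>The adjoint of \<open>weighted_comp\<close> written out: each coordinate collects the
  fibre of \<open>p\<close> over it.\<close>

definition weighted_comp_adj :: "('s \<Rightarrow> complex) \<Rightarrow> ('s \<Rightarrow> 's) \<Rightarrow> 's set \<Rightarrow> ('s ell2 \<Rightarrow>\<^sub>L 's ell2)"
  where "weighted_comp_adj w p D = Blinfun (\<lambda>y. Abs_ell2 (\<lambda>k. \<Sum>l | l \<in> D \<and> p l = k. cnj (w l) * coord y l))"

text \<open>Bounded weights and fibres of at most \<open>N\<close> points make both operators
  bounded by K times sqrt N.\<close>

locale weighted_map =
  fixes w :: "'s \<Rightarrow> complex" and p :: "'s \<Rightarrow> 's" and D :: "'s set" and K :: real and N :: nat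
  assumes bound: "k \<in> D \<Longrightarrow> cmod (w k) \<le> K" and K: "0 \<le> K"
    and finite_fibre: "finite {l \<in> D. p l = k}" and card_fibre: "card {l \<in> D. p l = k} \<le> N"
begin

lemma coord_weighted_comp: "coord (weighted_comp w p D x) k = (if k \<in> D then w k * coord x (p k) else 0)"
  unfolding weighted_comp_def
proof (rule coord_Blinfun[where M="K * sqrt N"])
  fix x :: "'s ell2" and F :: "'s set" assume F: "finite F"
  have "(\<Sum>k\<in>F. (cmod (if k \<in> D then w k * coord x (p k) else 0))\<^sup>2)
      = (\<Sum>k\<in>F \<inter> D. (cmod (w k * coord x (p k)))\<^sup>2)"
    by (rule sum.mono_neutral_cong_right) (use F in auto)
  also have "\<dots> \<le> (\<Sum>k\<in>F \<inter> D. K\<^sup>2 * (cmod (coord x (p k)))\<^sup>2)"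
    using bound K by (intro sum_mono) (auto simp: norm_mult power_mult_distrib intro!: mult_right_mono power_mono)
  also have "\<dots> = K\<^sup>2 * (\<Sum>k\<in>F \<inter> D. (cmod (coord x (p k)))\<^sup>2)" by (simp add: sum_distrib_left)
  \<comment> \<open>Grouping the terms by their image under \<open>p\<close> repeats each coordinate
    of \<open>x\<close> at most \<open>N\<close> times.\<close>
  also have "(\<Sum>k\<in>F \<inter> D. (cmod (coord x (p k)))\<^sup>2)
      = (\<Sum>m\<in>p ` (F \<inter> D). \<Sum>k | k \<in> F \<inter> D \<and> p k = m. (cmod (coord x (p k)))\<^sup>2)"
    by (rule sum.image_gen) (use F in simp)
  also have "\<dots> = (\<Sum>m\<in>p ` (F \<inter> D). card {k. k \<in> F \<inter> D \<and> p k = m} * (cmod (coord x m))\<^sup>2)"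
    by (rule sum.cong) auto
  also have "\<dots> \<le> (\<Sum>m\<in>p ` (F \<inter> D). N * (cmod (coord x m))\<^sup>2)"
  proof (intro sum_mono mult_right_mono)
    fix m
    have "card {k. k \<in> F \<inter> D \<and> p k = m} \<le> card {l \<in> D. p l = m}"
      by (rule card_mono[OF finite_fibre]) auto
    then show "real (card {k. k \<in> F \<inter> D \<and> p k = m}) \<le> real N" using card_fibre[of m] by linarith
  qed simp
  also have "\<dots> = N * (\<Sum>m\<in>p ` (F \<inter> D). (cmod (coord x m))\<^sup>2)" by (simp add: sum_distrib_left)
  also have "\<dots> \<le> N * (norm x)\<^sup>2" using F by (intro mult_left_mono ell2_sum_le_norm) auto
  finally show "(\<Sum>k\<in>F. (cmod (if k \<in> D then w k * coord x (p k) else 0))\<^sup>2) \<le> (K * sqrt N * norm x)\<^sup>2"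
    by (simp add: power_mult_distrib mult_left_mono)
qed (use K in \<open>auto simp: coord_simps algebra_simps\<close>)

lemma coord_weighted_comp_adj:
  "coord (weighted_comp_adj w p D y) k = (\<Sum>l | l \<in> D \<and> p l = k. cnj (w l) * coord y l)"
  unfolding weighted_comp_adj_def
proof (rule coord_Blinfun[where M="K * sqrt N"])
  fix x :: "'s ell2" and F :: "'s set" assume F: "finite F"
  have "(\<Sum>k\<in>F. (cmod (\<Sum>l | l \<in> D \<and> p l = k. cnj (w l) * coord x l))\<^sup>2)
      \<le> (\<Sum>k\<in>F. \<Sum>l | l \<in> D \<and> p l = k. N * K\<^sup>2 * (cmod (coord x l))\<^sup>2)"
  proof (rule sum_mono)
    fix k
    let ?L = "{l. l \<in> D \<and> p l = k}"
    have "cmod (\<Sum>l\<in>?L. cnj (w l) * coord x l) \<le> (\<Sum>l\<in>?L. cmod (cnj (w l) * coord x l))" by (rule norm_sum)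
    then have "(cmod (\<Sum>l\<in>?L. cnj (w l) * coord x l))\<^sup>2 \<le> (\<Sum>l\<in>?L. cmod (cnj (w l) * coord x l))\<^sup>2"
      by (intro power_mono) auto
    \<comment> \<open>Cauchy-Schwarz on one fibre, which has at most \<open>N\<close>
      points.\<close>
    also have "\<dots> \<le> (\<Sum>l\<in>?L. (cmod (cnj (w l) * coord x l))\<^sup>2) * card ?L"
      by (rule sum_squared_le_sum_of_squares)
    also have "\<dots> \<le> (\<Sum>l\<in>?L. K\<^sup>2 * (cmod (coord x l))\<^sup>2) * N"
      using card_fibre[of k] bound K
      by (intro mult_mono sum_mono sum_nonneg) (auto simp: norm_mult power_mult_distrib intro!: mult_right_mono power_mono)
    also have "\<dots> = (\<Sum>l\<in>?L. N * K\<^sup>2 * (cmod (coord x l))\<^sup>2)" by (simp add: sum_distrib_left sum_distrib_right mult_ac)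
    finally show "(cmod (\<Sum>l\<in>?L. cnj (w l) * coord x l))\<^sup>2 \<le> (\<Sum>l\<in>?L. N * K\<^sup>2 * (cmod (coord x l))\<^sup>2)" .
  qed
  also have "\<dots> = (\<Sum>l\<in>(\<Union>k\<in>F. {l. l \<in> D \<and> p l = k}). N * K\<^sup>2 * (cmod (coord x l))\<^sup>2)"
    by (rule sum.UNION_disjoint[symmetric]) (use F finite_fibre in auto)
  also have "\<dots> = N * K\<^sup>2 * (\<Sum>l\<in>(\<Union>k\<in>F. {l. l \<in> D \<and> p l = k}). (cmod (coord x l))\<^sup>2)"
    by (simp add: sum_distrib_left)
  also have "\<dots> \<le> N * K\<^sup>2 * (norm x)\<^sup>2"
    using F finite_fibre by (intro mult_left_mono ell2_sum_le_norm) auto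
  finally show "(\<Sum>k\<in>F. (cmod (\<Sum>l | l \<in> D \<and> p l = k. cnj (w l) * coord x l))\<^sup>2) \<le> (K * sqrt N * norm x)\<^sup>2"
    by (simp add: power_mult_distrib mult_ac)
qed (use K in \<open>auto simp: coord_simps algebra_simps sum.distrib sum_distrib_left\<close>)

lemma weighted_comp_adjoint: "adjoint_pair (weighted_comp w p D) (weighted_comp_adj w p D)"
  unfolding adjoint_pair_def
proof (intro allI)
  fix x y :: "'s ell2"
  define g where "g k = inner (w k * coord x (p k)) (coord y k)" for k
  let ?F = "\<lambda>k. {l. l \<in> D \<and> p l = k}"
  \<comment> \<open>Each point of \<open>D\<close> lies in exactly one fibre of \<open>p\<close>, so
    the sum over \<open>D\<close> becomes an iterated sum by the Fubini theorem for summable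
    families.\<close>
  have bij: "bij_betw snd (Sigma UNIV ?F) D"
    by (rule bij_betwI[where g="\<lambda>l. (p l, l)"]) auto
  have "(\<lambda>k. inner (coord (weighted_comp w p D x) k) (coord y k)) summable_on UNIV"
    by (rule Infinite_Sum.abs_summable_summable[OF inner_summable])
  then have "g summable_on D"
    by (subst (asm) summable_on_cong_neutral[where T=D and g=g]) (auto simp: g_def coord_weighted_comp)
  then have sum: "(\<lambda>q. g (snd q)) summable_on (Sigma UNIV ?F)"
    using summable_on_reindex_bij_betw[OF bij, of g] by simp
  have "inner (weighted_comp w p D x) y = infsum g D"
    unfolding inner_ell2_def by (rule infsum_cong_neutral) (auto simp: g_def coord_weighted_comp)
  also have "\<dots> = infsum (\<lambda>q. g (snd q)) (Sigma UNIV ?F)"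
    using infsum_reindex_bij_betw[OF bij, of g] by simp
  also have "\<dots> = (\<Sum>\<^sub>\<infinity>k. \<Sum>\<^sub>\<infinity>l\<in>?F k. g l)"
    using infsum_Sigma_banach[OF sum] by simp
  also have "\<dots> = inner x (weighted_comp_adj w p D y)"
    unfolding inner_ell2_def
  proof (rule infsum_cong)
    fix k
    have "(\<Sum>\<^sub>\<infinity>l\<in>?F k. g l) = (\<Sum>l\<in>?F k. g l)" using finite_fibre[of k] by simp
    also have "\<dots> = (\<Sum>l\<in>?F k. inner (coord x k) (cnj (w l) * coord y l))"
      by (rule sum.cong) (auto simp: g_def inner_complex_def algebra_simps)
    finally show "(\<Sum>\<^sub>\<infinity>l\<in>?F k. g l) = inner (coord x k) (coord (weighted_comp_adj w p D y) k)"
      by (simp add: coord_weighted_comp_adj inner_sum_right)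
  qed
  finally show "inner (weighted_comp w p D x) y = inner x (weighted_comp_adj w p D y)" .
qed

lemma weighted_comp_carr: "weighted_comp w p D \<in> carr ell2_ops"
  by (rule ell2_ops_carrI[OF weighted_comp_adjoint])
    (auto intro!: ell2_eqI simp: coord_weighted_comp coord_ell2_i)

lemma weighted_comp_cadj: "cadj ell2_ops (weighted_comp w p D) = weighted_comp_adj w p D"
  by (rule ell2_ops_adj[OF weighted_comp_adjoint])

end

section \<open>The representation on the square summable families over a set of paths\<close>

lemma csum_generated: "csum (cstar_generated A G) f n = csum A f n"
  by (induction n) auto

lemma coord_csum: "coord (csum ell2_ops f n x) k = (\<Sum>i<n. coord (f i x) k)"
  by (induction n) (auto simp: coord_simps blinfun.bilinear_simps)

text \<open>
  \<open>S\<close> is a set of paths, \<open>S1\<close> the paths of positive length; a path outside \<open>S1\<close> is a vertex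
  that receives no edge, where the covariance condition is void.
\<close>

locale path_model = compact_topological_graph E
  for E :: "('v, 'e) top_graph" +
  fixes S S1 :: "'s set" and first :: "'s \<Rightarrow> 'e" and tail :: "'s \<Rightarrow> 's" and base :: "'s \<Rightarrow> 'v"
  assumes base: "k \<in> S \<Longrightarrow> base k \<in> V"
    and S1: "k \<in> S1 \<Longrightarrow> k \<in> S \<and> tail k \<in> S \<and> first k \<in> W \<and> s (first k) = base (tail k) \<and> base k = r (first k)"
    and extend: "\<lbrakk>k \<in> S; e \<in> W; s e = base k\<rbrakk> \<Longrightarrow> \<exists>l\<in>S1. first l = e \<and> tail l = k"
    and path_eqI: "\<lbrakk>k \<in> S1; l \<in> S1; first k = first l; tail k = tail l\<rbrakk> \<Longrightarrow> k = l"
    and source: "\<lbrakk>k \<in> S; k \<notin> S1\<rbrakk> \<Longrightarrow> base k \<notin> r ` W"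
begin

text \<open>Prolonging a path \<open>k\<close> means choosing an edge whose source is
  \<open>base k\<close>. Sums over the paths with tail \<open>k\<close> thereby become fibre sums at
  \<open>base k\<close>.\<close>

lemma fibre_bij: "k \<in> S \<Longrightarrow> bij_betw first {l \<in> S1. tail l = k} (edges_from E (base k))"
  unfolding bij_betw_def
proof
  show "inj_on first {l \<in> S1. tail l = k}" by (auto simp: inj_on_def intro: path_eqI)
  show "first ` {l \<in> S1. tail l = k} = edges_from E (base k)" if "k \<in> S"
    using S1 extend[OF that] by (fastforce simp: edges_from_iff)
qed

lemma fibre_empty: "k \<notin> S \<Longrightarrow> {l \<in> S1. tail l = k} = {}"
  using S1 by auto

definition path_\<pi> :: "('v \<Rightarrow> complex) \<Rightarrow> 's ell2 \<Rightarrow>\<^sub>L 's ell2"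
  where "path_\<pi> a = weighted_comp (\<lambda>k. a (base k)) id S"

definition path_\<tau> :: "('e \<Rightarrow> complex) \<Rightarrow> 's ell2 \<Rightarrow>\<^sub>L 's ell2"
  where "path_\<tau> \<xi> = weighted_comp (\<lambda>k. \<xi> (first k)) tail S1"

lemma weighted_\<pi>:
  assumes "a \<in> cont_funs (verts E)"
  shows "weighted_map (\<lambda>k. a (base k)) id S (cnorm (C0_algebra (verts E)) a) 1"
proof
  have "{l \<in> S. id l = k} \<subseteq> {k}" for k by auto
  then show "finite {l \<in> S. id l = k}" "card {l \<in> S. id l = k} \<le> 1" for k
    using finite_subset[of _ "{k}"] card_mono[of "{k}" "{l \<in> S. id l = k}"] by auto
  show "cmod (a (base k)) \<le> cnorm (C0_algebra (verts E)) a" for k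
    by (rule C0_algebra_norm_upper[OF spaces(1) assms])
  show "0 \<le> cnorm (C0_algebra (verts E)) a"
    using cstar_algebra.norm_nonneg[OF C0_algebra_algebra[OF spaces(1)]] assms by (simp add: C0_algebra_carr spaces)
qed

lemma weighted_\<tau>:
  assumes "\<xi> \<in> cont_funs (edges E)"
  obtains N where "weighted_map (\<lambda>k. \<xi> (first k)) tail S1 (cnorm (C0_algebra (edges E)) \<xi>) N"
proof -
  obtain N where N: "\<And>v. finite (edges_from E v)" "\<And>v. card (edges_from E v) \<le> N"
    using card_edges_from_bounded by blast
  have fibre: "finite {l \<in> S1. tail l = k} \<and> card {l \<in> S1. tail l = k} \<le> N" for k
  proof (cases "k \<in> S")
    case True
    show ?thesis
      using bij_betw_finite[OF fibre_bij[OF True]] bij_betw_same_card[OF fibre_bij[OF True]] N by simp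
  next
    case False
    show ?thesis unfolding fibre_empty[OF False] by simp
  qed
  have "weighted_map (\<lambda>k. \<xi> (first k)) tail S1 (cnorm (C0_algebra (edges E)) \<xi>) N"
  proof
    show "cmod (\<xi> (first k)) \<le> cnorm (C0_algebra (edges E)) \<xi>" for k
      by (rule C0_algebra_norm_upper[OF spaces(2) assms])
    show "0 \<le> cnorm (C0_algebra (edges E)) \<xi>"
      using cstar_algebra.norm_nonneg[OF C0_algebra_algebra[OF spaces(2)]] assms by (simp add: C0_algebra_carr spaces)
  qed (use fibre in auto)
  then show thesis by (rule that)
qed

lemma coord_\<pi>: "a \<in> cont_funs (verts E) \<Longrightarrow> coord (path_\<pi> a x) k = (if k \<in> S then a (base k) * coord x k else 0)"
  unfolding path_\<pi>_def by (subst weighted_map.coord_weighted_comp[OF weighted_\<pi>]) auto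

lemma coord_\<tau>: "\<xi> \<in> cont_funs (edges E) \<Longrightarrow> coord (path_\<tau> \<xi> x) k = (if k \<in> S1 then \<xi> (first k) * coord x (tail k) else 0)"
  unfolding path_\<tau>_def by (rule weighted_\<tau>) (auto simp: weighted_map.coord_weighted_comp)

lemma coord_\<tau>_adj: "\<xi> \<in> cont_funs (edges E)
    \<Longrightarrow> coord (cadj ell2_ops (path_\<tau> \<xi>) x) k = (\<Sum>l | l \<in> S1 \<and> tail l = k. cnj (\<xi> (first l)) * coord x l)"
  unfolding path_\<tau>_def
  by (rule weighted_\<tau>)
    (auto simp: weighted_map.coord_weighted_comp_adj weighted_map.weighted_comp_cadj)

lemma carr_\<pi>: "a \<in> cont_funs (verts E) \<Longrightarrow> path_\<pi> a \<in> carr ell2_ops"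
  unfolding path_\<pi>_def by (rule weighted_map.weighted_comp_carr[OF weighted_\<pi>])

lemma carr_\<tau>: "\<xi> \<in> cont_funs (edges E) \<Longrightarrow> path_\<tau> \<xi> \<in> carr ell2_ops"
  unfolding path_\<tau>_def by (rule weighted_\<tau>) (auto intro: weighted_map.weighted_comp_carr)

lemma adj_\<pi>:
  assumes a: "a \<in> cont_funs (verts E)"
  shows "cadj ell2_ops (path_\<pi> a) = path_\<pi> (\<lambda>v. cnj (a v))"
proof (intro blinfun_eqI ell2_eqI)
  fix x k
  have ca: "(\<lambda>v. cnj (a v)) \<in> cont_funs (verts E)" using cont_funs_closed(5)[OF a a] .
  have "{l \<in> S. id l = k} = (if k \<in> S then {k} else {})" by auto
  then show "coord (cadj ell2_ops (path_\<pi> a) x) k = coord (path_\<pi> (\<lambda>v. cnj (a v)) x) k"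
    unfolding coord_\<pi>[OF ca] unfolding path_\<pi>_def
    by (simp add: weighted_map.weighted_comp_cadj[OF weighted_\<pi>[OF a]]
        weighted_map.coord_weighted_comp_adj[OF weighted_\<pi>[OF a]])
qed

lemma fibre_sum_path:
  assumes "k \<in> S"
  shows "(\<Sum>l | l \<in> S1 \<and> tail l = k. f (first l)) = fibre_sum f (base k)"
  unfolding fibre_sum_def using sum.reindex_bij_betw[OF fibre_bij[OF assms], of f] by simp

lemma path_toeplitz: "toeplitz E ell2_ops path_\<pi> path_\<tau>"
proof -
  have hom: "star_hom (C0_algebra (verts E)) ell2_ops path_\<pi>"
    unfolding star_hom_def C0_algebra_carr[OF spaces(1)]
  proof (intro conjI ballI allI)
    fix a b c assume a: "a \<in> cont_funs (verts E)" and b: "b \<in> cont_funs (verts E)"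
    show "path_\<pi> (cadd (C0_algebra (verts E)) a b) = cadd ell2_ops (path_\<pi> a) (path_\<pi> b)"
      by (intro blinfun_eqI ell2_eqI)
        (simp add: a b coord_\<pi> cont_funs_closed(1) coord_simps blinfun.bilinear_simps algebra_simps)
    show "path_\<pi> (cmult (C0_algebra (verts E)) a b) = cmult ell2_ops (path_\<pi> a) (path_\<pi> b)"
      by (intro blinfun_eqI ell2_eqI) (simp add: a b coord_\<pi> cont_funs_closed(3))
  next
    fix a c assume a: "a \<in> cont_funs (verts E)"
    show "path_\<pi> a \<in> carr ell2_ops" by (rule carr_\<pi>[OF a])
    show "path_\<pi> (cadj (C0_algebra (verts E)) a) = cadj ell2_ops (path_\<pi> a)" by (simp add: adj_\<pi>[OF a])
    show "path_\<pi> (cscale (C0_algebra (verts E)) c a) = cscale ell2_ops c (path_\<pi> a)"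
      by (intro blinfun_eqI ell2_eqI)
        (simp add: coord_ell2_ops_scale coord_\<pi>[OF a] coord_\<pi>[OF cont_funs_closed(4)[OF a a]])
  qed
  have add: "path_\<tau> (\<lambda>e. \<xi> e + \<eta> e) = path_\<tau> \<xi> + path_\<tau> \<eta>"
    if "\<xi> \<in> cont_funs (edges E)" "\<eta> \<in> cont_funs (edges E)" for \<xi> \<eta>
    by (intro blinfun_eqI ell2_eqI)
      (simp add: that coord_\<tau> cont_funs_closed(1) coord_simps blinfun.bilinear_simps algebra_simps)
  have scale: "path_\<tau> (\<lambda>e. c * \<xi> e) = cscale ell2_ops c (path_\<tau> \<xi>)" if "\<xi> \<in> cont_funs (edges E)" for c \<xi>
    by (intro blinfun_eqI ell2_eqI)
      (simp add: coord_ell2_ops_scale coord_\<tau>[OF that] coord_\<tau>[OF cont_funs_closed(4)[OF that that]])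
  have left: "path_\<tau> (\<lambda>e. a (r e) * \<xi> e) = path_\<pi> a o\<^sub>L path_\<tau> \<xi>"
    if "a \<in> cont_funs (verts E)" "\<xi> \<in> cont_funs (edges E)" for a \<xi>
    by (intro blinfun_eqI ell2_eqI)
      (use S1 in \<open>auto simp: coord_\<tau>[OF left_cont[OF that]] coord_\<tau>[OF that(2)] coord_\<pi>[OF that(1)]\<close>)
  have inner: "cadj ell2_ops (path_\<tau> \<xi>) o\<^sub>L path_\<tau> \<eta> = path_\<pi> (edge_inner \<xi> \<eta>)"
    if \<xi>: "\<xi> \<in> cont_funs (edges E)" and \<eta>: "\<eta> \<in> cont_funs (edges E)" for \<xi> \<eta>
  proof (intro blinfun_eqI ell2_eqI)
    fix x k
    \<comment> \<open>All paths in the sum have the same tail \<open>k\<close>, so the coordinate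
      factors out and leaves the inner product at \<open>base k\<close>.\<close>
    have "coord ((cadj ell2_ops (path_\<tau> \<xi>) o\<^sub>L path_\<tau> \<eta>) x) k
        = (\<Sum>l | l \<in> S1 \<and> tail l = k. cnj (\<xi> (first l)) * \<eta> (first l)) * coord x k"
      by (simp add: coord_\<tau>_adj[OF \<xi>] coord_\<tau>[OF \<eta>] sum_distrib_right mult.assoc)
    also have "\<dots> = coord (path_\<pi> (edge_inner \<xi> \<eta>) x) k"
    proof (cases "k \<in> S")
      case True
      then show ?thesis
        unfolding coord_\<pi>[OF inner_closed[OF \<xi> \<eta>]]
        using fibre_sum_path[OF True, of "\<lambda>e. cnj (\<xi> e) * \<eta> e"] by (simp add: edge_inner_def)
    next
      case False
      then show ?thesis unfolding coord_\<pi>[OF inner_closed[OF \<xi> \<eta>]] fibre_empty[OF False] by simp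
    qed
    finally show "coord ((cadj ell2_ops (path_\<tau> \<xi>) o\<^sub>L path_\<tau> \<eta>) x) k = coord (path_\<pi> (edge_inner \<xi> \<eta>) x) k" .
  qed
  have "toeplitz_rep X ell2_ops path_\<pi> path_\<tau>"
    unfolding toeplitz_rep_def minner_eq
    using hom carr_\<tau> add scale left inner by (simp add: C0_algebra_carr spaces)
  then show ?thesis
    unfolding toeplitz_def toeplitz_axioms_def
    using compact_topological_graph_axioms ell2_ops_algebra by blast
qed

text \<open>A continuous function with value 1 at the vertex and 0 on the compact set of ranges acts
  as zero on the module, and elements of the ideal annihilate every such function.\<close>

lemma katsura_source:
  assumes a: "a \<in> katsura_ideal X" and k: "k \<in> S" "k \<notin> S1"
  shows "a (base k) = 0"
proof -
  have "compactin (verts E) (r ` W)"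
    using image_compactin[OF _ spaces(7)] spaces(2) by (simp add: compact_space_def)
  then have "closedin (verts E) (r ` W)" using compactin_imp_closedin spaces(3) by blast
  moreover have "closedin (verts E) {base k}" using closedin_Hausdorff_singleton[OF spaces(3) base[OF k(1)]] .
  moreover have "normal_space (verts E)" using compact_Hausdorff_or_regular_imp_normal_space spaces(1,3) by blast
  ultimately obtain h where h: "continuous_map (verts E) euclideanreal h" "h ` {base k} \<subseteq> {1::real}" "h ` (r ` W) \<subseteq> {0}"
    using Urysohn_lemma_alt[of "verts E" "{base k}" "r ` W"] source[OF k] by (auto simp: disjnt_def)
  define b where "b = restrict0 (verts E) (\<lambda>v. complex_of_real (h v))"
  have b: "b \<in> cont_funs (verts E)"
    unfolding b_def by (intro restrict0_cont_funs continuous_intros h(1))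
  have "(\<lambda>e. b (r e) * \<xi> e) = (\<lambda>_. 0)" if "\<xi> \<in> cont_funs (edges E)" for \<xi>
  proof
    fix e show "b (r e) * \<xi> e = 0"
      using that h(3) by (cases "e \<in> W") (auto simp: b_def restrict0_def cont_funs_def)
  qed
  then have "left_op X b = czero (adjointable_ops X)"
    by (auto simp: left_op_def adjointable_ops_def restrict_def)
  then have "(\<lambda>v. a v * b v) = (\<lambda>_. 0)"
    using a b by (auto simp: katsura_ideal_def C0_algebra_carr spaces)
  moreover have "b (base k) = 1" using h(2) base[OF k(1)] by (simp add: b_def restrict0_def)
  ultimately show ?thesis by (metis mult_cancel_left1 mult.right_neutral)
qed

abbreviation "PC \<equiv> cstar_generated ell2_ops (path_\<pi> ` cont_funs (verts E) \<union> path_\<tau> ` cont_funs (edges E))"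

text \<open>On paths of positive length the frame sum acts as the identity, because the frame
  condition gives the identity matrix on paths with a common tail. On the other paths
  \<open>a\<close> vanishes by \<open>katsura_source\<close>. The algebra is \<open>PC\<close>
  because it is separable and so can be moved into the carrier type.\<close>

lemma path_covariant: "covariant_rep X PC path_\<pi> path_\<tau>"
proof -
  interpret C: toeplitz E PC path_\<pi> path_\<tau> by (rule toeplitz.generated_toeplitz[OF path_toeplitz])
  obtain n :: nat and \<xi> :: "nat \<Rightarrow> 'e \<Rightarrow> complex" where \<xi>: "\<And>i. i < n \<Longrightarrow> \<xi> i \<in> cont_funs (edges E)"
    "\<And>d e. \<lbrakk>d \<in> W; e \<in> W; s d = s e\<rbrakk> \<Longrightarrow> (\<Sum>i<n. \<xi> i d * cnj (\<xi> i e)) = (if d = e then 1 else 0)"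
    by (rule frame_exists) blast
  show ?thesis
  proof (rule C.frame_covariant[of n \<xi>])
    show "frame n \<xi>" using \<xi> by (simp add: frame_def)
    fix a assume a: "a \<in> katsura_ideal X"
    then have ac: "a \<in> cont_funs (verts E)" by (simp add: katsura_ideal_def C0_algebra_carr spaces)
    let ?P = "csum ell2_ops (\<lambda>i. path_\<tau> (\<xi> i) o\<^sub>L cadj ell2_ops (path_\<tau> (\<xi> i))) n"
    have P: "coord (?P x) k = coord x k" if k: "k \<in> S1" for x k
    proof -
      have "coord (?P x) k
          = (\<Sum>i<n. \<Sum>l | l \<in> S1 \<and> tail l = tail k. \<xi> i (first k) * cnj (\<xi> i (first l)) * coord x l)"
        unfolding coord_csum
        by (rule sum.cong) (use \<xi>(1) k in \<open>simp_all add: coord_\<tau> coord_\<tau>_adj sum_distrib_left mult.assoc\<close>)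
      also have "\<dots> = (\<Sum>l | l \<in> S1 \<and> tail l = tail k. (\<Sum>i<n. \<xi> i (first k) * cnj (\<xi> i (first l))) * coord x l)"
        by (subst sum.swap) (simp add: sum_distrib_right)
      also have "\<dots> = (\<Sum>l | l \<in> S1 \<and> tail l = tail k. if l = k then coord x k else 0)"
      proof (rule sum.cong)
        fix l assume l: "l \<in> {l. l \<in> S1 \<and> tail l = tail k}"
        have "(\<Sum>i<n. \<xi> i (first k) * cnj (\<xi> i (first l))) = (if first k = first l then 1 else 0)"
          using l k S1 by (intro \<xi>(2)) auto
        moreover have "first k = first l \<longleftrightarrow> l = k" using l k path_eqI by auto
        ultimately show "(\<Sum>i<n. \<xi> i (first k) * cnj (\<xi> i (first l))) * coord x l = (if l = k then coord x k else 0)"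
          by simp
      qed simp
      also have "\<dots> = coord x k"
      proof -
        have "finite {l. l \<in> S1 \<and> tail l = tail k}"
          using bij_betw_finite[OF fibre_bij[of "tail k"]] S1[OF k] finite_edges_from by auto
        then show ?thesis using k by simp
      qed
      finally show ?thesis .
    qed
    have "path_\<pi> a o\<^sub>L ?P = path_\<pi> a"
    proof (intro blinfun_eqI ell2_eqI)
      fix x k
      show "coord ((path_\<pi> a o\<^sub>L ?P) x) k = coord (path_\<pi> a x) k"
        using P[of k x] katsura_source[OF a, of k] by (cases "k \<in> S1") (auto simp: coord_\<pi>[OF ac])
    qed
    then show "cmult PC (path_\<pi> a) (csum PC (\<lambda>i. cmult PC (path_\<tau> (\<xi> i)) (cadj PC (path_\<tau> (\<xi> i)))) n) = path_\<pi> a"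
      by (simp add: csum_generated)
  qed
qed

lemma finite_imp_path_unitary:
  assumes fin: "cstar_finite (graph_algebra E)"
    and \<xi>: "\<xi> \<in> cont_funs (edges E)" "edge_inner \<xi> \<xi> = indicator V"
  shows "path_\<tau> \<xi> o\<^sub>L cadj ell2_ops (path_\<tau> \<xi>) = path_\<pi> (indicator V)"
proof -
  obtain j :: "_ \<Rightarrow> (('v \<Rightarrow> complex) + ('e \<Rightarrow> complex)) univ" where j: "inj_on j (carr PC)"
    by (rule toeplitz.generated_embedding[OF path_toeplitz])
  show ?thesis
    using finite_graph_algebra_unitary[OF fin toeplitz.generated_algebra[OF path_toeplitz] path_covariant j \<xi>] by simp
qed

text \<open>Both conclusions are read off the identity of \<open>finite_imp_path_unitary\<close>,
  applied to the basis vector of \<open>k\<close>: the first from the coordinate at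
  \<open>k\<close>, the second from the coordinate at \<open>l\<close>.\<close>

lemma finite_imp_paths_positive:
  assumes fin: "cstar_finite (graph_algebra E)" and sinks: "no_sinks E" and k: "k \<in> S"
  shows "k \<in> S1" and "\<lbrakk>l \<in> S1; k \<in> S1; tail l = tail k\<rbrakk> \<Longrightarrow> l = k"
proof -
  obtain \<xi> where \<xi>: "\<xi> \<in> cont_funs (edges E)" "\<And>e. e \<in> W \<Longrightarrow> \<xi> e \<noteq> 0"
    "fibre_sum (\<lambda>e. cnj (\<xi> e) * \<xi> e) = indicator V"
    by (rule normalized_exists[OF sinks]) blast
  have eq: "path_\<tau> \<xi> o\<^sub>L cadj ell2_ops (path_\<tau> \<xi>) = path_\<pi> (indicator V)"
    by (rule finite_imp_path_unitary[OF fin \<xi>(1)]) (simp add: edge_inner_def \<xi>(3))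
  define \<delta> where "\<delta> = Abs_ell2 (\<lambda>l. if l = k then 1 else 0)"
  have \<delta>: "coord \<delta> l = (if l = k then 1 else 0)" for l
  proof -
    have "coord \<delta> = (\<lambda>l. if l = k then 1 else 0)"
      unfolding \<delta>_def
    proof (rule ell2_normI(1)[of _ 1])
      fix F :: "'s set" assume F: "finite F"
      have "(\<Sum>i\<in>F. (cmod (if i = k then 1 else 0))\<^sup>2) = (\<Sum>i\<in>F. if i = k then 1 else 0)"
        by (rule sum.cong) auto
      also have "\<dots> \<le> 1\<^sup>2" using F by simp
      finally show "(\<Sum>i\<in>F. (cmod (if i = k then 1 else 0))\<^sup>2) \<le> 1\<^sup>2" .
    qed simp
    then show ?thesis by simp
  qed
  have coord_eq: "(if l \<in> S1 then \<xi> (first l) * (\<Sum>m | m \<in> S1 \<and> tail m = tail l. cnj (\<xi> (first m)) * coord \<delta> m) else 0)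
      = (if l \<in> S then indicator V (base l) * coord \<delta> l else 0)" for l
    using arg_cong[OF eq, of "\<lambda>T. coord (T \<delta>) l"]
    by (simp add: coord_\<tau>[OF \<xi>(1)] coord_\<tau>_adj[OF \<xi>(1)] coord_\<pi>[OF indicator_cont_funs] cong: if_cong)
  show k1: "k \<in> S1" using coord_eq[of k] k base[OF k] by (auto simp: \<delta> split: if_splits)
  show "l = k" if l: "l \<in> S1" and "tail l = tail k"
  proof (rule ccontr)
    assume ne: "l \<noteq> k"
    have fin: "finite {m. m \<in> S1 \<and> tail m = tail l}"
      using bij_betw_finite[OF fibre_bij[of "tail l"]] S1[OF l] finite_edges_from by auto
    have "(\<Sum>m | m \<in> S1 \<and> tail m = tail l. cnj (\<xi> (first m)) * coord \<delta> m)
        = (\<Sum>m | m \<in> S1 \<and> tail m = tail l. if m = k then cnj (\<xi> (first k)) else 0)"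
      by (rule sum.cong) (auto simp: \<delta>)
    also have "\<dots> = cnj (\<xi> (first k))" using fin k1 that by simp
    finally have "\<xi> (first l) * cnj (\<xi> (first k)) = 0" using coord_eq[of l] l ne by (simp add: \<delta> split: if_splits)
    then show False using \<xi>(2) S1[OF l] S1[OF k1] by simp
  qed
qed

end

section \<open>Finiteness\<close>

lemma topspace_inf_paths:
  "topspace (inf_paths E) = {\<alpha>. \<forall>n. \<alpha> n \<in> topspace (edges E) \<and> src E (\<alpha> n) = rng E (\<alpha> (Suc n))}"
  by (auto simp: inf_paths_def)

context compact_topological_graph
begin

text \<open>A path is the list of its edges, read from its range end, and it ends at the fixed
  vertex \<open>v\<close>; the empty list stands for \<open>v\<close> itself.\<close>

fun path_base :: "'v \<Rightarrow> 'e list \<Rightarrow> 'v" where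
  "path_base v [] = v"
| "path_base v (e # p) = r e"

fun is_path :: "'v \<Rightarrow> 'e list \<Rightarrow> bool" where
  "is_path v [] = True"
| "is_path v (e # p) = (e \<in> W \<and> s e = path_base v p \<and> is_path v p)"

lemma finite_path_model:
  assumes v: "v \<in> V" "v \<notin> r ` W"
  shows "path_model E {p. is_path v p} {p. is_path v p \<and> p \<noteq> []} hd tl (path_base v)"
proof (intro path_model.intro path_model_axioms.intro compact_topological_graph_axioms)
  show "path_base v p \<in> V" if "p \<in> {p. is_path v p}" for p using that v(1) rng_V by (cases p) auto
  show "p \<in> {p. is_path v p} \<and> tl p \<in> {p. is_path v p} \<and> hd p \<in> W \<and> s (hd p) = path_base v (tl p) \<and> path_base v p = r (hd p)"
    if "p \<in> {p. is_path v p \<and> p \<noteq> []}" for p using that by (cases p) auto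
  show "\<exists>l\<in>{p. is_path v p \<and> p \<noteq> []}. hd l = e \<and> tl l = p"
    if "p \<in> {p. is_path v p}" "e \<in> W" "s e = path_base v p" for p e
    using that by (intro bexI[of _ "e # p"]) auto
  show "p = q" if "p \<in> {p. is_path v p \<and> p \<noteq> []}" "q \<in> {p. is_path v p \<and> p \<noteq> []}" "hd p = hd q" "tl p = tl q" for p q
    using that by (simp add: list.expand)
  show "path_base v p \<notin> r ` W" if "p \<in> {p. is_path v p}" "p \<notin> {p. is_path v p \<and> p \<noteq> []}" for p
    using that v(2) by auto
qed

text \<open>Every infinite path has a first edge, so both sets of the model are the whole path
  space. An edge is put in front of a path by \<open>case_nat\<close>.\<close>

lemma infinite_path_model:
  "path_model E (topspace (inf_paths E)) (topspace (inf_paths E)) first_edge back_shift (\<lambda>\<alpha>. r (\<alpha> 0))"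
proof (intro path_model.intro path_model_axioms.intro compact_topological_graph_axioms)
  let ?S = "topspace (inf_paths E)"
  show "\<exists>\<beta>\<in>?S. first_edge \<beta> = e \<and> back_shift \<beta> = \<alpha>" if "\<alpha> \<in> ?S" "e \<in> W" "s e = r (\<alpha> 0)" for \<alpha> e
    by (rule bexI[of _ "case_nat e \<alpha>"])
      (use that in \<open>auto simp: topspace_inf_paths first_edge_def back_shift_def split: nat.split\<close>)
  show "\<alpha> = \<beta>" if "first_edge \<alpha> = first_edge \<beta>" "back_shift \<alpha> = back_shift \<beta>" for \<alpha> \<beta> :: "nat \<Rightarrow> 'e"
  proof
    fix n show "\<alpha> n = \<beta> n"
      using that by (cases n) (auto simp: first_edge_def back_shift_def dest: fun_cong)
  qed
qed (use rng_V in \<open>auto simp: topspace_inf_paths first_edge_def back_shift_def\<close>)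

text \<open>Dependent choice: surjectivity of \<open>r\<close> supplies a next edge at the source of
  each edge.\<close>

lemma inf_path_extends:
  assumes r: "r ` W = V" and e: "e \<in> W"
  obtains \<alpha> where "\<alpha> \<in> topspace (inf_paths E)" "\<alpha> 0 = e"
proof -
  have "\<exists>\<alpha>. \<forall>n. (\<alpha> n \<in> W \<and> (n = 0 \<longrightarrow> \<alpha> n = e)) \<and> s (\<alpha> n) = r (\<alpha> (Suc n))"
  proof (rule dependent_nat_choice[of "\<lambda>n x. x \<in> W \<and> (n = 0 \<longrightarrow> x = e)" "\<lambda>n x y. s x = r y"])
    show "\<exists>x. x \<in> W \<and> (0 = (0::nat) \<longrightarrow> x = e)" using e by blast
    fix x :: 'e and n :: nat assume "x \<in> W \<and> (n = 0 \<longrightarrow> x = e)"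
    then have "s x \<in> r ` W" using src_V r by blast
    then show "\<exists>y. (y \<in> W \<and> (Suc n = 0 \<longrightarrow> y = e)) \<and> s x = r y" by auto
  qed
  then obtain \<alpha> where \<alpha>: "\<And>n. \<alpha> n \<in> W" "\<alpha> 0 = e" "\<And>n. s (\<alpha> n) = r (\<alpha> (Suc n))" by metis
  show thesis by (rule that[of \<alpha>]) (use \<alpha> in \<open>auto simp: topspace_inf_paths\<close>)
qed

text \<open>Surjectivity of \<open>r\<close> comes first, because the proof that \<open>s\<close> is
  injective prolongs an edge to an infinite path.\<close>

lemma finite_graph_algebra:
  assumes fin: "cstar_finite (graph_algebra E)" and sinks: "no_sinks E"
  shows "inj_on s W" and "r ` W = V"
proof -
  show surj: "r ` W = V"
  proof (rule ccontr)
    assume "r ` W \<noteq> V"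
    then obtain v where v: "v \<in> V" "v \<notin> r ` W" using rng_V by blast
    interpret path_model E "{p. is_path v p}" "{p. is_path v p \<and> p \<noteq> []}" hd tl "path_base v"
      by (rule finite_path_model[OF v])
    show False using finite_imp_paths_positive(1)[OF fin sinks, of "[]"] by simp
  qed
  show "inj_on s W"
  proof (rule inj_onI)
    fix e f assume e: "e \<in> W" and f: "f \<in> W" and eq: "s e = s f"
    obtain \<alpha> where \<alpha>: "\<alpha> \<in> topspace (inf_paths E)" "\<alpha> 0 = e" by (rule inf_path_extends[OF surj e])
    interpret path_model E "topspace (inf_paths E)" "topspace (inf_paths E)" first_edge back_shift "\<lambda>\<alpha>. r (\<alpha> 0)"
      by (rule infinite_path_model)
    have "s (\<alpha> 0) = r (\<alpha> (Suc 0))" using \<alpha>(1) by (simp add: topspace_inf_paths)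
    then have "s f = r (back_shift \<alpha> 0)" using \<alpha>(2) eq by (simp add: back_shift_def)
    then obtain \<beta> where \<beta>: "\<beta> \<in> topspace (inf_paths E)" "first_edge \<beta> = f" "back_shift \<beta> = back_shift \<alpha>"
      using extend[of "back_shift \<alpha>" f] f S1[OF \<alpha>(1)] by blast
    have "\<beta> = \<alpha>" by (rule finite_imp_paths_positive(2)[OF fin sinks \<alpha>(1) \<beta>(1) \<alpha>(1) \<beta>(3)])
    then show "e = f" using \<alpha>(2) \<beta>(2) by (simp add: first_edge_def)
  qed
qed

end

section \<open>The universal property of a crossed product\<close>

lemma cstar_unit_transport:
  assumes "inj_on j (carr A)" "cstar_unit A e"
  shows "cstar_unit (cstar_transport j A) (j e)"
  using assms by (auto simp: cstar_unit_def cstar_transport_def Let_def)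

lemma cstar_unitary_transport:
  assumes A: "cstar_algebra A" and j: "inj_on j (carr A)" and u: "cstar_unitary A u"
  shows "cstar_unitary (cstar_transport j A) (j u)"
proof -
  note h = star_homD[OF cstar_transport_hom[OF j]]
  have u: "u \<in> carr A" "cadj A u \<in> carr A" "cstar_unit A (cmult A (cadj A u) u)" "cstar_unit A (cmult A u (cadj A u))"
    using u cstar_algebra.adj_closed[OF A] by (auto simp: cstar_unitary_def)
  show ?thesis
    unfolding cstar_unitary_def
    using h(1)[OF u(1)] cstar_unit_transport[OF j u(3)] cstar_unit_transport[OF j u(4)]
      h(4)[OF u(2,1)] h(4)[OF u(1,2)] h(5)[OF u(1)] by simp
qed

locale compact_dynamics =
  fixes Y :: "'y topology" and \<sigma> :: "'y \<Rightarrow> 'y"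
  assumes Y: "compact_space Y"
begin

abbreviation "R \<equiv> crossed_reps Y \<sigma>"

lemma crossed_repD:
  assumes "i \<in> R"
  shows "cstar_algebra (fst i)" "star_hom (C0_algebra Y) (fst i) (\<lambda>a. snd i (Inl a))"
    "cstar_unit (fst i) (snd i (Inl (indicator (topspace Y))))" "cstar_unitary (fst i) (snd i (Inr ()))"
    "a \<in> cont_funs Y \<Longrightarrow> cmult (fst i) (cmult (fst i) (snd i (Inr ())) (snd i (Inl a))) (cadj (fst i) (snd i (Inr ())))
       = snd i (Inl (restrict0 Y (a \<circ> \<sigma>)))"
  using assms by (auto simp: crossed_reps_def C0_funs_compact[OF Y])

lemma universal_family: "universal_family (C0_funs Y <+> UNIV) R"
proof -
  define Z :: "(('y \<Rightarrow> complex) + unit) univ cstar" where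
    "Z = \<lparr>carr = {undefined}, cadd = \<lambda>_ _. undefined, czero = undefined, cscale = \<lambda>_ _. undefined,
      cmult = \<lambda>_ _. undefined, cadj = \<lambda>_. undefined, cnorm = \<lambda>_. 0\<rparr>"
  have "(Z, \<lambda>_. undefined) \<in> R"
    using cstar_trivial[of undefined]
    by (simp add: crossed_reps_def star_hom_def cstar_unit_def cstar_unitary_def Z_def)
  then have ne: "R \<noteq> {}" by blast
  have alg: "cstar_algebra (fst i)" if "i \<in> R" for i by (rule crossed_repD(1)[OF that])
  have closed: "snd i g \<in> carr (fst i)" if i: "i \<in> R" and g: "g \<in> C0_funs Y <+> UNIV" for i g
    using g star_homD(1)[OF crossed_repD(2)[OF i]] crossed_repD(4)[OF i]
    by (auto simp: C0_algebra_def cstar_unitary_def)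
  have bounded: "\<exists>K. \<forall>i\<in>R. cnorm (fst i) (snd i g) \<le> K" if g: "g \<in> C0_funs Y <+> UNIV" for g
  proof (cases g)
    case (Inl a)
    then have a: "a \<in> carr (C0_algebra Y)" using g by (auto simp: C0_algebra_def)
    have "cnorm (fst i) (snd i g) \<le> cnorm (C0_algebra Y) a" if "i \<in> R" for i
      using C0_algebra_hom_contractive[OF Y crossed_repD(1,2)[OF that]] a Inl by (simp add: contractive_hom_def)
    then show ?thesis by blast
  next
    case (Inr x)
    have "cnorm (fst i) (snd i g) \<le> 1" if i: "i \<in> R" for i
    proof -
      interpret cstar_algebra "fst i" by (rule crossed_repD(1)[OF i])
      let ?B = "fst i" and ?u = "snd i (Inr ())"
      \<comment> \<open>A unit of this form is a projection, which bounds the norm of the unitary by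
        1.\<close>
      define e where "e = cmult ?B (cadj ?B ?u) ?u"
      have u: "?u \<in> carr ?B" "cstar_unit ?B e" using crossed_repD(4)[OF i] by (auto simp: cstar_unitary_def e_def)
      then have e: "e \<in> carr ?B" by (simp add: cstar_unit_def)
      have "cadj ?B e = e" using u by (simp add: e_def adj_mult adj_adj closed)
      moreover have "cmult ?B e e = e" using u(2) e by (simp add: cstar_unit_def)
      ultimately have "cnorm ?B e \<le> 1" using projection_norm_le[OF e] by simp
      then have "(cnorm ?B ?u)\<^sup>2 \<le> 1\<^sup>2" using norm_cstar[OF u(1)] by (simp add: e_def)
      then have "cnorm ?B ?u \<le> 1" by (rule power2_le_imp_le) simp
      then show ?thesis using Inr by simp
    qed
    then show ?thesis by blast
  qed
  show ?thesis unfolding universal_family_def using ne alg closed bounded by blast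
qed

sublocale U: universal_family "C0_funs Y <+> UNIV" R
  by (rule universal_family)

abbreviation "A \<equiv> crossed_product Y \<sigma>"
abbreviation "cf \<equiv> cross_fun Y \<sigma>"
abbreviation "u \<equiv> cross_unitary Y \<sigma>"

lemma crossed_eq: "A = U.U"
  by (simp add: crossed_product_def)

lemma crossed_at [simp]: "i \<in> R \<Longrightarrow> cf a i = snd i (Inl a)" "i \<in> R \<Longrightarrow> u i = snd i (Inr ())"
  by (simp_all add: cross_fun_def cross_unitary_def)

lemma crossed_algebra: "cstar_algebra A"
  unfolding crossed_eq by (rule U.universal_algebra)

sublocale A: cstar_algebra A
  by (rule crossed_algebra)

lemma cf_closed: "a \<in> cont_funs Y \<Longrightarrow> cf a \<in> carr A"
  unfolding crossed_eq cross_fun_def by (rule U.gen_carr) (simp add: InlI C0_funs_compact[OF Y])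

lemma u_closed: "u \<in> carr A"
  unfolding crossed_eq cross_unitary_def by (rule U.gen_carr) (simp add: InrI)

lemma cf_hom: "star_hom (C0_algebra Y) A cf"
proof -
  note h = star_homD[OF crossed_repD(2), simplified C0_algebra_carr[OF Y] C0_algebra_ops]
  have eqI: "x = y" if "x \<in> carr A" "y \<in> carr A" "\<And>i. i \<in> R \<Longrightarrow> x i = y i" for x y
    using that U.universal_eqI by (simp add: crossed_eq)
  show ?thesis
    unfolding star_hom_def C0_algebra_carr[OF Y] C0_algebra_ops
  proof (intro conjI ballI allI)
    fix a b assume a: "a \<in> cont_funs Y" and b: "b \<in> cont_funs Y"
    show "cf (\<lambda>y. a y + b y) = cadd A (cf a) (cf b)"
    proof (rule eqI)
      show "cf (\<lambda>y. a y + b y) i = cadd A (cf a) (cf b) i" if "i \<in> R" for i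
        using that h(2)[OF that a b] by (simp add: crossed_eq)
    qed (simp_all add: cf_closed a b A.closed cont_funs_closed(1))
    show "cf (\<lambda>y. a y * b y) = cmult A (cf a) (cf b)"
    proof (rule eqI)
      show "cf (\<lambda>y. a y * b y) i = cmult A (cf a) (cf b) i" if "i \<in> R" for i
        using that h(4)[OF that a b] by (simp add: crossed_eq)
    qed (simp_all add: cf_closed a b A.closed cont_funs_closed(3))
  next
    fix a c assume a: "a \<in> cont_funs Y"
    show "cf a \<in> carr A" by (rule cf_closed[OF a])
    show "cf (\<lambda>y. c * a y) = cscale A c (cf a)"
    proof (rule eqI)
      show "cf (\<lambda>y. c * a y) i = cscale A c (cf a) i" if "i \<in> R" for i
        using that h(3)[OF that a] by (simp add: crossed_eq)
    qed (simp_all add: cf_closed a A.closed cont_funs_closed(4)[OF a a])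
    show "cf (\<lambda>y. cnj (a y)) = cadj A (cf a)"
    proof (rule eqI)
      show "cf (\<lambda>y. cnj (a y)) i = cadj A (cf a) i" if "i \<in> R" for i
        using that h(5)[OF that a] by (simp add: crossed_eq)
    qed (simp_all add: cf_closed a A.closed cont_funs_closed(5)[OF a a])
  qed
qed

lemma cf_contractive: "contractive_hom (C0_algebra Y) A cf"
  by (rule C0_algebra_hom_contractive[OF Y crossed_algebra cf_hom])

lemma unit_at: "cstar_unit A e" if e: "e \<in> carr A" and at: "\<And>i. i \<in> R \<Longrightarrow> cstar_unit (fst i) (e i)" for e
  unfolding cstar_unit_def
proof (intro conjI ballI)
  fix x assume x: "x \<in> carr A"
  have "cmult (fst i) (e i) (x i) = x i" "cmult (fst i) (x i) (e i) = x i" if "i \<in> R" for i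
    using at[OF that] U.carr_coord[of x i] x that by (auto simp: cstar_unit_def crossed_eq)
  then show "cmult A e x = x" "cmult A x e = x"
    using x A.mult_closed[OF e x] A.mult_closed[OF x e] U.universal_eqI unfolding crossed_eq by auto
qed (rule e)

lemma crossed_unit: "cstar_unit A (cf (indicator (topspace Y)))"
  by (rule unit_at) (simp_all add: cf_closed indicator_cont_funs crossed_repD(3))

lemma crossed_unitary: "cstar_unitary A u"
proof -
  have at: "cmult A x y i = cmult (fst i) (x i) (y i)" "cadj A x i = cadj (fst i) (x i)" if "i \<in> R" for i x y
    using that by (simp_all add: crossed_eq)
  have "cstar_unit A (cmult A (cadj A u) u)" "cstar_unit A (cmult A u (cadj A u))"
    by (rule unit_at; use u_closed crossed_repD(4) in \<open>simp add: A.closed at cstar_unitary_def\<close>)+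
  then show ?thesis using u_closed by (simp add: cstar_unitary_def)
qed

lemma crossed_covariance:
  assumes a: "a \<in> cont_funs Y" and \<sigma>: "continuous_map Y Y \<sigma>"
  shows "cmult A (cmult A u (cf a)) (cadj A u) = cf (restrict0 Y (a \<circ> \<sigma>))"
proof -
  have "restrict0 Y (a \<circ> \<sigma>) \<in> cont_funs Y"
    using a continuous_map_compose[OF \<sigma>, of euclidean a] by (intro restrict0_cont_funs) (simp add: cont_funs_def)
  then have "cf (restrict0 Y (a \<circ> \<sigma>)) \<in> carr A" by (rule cf_closed)
  moreover have "cmult A (cmult A u (cf a)) (cadj A u) \<in> carr A" by (intro A.closed u_closed cf_closed a)
  moreover have "cmult A (cmult A u (cf a)) (cadj A u) i = cf (restrict0 Y (a \<circ> \<sigma>)) i" if "i \<in> R" for i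
    using that crossed_repD(5)[OF that a] by (simp add: crossed_eq)
  ultimately show ?thesis using U.universal_eqI by (simp add: crossed_eq)
qed

lemma crossed_hom:
  fixes j :: "'b \<Rightarrow> (('y \<Rightarrow> complex) + unit) univ"
  assumes C: "cstar_algebra C" and p: "star_hom (C0_algebra Y) C p"
    and unit: "cstar_unit C (p (indicator (topspace Y)))" and v: "cstar_unitary C v"
    and cov: "\<And>a. a \<in> cont_funs Y \<Longrightarrow> cmult C (cmult C v (p a)) (cadj C v) = p (restrict0 Y (a \<circ> \<sigma>))"
    and j: "inj_on j (carr C)"
  obtains F where "contractive_hom A C F" "\<And>a. a \<in> cont_funs Y \<Longrightarrow> F (cf a) = p a" "F u = v"
proof -
  interpret C: cstar_algebra C by fact
  define \<rho> where "\<rho> g = (case g of Inl a \<Rightarrow> p a | Inr _ \<Rightarrow> v)" for g :: "('y \<Rightarrow> complex) + unit"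
  note h = star_homD[OF cstar_transport_hom[OF j]]
  have p_closed: "p a \<in> carr C" if "a \<in> cont_funs Y" for a
    using star_homD(1)[OF p] that by (simp add: C0_algebra_carr[OF Y])
  have v_closed: "v \<in> carr C" using v by (simp add: cstar_unitary_def)
  have "(cstar_transport j C, \<lambda>g. j (\<rho> g)) \<in> R"
    unfolding crossed_reps_def
  proof (simp add: \<rho>_def, intro conjI ballI)
    show "cstar_algebra (cstar_transport j C)" by (rule cstar_transport[OF C j])
    show "star_hom (C0_algebra Y) (cstar_transport j C) (\<lambda>a. j (p a))"
      by (rule star_hom_comp[OF p cstar_transport_hom[OF j]])
    show "cstar_unit (cstar_transport j C) (j (p (indicator (topspace Y))))"
      by (rule cstar_unit_transport[OF j unit])
    show "cstar_unitary (cstar_transport j C) (j v)" by (rule cstar_unitary_transport[OF C j v])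
    fix a assume "a \<in> C0_funs Y"
    then have a: "a \<in> cont_funs Y" by (simp add: C0_funs_compact[OF Y])
    show "cmult (cstar_transport j C) (cmult (cstar_transport j C) (j v) (j (p a))) (cadj (cstar_transport j C) (j v))
        = j (p (restrict0 Y (a \<circ> \<sigma>)))"
      unfolding cov[OF a, symmetric] using v_closed p_closed[OF a] by (simp add: h C.closed)
  qed
  moreover have "\<rho> g \<in> carr C" if "g \<in> C0_funs Y <+> UNIV" for g
    using that p_closed v_closed by (auto simp: \<rho>_def C0_funs_compact[OF Y])
  ultimately obtain F where F: "contractive_hom U.U C F"
    "\<And>g. g \<in> C0_funs Y <+> UNIV \<Longrightarrow> F (universal_gen R g) = \<rho> g"
    using U.universal_hom[OF C j] by blast
  show thesis
  proof
    show "contractive_hom A C F" using F(1) by (simp add: crossed_eq)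
    show "F (cf a) = p a" if "a \<in> cont_funs Y" for a
      using F(2)[of "Inl a"] that by (simp add: InlI cross_fun_def \<rho>_def C0_funs_compact[OF Y])
    show "F u = v" using F(2)[of "Inr ()"] by (simp add: InrI cross_unitary_def \<rho>_def)
  qed
qed

lemma crossed_hom_eq:
  assumes "cstar_algebra C" "contractive_hom A C f" "contractive_hom A C g"
    "\<And>a. a \<in> cont_funs Y \<Longrightarrow> f (cf a) = g (cf a)" "f u = g u" "x \<in> carr A"
  shows "f x = g x"
proof (rule U.universal_hom_eq[OF assms(1)])
  show "f (universal_gen R y) = g (universal_gen R y)" if "y \<in> C0_funs Y <+> UNIV" for y
    using that assms(4,5) by (auto simp: C0_funs_compact[OF Y] cross_fun_def cross_unitary_def)
qed (use assms in \<open>auto simp: crossed_eq\<close>)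

text \<open>The generators are the contractive image of a separable algebra together with one
  further element.\<close>

lemma crossed_embedding:
  assumes sep: "separable_in (C0_algebra Y) (cont_funs Y)"
  obtains j :: "_ \<Rightarrow> 'h univ" where "inj_on j (carr A)"
proof -
  have cP: "cf a \<in> carr U.P" if "a \<in> cont_funs Y" for a
    using cf_closed[OF that] U.carr_subset by (auto simp: crossed_eq)
  have uP: "u \<in> carr U.P" using u_closed U.carr_subset by (auto simp: crossed_eq)
  have "star_hom (C0_algebra Y) U.P cf"
    using cf_hom cP by (simp add: star_hom_def crossed_eq universal_cstar_def C0_algebra_carr[OF Y])
  then have "contractive_hom (C0_algebra Y) U.P cf"
    by (rule C0_algebra_hom_contractive[OF Y U.prod_algebra])
  then have "separable_in U.P (cf ` cont_funs Y)"
    by (rule separable_in_contractive[OF C0_algebra_algebra[OF Y]]) (use sep in \<open>simp_all add: C0_algebra_carr[OF Y]\<close>)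
  moreover have "separable_in U.P {u}"
    by (rule separable_inI[of "{u}"])
      (use uP cstar_algebra.diff_self[OF U.prod_algebra uP] cstar_algebra.norm_zero[OF U.prod_algebra] in auto)
  ultimately have "separable_in U.P (cf ` cont_funs Y \<union> {u})" by (rule separable_in_Un)
  also have "cf ` cont_funs Y \<union> {u} = universal_gen R ` (C0_funs Y <+> UNIV)"
    by (auto simp: cross_fun_def cross_unitary_def C0_funs_compact[OF Y] Plus_def)
  finally show thesis using U.universal_embedding that unfolding crossed_eq by blast
qed

end

section \<open>The infinite path space\<close>

locale reversible_graph = compact_topological_graph E
  for E :: "('v, 'e) top_graph" +
  assumes sinks: "no_sinks E" and inj: "inj_on (src E) (topspace (edges E))"
    and surj: "rng E ` topspace (edges E) = topspace (verts E)"
begin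

abbreviation "Y \<equiv> inf_paths E"
abbreviation "S \<equiv> topspace (inf_paths E)"

lemma S_iff: "\<alpha> \<in> S \<longleftrightarrow> (\<forall>n. \<alpha> n \<in> W \<and> s (\<alpha> n) = r (\<alpha> (Suc n)))"
  by (simp add: topspace_inf_paths)

text \<open>The path conditions are equalities of continuous maps into a Hausdorff space, so the
  path space is closed in the compact product.\<close>

lemma compact_Y: "compact_space Y"
proof -
  let ?P = "product_topology (\<lambda>_::nat. edges E) UNIV"
  have P: "compact_space ?P" by (simp add: compact_space_product_topology spaces(2))
  have proj: "continuous_map ?P (edges E) (\<lambda>\<alpha>. \<alpha> n)" for n by (rule continuous_map_product_projection) simp
  have "closedin ?P {\<alpha> \<in> topspace ?P. s (\<alpha> n) = r (\<alpha> (Suc n))}" for n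
    by (rule closedin_continuous_maps_eq[OF spaces(3)])
      (use continuous_map_compose[OF proj spaces(8)] continuous_map_compose[OF proj spaces(7)] in \<open>simp_all add: o_def\<close>)
  then have "closedin ?P (\<Inter>n. {\<alpha> \<in> topspace ?P. s (\<alpha> n) = r (\<alpha> (Suc n))})" by (intro closedin_Inter) auto
  moreover have "(\<Inter>n. {\<alpha> \<in> topspace ?P. s (\<alpha> n) = r (\<alpha> (Suc n))}) = S" by (auto simp: inf_paths_def)
  ultimately have "compactin ?P S" using closedin_compact_space[OF P] by simp
  moreover have "subtopology ?P S = Y"
    unfolding inf_paths_def by (metis inf_commute subtopology_restrict topspace_subtopology)
  ultimately show ?thesis using compact_space_subtopology by metis
qed

lemma Hausdorff_Y: "Hausdorff_space Y"
  unfolding inf_paths_def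
  by (intro Hausdorff_space_subtopology) (simp add: Hausdorff_space_product_topology spaces(4))

lemma coordinate_cont: "continuous_map Y (edges E) (\<lambda>\<alpha>. \<alpha> n)"
  unfolding inf_paths_def by (intro continuous_map_from_subtopology continuous_map_product_projection) simp

lemma vertex_cont: "continuous_map Y (verts E) (\<lambda>\<alpha>. r (\<alpha> n))"
  using continuous_map_compose[OF coordinate_cont spaces(7)] by (simp add: o_def)

lemma back_shift_cont: "continuous_map Y Y back_shift"
proof -
  have "continuous_map Y (product_topology (\<lambda>_. edges E) UNIV) back_shift"
    using coordinate_cont by (simp add: continuous_map_componentwise_UNIV back_shift_def)
  then show ?thesis
    unfolding inf_paths_def[of E]
    by (subst continuous_map_in_subtopology) (auto simp: back_shift_def inf_paths_def)
qed

lemma back_shift_S: "\<alpha> \<in> S \<Longrightarrow> back_shift \<alpha> \<in> S"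
  by (simp add: S_iff back_shift_def)

text \<open>The absence of sinks supplies an edge to put in front of any path.\<close>

lemma back_shift_image: "back_shift ` S = S"
proof (intro equalityI subsetI)
  fix \<alpha> assume \<alpha>: "\<alpha> \<in> S"
  then have "r (\<alpha> 0) \<in> V" using rng_V by (simp add: S_iff)
  then obtain e where e: "e \<in> W" "s e = r (\<alpha> 0)" using sinks by (auto simp: no_sinks_def edges_from_def)
  have "case_nat e \<alpha> \<in> S" using \<alpha> e by (auto simp: S_iff split: nat.split)
  moreover have "back_shift (case_nat e \<alpha>) = \<alpha>" by (simp add: back_shift_def)
  ultimately show "\<alpha> \<in> back_shift ` S" by (metis imageI)
qed (use back_shift_S in auto)

text \<open>The first edge is recovered from the rest: its source is the range of the second edge,
  and \<open>s\<close> is injective.\<close>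

lemma back_shift_inj: "inj_on back_shift S"
proof (rule inj_onI)
  fix \<alpha> \<beta> assume \<alpha>: "\<alpha> \<in> S" and \<beta>: "\<beta> \<in> S" and eq: "back_shift \<alpha> = back_shift \<beta>"
  have tail: "\<alpha> (Suc n) = \<beta> (Suc n)" for n using fun_cong[OF eq, of n] by (simp add: back_shift_def)
  have "s (\<alpha> 0) = s (\<beta> 0)" using \<alpha> \<beta> tail[of 0] by (simp add: S_iff)
  then have "\<alpha> 0 = \<beta> 0" using inj \<alpha> \<beta> by (auto simp: S_iff inj_on_def)
  then show "\<alpha> = \<beta>" using tail by (metis ext not0_implies_Suc)
qed

lemma back_shift_homeomorphic: "homeomorphic_map Y Y back_shift"
  by (rule continuous_imp_homeomorphic_map[OF back_shift_cont compact_Y Hausdorff_Y back_shift_image back_shift_inj])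

text \<open>For n = 0 an edge with the given range is prolonged to a path; surjectivity of the shift
  then raises n.\<close>

lemma vertex_surj: "(\<lambda>\<alpha>. r (\<alpha> n)) ` S = V"
proof (induction n)
  case 0
  show ?case
  proof (intro equalityI subsetI)
    fix v assume "v \<in> V"
    then obtain e where e: "e \<in> W" "v = r e" using surj by blast
    obtain \<alpha> where "\<alpha> \<in> S" "\<alpha> 0 = e" by (rule inf_path_extends[OF surj e(1)])
    then show "v \<in> (\<lambda>\<alpha>. r (\<alpha> 0)) ` S" using e(2) by force
  qed (use rng_V in \<open>auto simp: S_iff\<close>)
next
  case (Suc n)
  have "(\<lambda>\<alpha>. r (\<alpha> (Suc n))) ` S = (\<lambda>\<alpha>. r (\<alpha> n)) ` back_shift ` S"
    by (simp add: image_image back_shift_def)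
  then show ?case using Suc back_shift_image by simp
qed

text \<open>The vertex r(\<alpha>(n)) is the source of \<alpha>(n-1), which determines that edge,
  hence its range, and so on backwards.\<close>

lemma vertex_determines:
  assumes "\<alpha> \<in> S" "\<beta> \<in> S" "r (\<alpha> n) = r (\<beta> n)" "k < n"
  shows "\<alpha> k = \<beta> k"
  using assms(3,4)
proof (induction n)
  case (Suc n)
  have "s (\<alpha> n) = s (\<beta> n)" using assms(1,2) Suc.prems(1) by (simp add: S_iff)
  then have "\<alpha> n = \<beta> n" using inj assms(1,2) by (auto simp: S_iff inj_on_def)
  then show ?case using Suc by (cases "k = n") auto
qed simp

text \<open>Level n of the direct limit of copies of C(E^0). By \<open>pull_push\<close>, level n is
  contained in level n + 1.\<close>

definition pull :: "nat \<Rightarrow> ('v \<Rightarrow> complex) \<Rightarrow> (nat \<Rightarrow> 'e) \<Rightarrow> complex"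
  where "pull n a = restrict0 Y (\<lambda>\<alpha>. a (r (\<alpha> n)))"

text \<open>The function a o r o s^-1. In the form of a fibre sum it is continuous by
  \<open>fibre_sum_cont\<close>.\<close>

definition push :: "('v \<Rightarrow> complex) \<Rightarrow> 'v \<Rightarrow> complex"
  where "push a = fibre_sum (\<lambda>e. a (r e) * indicator W e)"

lemma pull_cont: "a \<in> cont_funs (verts E) \<Longrightarrow> pull n a \<in> cont_funs Y"
  unfolding pull_def using continuous_map_compose[OF vertex_cont, of euclidean a n]
  by (intro restrict0_cont_funs) (simp add: cont_funs_def o_def)

lemma push_cont: "a \<in> cont_funs (verts E) \<Longrightarrow> push a \<in> cont_funs (verts E)"
  unfolding push_def by (intro fibre_sum_cont left_cont indicator_cont_funs)

lemma fibre_sum_src: "e \<in> W \<Longrightarrow> fibre_sum f (s e) = f e"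
proof -
  assume "e \<in> W"
  then have "edges_from E (s e) = {e}" using inj by (auto simp: edges_from_iff inj_on_def)
  then show ?thesis by (simp add: fibre_sum_def)
qed

lemma push_src: "e \<in> W \<Longrightarrow> push a (s e) = a (r e)"
  by (simp add: push_def fibre_sum_src)

lemma pull_push: "pull (Suc n) (push a) = pull n a"
  using push_src by (auto simp: pull_def restrict0_def fun_eq_iff S_iff) metis

lemma pull_shift: "restrict0 Y (pull n a \<circ> back_shift) = pull (Suc n) a"
  using back_shift_S by (auto simp: pull_def restrict0_def fun_eq_iff back_shift_def)

lemma pull_hom: "star_hom (C0_algebra (verts E)) (C0_algebra Y) (pull n)"
  unfolding star_hom_def C0_algebra_carr[OF spaces(1)] C0_algebra_carr[OF compact_Y] C0_algebra_ops
  using pull_cont by (auto simp: pull_def restrict0_def fun_eq_iff)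

text \<open>By \<open>vertex_surj\<close> every vertex is r(\<alpha>(n)) for some path, so no value
  of \<open>a\<close> is lost at level n.\<close>

lemma pull_norm:
  assumes a: "a \<in> cont_funs (verts E)"
  shows "cnorm (C0_algebra (verts E)) a \<le> cnorm (C0_algebra Y) (pull n a)"
proof (rule C0_algebra_norm_least)
  fix v
  show "cmod (a v) \<le> cnorm (C0_algebra Y) (pull n a)"
  proof (cases "v \<in> V")
    case True
    then obtain \<alpha> where \<alpha>: "\<alpha> \<in> S" "v = r (\<alpha> n)" using vertex_surj[of n] by blast
    then have "a v = pull n a \<alpha>" by (simp add: pull_def restrict0_def)
    then show ?thesis using C0_algebra_norm_upper[OF compact_Y pull_cont[OF a]] by simp
  next
    case False
    then have "a v = 0" using a by (simp add: cont_funs_def)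
    then show ?thesis
      using order_trans[OF norm_ge_zero C0_algebra_norm_upper[OF compact_Y pull_cont[OF a, of n], of undefined]]
      by simp
  qed
qed

text \<open>
  Finitely many cylinder sets on which \<open>f\<close> is nearly constant cover the path space, and by
  injectivity of \<open>s\<close> a far enough vertex decides membership in each of them.
\<close>

lemma nearly_factors:
  assumes f: "f \<in> cont_funs Y" and \<epsilon>: "\<epsilon> > 0"
  obtains N where "\<And>\<alpha> \<beta>. \<alpha> \<in> S \<Longrightarrow> \<beta> \<in> S \<Longrightarrow> r (\<alpha> N) = r (\<beta> N) \<Longrightarrow> dist (f \<alpha>) (f \<beta>) < \<epsilon>"
proof -
  define Q where "Q U N \<longleftrightarrow> openin Y U \<and> (\<forall>\<alpha>\<in>S. \<forall>\<beta>\<in>U. (\<forall>k<N. \<alpha> k = \<beta> k) \<longrightarrow> dist (f \<alpha>) (f \<beta>) < \<epsilon>)" for U and N :: nat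
  have local: "\<exists>U N. \<alpha> \<in> U \<and> Q U N" if \<alpha>: "\<alpha> \<in> S" for \<alpha>
  proof -
    have "openin Y {\<beta> \<in> S. f \<beta> \<in> ball (f \<alpha>) (\<epsilon> / 2)}"
      by (rule openin_continuous_map_preimage[of _ euclidean]) (use f in \<open>auto simp: cont_funs_def\<close>)
    then obtain T where T: "openin (product_topology (\<lambda>_. edges E) UNIV) T"
      "{\<beta> \<in> S. f \<beta> \<in> ball (f \<alpha>) (\<epsilon> / 2)} = T \<inter> {\<alpha>. \<forall>n. s (\<alpha> n) = r (\<alpha> (Suc n))}"
      unfolding inf_paths_def openin_subtopology by blast
    have "\<alpha> \<in> T" using \<alpha> \<epsilon> T(2) by auto
    then obtain B where B: "finite {i. B i \<noteq> W}" "\<And>i. openin (edges E) (B i)" "\<alpha> \<in> Pi\<^sub>E UNIV B" "Pi\<^sub>E UNIV B \<subseteq> T"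
      using T(1) unfolding openin_product_topology_alt by auto
    obtain N where N: "\<And>i. B i \<noteq> W \<Longrightarrow> i < N"
      using finite_nat_set_iff_bounded[of "{i. B i \<noteq> W}"] B(1) by auto
    have near: "dist (f \<alpha>) (f \<beta>) < \<epsilon> / 2" if \<beta>: "\<beta> \<in> S" "\<And>k. k < N \<Longrightarrow> \<beta> k \<in> B k" for \<beta>
    proof -
      have "\<beta> i \<in> B i" for i using \<beta> N[of i] by (cases "B i = W") (auto simp: S_iff)
      then have "\<beta> \<in> T" using B(4) by auto
      then have "\<beta> \<in> {\<beta> \<in> S. f \<beta> \<in> ball (f \<alpha>) (\<epsilon> / 2)}" unfolding T(2) using \<beta>(1) by (simp add: S_iff)
      then show ?thesis by simp
    qed
    \<comment> \<open>Intersecting with \<open>S\<close> also covers \<open>N = 0\<close>, where the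
      first intersection is over no sets at all.\<close>
    define U where "U = (\<Inter>k\<in>{..<N}. {\<beta> \<in> S. \<beta> k \<in> B k}) \<inter> S"
    have "openin Y U"
    proof (cases "N = 0")
      case True
      then show ?thesis by (simp add: U_def)
    next
      case False
      have "openin Y (\<Inter>k\<in>{..<N}. {\<beta> \<in> S. \<beta> k \<in> B k})"
        by (rule openin_Inter) (use False openin_continuous_map_preimage[OF coordinate_cont B(2)] in auto)
      then show ?thesis unfolding U_def by (intro openin_Int) auto
    qed
    moreover have "dist (f \<gamma>) (f \<beta>) < \<epsilon>" if "\<gamma> \<in> S" "\<beta> \<in> U" "\<forall>k<N. \<gamma> k = \<beta> k" for \<beta> \<gamma>
    proof -
      have "dist (f \<alpha>) (f \<beta>) < \<epsilon> / 2" by (rule near) (use that(2) in \<open>auto simp: U_def\<close>)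
      moreover have "dist (f \<alpha>) (f \<gamma>) < \<epsilon> / 2" by (rule near) (use that in \<open>auto simp: U_def\<close>)
      ultimately show ?thesis using dist_triangle_half_r by blast
    qed
    moreover have "\<alpha> \<in> U" using \<alpha> B(3) by (auto simp: U_def)
    ultimately show ?thesis unfolding Q_def by blast
  qed
  have opn: "openin Y U" if "U \<in> {U. \<exists>N. Q U N}" for U using that by (auto simp: Q_def)
  have cover: "S \<subseteq> \<Union>{U. \<exists>N. Q U N}" using local by blast
  obtain \<F> where \<F>: "finite \<F>" "\<F> \<subseteq> {U. \<exists>N. Q U N}" "S \<subseteq> \<Union>\<F>"
    by (rule compact_space_finite_subcover[OF compact_Y opn cover])
  have "\<forall>U\<in>\<F>. \<exists>n. Q U n" using \<F>(2) by blast
  then obtain n where n: "\<And>U. U \<in> \<F> \<Longrightarrow> Q U (n U)" using bchoice[of \<F> Q] by blast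
  define N where "N = Max (insert 0 (n ` \<F>))"
  have N: "n U \<le> N" if "U \<in> \<F>" for U unfolding N_def using \<F>(1) that by (intro Max_ge) auto
  show thesis
  proof
    fix \<alpha> \<beta> assume \<alpha>: "\<alpha> \<in> S" and \<beta>: "\<beta> \<in> S" and eq: "r (\<alpha> N) = r (\<beta> N)"
    obtain U where U: "U \<in> \<F>" "\<beta> \<in> U" using \<F>(3) \<beta> by blast
    have "\<alpha> k = \<beta> k" if "k < n U" for k using vertex_determines[OF \<alpha> \<beta> eq, of k] that N[OF U(1)] by simp
    then show "dist (f \<alpha>) (f \<beta>) < \<epsilon>" using n[OF U(1)] \<alpha> U(2) unfolding Q_def by blast
  qed
qed

text \<open>By \<open>nearly_factors\<close>, \<open>f\<close> varies little on the fibres of the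
  map from \<alpha> to r(\<alpha>(N)). This map is closed, so each vertex has a neighborhood over
  which \<open>f\<close> stays near one value; a partition of unity glues these values to a function
  on the vertices.\<close>

lemma pull_dense:
  assumes f: "f \<in> cont_funs Y" and \<epsilon>: "\<epsilon> > 0"
  obtains n a where "a \<in> cont_funs (verts E)" "cnorm (C0_algebra Y) (cdiff (C0_algebra Y) (pull n a) f) < \<epsilon>"
proof -
  obtain N where N: "\<And>\<alpha> \<beta>. \<alpha> \<in> S \<Longrightarrow> \<beta> \<in> S \<Longrightarrow> r (\<alpha> N) = r (\<beta> N) \<Longrightarrow> dist (f \<alpha>) (f \<beta>) < \<epsilon> / 2"
    using nearly_factors[OF f, of "\<epsilon> / 2"] \<epsilon> by auto
  let ?\<U> = "{U. \<exists>c. \<forall>\<alpha>\<in>S. r (\<alpha> N) \<in> U \<longrightarrow> dist c (f \<alpha>) < \<epsilon> / 2}"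
  have cover: "\<exists>U\<in>?\<U>. openin (verts E) U \<and> v \<in> U" if v: "v \<in> V" for v
  proof -
    obtain \<alpha> where \<alpha>: "\<alpha> \<in> S" "v = r (\<alpha> N)" using vertex_surj[of N] v by blast
    define O' where "O' = {\<beta> \<in> S. f \<beta> \<in> ball (f \<alpha>) (\<epsilon> / 2)}"
    have "openin Y O'" unfolding O'_def
      by (rule openin_continuous_map_preimage[of _ euclidean]) (use f in \<open>auto simp: cont_funs_def\<close>)
    \<comment> \<open>A vertex outside this closed image has all its paths in
      \<open>O'\<close>.\<close>
    then have "closedin (verts E) ((\<lambda>\<alpha>. r (\<alpha> N)) ` (S - O'))"
      using continuous_imp_closed_map[OF vertex_cont compact_Y spaces(3)] unfolding closed_map_def by blast
    then have "openin (verts E) (V - (\<lambda>\<alpha>. r (\<alpha> N)) ` (S - O'))" by blast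
    moreover have "v \<in> V - (\<lambda>\<alpha>. r (\<alpha> N)) ` (S - O')"
      using v \<alpha> N[OF \<alpha>(1)] by (auto simp: O'_def dist_commute)
    moreover have "\<forall>\<beta>\<in>S. r (\<beta> N) \<in> V - (\<lambda>\<alpha>. r (\<alpha> N)) ` (S - O') \<longrightarrow> dist (f \<alpha>) (f \<beta>) < \<epsilon> / 2"
      by (auto simp: O'_def)
    ultimately show ?thesis by blast
  qed
  show thesis
  proof (rule partition_of_unity[OF spaces(1,3) cover])
    fix n :: nat and \<psi> :: "nat \<Rightarrow> 'v \<Rightarrow> real" and U :: "nat \<Rightarrow> 'v set"
    assume p: "\<And>i. i < n \<Longrightarrow> U i \<in> ?\<U>" "\<And>i. i < n \<Longrightarrow> continuous_map (verts E) euclidean (\<psi> i)"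
      "\<And>i v. i < n \<Longrightarrow> v \<in> V \<Longrightarrow> 0 \<le> \<psi> i v"
      "\<And>i v. i < n \<Longrightarrow> v \<in> V \<Longrightarrow> v \<notin> U i \<Longrightarrow> \<psi> i v = 0"
      "\<And>v. v \<in> V \<Longrightarrow> (\<Sum>i<n. \<psi> i v) = 1"
    have "\<forall>i. \<exists>c. i < n \<longrightarrow> (\<forall>\<alpha>\<in>S. r (\<alpha> N) \<in> U i \<longrightarrow> dist c (f \<alpha>) < \<epsilon> / 2)" using p(1) by blast
    then obtain c where c: "\<And>i \<alpha>. i < n \<Longrightarrow> \<alpha> \<in> S \<Longrightarrow> r (\<alpha> N) \<in> U i \<Longrightarrow> dist (c i) (f \<alpha>) < \<epsilon> / 2" by metis
    define a where "a = restrict0 (verts E) (\<lambda>v. \<Sum>i<n. complex_of_real (\<psi> i v) * c i)"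
    have a: "a \<in> cont_funs (verts E)"
      unfolding a_def by (intro restrict0_cont_funs continuous_intros p(2)) auto
    have "cnorm (C0_algebra Y) (cdiff (C0_algebra Y) (pull N a) f) \<le> \<epsilon> / 2"
    proof (rule C0_algebra_norm_least)
      fix \<alpha>
      show "cmod (cdiff (C0_algebra Y) (pull N a) f \<alpha>) \<le> \<epsilon> / 2"
      proof (cases "\<alpha> \<in> S")
        case True
        define v where "v = r (\<alpha> N)"
        have v: "v \<in> V" using True rng_V by (simp add: v_def S_iff)
        have sum1: "(\<Sum>i<n. complex_of_real (\<psi> i v)) = 1" using p(5)[OF v] by (metis of_real_1 of_real_sum)
        have "pull N a \<alpha> - f \<alpha> = (\<Sum>i<n. complex_of_real (\<psi> i v) * c i) - (\<Sum>i<n. complex_of_real (\<psi> i v)) * f \<alpha>"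
          unfolding sum1 using True v by (simp add: pull_def restrict0_def a_def flip: v_def)
        also have "\<dots> = (\<Sum>i<n. complex_of_real (\<psi> i v) * (c i - f \<alpha>))"
          by (simp add: sum_distrib_right sum_subtractf right_diff_distrib)
        finally have "cmod (pull N a \<alpha> - f \<alpha>) \<le> (\<Sum>i<n. cmod (complex_of_real (\<psi> i v) * (c i - f \<alpha>)))"
          by (simp only: norm_sum)
        also have "\<dots> \<le> (\<Sum>i<n. \<psi> i v * (\<epsilon> / 2))"
        proof (rule sum_mono)
          fix i assume "i \<in> {..<n}"
          then have i: "i < n" by simp
          show "cmod (complex_of_real (\<psi> i v) * (c i - f \<alpha>)) \<le> \<psi> i v * (\<epsilon> / 2)"
          proof (cases "v \<in> U i")
            case True
            then have "cmod (c i - f \<alpha>) \<le> \<epsilon> / 2"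
              using c[OF i \<open>\<alpha> \<in> S\<close>] by (simp add: v_def dist_norm less_imp_le)
            then have "\<psi> i v * cmod (c i - f \<alpha>) \<le> \<psi> i v * (\<epsilon> / 2)" by (rule mult_left_mono[OF _ p(3)[OF i v]])
            moreover have "cmod (complex_of_real (\<psi> i v) * (c i - f \<alpha>)) = \<psi> i v * cmod (c i - f \<alpha>)"
              using p(3)[OF i v] by (simp add: norm_mult)
            ultimately show ?thesis by (simp only:)
          next
            case False
            then show ?thesis using p(4)[OF i v] by simp
          qed
        qed
        also have "\<dots> = \<epsilon> / 2" by (simp only: sum_distrib_right[symmetric] p(5)[OF v] mult_1)
        finally show ?thesis by simp
      next
        case False
        then show ?thesis using f \<epsilon> by (simp add: pull_def restrict0_def cont_funs_def)
      qed
    qed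
    then show thesis using \<epsilon> by (intro that[OF a, of N]) linarith
  qed
qed

text \<open>The levels are countably many contractive images of the separable algebra C(E^0), and
  their union is dense.\<close>

lemma separable_Y: "separable_in (C0_algebra Y) (cont_funs Y)"
proof -
  let ?A = "C0_algebra (verts E)" and ?B = "C0_algebra Y"
  interpret A: cstar_algebra ?A by (rule C0_algebra_algebra[OF spaces(1)])
  interpret B: cstar_algebra ?B by (rule C0_algebra_algebra[OF compact_Y])
  have contr: "contractive_hom ?A ?B (pull n)" for n
    by (rule C0_algebra_hom_contractive[OF spaces(1) B.cstar_algebra_axioms pull_hom])
  have le: "cnorm ?B (cdiff ?B (pull n a) (pull n b)) \<le> cnorm ?A (cdiff ?A a b)"
    if "a \<in> carr ?A" "b \<in> carr ?A" for n a b
    using contr[of n] A.diff_closed[OF that] star_hom_diff[OF A.cstar_algebra_axioms pull_hom that, of n]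
    unfolding contractive_hom_def by metis
  obtain d :: "nat \<Rightarrow> _" where d: "range d \<subseteq> carr ?A"
    "\<And>a e. a \<in> cont_funs (verts E) \<Longrightarrow> e > 0 \<Longrightarrow> \<exists>n. cnorm ?A (cdiff ?A (d n) a) < e"
    using C0_algebra_separable[OF spaces(1,5)] unfolding separable_in_def by metis
  show ?thesis
  proof (rule separable_inI[of "range (\<lambda>(n, m). pull n (d m))"])
    have dc: "d m \<in> cont_funs (verts E)" for m using d(1) by (auto simp: C0_algebra_carr spaces)
    then show "range (\<lambda>(n, m). pull n (d m)) \<subseteq> carr ?B"
      using pull_cont by (auto simp: C0_algebra_carr compact_Y)
    fix f and e :: real assume f: "f \<in> cont_funs Y" and e: "e > 0"
    have "e / 2 > 0" using e by simp
    then obtain n a where a: "a \<in> cont_funs (verts E)" "cnorm ?B (cdiff ?B (pull n a) f) < e / 2"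
      by (rule pull_dense[OF f]) blast
    obtain m where m: "cnorm ?A (cdiff ?A (d m) a) < e / 2" using d(2)[OF a(1), of "e / 2"] e by auto
    have "cnorm ?B (cdiff ?B (pull n (d m)) (pull n a)) < e / 2"
      using le[of "d m" a n] m dc a(1) by (simp add: C0_algebra_carr spaces)
    then have "cnorm ?B (cdiff ?B (pull n (d m)) f) < e"
      using B.norm_diff_triangle[of "pull n (d m)" "pull n a" f] a f pull_cont dc
      by (simp add: C0_algebra_carr compact_Y)
    then show "\<exists>g\<in>range (\<lambda>(n, m). pull n (d m)). cnorm ?B (cdiff ?B g f) < e" by (intro bexI[of _ "pull n (d m)"]) auto
  qed auto
qed

end

lemma (in cstar_algebra) unit_adj: "cstar_unit A e \<Longrightarrow> cadj A e = e"
proof -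
  assume e: "cstar_unit A e"
  then have c: "e \<in> carr A" "cadj A e \<in> carr A" by (auto simp: cstar_unit_def closed)
  have "cmult A (cadj A e) e = cadj A e" using e c by (simp add: cstar_unit_def)
  moreover have "cadj A (cmult A (cadj A e) e) = cmult A (cadj A e) e" using c by (simp add: adj_mult adj_adj)
  ultimately show ?thesis using c by (simp add: adj_adj)
qed

section \<open>Covariance when \<open>s\<close> is injective and \<open>r\<close> is
  surjective\<close>

context reversible_graph
begin

lemma src_surj: "v \<in> V \<Longrightarrow> \<exists>e\<in>W. s e = v"
  using sinks by (auto simp: no_sinks_def edges_from_def)

lemma vert_eqI:
  assumes "a \<in> cont_funs (verts E)" "b \<in> cont_funs (verts E)" "\<And>e. e \<in> W \<Longrightarrow> a (s e) = b (s e)"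
  shows "a = b"
proof
  fix v show "a v = b v"
    using assms src_surj[of v] by (cases "v \<in> V") (auto simp: cont_funs_def)
qed

lemma edge_inner_src: "e \<in> W \<Longrightarrow> edge_inner \<xi> \<eta> (s e) = cnj (\<xi> e) * \<eta> e"
  by (simp add: edge_inner_def fibre_sum_src)

lemma edge_inner_one: "edge_inner (indicator W) (indicator W) = indicator V"
  by (rule vert_eqI) (simp_all add: inner_closed indicator_cont_funs edge_inner_src src_V)

lemma covariant_range:
  assumes "covariant_rep X B \<pi> \<tau>"
  shows "cmult B (\<tau> (indicator W)) (cadj B (\<tau> (indicator W))) = \<pi> (indicator V)"
proof -
  let ?one = "indicator W :: 'e \<Rightarrow> complex" and ?e = "indicator V :: 'v \<Rightarrow> complex"
  obtain \<phi> where \<phi>: "\<And>\<xi> \<eta>. \<xi> \<in> mcarr X \<Longrightarrow> \<eta> \<in> mcarr X \<Longrightarrow> \<phi> (rank_one X \<xi> \<eta>) = cmult B (\<tau> \<xi>) (cadj B (\<tau> \<eta>))"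
    "\<And>a. a \<in> katsura_ideal X \<Longrightarrow> \<phi> (left_op X a) = \<pi> a"
    using assms unfolding covariant_rep_def by metis
  \<comment> \<open>For injective \<open>s\<close> the inner product of 1 with \<xi>, taken at s(e),
    is \<xi>(e); so the rank one operator of 1 with itself is the identity.\<close>
  have eq: "left_op X ?e = rank_one X ?one ?one"
    unfolding left_op_def rank_one_def
  proof (rule restrict_ext)
    fix \<xi> assume "\<xi> \<in> mcarr X"
    then have \<xi>: "\<xi> \<in> cont_funs (edges E)" by simp
    have "?e (r e) * \<xi> e = ?one e * fibre_sum (\<lambda>d. cnj (?one d) * \<xi> d) (s e)" for e
      using \<xi> rng_V[of e] fibre_sum_src[of e "\<lambda>d. cnj (?one d) * \<xi> d"]
      by (cases "e \<in> W") (auto simp: cont_funs_def)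
    then show "mleft X ?e \<xi> = mright X ?one (minner X ?one \<xi>)" by simp
  qed
  have "?e \<in> katsura_ideal X"
    unfolding katsura_ideal_def
  proof (intro CollectI conjI ballI impI)
    show "?e \<in> carr (coeff X)" by (simp add: C0_algebra_carr spaces indicator_cont_funs)
    show "left_op X ?e \<in> carr (compact_ops X)" unfolding eq by (intro rank_one_compact indicator_cont_funs)
    fix b assume "b \<in> carr (coeff X)" and zero: "left_op X b = czero (adjointable_ops X)"
    then have b: "b \<in> cont_funs (verts E)" by (simp add: C0_algebra_carr spaces)
    \<comment> \<open>Evaluating the zero operator at the constant 1 gives b o r = 0, and
      \<open>r\<close> is surjective.\<close>
    have "left_op X b ?one = czero (adjointable_ops X) ?one" using zero by simp
    then have br: "b (r e) * ?one e = 0" for e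
      by (simp add: left_op_def adjointable_ops_def indicator_cont_funs fun_eq_iff)
    have "b v = 0" for v
    proof (cases "v \<in> V")
      case True
      then obtain e where "e \<in> W" "v = r e" using surj by blast
      then show ?thesis using br[of e] by simp
    qed (use b in \<open>simp add: cont_funs_def\<close>)
    then show "cmult (coeff X) ?e b = czero (coeff X)" by simp
  qed
  then show ?thesis using \<phi>(2)[of ?e] \<phi>(1)[of ?one ?one] by (simp add: eq indicator_cont_funs)
qed

end

text \<open>The relation \<open>range\<close>, which makes \<open>u\<close> a unitary, is all of
  covariance that enters the extension to C(E^infinity).\<close>

locale crossed_graph_rep = reversible_graph E + toeplitz E B \<pi> \<tau>
  for E :: "('v, 'e) top_graph" and B :: "'b cstar" and \<pi> \<tau> +
  assumes unit: "cstar_unit B (\<pi> (indicator V))"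
    and range: "cmult B (\<tau> (indicator W)) (cadj B (\<tau> (indicator W))) = \<pi> (indicator V)"
begin

abbreviation "u \<equiv> \<tau> (indicator W)"

definition Ad :: "'b \<Rightarrow> 'b" where "Ad x = cmult B (cmult B u x) (cadj B u)"

definition rho :: "nat \<Rightarrow> ('v \<Rightarrow> complex) \<Rightarrow> 'b" where "rho n a = (Ad ^^ n) (\<pi> a)"

lemma u_closed: "u \<in> carr B" "cadj B u \<in> carr B"
  using \<tau>_closed[OF indicator_cont_funs] B.adj_closed by auto

lemma u_isometry: "cmult B (cadj B u) u = \<pi> (indicator V)"
  using \<tau>_inner[OF indicator_cont_funs indicator_cont_funs] edge_inner_one by simp

lemma u_unitary: "cstar_unitary B u"
  using u_closed unit u_isometry range by (simp add: cstar_unitary_def)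

lemma u_cancel: "x \<in> carr B \<Longrightarrow> cmult B (cadj B u) (cmult B u x) = x"
    "x \<in> carr B \<Longrightarrow> cmult B u (cmult B (cadj B u) x) = x"
  using unit u_closed u_isometry range by (simp_all add: cstar_unit_def flip: B.mult_assoc)

lemma norm_u: "cnorm B u \<le> 1"
proof -
  have "cnorm B (\<pi> (indicator V)) \<le> 1"
    by (rule B.projection_norm_le) (use unit B.unit_adj[OF unit] in \<open>auto simp: cstar_unit_def\<close>)
  then have "(cnorm B u)\<^sup>2 \<le> 1\<^sup>2" using B.norm_cstar[OF u_closed(1)] u_isometry by simp
  then show ?thesis by (rule power2_le_imp_le) simp
qed

lemma Ad_closed: "x \<in> carr B \<Longrightarrow> Ad x \<in> carr B"
  unfolding Ad_def by (intro B.mult_closed u_closed)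

lemma Ad_contractive: "contractive_hom B B Ad"
  unfolding contractive_hom_def star_hom_def
proof (intro conjI ballI allI)
  fix x y assume x: "x \<in> carr B" and y: "y \<in> carr B"
  show "Ad (cadd B x y) = cadd B (Ad x) (Ad y)"
    using x y u_closed by (simp add: Ad_def B.mult_add B.add_mult B.closed)
  have "cmult B (Ad x) (Ad y) = cmult B u (cmult B x (cmult B (cadj B u) (cmult B u (cmult B y (cadj B u)))))"
    using x y u_closed by (simp add: Ad_def B.mult_assoc B.closed)
  also have "\<dots> = Ad (cmult B x y)"
    using x y u_closed by (simp add: Ad_def u_cancel B.mult_assoc B.closed)
  finally show "Ad (cmult B x y) = cmult B (Ad x) (Ad y)" by simp
next
  fix x c assume x: "x \<in> carr B"
  show "Ad x \<in> carr B" by (rule Ad_closed[OF x])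
  show "Ad (cscale B c x) = cscale B c (Ad x)"
    using x u_closed by (simp add: Ad_def B.mult_scale B.scale_mult B.closed)
  show "Ad (cadj B x) = cadj B (Ad x)"
    using x u_closed by (simp add: Ad_def B.adj_mult B.adj_adj B.mult_assoc B.closed)
  have "cnorm B (Ad x) \<le> cnorm B (cmult B u x) * cnorm B (cadj B u)"
    unfolding Ad_def by (intro B.norm_mult B.mult_closed u_closed x)
  also have "\<dots> \<le> cnorm B (cmult B u x) * 1"
    using norm_u u_closed x by (intro mult_left_mono) (auto simp: B.norm_adj B.norm_nonneg B.closed)
  also have "\<dots> \<le> cnorm B u * cnorm B x" using B.norm_mult[OF u_closed(1) x] by simp
  also have "\<dots> \<le> 1 * cnorm B x" using norm_u x by (intro mult_right_mono) (auto simp: B.norm_nonneg)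
  finally show "cnorm B (Ad x) \<le> cnorm B x" by simp
qed

lemma rho_hom: "star_hom (C0_algebra (verts E)) B (rho n)"
proof (induction n)
  case 0
  then show ?case using \<pi>_hom by (simp add: rho_def[abs_def])
next
  case (Suc n)
  have "star_hom (C0_algebra (verts E)) B (\<lambda>a. Ad (rho n a))"
    by (rule star_hom_comp[OF Suc]) (use Ad_contractive in \<open>simp add: contractive_hom_def\<close>)
  then show ?case by (simp add: rho_def[abs_def])
qed

lemma rho_closed: "a \<in> cont_funs (verts E) \<Longrightarrow> rho n a \<in> carr B"
  using star_homD(1)[OF rho_hom] by (simp add: C0_algebra_carr spaces)

lemma rho_norm: "a \<in> cont_funs (verts E) \<Longrightarrow> cnorm B (rho n a) \<le> cnorm (C0_algebra (verts E)) a"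
  using C0_algebra_hom_contractive[OF spaces(1) B.cstar_algebra_axioms rho_hom]
  by (simp add: contractive_hom_def C0_algebra_carr spaces)

text \<open>In the module, \<open>\<xi>\<close> is the constant 1 times the coefficient \<xi> o
  s^-1, which is \<open>fibre_sum \<xi>\<close>.\<close>

lemma \<tau>_fibre_sum:
  assumes \<xi>: "\<xi> \<in> cont_funs (edges E)"
  shows "\<tau> \<xi> = cmult B u (\<pi> (fibre_sum \<xi>))"
proof -
  have "(\<lambda>e. indicator W e * fibre_sum \<xi> (s e)) = \<xi>"
  proof
    fix e show "indicator W e * fibre_sum \<xi> (s e) = \<xi> e"
      using \<xi> fibre_sum_src[of e \<xi>] by (cases "e \<in> W") (auto simp: cont_funs_def)
  qed
  then show ?thesis using \<tau>_right[OF fibre_sum_cont[OF \<xi>] indicator_cont_funs] by simp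
qed

text \<open>Both u \<pi>(push a) and \<pi>(a) u are the image of the module element a o r;
  multiplying by u* on the right gives the claim.\<close>

lemma \<pi>_push: "a \<in> cont_funs (verts E) \<Longrightarrow> \<pi> a = Ad (\<pi> (push a))"
proof -
  assume a: "a \<in> cont_funs (verts E)"
  have "cmult B u (\<pi> (push a)) = \<tau> (\<lambda>e. a (r e) * indicator W e)"
    unfolding push_def by (rule \<tau>_fibre_sum[symmetric]) (intro left_cont a indicator_cont_funs)
  also have "\<dots> = cmult B (\<pi> a) u" by (rule \<tau>_left[OF a indicator_cont_funs])
  finally have "Ad (\<pi> (push a)) = cmult B (\<pi> a) (\<pi> (indicator V))"
    using u_closed \<pi>_closed[OF a] by (simp add: Ad_def B.mult_assoc range)
  then show ?thesis using unit \<pi>_closed[OF a] by (simp add: cstar_unit_def)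
qed

text \<open>By \<open>pull_push\<close> and \<open>\<pi>_push\<close>, a function at level n and the
  element assigned to it can be rewritten together at any later level. This brings two functions of
  different levels to a common one.\<close>

lemma lift:
  assumes "a \<in> cont_funs (verts E)" "n \<le> N"
  shows "\<exists>b. b \<in> cont_funs (verts E) \<and> pull N b = pull n a \<and> rho N b = rho n a"
  using assms(2)
proof (induction N rule: dec_induct)
  case base
  then show ?case using assms(1) by blast
next
  case (step N)
  then obtain b where b: "b \<in> cont_funs (verts E)" "pull N b = pull n a" "rho N b = rho n a" by blast
  have "rho (Suc N) (push b) = rho N b"
    unfolding rho_def funpow_Suc_right using \<pi>_push[OF b(1)] by simp
  then show ?case using b push_cont[OF b(1)] pull_push[of N b] by (intro exI[of _ "push b"]) simp
qed

section \<open>Extension of the representation to C(E^infinity)\<close>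

interpretation F: cstar_algebra "C0_algebra Y"
  by (rule C0_algebra_algebra[OF compact_Y])

text \<open>
  \<open>lim_graph\<close> is the closure of the graph of \<open>pull n a \<mapsto> rho n a\<close>; being a subalgebra on
  which the second component is dominated by the first, it is the graph of a homomorphism.
\<close>

definition lim_graph :: "((nat \<Rightarrow> 'e) \<Rightarrow> complex) \<Rightarrow> 'b \<Rightarrow> bool"
  where "lim_graph f x \<longleftrightarrow> f \<in> cont_funs Y \<and> x \<in> carr B \<and>
    (\<exists>n a. (\<forall>k. a k \<in> cont_funs (verts E)) \<and> F.clim (\<lambda>k. pull (n k) (a k)) f \<and> B.clim (\<lambda>k. rho (n k) (a k)) x)"

lemma lim_graphI:
  "\<lbrakk>\<And>k. a k \<in> cont_funs (verts E); f \<in> cont_funs Y; x \<in> carr B;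
    F.clim (\<lambda>k. pull (n k) (a k)) f; B.clim (\<lambda>k. rho (n k) (a k)) x\<rbrakk> \<Longrightarrow> lim_graph f x"
  unfolding lim_graph_def by blast

lemma carr_Y [simp]: "carr (C0_algebra Y) = cont_funs Y"
  by (rule C0_algebra_carr[OF compact_Y])

lemma carr_V [simp]: "carr (C0_algebra (verts E)) = cont_funs (verts E)"
  by (rule C0_algebra_carr[OF spaces(1)])

lemma lim_graph_pull: "a \<in> cont_funs (verts E) \<Longrightarrow> lim_graph (pull n a) (rho n a)"
  by (rule lim_graphI[of "\<lambda>_. a" _ _ "\<lambda>_. n"])
    (simp_all add: pull_cont rho_closed F.clim_const B.clim_const)

text \<open>Both sequences are lifted term by term to the larger of their levels; at a fixed level
  \<open>pull\<close> and \<open>rho\<close> are homomorphisms.\<close>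

lemma lim_graph_common:
  assumes "lim_graph f x" "lim_graph g y"
  obtains n a b where "\<And>k. a k \<in> cont_funs (verts E)" "\<And>k. b k \<in> cont_funs (verts E)"
    "F.clim (\<lambda>k. pull (n k) (a k)) f" "B.clim (\<lambda>k. rho (n k) (a k)) x"
    "F.clim (\<lambda>k. pull (n k) (b k)) g" "B.clim (\<lambda>k. rho (n k) (b k)) y"
proof -
  obtain n a where a: "\<And>k. a k \<in> cont_funs (verts E)" "F.clim (\<lambda>k. pull (n k) (a k)) f" "B.clim (\<lambda>k. rho (n k) (a k)) x"
    using assms(1) unfolding lim_graph_def by blast
  obtain m b where b: "\<And>k. b k \<in> cont_funs (verts E)" "F.clim (\<lambda>k. pull (m k) (b k)) g" "B.clim (\<lambda>k. rho (m k) (b k)) y"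
    using assms(2) unfolding lim_graph_def by blast
  define N where "N k = max (n k) (m k)" for k
  have "\<forall>k. \<exists>c. c \<in> cont_funs (verts E) \<and> pull (N k) c = pull (n k) (a k) \<and> rho (N k) c = rho (n k) (a k)"
    using lift[OF a(1)] by (simp add: N_def)
  then obtain a' where a': "\<And>k. a' k \<in> cont_funs (verts E)" "\<And>k. pull (N k) (a' k) = pull (n k) (a k)"
    "\<And>k. rho (N k) (a' k) = rho (n k) (a k)" by metis
  have "\<forall>k. \<exists>c. c \<in> cont_funs (verts E) \<and> pull (N k) c = pull (m k) (b k) \<and> rho (N k) c = rho (m k) (b k)"
    using lift[OF b(1)] by (simp add: N_def)
  then obtain b' where b': "\<And>k. b' k \<in> cont_funs (verts E)" "\<And>k. pull (N k) (b' k) = pull (m k) (b k)"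
    "\<And>k. rho (N k) (b' k) = rho (m k) (b k)" by metis
  show thesis
    by (rule that[of a' b' N]) (simp_all add: a b a' b')
qed

lemma lim_graph_closed: "lim_graph f x \<Longrightarrow> f \<in> cont_funs Y" "lim_graph f x \<Longrightarrow> x \<in> carr B"
  by (auto simp: lim_graph_def)

text \<open>At each level \<open>rho n a\<close> is bounded by the norm of \<open>a\<close>, and
  that by the norm of \<open>pull n a\<close>, the second because \<open>r\<close> is surjective.
  The inequality between the outer terms passes to limits.\<close>

lemma lim_graph_norm:
  assumes "lim_graph f x"
  shows "cnorm B x \<le> cnorm (C0_algebra Y) f"
proof -
  note c = lim_graph_closed[OF assms]
  obtain n a where a: "\<And>k. a k \<in> cont_funs (verts E)" "F.clim (\<lambda>k. pull (n k) (a k)) f" "B.clim (\<lambda>k. rho (n k) (a k)) x"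
    using assms unfolding lim_graph_def by blast
  show ?thesis
  proof (rule LIMSEQ_le)
    show "(\<lambda>k. cnorm B (rho (n k) (a k))) \<longlonglongrightarrow> cnorm B x"
      by (rule B.clim_norm[OF a(3)]) (simp_all add: rho_closed a c)
    show "(\<lambda>k. cnorm (C0_algebra Y) (pull (n k) (a k))) \<longlonglongrightarrow> cnorm (C0_algebra Y) f"
      by (rule F.clim_norm[OF a(2)]) (simp_all add: pull_cont a c)
    have "cnorm B (rho (n k) (a k)) \<le> cnorm (C0_algebra Y) (pull (n k) (a k))" for k
      using rho_norm[OF a(1)] pull_norm[OF a(1)] by (rule order_trans)
    then show "\<exists>N. \<forall>k\<ge>N. cnorm B (rho (n k) (a k)) \<le> cnorm (C0_algebra Y) (pull (n k) (a k))" by blast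
  qed
qed

lemma lim_graph_ops:
  assumes f: "lim_graph f x" and g: "lim_graph g y"
  shows "lim_graph (cadd (C0_algebra Y) f g) (cadd B x y)" "lim_graph (cmult (C0_algebra Y) f g) (cmult B x y)"
    "lim_graph (cscale (C0_algebra Y) c f) (cscale B c x)" "lim_graph (cadj (C0_algebra Y) f) (cadj B x)"
proof -
  note fc = lim_graph_closed[OF f] and gc = lim_graph_closed[OF g]
  obtain n a b where a: "\<And>k. a k \<in> cont_funs (verts E)" and b: "\<And>k. b k \<in> cont_funs (verts E)"
    and lim: "F.clim (\<lambda>k. pull (n k) (a k)) f" "B.clim (\<lambda>k. rho (n k) (a k)) x"
      "F.clim (\<lambda>k. pull (n k) (b k)) g" "B.clim (\<lambda>k. rho (n k) (b k)) y"
    by (rule lim_graph_common[OF f g]) blast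
  note pc = pull_cont[OF a] pull_cont[OF b] rho_closed[OF a] rho_closed[OF b]
  note hom = star_homD[OF rho_hom] star_homD[OF pull_hom]
  let ?V = "C0_algebra (verts E)"
  show "lim_graph (cadd (C0_algebra Y) f g) (cadd B x y)"
  proof (rule lim_graphI[of "\<lambda>k. cadd ?V (a k) (b k)" _ _ n])
    show "F.clim (\<lambda>k. pull (n k) (cadd ?V (a k) (b k))) (cadd (C0_algebra Y) f g)"
      unfolding hom(7)[unfolded carr_V, OF a b] by (rule F.clim_add) (simp_all add: lim pc fc gc)
    show "B.clim (\<lambda>k. rho (n k) (cadd ?V (a k) (b k))) (cadd B x y)"
      unfolding hom(2)[unfolded carr_V, OF a b] by (rule B.clim_add) (simp_all add: lim pc fc gc)
  qed (use a b fc gc in \<open>simp_all add: cont_funs_closed(1) B.closed\<close>)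
  show "lim_graph (cmult (C0_algebra Y) f g) (cmult B x y)"
  proof (rule lim_graphI[of "\<lambda>k. cmult ?V (a k) (b k)" _ _ n])
    show "F.clim (\<lambda>k. pull (n k) (cmult ?V (a k) (b k))) (cmult (C0_algebra Y) f g)"
      unfolding hom(9)[unfolded carr_V, OF a b] by (rule F.clim_mult) (simp_all add: lim pc fc gc)
    show "B.clim (\<lambda>k. rho (n k) (cmult ?V (a k) (b k))) (cmult B x y)"
      unfolding hom(4)[unfolded carr_V, OF a b] by (rule B.clim_mult) (simp_all add: lim pc fc gc)
  qed (use a b fc gc in \<open>simp_all add: cont_funs_closed(3) B.closed\<close>)
  show "lim_graph (cscale (C0_algebra Y) c f) (cscale B c x)"
  proof (rule lim_graphI[of "\<lambda>k. cscale ?V c (a k)" _ _ n])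
    show "F.clim (\<lambda>k. pull (n k) (cscale ?V c (a k))) (cscale (C0_algebra Y) c f)"
      unfolding hom(8)[unfolded carr_V, OF a] by (rule F.clim_scale) (simp_all add: lim pc fc)
    show "B.clim (\<lambda>k. rho (n k) (cscale ?V c (a k))) (cscale B c x)"
      unfolding hom(3)[unfolded carr_V, OF a] by (rule B.clim_scale) (simp_all add: lim pc fc)
  qed (use a fc in \<open>simp_all add: cont_funs_closed(4)[OF a a] cont_funs_closed(4)[OF fc(1) fc(1)] B.closed\<close>)
  show "lim_graph (cadj (C0_algebra Y) f) (cadj B x)"
  proof (rule lim_graphI[of "\<lambda>k. cadj ?V (a k)" _ _ n])
    show "F.clim (\<lambda>k. pull (n k) (cadj ?V (a k))) (cadj (C0_algebra Y) f)"
      unfolding hom(10)[unfolded carr_V, OF a] by (rule F.clim_adj) (simp_all add: lim pc fc)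
    show "B.clim (\<lambda>k. rho (n k) (cadj ?V (a k))) (cadj B x)"
      unfolding hom(5)[unfolded carr_V, OF a] by (rule B.clim_adj) (simp_all add: lim pc fc)
  qed (use a fc in \<open>simp_all add: cont_funs_closed(5)[OF a a] cont_funs_closed(5)[OF fc(1) fc(1)] B.closed\<close>)
qed

lemma lim_graph_diff:
  assumes "lim_graph f x" "lim_graph g y"
  shows "lim_graph (cdiff (C0_algebra Y) f g) (cdiff B x y)"
  unfolding cdiff_def by (rule lim_graph_ops(1)[OF assms(1) lim_graph_ops(3)[OF assms(2) assms(2)]])

lemma lim_graph_dist:
  "\<lbrakk>lim_graph f x; lim_graph g y\<rbrakk> \<Longrightarrow> cnorm B (cdiff B x y) \<le> cnorm (C0_algebra Y) (cdiff (C0_algebra Y) f g)"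
  using lim_graph_norm lim_graph_diff by blast

lemma lim_graph_unique:
  assumes "lim_graph f x" "lim_graph f y"
  shows "x = y"
proof -
  note c = lim_graph_closed[OF assms(1)] lim_graph_closed[OF assms(2)]
  have "cnorm B (cdiff B x y) \<le> 0"
    using lim_graph_dist[OF assms] F.diff_self[of f] c F.norm_zero by simp
  then have "cnorm B (cdiff B x y) = 0" using B.norm_nonneg[OF B.diff_closed, of x y] c by simp
  then show ?thesis using B.norm_diff_eq_zero_iff c by blast
qed

text \<open>Approximants of \<open>f\<close> come from \<open>pull_dense\<close>; by
  \<open>lim_graph_dist\<close> the elements assigned to them form a Cauchy sequence.\<close>

lemma lim_graph_exists:
  assumes f: "f \<in> cont_funs Y"
  shows "\<exists>x. lim_graph f x"
proof -
  have "\<forall>k. \<exists>n a. a \<in> cont_funs (verts E) \<and> cnorm (C0_algebra Y) (cdiff (C0_algebra Y) (pull n a) f) < 1 / Suc k"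
  proof
    fix k show "\<exists>n a. a \<in> cont_funs (verts E) \<and> cnorm (C0_algebra Y) (cdiff (C0_algebra Y) (pull n a) f) < 1 / Suc k"
      by (rule pull_dense[OF f, of "1 / Suc k"]) auto
  qed
  then obtain n a where a: "\<And>k. a k \<in> cont_funs (verts E)"
    and lim: "\<And>k. cnorm (C0_algebra Y) (cdiff (C0_algebra Y) (pull (n k) (a k)) f) < 1 / Suc k" by metis
  have small: "\<exists>N. \<forall>k\<ge>N. cnorm (C0_algebra Y) (cdiff (C0_algebra Y) (pull (n k) (a k)) f) < e" if e: "e > 0" for e
  proof -
    obtain N where N: "1 / Suc N < e" using nat_approx_posE[OF e] by blast
    have "cnorm (C0_algebra Y) (cdiff (C0_algebra Y) (pull (n k) (a k)) f) < e" if "k \<ge> N" for k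
    proof -
      have "1 / real (Suc k) \<le> 1 / real (Suc N)" using that by (simp add: frac_le)
      then show ?thesis using lim[of k] N by linarith
    qed
    then show ?thesis by blast
  qed
  have "F.clim (\<lambda>k. pull (n k) (a k)) f"
    by (rule F.climI[OF less_imp_le[OF lim] LIMSEQ_Suc[OF lim_1_over_n]]) (simp_all add: pull_cont a f)
  moreover have "\<exists>x\<in>carr B. (\<lambda>k. cnorm B (cdiff B (rho (n k) (a k)) x)) \<longlonglongrightarrow> 0"
  proof (rule B.complete)
    fix e :: real assume e: "e > 0"
    obtain N where N: "\<And>k. k \<ge> N \<Longrightarrow> cnorm (C0_algebra Y) (cdiff (C0_algebra Y) (pull (n k) (a k)) f) < e / 2"
      using small[of "e / 2"] e by auto
    have "cnorm B (cdiff B (rho (n k) (a k)) (rho (n l) (a l))) < e" if "k \<ge> N" "l \<ge> N" for k l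
    proof -
      let ?p = "\<lambda>k. pull (n k) (a k)"
      have p: "?p k \<in> carr (C0_algebra Y)" "f \<in> carr (C0_algebra Y)" for k by (simp_all add: pull_cont a f)
      have "cnorm B (cdiff B (rho (n k) (a k)) (rho (n l) (a l))) \<le> cnorm (C0_algebra Y) (cdiff (C0_algebra Y) (?p k) (?p l))"
        by (rule lim_graph_dist[OF lim_graph_pull[OF a] lim_graph_pull[OF a]])
      also have "\<dots> \<le> cnorm (C0_algebra Y) (cdiff (C0_algebra Y) (?p k) f) + cnorm (C0_algebra Y) (cdiff (C0_algebra Y) f (?p l))"
        by (rule F.norm_diff_triangle[OF p(1) p(2) p(1)])
      also have "\<dots> < e" using N[OF that(1)] N[OF that(2)] F.norm_diff_commute[OF p(2) p(1), of l] by linarith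
      finally show ?thesis .
    qed
    then show "\<exists>N. \<forall>k\<ge>N. \<forall>l\<ge>N. cnorm B (cdiff B (rho (n k) (a k)) (rho (n l) (a l))) < e" by blast
  qed (simp add: rho_closed a)
  then obtain x where "x \<in> carr B" "B.clim (\<lambda>k. rho (n k) (a k)) x" by (auto simp: B.clim_def)
  ultimately have "lim_graph f x" using f a by (intro lim_graphI)
  then show ?thesis ..
qed

definition ext :: "((nat \<Rightarrow> 'e) \<Rightarrow> complex) \<Rightarrow> 'b"
  where "ext f = (THE x. lim_graph f x)"

lemma ext_eq: "lim_graph f x \<Longrightarrow> ext f = x"
  unfolding ext_def using lim_graph_unique by blast

lemma lim_graph_ext: "f \<in> cont_funs Y \<Longrightarrow> lim_graph f (ext f)"
  using lim_graph_exists ext_eq by blast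

lemma ext_pull: "a \<in> cont_funs (verts E) \<Longrightarrow> ext (pull n a) = rho n a"
  by (rule ext_eq[OF lim_graph_pull])

lemma ext_hom: "star_hom (C0_algebra Y) B ext"
  unfolding star_hom_def carr_Y
  using lim_graph_ops[OF lim_graph_ext lim_graph_ext] lim_graph_closed(2)[OF lim_graph_ext] ext_eq
  by blast

lemma shift_hom: "star_hom (C0_algebra Y) (C0_algebra Y) (\<lambda>f. restrict0 Y (f \<circ> back_shift))"
proof -
  have "restrict0 Y (f \<circ> back_shift) \<in> cont_funs Y" if "f \<in> cont_funs Y" for f
    using that continuous_map_compose[OF back_shift_cont, of euclidean f]
    by (intro restrict0_cont_funs) (simp add: cont_funs_def)
  then show ?thesis
    unfolding star_hom_def by (auto simp: restrict0_def fun_eq_iff)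
qed

text \<open>Composition with the shift raises the level of \<open>pull\<close> by one, and
  \<open>Ad\<close> raises that of \<open>rho\<close> by one; both maps are contractive, so the
  identity passes to limits.\<close>

lemma ext_shift:
  assumes f: "f \<in> cont_funs Y"
  shows "ext (restrict0 Y (f \<circ> back_shift)) = Ad (ext f)"
proof (rule ext_eq)
  have x: "lim_graph f (ext f)" by (rule lim_graph_ext[OF f])
  note c = lim_graph_closed[OF x]
  obtain n a where a: "\<And>k. a k \<in> cont_funs (verts E)" "F.clim (\<lambda>k. pull (n k) (a k)) f" "B.clim (\<lambda>k. rho (n k) (a k)) (ext f)"
    using x unfolding lim_graph_def by blast
  note contr = C0_algebra_hom_contractive[OF compact_Y F.cstar_algebra_axioms shift_hom]
  show "lim_graph (restrict0 Y (f \<circ> back_shift)) (Ad (ext f))"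
  proof (rule lim_graphI[of a _ _ "\<lambda>k. Suc (n k)"])
    show "F.clim (\<lambda>k. pull (Suc (n k)) (a k)) (restrict0 Y (f \<circ> back_shift))"
      unfolding pull_shift[symmetric]
      by (rule contractive_hom_clim[OF F.cstar_algebra_axioms F.cstar_algebra_axioms contr])
        (simp_all add: pull_cont a f)
    have "rho (Suc m) b = Ad (rho m b)" for m b by (simp add: rho_def)
    then show "B.clim (\<lambda>k. rho (Suc (n k)) (a k)) (Ad (ext f))"
      using contractive_hom_clim[OF B.cstar_algebra_axioms B.cstar_algebra_axioms Ad_contractive _ c(2) a(3)]
      by (simp add: rho_closed a)
    show "restrict0 Y (f \<circ> back_shift) \<in> cont_funs Y" using star_homD(1)[OF shift_hom] f by simp
  qed (use a Ad_closed c in auto)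
qed

lemma ext_one: "ext (indicator S) = \<pi> (indicator V)"
proof -
  have "pull 0 (indicator V) = indicator S"
    using rng_V by (auto simp: pull_def restrict0_def fun_eq_iff indicator_def S_iff)
  then show ?thesis using ext_pull[OF indicator_cont_funs, of 0] by (simp add: rho_def)
qed

end

section \<open>The isomorphism\<close>

context reversible_graph
begin

sublocale D: compact_dynamics "inf_paths E" back_shift
  by unfold_locales (rule compact_Y)

definition lift_fun :: "('e \<Rightarrow> complex) \<Rightarrow> (nat \<Rightarrow> 'e) \<Rightarrow> complex"
  where "lift_fun \<xi> = restrict0 Y (\<xi> \<circ> first_edge)"

text \<open>The first edge \<alpha>(0) has source r(\<alpha>(1)) and is determined by it, so a
  function of the first edge lives at level 1.\<close>

lemma lift_fun_pull: "lift_fun \<xi> = pull 1 (fibre_sum \<xi>)"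
  unfolding lift_fun_def pull_def
proof (rule ext)
  fix \<alpha> show "restrict0 Y (\<xi> \<circ> first_edge) \<alpha> = restrict0 Y (\<lambda>\<alpha>. fibre_sum \<xi> (r (\<alpha> 1))) \<alpha>"
    using fibre_sum_src[of "\<alpha> 0" \<xi>] by (auto simp: restrict0_def first_edge_def S_iff)
qed

lemma lift_fun_cont: "\<xi> \<in> cont_funs (edges E) \<Longrightarrow> lift_fun \<xi> \<in> cont_funs Y"
  unfolding lift_fun_pull by (intro pull_cont fibre_sum_cont)

definition cross_\<pi> where "cross_\<pi> a = D.cf (pull 0 a)"
definition cross_\<tau> where "cross_\<tau> \<xi> = cmult D.A (D.cf (lift_fun \<xi>)) D.u"

lemma cross_u:
  "D.u \<in> carr D.A" "cadj D.A D.u \<in> carr D.A"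
  "x \<in> carr D.A \<Longrightarrow> cmult D.A (cadj D.A D.u) (cmult D.A D.u x) = x"
  "x \<in> carr D.A \<Longrightarrow> cmult D.A D.u (cmult D.A (cadj D.A D.u) x) = x"
  using D.crossed_unitary D.A.adj_closed[OF D.u_closed]
  by (auto simp: cstar_unitary_def cstar_unit_def simp flip: D.A.mult_assoc)

lemma lift_one: "D.cf (lift_fun (indicator W)) = D.cf (indicator S)"
proof -
  have "lift_fun (indicator W) = indicator S"
    by (auto simp: lift_fun_def restrict0_def fun_eq_iff first_edge_def S_iff indicator_def)
  then show ?thesis by simp
qed

lemma cross_\<tau>_one: "cross_\<tau> (indicator W) = D.u"
  unfolding cross_\<tau>_def lift_one using D.crossed_unit D.u_closed by (simp add: cstar_unit_def)

lemma cross_toeplitz: "toeplitz E D.A cross_\<pi> cross_\<tau>"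
proof -
  note hom = star_homD[OF D.cf_hom, simplified C0_algebra_carr[OF compact_Y] C0_algebra_ops]
  have \<pi>: "star_hom (C0_algebra (verts E)) D.A cross_\<pi>"
    unfolding cross_\<pi>_def[abs_def] by (rule star_hom_comp[OF pull_hom D.cf_hom])
  have c: "D.cf (lift_fun \<xi>) \<in> carr D.A" "cross_\<tau> \<xi> \<in> carr D.A" if "\<xi> \<in> cont_funs (edges E)" for \<xi>
    using D.cf_closed[OF lift_fun_cont[OF that]] D.u_closed D.A.mult_closed by (auto simp: cross_\<tau>_def)
  have add: "cross_\<tau> (\<lambda>e. \<xi> e + \<eta> e) = cadd D.A (cross_\<tau> \<xi>) (cross_\<tau> \<eta>)"
    if "\<xi> \<in> cont_funs (edges E)" "\<eta> \<in> cont_funs (edges E)" for \<xi> \<eta>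
  proof -
    have "lift_fun (\<lambda>e. \<xi> e + \<eta> e) = (\<lambda>\<alpha>. lift_fun \<xi> \<alpha> + lift_fun \<eta> \<alpha>)"
      by (auto simp: lift_fun_def restrict0_def)
    then show ?thesis
      using hom(2)[OF lift_fun_cont[OF that(1)] lift_fun_cont[OF that(2)]] c[OF that(1)] c[OF that(2)] D.u_closed
      by (simp add: cross_\<tau>_def D.A.add_mult)
  qed
  have scale: "cross_\<tau> (\<lambda>e. k * \<xi> e) = cscale D.A k (cross_\<tau> \<xi>)" if "\<xi> \<in> cont_funs (edges E)" for k \<xi>
  proof -
    have "lift_fun (\<lambda>e. k * \<xi> e) = (\<lambda>\<alpha>. k * lift_fun \<xi> \<alpha>)"
      by (auto simp: lift_fun_def restrict0_def)
    then show ?thesis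
      using hom(3)[OF lift_fun_cont[OF that], of k] c[OF that] D.u_closed by (simp add: cross_\<tau>_def D.A.scale_mult)
  qed
  have left: "cross_\<tau> (\<lambda>e. a (r e) * \<xi> e) = cmult D.A (cross_\<pi> a) (cross_\<tau> \<xi>)"
    if a: "a \<in> cont_funs (verts E)" and \<xi>: "\<xi> \<in> cont_funs (edges E)" for a \<xi>
  proof -
    have "lift_fun (\<lambda>e. a (r e) * \<xi> e) = (\<lambda>\<alpha>. pull 0 a \<alpha> * lift_fun \<xi> \<alpha>)"
      by (auto simp: lift_fun_def pull_def restrict0_def first_edge_def)
    then show ?thesis
      using hom(4)[OF pull_cont[OF a, of 0] lift_fun_cont[OF \<xi>]] c[OF \<xi>] D.cf_closed[OF pull_cont[OF a]] D.u_closed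
      by (simp add: cross_\<tau>_def cross_\<pi>_def D.A.mult_assoc)
  qed
  have inner: "cmult D.A (cadj D.A (cross_\<tau> \<xi>)) (cross_\<tau> \<eta>) = cross_\<pi> (edge_inner \<xi> \<eta>)"
    if \<xi>: "\<xi> \<in> cont_funs (edges E)" and \<eta>: "\<eta> \<in> cont_funs (edges E)" for \<xi> \<eta>
  proof -
    let ?b = "edge_inner \<xi> \<eta>"
    have b: "?b \<in> cont_funs (verts E)" by (rule inner_closed[OF \<xi> \<eta>])
    \<comment> \<open>At s(\<alpha>(0)) = r(\<alpha>(1)) the inner product is cnj(\<xi>) \<eta> at
      the first edge. Covariance turns the composite with the shift into a conjugate by
      \<open>u\<close>, which the outer factors u* and u undo.\<close>
    have eq: "restrict0 Y (pull 0 ?b \<circ> back_shift) = (\<lambda>\<alpha>. cnj (lift_fun \<xi> \<alpha>) * lift_fun \<eta> \<alpha>)"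
    proof
      fix \<alpha> show "restrict0 Y (pull 0 ?b \<circ> back_shift) \<alpha> = cnj (lift_fun \<xi> \<alpha>) * lift_fun \<eta> \<alpha>"
        unfolding pull_shift using edge_inner_src[of "\<alpha> 0" \<xi> \<eta>]
        by (auto simp: pull_def lift_fun_def restrict0_def first_edge_def S_iff)
    qed
    have "cmult D.A (cadj D.A (cross_\<tau> \<xi>)) (cross_\<tau> \<eta>)
        = cmult D.A (cadj D.A D.u) (cmult D.A (cmult D.A (cadj D.A (D.cf (lift_fun \<xi>))) (D.cf (lift_fun \<eta>))) D.u)"
      using c[OF \<xi>] c[OF \<eta>] cross_u(1,2) by (simp add: cross_\<tau>_def D.A.adj_mult D.A.mult_assoc D.A.closed)
    also have "cmult D.A (cadj D.A (D.cf (lift_fun \<xi>))) (D.cf (lift_fun \<eta>)) = D.cf (restrict0 Y (pull 0 ?b \<circ> back_shift))"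
      unfolding eq using hom(4)[of "\<lambda>\<alpha>. cnj (lift_fun \<xi> \<alpha>)" "lift_fun \<eta>"] hom(5)[of "lift_fun \<xi>"]
        lift_fun_cont[OF \<xi>] lift_fun_cont[OF \<eta>] cont_funs_closed(5)[OF lift_fun_cont[OF \<xi>] lift_fun_cont[OF \<xi>]] by simp
    also have "\<dots> = cmult D.A (cmult D.A D.u (D.cf (pull 0 ?b))) (cadj D.A D.u)"
      by (rule D.crossed_covariance[symmetric, OF pull_cont[OF b] back_shift_cont])
    also have "cmult D.A (cadj D.A D.u) (cmult D.A \<dots> D.u) = D.cf (pull 0 ?b)"
    proof -
      have p: "D.cf (pull 0 ?b) \<in> carr D.A" by (rule D.cf_closed[OF pull_cont[OF b]])
      have "cmult D.A (D.cf (pull 0 ?b)) (cmult D.A (cadj D.A D.u) D.u) = D.cf (pull 0 ?b)"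
        using D.crossed_unitary p by (simp add: cstar_unitary_def cstar_unit_def)
      then show ?thesis using p cross_u by (simp add: D.A.mult_assoc D.A.closed)
    qed
    finally show ?thesis by (simp add: cross_\<pi>_def)
  qed
  have "toeplitz_rep X D.A cross_\<pi> cross_\<tau>"
    unfolding toeplitz_rep_def minner_eq
    using \<pi> c add scale left inner by (simp add: C0_algebra_carr spaces)
  then show ?thesis
    unfolding toeplitz_def toeplitz_axioms_def
    using compact_topological_graph_axioms D.crossed_algebra by blast
qed

text \<open>For injective \<open>s\<close> the single vector 1 is a frame; its image is the unitary
  \<open>u\<close>, so the frame sum is the unit.\<close>

lemma cross_covariant: "covariant_rep X D.A cross_\<pi> cross_\<tau>"
proof -
  interpret T: toeplitz E D.A cross_\<pi> cross_\<tau> by (rule cross_toeplitz)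
  show ?thesis
  proof (rule T.frame_covariant[of 1 "\<lambda>_. indicator W"])
    show "frame 1 (\<lambda>_. indicator W)"
      using inj by (auto simp: frame_def indicator_cont_funs inj_on_def)
    fix a assume "a \<in> katsura_ideal X"
    then have a: "cross_\<pi> a \<in> carr D.A" using T.\<pi>_closed by (simp add: katsura_ideal_def C0_algebra_carr spaces)
    have e: "cstar_unit D.A (cmult D.A D.u (cadj D.A D.u))" using D.crossed_unitary by (simp add: cstar_unitary_def)
    then show "cmult D.A (cross_\<pi> a) (csum D.A (\<lambda>i. cmult D.A (cross_\<tau> (indicator W)) (cadj D.A (cross_\<tau> (indicator W)))) 1) = cross_\<pi> a"
      using a by (simp add: cross_\<tau>_one cstar_unit_def D.A.zero_add)
  qed
qed

text \<open>The range relation needs covariance, which holds in every coordinate of the product, and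
  elements of the universal algebra are equal if their coordinates are.\<close>

lemma graph_algebra_crossed: "crossed_graph_rep E (graph_algebra E) (cp_coeff X) (cp_module X)"
proof -
  interpret T: toeplitz E "graph_algebra E" "cp_coeff X" "cp_module X" by (rule graph_algebra_toeplitz)
  let ?A = "graph_algebra E" and ?u = "cp_module X (indicator W)"
  have u: "?u \<in> carr ?A" by (rule T.\<tau>_closed[OF indicator_cont_funs])
  have "cmult ?A ?u (cadj ?A ?u) = cp_coeff X (indicator V)"
    unfolding graph_algebra_eq
  proof (rule U.universal_eqI)
    show "cmult U.U ?u (cadj U.U ?u) \<in> carr U.U"
      using T.B.mult_closed[OF u T.B.adj_closed[OF u]] by (simp add: graph_algebra_eq)
    show "cp_coeff X (indicator V) \<in> carr U.U"
      using T.\<pi>_closed[OF indicator_cont_funs] by (simp add: graph_algebra_eq)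
    fix i assume i: "i \<in> cuntz_pimsner_reps X"
    have "covariant_rep X (fst i) (\<lambda>a. snd i (Inl a)) (\<lambda>\<xi>. snd i (Inr \<xi>))"
      using i by (auto simp: cuntz_pimsner_reps_def)
    from covariant_range[OF this]
    show "cmult U.U ?u (cadj U.U ?u) i = cp_coeff X (indicator V) i"
      using i by (simp add: cp_coeff_def cp_module_def del: X_ops)
  qed
  then show ?thesis
    unfolding crossed_graph_rep_def crossed_graph_rep_axioms_def
    using reversible_graph_axioms graph_algebra_toeplitz graph_algebra_unit by blast
qed

text \<open>Each universal algebra has to be a target for the other, so \<open>j\<close> and
  \<open>k\<close> embed each of them into the carrier type of the other's representations. That the
  two homomorphisms are mutually inverse is then checked on generators.\<close>

lemma graph_algebra_iso:
  "\<exists>\<Phi>. star_iso (graph_algebra E) D.A \<Phi> \<and>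
     (\<forall>a\<in>cont_funs (verts E). \<Phi> (cp_coeff X a) = cross_\<pi> a) \<and>
     (\<forall>\<xi>\<in>cont_funs (edges E). \<Phi> (cp_module X \<xi>) = cross_\<tau> \<xi>)"
proof -
  let ?G = "graph_algebra E"
  interpret T: crossed_graph_rep E ?G "cp_coeff X" "cp_module X" by (rule graph_algebra_crossed)
  obtain j where j: "inj_on (j :: _ \<Rightarrow> (('v \<Rightarrow> complex) + ('e \<Rightarrow> complex)) univ) (carr D.A)"
    by (rule D.crossed_embedding[OF separable_Y])
  obtain \<Phi> where \<Phi>: "contractive_hom ?G D.A \<Phi>" "\<And>a. a \<in> cont_funs (verts E) \<Longrightarrow> \<Phi> (cp_coeff X a) = cross_\<pi> a"
    "\<And>\<xi>. \<xi> \<in> cont_funs (edges E) \<Longrightarrow> \<Phi> (cp_module X \<xi>) = cross_\<tau> \<xi>"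
    by (rule graph_algebra_hom[OF D.crossed_algebra cross_covariant j]) blast
  obtain k where k: "inj_on (k :: _ \<Rightarrow> (((nat \<Rightarrow> 'e) \<Rightarrow> complex) + unit) univ) (carr ?G)"
    by (rule graph_algebra_embedding)
  have cov: "cmult ?G (cmult ?G T.u (T.ext f)) (cadj ?G T.u) = T.ext (restrict0 Y (f \<circ> back_shift))"
    if "f \<in> cont_funs Y" for f using T.ext_shift[OF that] by (simp add: T.Ad_def)
  have unit: "cstar_unit ?G (T.ext (indicator S))" unfolding T.ext_one by (rule T.unit)
  obtain \<Psi> where \<Psi>: "contractive_hom D.A ?G \<Psi>" "\<And>f. f \<in> cont_funs Y \<Longrightarrow> \<Psi> (D.cf f) = T.ext f" "\<Psi> D.u = T.u"
    by (rule D.crossed_hom[OF T.B.cstar_algebra_axioms T.ext_hom unit T.u_unitary cov k], assumption) blast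
  have \<Phi>hom: "star_hom ?G D.A \<Phi>" and \<Psi>hom: "star_hom D.A ?G \<Psi>" using \<Phi>(1) \<Psi>(1) by (auto simp: contractive_hom_def)
  have \<Phi>u: "\<Phi> T.u = D.u" using \<Phi>(3)[OF indicator_cont_funs] cross_\<tau>_one by simp
  have \<Psi>\<pi>: "\<Psi> (cross_\<pi> a) = cp_coeff X a" if "a \<in> cont_funs (verts E)" for a
    using \<Psi>(2)[OF pull_cont[OF that, of 0]] T.ext_pull[OF that, of 0] by (simp add: cross_\<pi>_def T.rho_def)
  \<comment> \<open>With b for the image of \<open>fibre_sum \<xi>\<close>, the product of the
    lifted function and the unitary goes to u b u* u = u b, which is the image of
    \<open>\<xi>\<close>.\<close>
  have \<Psi>\<tau>: "\<Psi> (cross_\<tau> \<xi>) = cp_module X \<xi>" if \<xi>: "\<xi> \<in> cont_funs (edges E)" for \<xi>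
  proof -
    have b: "fibre_sum \<xi> \<in> cont_funs (verts E)" by (rule fibre_sum_cont[OF \<xi>])
    have "\<Psi> (cross_\<tau> \<xi>) = cmult ?G (T.Ad (cp_coeff X (fibre_sum \<xi>))) T.u"
      unfolding cross_\<tau>_def lift_fun_pull
      using star_homD(4)[OF \<Psi>hom D.cf_closed[OF pull_cont[OF b]] D.u_closed] \<Psi>(2)[OF pull_cont[OF b]] \<Psi>(3)
        T.ext_pull[OF b, of 1] by (simp add: T.rho_def)
    also have "\<dots> = cmult ?G T.u (cmult ?G (cp_coeff X (fibre_sum \<xi>)) (cmult ?G (cadj ?G T.u) T.u))"
      using T.u_closed T.\<pi>_closed[OF b] by (simp add: T.Ad_def T.B.mult_assoc T.B.closed)
    also have "\<dots> = cmult ?G T.u (cp_coeff X (fibre_sum \<xi>))"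
      using T.unit T.\<pi>_closed[OF b] unfolding T.u_isometry by (simp add: cstar_unit_def)
    also have "\<dots> = cp_module X \<xi>" by (rule T.\<tau>_fibre_sum[OF \<xi>, symmetric])
    finally show ?thesis .
  qed
  have \<Psi>\<Phi>: "\<Psi> (\<Phi> x) = x" if x: "x \<in> carr ?G" for x
  proof -
    have "\<Psi> (\<Phi> x) = (\<lambda>x. x) x"
    proof (rule U.universal_hom_eq[OF T.B.cstar_algebra_axioms])
      show "contractive_hom U.U ?G (\<lambda>x. \<Psi> (\<Phi> x))"
        using contractive_hom_comp[OF \<Phi>(1) \<Psi>(1)] by (simp add: graph_algebra_eq)
      show "contractive_hom U.U ?G (\<lambda>x. x)" using contractive_hom_id by (simp add: graph_algebra_eq)
      show "x \<in> carr U.U" using x by (simp add: graph_algebra_eq)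
      fix g assume "g \<in> carr (coeff X) <+> mcarr X"
      then consider a where "a \<in> cont_funs (verts E)" "universal_gen (cuntz_pimsner_reps X) g = cp_coeff X a"
        | \<xi> where "\<xi> \<in> cont_funs (edges E)" "universal_gen (cuntz_pimsner_reps X) g = cp_module X \<xi>"
        by (auto simp: cp_coeff_def cp_module_def C0_algebra_carr spaces)
      then show "\<Psi> (\<Phi> (universal_gen (cuntz_pimsner_reps X) g)) = universal_gen (cuntz_pimsner_reps X) g"
        by cases (simp_all add: \<Phi> \<Psi>\<pi> \<Psi>\<tau>)
    qed
    then show ?thesis by simp
  qed
  \<comment> \<open>On the functions of level n the composite of \<open>\<Phi>\<close> with
    \<open>T.ext\<close> is found by induction on n; \<open>\<Phi>ext\<close> then passes to
    limits.\<close>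
  have \<Phi>rho: "\<Phi> (T.rho n a) = D.cf (pull n a)" if a: "a \<in> cont_funs (verts E)" for n a
  proof (induction n)
    case 0
    then show ?case using \<Phi>(2)[OF a] by (simp add: T.rho_def cross_\<pi>_def)
  next
    case (Suc n)
    have step: "T.rho (Suc n) a = cmult ?G (cmult ?G T.u (T.rho n a)) (cadj ?G T.u)"
      by (simp add: T.rho_def T.Ad_def)
    show ?case
      unfolding step pull_shift[symmetric] D.crossed_covariance[OF pull_cont[OF a] back_shift_cont, symmetric]
        star_homD(4)[OF \<Phi>hom T.B.mult_closed[OF T.u_closed(1) T.rho_closed[OF a]] T.u_closed(2)]
        star_homD(4)[OF \<Phi>hom T.u_closed(1) T.rho_closed[OF a]] star_homD(5)[OF \<Phi>hom T.u_closed(1)] \<Phi>u Suc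
      by (rule refl)
  qed
  have \<Phi>ext: "\<Phi> (T.ext f) = D.cf f" if f: "f \<in> cont_funs Y" for f
  proof -
    let ?F = "C0_algebra Y"
    interpret F: cstar_algebra ?F by (rule C0_algebra_algebra[OF compact_Y])
    have lim: "T.lim_graph f (T.ext f)" by (rule T.lim_graph_ext[OF f])
    note c = T.lim_graph_closed[OF lim]
    obtain n a where a: "\<And>k. a k \<in> cont_funs (verts E)" "F.clim (\<lambda>k. pull (n k) (a k)) f"
      "T.B.clim (\<lambda>k. T.rho (n k) (a k)) (T.ext f)"
      using lim unfolding T.lim_graph_def by blast
    have "D.A.clim (\<lambda>k. \<Phi> (T.rho (n k) (a k))) (\<Phi> (T.ext f))"
      by (rule contractive_hom_clim[OF T.B.cstar_algebra_axioms D.crossed_algebra \<Phi>(1) T.rho_closed[OF a(1)] c(2) a(3)])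
    moreover have "D.A.clim (\<lambda>k. D.cf (pull (n k) (a k))) (D.cf f)"
      by (rule contractive_hom_clim[OF F.cstar_algebra_axioms D.crossed_algebra D.cf_contractive _ _ a(2)])
        (simp_all add: C0_algebra_carr compact_Y pull_cont a f)
    ultimately show ?thesis
      unfolding \<Phi>rho[OF a(1)]
      by (rule D.A.clim_unique) (simp_all add: D.cf_closed pull_cont a f star_homD(1)[OF \<Phi>hom] c)
  qed
  have \<Phi>\<Psi>: "\<Phi> (\<Psi> x) = x" if x: "x \<in> carr D.A" for x
    by (rule D.crossed_hom_eq[OF D.crossed_algebra contractive_hom_comp[OF \<Psi>(1) \<Phi>(1)] contractive_hom_id _ _ x])
      (simp_all add: \<Psi> \<Phi>ext \<Phi>u)
  have "bij_betw \<Phi> (carr ?G) (carr D.A)"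
    by (rule bij_betwI[of _ _ _ \<Psi>]) (use star_homD(1)[OF \<Phi>hom] star_homD(1)[OF \<Psi>hom] \<Psi>\<Phi> \<Phi>\<Psi> in auto)
  then show ?thesis using \<Phi> \<Phi>hom unfolding star_iso_def by blast
qed

end

theorem theorem6p4:
  fixes E :: "('v, 'e) top_graph"
  assumes "topological_graph E" and "compact_graph E" and "no_sinks E"
  shows
    "(cstar_finite (graph_algebra E) \<longrightarrow>
        inj_on (src E) (topspace (edges E)) \<and>
        rng E ` topspace (edges E) = topspace (verts E)) \<and>
     (inj_on (src E) (topspace (edges E)) \<and>
      rng E ` topspace (edges E) = topspace (verts E) \<longrightarrow>
        homeomorphic_map (inf_paths E) (inf_paths E) back_shift \<and>
        (\<exists>\<Phi>. star_iso (graph_algebra E) (crossed_product (inf_paths E) back_shift) \<Phi> \<and>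
           (\<forall>a\<in>cont_funs (verts E).
              \<Phi> (cp_coeff (graph_correspondence E) a) =
                cross_fun (inf_paths E) back_shift
                  (restrict0 (inf_paths E) (a \<circ> rng E \<circ> first_edge))) \<and>
           (\<forall>\<xi>\<in>cont_funs (edges E).
              \<Phi> (cp_module (graph_correspondence E) \<xi>) =
                cmult (crossed_product (inf_paths E) back_shift)
                  (cross_fun (inf_paths E) back_shift
                     (restrict0 (inf_paths E) (\<xi> \<circ> first_edge)))
                  (cross_unitary (inf_paths E) back_shift))))"
proof (intro conjI impI; (elim conjE)?)
  interpret compact_topological_graph E by unfold_locales (fact assms)+
  show "inj_on (src E) (topspace (edges E))" "rng E ` topspace (edges E) = topspace (verts E)"
    if "cstar_finite (graph_algebra E)"
    using finite_graph_algebra[OF that assms(3)] .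
  assume *: "inj_on (src E) (topspace (edges E))" "rng E ` topspace (edges E) = topspace (verts E)"
  interpret reversible_graph E by unfold_locales (fact assms(3) *)+
  show "homeomorphic_map (inf_paths E) (inf_paths E) back_shift" by (rule back_shift_homeomorphic)
  \<comment> \<open>The natural map sends vertex functions to level 0.\<close>
  have "pull 0 a = restrict0 (inf_paths E) (a \<circ> rng E \<circ> first_edge)" for a
    by (auto simp: pull_def restrict0_def first_edge_def)
  then show "\<exists>\<Phi>. star_iso (graph_algebra E) (crossed_product (inf_paths E) back_shift) \<Phi> \<and>
           (\<forall>a\<in>cont_funs (verts E).
              \<Phi> (cp_coeff (graph_correspondence E) a) =
                cross_fun (inf_paths E) back_shift
                  (restrict0 (inf_paths E) (a \<circ> rng E \<circ> first_edge))) \<and>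
           (\<forall>\<xi>\<in>cont_funs (edges E).
              \<Phi> (cp_module (graph_correspondence E) \<xi>) =
                cmult (crossed_product (inf_paths E) back_shift)
                  (cross_fun (inf_paths E) back_shift
                     (restrict0 (inf_paths E) (\<xi> \<circ> first_edge)))
                  (cross_unitary (inf_paths E) back_shift))"
    using graph_algebra_iso by (simp add: cross_\<pi>_def cross_\<tau>_def lift_fun_def)
qed

end
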